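(* Consider asymptotics as $n\to\infty$ ($p$ may depend on $n$). Suppose that Assumptions 1, 2 and 3 (stated in the context) hold and that $(|S_\gamma|+|S_\alpha|)\log(p)=o(n^{1/2})$. Then, for sufficiently large constants $A_0$ and $A_1$, if the logistic propensity score model is correctly specified (i.e. $\pi^*(X)=\pi(X;\gamma^* )$ for some $\gamma^*$) but the generalized linear outcome model $E(Y\mid T=1,X)=\psi\{\alpha^\top f(X)\}$ may be misspecified, the following hold: (i) $n^{1/2}\{\hat\mu^1(\hat m,\hat\pi)-\mu^1\}\to_{\mathcal D}\mathrm N(0,V)$, where $V=\mathrm{var}\{\varphi(Y,T,X;\bar m,\bar\pi)\}$; (ii) a consistent estimator of $V$ is $\hat V=\tilde E[\{\varphi(Y,T,X;\hat m,\hat\pi)-\hat\mu^1(\hat m,\hat\pi)\}^2]$; (iii) an asymptotic $(1-c)$ confidence interval for $\mu^1$ is $\hat\mu^1(\hat m,\hat\pi)\pm z_{c/2}\sqrt{\hat V/n}$, where $z_{c/2}$ is the $(1-c/2)$ quantile of $\mathrm N(0,1)$.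
   Context: **Setup.** $(Y_i,T_i,X_i)$, $i=1,\dots,n$, are i.i.d. copies of $(Y,T,X)$, where $T\in\{0,1\}$ is a treatment, $X$ is a covariate vector, and $Y=(1-T)Y^0+TY^1$ with potential outcomes $Y^0,Y^1$. Standing assumptions: $T\perp Y^0\mid X$, $T\perp Y^1\mid X$, and $0<\pi^*(x)<1$ for all $x$, where $\pi^*(x)=P(T=1\mid X=x)$. Let $\mu^1=E(Y^1)$. $\tilde E(\cdot)$ denotes the sample average over $i=1,\dots,n$. $f(x)=(f_0(x),f_1(x),\dots,f_p(x))^\top$ is a vector of known functions with $f_0\equiv1$; for $b=(b_0,\dots,b_p)^\top$, $b_{1:p}=(b_1,\dots,b_p)^\top$; $|S|$ is the size of a set $S$. **Propensity score.** $\pi(x;\gamma)=\{1+e^{-\gamma^\top f(x)}\}^{-1}$, $w(x;\gamma)=e^{-\gamma^\top f(x)}$, and $\ell_{\rm CAL}(\gamma)=\tilde E\{Te^{-\gamma^\top f(X)}+(1-T)\gamma^\top f(X)\}$. $\hat\gamma$ minimizes $\ell_{\rm CAL}(\gamma)+A_0\lambda_0\|\gamma_{1:p}\|_1$; $\bar\gamma$ minimizes $E\{\ell_{\rm CAL}(\gamma)\}$. $\hat\pi=\pi(\cdot;\hat\gamma)$, $\bar\pi=\pi(\cdot;\bar\gamma)$, $\hat g=\hat\gamma^\top f$, $\bar g=\bar\gamma^\top f$. **Outcome regression.** $\psi$ is an increasing inverse link function, $\Psi(u)=\int_0^u\psi(u')\,du'$, and $\ell_{\rm WL}(\alpha;\gamma)=\tilde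 E(T\,w(X;\gamma)[-Y\alpha^\top f(X)+\Psi\{\alpha^\top f(X)\}])$. $\hat\alpha$ minimizes $\ell_{\rm WL}(\alpha;\hat\gamma)+A_1\lambda_1\|\alpha_{1:p}\|_1$; $\bar\alpha$ minimizes $E\{\ell_{\rm WL}(\alpha;\bar\gamma)\}$. $\hat h=\hat\alpha^\top f$, $\bar h=\bar\alpha^\top f$, $\hat m=\psi(\hat h)$, $\bar m=\psi(\bar h)$. **Augmented IPW estimator.** $\varphi(Y,T,X;m,\pi)=\frac{TY}{\pi(X)}-\{\frac{T}{\pi(X)}-1\}m(X)$ and $\hat\mu^1(m,\pi)=\tilde E\{\varphi(Y,T,X;m,\pi)\}$. $S_\gamma=\{0\}\cup\{j\ge1:\bar\gamma_j\ne0\}$, $S_\alpha=\{0\}\cup\{j\ge1:\bar\alpha_j\ne0\}$, $\Sigma_\gamma=E[T\,w(X;\bar\gamma)f(X)f(X)^\top]$, $\tilde\Sigma_\gamma=\tilde E[T\,w(X;\bar\gamma)f(X)f(X)^\top]$. **Compatibility condition.** It holds for a matrix $\Sigma$ with subset $S\subset\{0,\dots,p\}$ and constants $\nu>0,\xi>1$ if $\nu^2(\sum_{j\in S}|b_j|)^2\le|S|\,b^\top\Sigma b$ for all $b\in\mathbb R^{1+p}$ with $\sum_{j\notin S}|b_j|\le\xi\sum_{j\in S}|b_j|$. **Rates.** $\lambda_0=C_{01}\sqrt{\log\{(1+p)/\epsilon\}/n}$ with $C_{01}=\max\{\sqrt2(e^{-B_0}+1)C_0,\,4e^{-B_0}C_0^2\}$,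 and $\lambda_1=\max\{\lambda_0,\ e^{-B_0}C_0\sqrt{8(D_0^2+D_1^2)}\sqrt{\log\{(1+p)/\epsilon\}/n}\}$, with $\epsilon=1/(1+p)$; $A_0>1$, $A_1>1$ constants. **Assumption 1.** (i) $\max_{0\le j\le p}|f_j(X)|\le C_0$ a.s., $C_0\ge1$; (ii) $\bar g(X)\ge B_0$ a.s., $B_0\in\mathbb R$; (iii) the compatibility condition holds for $\Sigma_\gamma$ with $S_\gamma$ and constants $\nu_0>0,\xi_0>1$; (iv) $|S_\gamma|\lambda_0\le\eta_0$ for a sufficiently small constant $\eta_0>0$, depending only on $(A_0,C_0,\xi_0,\nu_0)$. **Assumption 2.** (i) $D_0^2E(\exp[\{Y^1-\bar m(X)\}^2/D_0^2]-1\mid X)\le D_1^2$ for positive constants $D_0,D_1$; (ii) the compatibility condition holds for $\Sigma_\gamma$ with $S_\alpha$ and constants $\nu_1>0,\xi_1>1$; (iii) $(1+\xi_1)^2\nu_1^{-2}|S_\alpha|\lambda_1\le\eta_1$ for a constant $0<\eta_1<1$. **The constant $M_0$ (known result).** Let $D^\dagger_{\rm CAL}(\hat g,\bar g)=-\tilde E[T\{e^{-\hat g(X)}-e^{-\bar g(X)}\}\{\hat g(X)-\bar g(X)\}]$. Let $\Omega_0$ be the event $\sup_j|\tilde E[\{-Te^{-\bar g(X)}+(1-T)\}f_j(X)]|\le\lambda_0$ and $\Omega_1$ the event $\sup_{j,k}|(\tilde\Sigma_\gamma)_{jk}-(\Sigma_\gamma)_{jk}|\le\lambda_0$. Under Assumption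 1 and $A_0>(\xi_0+1)/(\xi_0-1)$, $P(\Omega_0\cap\Omega_1)\ge1-4\epsilon$, and there is a constant $M_0>0$ depending only on $(A_0,C_0,B_0,\xi_0,\nu_0,\eta_0)$ such that on $\Omega_0\cap\Omega_1$, $D^\dagger_{\rm CAL}(\hat g,\bar g)+(A_0-1)\lambda_0\|\hat\gamma-\bar\gamma\|_1\le M_0|S_\gamma|\lambda_0^2$. Fix such $M_0$. **Derived constants.** $\xi_2=1-2A_1/\{(\xi_1+1)(A_1-1)\}$, $\xi_3=(\xi_1+1)(A_1-1)$, $\nu_2=\nu_1(1-\eta_1)^{1/2}$, $\eta_{01}=(A_0-1)^{-1}M_0\eta_0C_0$, $\eta_{02}=(A_0-1)^{-2}M_0^2\eta_0$, $M_{01}=(D_0^2+D_1^2)(e^{\eta_{01}}M_0+\eta_{02})+(D_0^2+D_0D_1)\eta_{02}$. **Assumption 3.** $\psi$ is differentiable with derivative $\psi_2$, and (i) $\psi_2\{\bar h(X)\}\le C_1$ a.s., $C_1>0$; (ii) $\psi_2\{\bar h(X)\}\ge C_2$ a.s., $C_2>0$; (iii) $\psi_2(u)\le\psi_2(u')e^{C_3|u-u'|}$ for all $u,u'$, with a constant $C_3\ge0$; (iv) $C_0C_3(A_1-1)^{-1}\xi_3^2\nu_2^{-2}C_2^{-1}|S_\alpha|\lambda_1\le\eta_2$ for a constant $0\le\eta_2<1$, and $C_0C_3e^{3\eta_{01}}(A_1-1)^{-1}\xi_2^{-2}C_2^{-1}(M_{01}|S_\gamma|\lambda_0)\le\eta_3$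 for a constant $0\le\eta_3<1$. All constants in Assumptions 1–3 are fixed (not depending on $n$).
   Formalization: Claim (iii) assumes V bounded away from 0, since for V=0 (e.g. constant Y¹) the interval covers with probability tending to 1, not 1−c; if the law of the data changes with n, (Y¹)² is assumed uniformly integrable, which is automatic for a fixed law. *)

theory Defs
  imports "HOL-Probability.Probability" "HOL-Library.Landau_Symbols"
begin

section \<open>Population\<close>

text \<open>
  One record bundles a probability space carrying the potential outcomes, the treatment and the
  covariate, together with the dictionary \<open>f = (f 0, \<dots>, f p)\<close>.  Covariates live in an arbitrary
  measurable space.  Coefficient vectors are functions \<open>nat \<Rightarrow> real\<close> of which only the
  coordinates \<open>0, \<dots>, p\<close> matter.
\<close>

record ('a, 'x) population =
  pop_space :: "'a measure"
  cov_space :: "'x measure"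
  Y_ctl :: "'a \<Rightarrow> real"
  Y_trt :: "'a \<Rightarrow> real"
  Trt :: "'a \<Rightarrow> real"
  Cov :: "'a \<Rightarrow> 'x"
  true_ps :: "'x \<Rightarrow> real"
  dict_dim :: nat
  dict :: "nat \<Rightarrow> 'x \<Rightarrow> real"

text \<open>An observation is a triple \<open>(y, t, x)\<close>.\<close>

type_synonym 'x obs = "real \<times> real \<times> 'x"

definition outcome :: "('a, 'x) population \<Rightarrow> 'a \<Rightarrow> real" where
  "outcome D \<omega> = (1 - Trt D \<omega>) * Y_ctl D \<omega> + Trt D \<omega> * Y_trt D \<omega>"

definition observe :: "('a, 'x) population \<Rightarrow> 'a \<Rightarrow> 'x obs" where
  "observe D \<omega> = (outcome D \<omega>, Trt D \<omega>, Cov D \<omega>)"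

definition obs_space :: "('a, 'x) population \<Rightarrow> 'x obs measure" where
  "obs_space D = borel \<Otimes>\<^sub>M borel \<Otimes>\<^sub>M cov_space D"

definition cov_algebra :: "('a, 'x) population \<Rightarrow> 'a measure" where
  "cov_algebra D = vimage_algebra (space (pop_space D)) (Cov D) (cov_space D)"

definition cond_prob_on :: "'a measure \<Rightarrow> 'a measure \<Rightarrow> 'a set \<Rightarrow> 'a \<Rightarrow> real" where
  "cond_prob_on M F A = real_cond_exp M F (indicator (A \<inter> space M))"

definition cond_indep :: "'a measure \<Rightarrow> 'a measure \<Rightarrow> ('a \<Rightarrow> real) \<Rightarrow> ('a \<Rightarrow> real) \<Rightarrow> bool" where
  "cond_indep M F U W \<longleftrightarrow>
     (\<forall>A \<in> sets borel. \<forall>B \<in> sets borel. AE \<omega> in M.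
        cond_prob_on M F (U -` A \<inter> W -` B) \<omega> = cond_prob_on M F (U -` A) \<omega> * cond_prob_on M F (W -` B) \<omega>)"

definition population_model :: "('a, 'x) population \<Rightarrow> bool" where
  "population_model D \<longleftrightarrow>
     prob_space (pop_space D)
   \<and> Y_ctl D \<in> borel_measurable (pop_space D)
   \<and> Y_trt D \<in> borel_measurable (pop_space D)
   \<and> Trt D \<in> borel_measurable (pop_space D)
   \<and> Cov D \<in> measurable (pop_space D) (cov_space D)
   \<and> (\<forall>\<omega> \<in> space (pop_space D). Trt D \<omega> \<in> {0, 1})
   \<and> integrable (pop_space D) (Y_trt D)
   \<and> cond_indep (pop_space D) (cov_algebra D) (Trt D) (Y_ctl D)
   \<and> cond_indep (pop_space D) (cov_algebra D) (Trt D) (Y_trt D)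
   \<and> true_ps D \<in> borel_measurable (cov_space D)
   \<and> (AE \<omega> in pop_space D. true_ps D (Cov D \<omega>) = cond_prob_on (pop_space D) (cov_algebra D) (Trt D -` {1}) \<omega>)
   \<and> (\<forall>x \<in> space (cov_space D). 0 < true_ps D x \<and> true_ps D x < 1)
   \<and> 1 \<le> dict_dim D
   \<and> (\<forall>j \<le> dict_dim D. dict D j \<in> borel_measurable (cov_space D))
   \<and> (\<forall>x \<in> space (cov_space D). dict D 0 x = 1)"

definition mu1 :: "('a, 'x) population \<Rightarrow> real" where
  "mu1 D = (\<integral>\<omega>. Y_trt D \<omega> \<partial>pop_space D)"

definition pop_mean :: "('a, 'x) population \<Rightarrow> ('x obs \<Rightarrow> real) \<Rightarrow> real" where
  "pop_mean D g = (\<integral>\<omega>. g (observe D \<omega>) \<partial>pop_space D)"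

definition samp_mean :: "nat \<Rightarrow> (nat \<Rightarrow> 'x obs) \<Rightarrow> ('x obs \<Rightarrow> real) \<Rightarrow> real" where
  "samp_mean n z g = (\<Sum>i<n. g (z i)) / real n"

definition iid_sample :: "('a, 'x) population \<Rightarrow> nat \<Rightarrow> 'w measure \<Rightarrow> (nat \<Rightarrow> 'w \<Rightarrow> 'x obs) \<Rightarrow> bool" where
  "iid_sample D n Q Z \<longleftrightarrow>
     prob_space Q
   \<and> prob_space.indep_vars Q (\<lambda>_. obs_space D) Z {..<n}
   \<and> (\<forall>i<n. distr Q (obs_space D) (Z i) = distr (pop_space D) (obs_space D) (observe D))"


section \<open>Models, losses and estimators\<close>

definition lin :: "('a, 'x) population \<Rightarrow> (nat \<Rightarrow> real) \<Rightarrow> 'x \<Rightarrow> real" where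
  "lin D b x = (\<Sum>j\<le>dict_dim D. b j * dict D j x)"

definition ps :: "('a, 'x) population \<Rightarrow> (nat \<Rightarrow> real) \<Rightarrow> 'x \<Rightarrow> real" where
  "ps D \<gamma> x = inverse (1 + exp (- lin D \<gamma> x))"

definition wt :: "('a, 'x) population \<Rightarrow> (nat \<Rightarrow> real) \<Rightarrow> 'x \<Rightarrow> real" where
  "wt D \<gamma> x = exp (- lin D \<gamma> x)"

definition correct_ps :: "('a, 'x) population \<Rightarrow> bool" where
  "correct_ps D \<longleftrightarrow> (\<exists>\<gamma>. AE \<omega> in pop_space D. true_ps D (Cov D \<omega>) = ps D \<gamma> (Cov D \<omega>))"

definition loss_cal :: "('a, 'x) population \<Rightarrow> (nat \<Rightarrow> real) \<Rightarrow> 'x obs \<Rightarrow> real" where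
  "loss_cal D \<gamma> = (\<lambda>(y, t, x). t * exp (- lin D \<gamma> x) + (1 - t) * lin D \<gamma> x)"

text \<open>The interval integral is oriented, so this is also the right primitive for \<open>u < 0\<close>.\<close>

definition link_primitive :: "(real \<Rightarrow> real) \<Rightarrow> real \<Rightarrow> real" where
  "link_primitive \<psi> u = interval_lebesgue_integral lborel (ereal 0) (ereal u) \<psi>"

definition loss_wl :: "(real \<Rightarrow> real) \<Rightarrow> ('a, 'x) population \<Rightarrow> (nat \<Rightarrow> real) \<Rightarrow> (nat \<Rightarrow> real) \<Rightarrow> 'x obs \<Rightarrow> real" where
  "loss_wl \<psi> D \<alpha> \<gamma> =
     (\<lambda>(y, t, x). t * wt D \<gamma> x * (- y * lin D \<alpha> x + link_primitive \<psi> (lin D \<alpha> x)))"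

definition penalty :: "('a, 'x) population \<Rightarrow> (nat \<Rightarrow> real) \<Rightarrow> real" where
  "penalty D b = (\<Sum>j\<in>{1..dict_dim D}. \<bar>b j\<bar>)"

definition l1_norm :: "('a, 'x) population \<Rightarrow> (nat \<Rightarrow> real) \<Rightarrow> real" where
  "l1_norm D b = (\<Sum>j\<le>dict_dim D. \<bar>b j\<bar>)"

abbreviation minimizes :: "('b \<Rightarrow> real) \<Rightarrow> 'b \<Rightarrow> bool" where
  "minimizes F b \<equiv> is_arg_min F (\<lambda>_. True) b"

definition target_cal :: "('a, 'x) population \<Rightarrow> (nat \<Rightarrow> real) \<Rightarrow> bool" where
  "target_cal D \<gamma> \<longleftrightarrow> minimizes (\<lambda>g. pop_mean D (loss_cal D g)) \<gamma>"

definition target_wl :: "(real \<Rightarrow> real) \<Rightarrow> ('a, 'x) population \<Rightarrow> (nat \<Rightarrow> real) \<Rightarrow> (nat \<Rightarrow> real) \<Rightarrow> bool" where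
  "target_wl \<psi> D \<gamma> \<alpha> \<longleftrightarrow> minimizes (\<lambda>a. pop_mean D (loss_wl \<psi> D a \<gamma>)) \<alpha>"

text \<open>
  The intercept is not penalized, so with positive probability (for instance if nobody is treated)
  the penalized criteria have no minimizer; requiring one for almost every sample would be
  contradictory.  The estimators are measurable and minimize whenever this is possible.
\<close>

definition estimator_of :: "('a, 'x) population \<Rightarrow> 'w measure \<Rightarrow> ('w \<Rightarrow> (nat \<Rightarrow> real) \<Rightarrow> real) \<Rightarrow> ('w \<Rightarrow> nat \<Rightarrow> real) \<Rightarrow> bool" where
  "estimator_of D Q F est \<longleftrightarrow>
     (\<forall>j \<le> dict_dim D. (\<lambda>\<omega>. est \<omega> j) \<in> borel_measurable Q)
   \<and> (\<forall>\<omega> \<in> space Q. (\<exists>b. minimizes (F \<omega>) b) \<longrightarrow> minimizes (F \<omega>) (est \<omega>))"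

definition estimator_cal :: "('a, 'x) population \<Rightarrow> nat \<Rightarrow> 'w measure \<Rightarrow> (nat \<Rightarrow> 'w \<Rightarrow> 'x obs) \<Rightarrow> real \<Rightarrow> ('w \<Rightarrow> nat \<Rightarrow> real) \<Rightarrow> bool" where
  "estimator_cal D n Q Z \<kappa> gh \<longleftrightarrow>
     estimator_of D Q (\<lambda>\<omega> g. samp_mean n (\<lambda>i. Z i \<omega>) (loss_cal D g) + \<kappa> * penalty D g) gh"

definition estimator_wl :: "(real \<Rightarrow> real) \<Rightarrow> ('a, 'x) population \<Rightarrow> nat \<Rightarrow> 'w measure \<Rightarrow> (nat \<Rightarrow> 'w \<Rightarrow> 'x obs) \<Rightarrow> real \<Rightarrow> ('w \<Rightarrow> nat \<Rightarrow> real) \<Rightarrow> ('w \<Rightarrow> nat \<Rightarrow> real) \<Rightarrow> bool" where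
  "estimator_wl \<psi> D n Q Z \<kappa> gh ah \<longleftrightarrow>
     estimator_of D Q (\<lambda>\<omega> a. samp_mean n (\<lambda>i. Z i \<omega>) (loss_wl \<psi> D a (gh \<omega>)) + \<kappa> * penalty D a) ah"

definition aipw :: "('x \<Rightarrow> real) \<Rightarrow> ('x \<Rightarrow> real) \<Rightarrow> 'x obs \<Rightarrow> real" where
  "aipw m \<pi> = (\<lambda>(y, t, x). t * y / \<pi> x - (t / \<pi> x - 1) * m x)"

abbreviation fitted_aipw :: "(real \<Rightarrow> real) \<Rightarrow> ('a, 'x) population \<Rightarrow> (nat \<Rightarrow> real) \<Rightarrow> (nat \<Rightarrow> real) \<Rightarrow> 'x obs \<Rightarrow> real" where
  "fitted_aipw \<psi> D \<gamma> \<alpha> \<equiv> aipw (\<lambda>x. \<psi> (lin D \<alpha> x)) (ps D \<gamma>)"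

definition mu_hat :: "(real \<Rightarrow> real) \<Rightarrow> ('a, 'x) population \<Rightarrow> nat \<Rightarrow> (nat \<Rightarrow> 'x obs) \<Rightarrow> (nat \<Rightarrow> real) \<Rightarrow> (nat \<Rightarrow> real) \<Rightarrow> real" where
  "mu_hat \<psi> D n z \<gamma> \<alpha> = samp_mean n z (fitted_aipw \<psi> D \<gamma> \<alpha>)"

definition V_hat :: "(real \<Rightarrow> real) \<Rightarrow> ('a, 'x) population \<Rightarrow> nat \<Rightarrow> (nat \<Rightarrow> 'x obs) \<Rightarrow> (nat \<Rightarrow> real) \<Rightarrow> (nat \<Rightarrow> real) \<Rightarrow> real" where
  "V_hat \<psi> D n z \<gamma> \<alpha> = samp_mean n z (\<lambda>ob. (fitted_aipw \<psi> D \<gamma> \<alpha> ob - mu_hat \<psi> D n z \<gamma> \<alpha>)\<^sup>2)"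

definition asy_var :: "(real \<Rightarrow> real) \<Rightarrow> ('a, 'x) population \<Rightarrow> (nat \<Rightarrow> real) \<Rightarrow> (nat \<Rightarrow> real) \<Rightarrow> real" where
  "asy_var \<psi> D \<gamma> \<alpha> = prob_space.variance (pop_space D) (\<lambda>\<omega>. fitted_aipw \<psi> D \<gamma> \<alpha> (observe D \<omega>))"


section \<open>Assumptions\<close>

definition supp0 :: "('a, 'x) population \<Rightarrow> (nat \<Rightarrow> real) \<Rightarrow> nat set" where
  "supp0 D b = {0} \<union> {j \<in> {1..dict_dim D}. b j \<noteq> 0}"

definition gram :: "('a, 'x) population \<Rightarrow> (nat \<Rightarrow> real) \<Rightarrow> nat \<Rightarrow> nat \<Rightarrow> 'x obs \<Rightarrow> real" where
  "gram D \<gamma> j k = (\<lambda>(y, t, x). t * wt D \<gamma> x * dict D j x * dict D k x)"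

definition Sigma_pop :: "('a, 'x) population \<Rightarrow> (nat \<Rightarrow> real) \<Rightarrow> nat \<Rightarrow> nat \<Rightarrow> real" where
  "Sigma_pop D \<gamma> j k = pop_mean D (gram D \<gamma> j k)"

definition Sigma_samp :: "('a, 'x) population \<Rightarrow> nat \<Rightarrow> (nat \<Rightarrow> 'x obs) \<Rightarrow> (nat \<Rightarrow> real) \<Rightarrow> nat \<Rightarrow> nat \<Rightarrow> real" where
  "Sigma_samp D n z \<gamma> j k = samp_mean n z (gram D \<gamma> j k)"

definition compatibility :: "nat \<Rightarrow> (nat \<Rightarrow> nat \<Rightarrow> real) \<Rightarrow> nat set \<Rightarrow> real \<Rightarrow> real \<Rightarrow> bool" where
  "compatibility p \<Sigma> S \<nu> \<xi> \<longleftrightarrow>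
     (\<forall>b :: nat \<Rightarrow> real. (\<Sum>j\<in>{..p} - S. \<bar>b j\<bar>) \<le> \<xi> * (\<Sum>j\<in>S. \<bar>b j\<bar>) \<longrightarrow>
        \<nu>\<^sup>2 * (\<Sum>j\<in>S. \<bar>b j\<bar>)\<^sup>2 \<le> real (card S) * (\<Sum>j\<le>p. \<Sum>k\<le>p. b j * \<Sigma> j k * b k))"

definition eps :: "nat \<Rightarrow> real" where
  "eps p = 1 / (1 + real p)"

definition C01 :: "real \<Rightarrow> real \<Rightarrow> real" where
  "C01 C0 B0 = max (sqrt 2 * (exp (- B0) + 1) * C0) (4 * exp (- B0) * C0\<^sup>2)"

definition lam0 :: "real \<Rightarrow> real \<Rightarrow> nat \<Rightarrow> nat \<Rightarrow> real" where
  "lam0 C0 B0 p n = C01 C0 B0 * sqrt (ln ((1 + real p) / eps p) / real n)"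

definition lam1 :: "real \<Rightarrow> real \<Rightarrow> real \<Rightarrow> real \<Rightarrow> nat \<Rightarrow> nat \<Rightarrow> real" where
  "lam1 C0 B0 D0 D1 p n =
     max (lam0 C0 B0 p n)
         (exp (- B0) * C0 * sqrt (8 * (D0\<^sup>2 + D1\<^sup>2)) * sqrt (ln ((1 + real p) / eps p) / real n))"

definition assumption1 :: "('a, 'x) population \<Rightarrow> nat \<Rightarrow> (nat \<Rightarrow> real) \<Rightarrow> real \<Rightarrow> real \<Rightarrow> real \<Rightarrow> real \<Rightarrow> real \<Rightarrow> bool" where
  "assumption1 D n gb C0 B0 \<nu>0 \<xi>0 \<eta>0 \<longleftrightarrow>
     (AE \<omega> in pop_space D. \<forall>j \<le> dict_dim D. \<bar>dict D j (Cov D \<omega>)\<bar> \<le> C0)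
   \<and> (AE \<omega> in pop_space D. B0 \<le> lin D gb (Cov D \<omega>))
   \<and> compatibility (dict_dim D) (Sigma_pop D gb) (supp0 D gb) \<nu>0 \<xi>0
   \<and> real (card (supp0 D gb)) * lam0 C0 B0 (dict_dim D) n \<le> \<eta>0"

text \<open>
  The conditional exponential moment is taken in \<open>[0, \<infinity>]\<close>, so that the bound entails its finiteness;
  \<open>real_cond_exp\<close> would return a junk value for a non-integrable function.
\<close>

definition assumption2 :: "(real \<Rightarrow> real) \<Rightarrow> ('a, 'x) population \<Rightarrow> nat \<Rightarrow> (nat \<Rightarrow> real) \<Rightarrow> (nat \<Rightarrow> real)
    \<Rightarrow> real \<Rightarrow> real \<Rightarrow> real \<Rightarrow> real \<Rightarrow> real \<Rightarrow> real \<Rightarrow> real \<Rightarrow> bool" where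
  "assumption2 \<psi> D n gb ab C0 B0 D0 D1 \<nu>1 \<xi>1 \<eta>1 \<longleftrightarrow>
     (AE \<omega> in pop_space D.
        ennreal (D0\<^sup>2) *
          nn_cond_exp (pop_space D) (cov_algebra D)
            (\<lambda>\<omega>. ennreal (exp ((Y_trt D \<omega> - \<psi> (lin D ab (Cov D \<omega>)))\<^sup>2 / D0\<^sup>2) - 1)) \<omega>
        \<le> ennreal (D1\<^sup>2))
   \<and> compatibility (dict_dim D) (Sigma_pop D gb) (supp0 D ab) \<nu>1 \<xi>1
   \<and> (1 + \<xi>1)\<^sup>2 / \<nu>1\<^sup>2 * real (card (supp0 D ab)) * lam1 C0 B0 D0 D1 (dict_dim D) n \<le> \<eta>1"

definition xi2 :: "real \<Rightarrow> real \<Rightarrow> real" where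
  "xi2 A1 \<xi>1 = 1 - 2 * A1 / ((\<xi>1 + 1) * (A1 - 1))"

definition xi3 :: "real \<Rightarrow> real \<Rightarrow> real" where
  "xi3 A1 \<xi>1 = (\<xi>1 + 1) * (A1 - 1)"

definition nu2 :: "real \<Rightarrow> real \<Rightarrow> real" where
  "nu2 \<nu>1 \<eta>1 = \<nu>1 * sqrt (1 - \<eta>1)"

definition eta01 :: "real \<Rightarrow> real \<Rightarrow> real \<Rightarrow> real \<Rightarrow> real" where
  "eta01 A0 M0 \<eta>0 C0 = M0 * \<eta>0 * C0 / (A0 - 1)"

definition eta02 :: "real \<Rightarrow> real \<Rightarrow> real \<Rightarrow> real" where
  "eta02 A0 M0 \<eta>0 = M0\<^sup>2 * \<eta>0 / (A0 - 1)\<^sup>2"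

definition M01 :: "real \<Rightarrow> real \<Rightarrow> real \<Rightarrow> real \<Rightarrow> real \<Rightarrow> real \<Rightarrow> real" where
  "M01 A0 M0 \<eta>0 C0 D0 D1 =
     (D0\<^sup>2 + D1\<^sup>2) * (exp (eta01 A0 M0 \<eta>0 C0) * M0 + eta02 A0 M0 \<eta>0) + (D0\<^sup>2 + D0 * D1) * eta02 A0 M0 \<eta>0"

definition assumption3 :: "(real \<Rightarrow> real) \<Rightarrow> (real \<Rightarrow> real) \<Rightarrow> ('a, 'x) population \<Rightarrow> nat \<Rightarrow> (nat \<Rightarrow> real) \<Rightarrow> (nat \<Rightarrow> real)
    \<Rightarrow> real \<Rightarrow> real \<Rightarrow> real \<Rightarrow> real \<Rightarrow> real \<Rightarrow> real \<Rightarrow> real \<Rightarrow> real \<Rightarrow> real \<Rightarrow> real \<Rightarrow> real \<Rightarrow> real \<Rightarrow> real \<Rightarrow> real \<Rightarrow> real \<Rightarrow> real \<Rightarrow> bool" where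
  "assumption3 \<psi> \<psi>2 D n gb ab A0 A1 M0 C0 B0 \<eta>0 D0 D1 \<nu>1 \<xi>1 \<eta>1 C1 C2 C3 \<eta>2 \<eta>3 \<longleftrightarrow>
     (\<forall>u. (\<psi> has_real_derivative \<psi>2 u) (at u))
   \<and> (AE \<omega> in pop_space D. \<psi>2 (lin D ab (Cov D \<omega>)) \<le> C1)
   \<and> (AE \<omega> in pop_space D. C2 \<le> \<psi>2 (lin D ab (Cov D \<omega>)))
   \<and> (\<forall>u u'. \<psi>2 u \<le> \<psi>2 u' * exp (C3 * \<bar>u - u'\<bar>))
   \<and> C0 * C3 / (A1 - 1) * (xi3 A1 \<xi>1)\<^sup>2 / (nu2 \<nu>1 \<eta>1)\<^sup>2 / C2
        * real (card (supp0 D ab)) * lam1 C0 B0 D0 D1 (dict_dim D) n \<le> \<eta>2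
   \<and> C0 * C3 * exp (3 * eta01 A0 M0 \<eta>0 C0) / (A1 - 1) / (xi2 A1 \<xi>1)\<^sup>2 / C2
        * (M01 A0 M0 \<eta>0 C0 D0 D1 * real (card (supp0 D gb)) * lam0 C0 B0 (dict_dim D) n) \<le> \<eta>3"

definition event0 :: "('a, 'x) population \<Rightarrow> nat \<Rightarrow> (nat \<Rightarrow> 'x obs) \<Rightarrow> (nat \<Rightarrow> real) \<Rightarrow> real \<Rightarrow> bool" where
  "event0 D n z gb l \<longleftrightarrow>
     (\<forall>j \<le> dict_dim D. \<bar>samp_mean n z (\<lambda>(y, t, x). (- t * exp (- lin D gb x) + (1 - t)) * dict D j x)\<bar> \<le> l)"

definition event1 :: "('a, 'x) population \<Rightarrow> nat \<Rightarrow> (nat \<Rightarrow> 'x obs) \<Rightarrow> (nat \<Rightarrow> real) \<Rightarrow> real \<Rightarrow> bool" where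
  "event1 D n z gb l \<longleftrightarrow>
     (\<forall>j \<le> dict_dim D. \<forall>k \<le> dict_dim D. \<bar>Sigma_samp D n z gb j k - Sigma_pop D gb j k\<bar> \<le> l)"

definition div_cal :: "('a, 'x) population \<Rightarrow> nat \<Rightarrow> (nat \<Rightarrow> 'x obs) \<Rightarrow> (nat \<Rightarrow> real) \<Rightarrow> (nat \<Rightarrow> real) \<Rightarrow> real" where
  "div_cal D n z gh gb =
     - samp_mean n z (\<lambda>(y, t, x). t * (exp (- lin D gh x) - exp (- lin D gb x)) * (lin D gh x - lin D gb x))"

definition cal_error_bound :: "('a, 'x) population \<Rightarrow> nat \<Rightarrow> 'w measure \<Rightarrow> (nat \<Rightarrow> 'w \<Rightarrow> 'x obs) \<Rightarrow> ('w \<Rightarrow> nat \<Rightarrow> real) \<Rightarrow> (nat \<Rightarrow> real)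
    \<Rightarrow> real \<Rightarrow> real \<Rightarrow> real \<Rightarrow> bool" where
  "cal_error_bound D n Q Z gh gb A0 l M0 \<longleftrightarrow>
     (AE \<omega> in Q. event0 D n (\<lambda>i. Z i \<omega>) gb l \<and> event1 D n (\<lambda>i. Z i \<omega>) gb l \<longrightarrow>
        div_cal D n (\<lambda>i. Z i \<omega>) (gh \<omega>) gb + (A0 - 1) * l * l1_norm D (\<lambda>j. gh \<omega> j - gb j)
        \<le> M0 * real (card (supp0 D gb)) * l\<^sup>2)"


section \<open>Asymptotic notions\<close>

text \<open>\<open>normal_law v\<close> is N(0, v), the point mass at 0 if \<open>v = 0\<close>.\<close>

definition normal_law :: "real \<Rightarrow> real measure" where
  "normal_law v = distr std_normal_distribution borel (\<lambda>z. sqrt v * z)"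

text \<open>
  Convergence in distribution to \<open>N(0, V n)\<close> when the variance is allowed to move with \<open>n\<close>:
  expectations of bounded continuous functions get close.  For a constant (or convergent)
  variance this is weak convergence, see \<open>asymp_normal_iff\<close> below.
\<close>

definition asymp_normal :: "(nat \<Rightarrow> real measure) \<Rightarrow> (nat \<Rightarrow> real) \<Rightarrow> bool" where
  "asymp_normal \<mu> V \<longleftrightarrow>
     (\<forall>g :: real \<Rightarrow> real. (\<forall>x. isCont g x) \<and> (\<exists>B. \<forall>x. \<bar>g x\<bar> \<le> B) \<longrightarrow>
        (\<lambda>n. integral\<^sup>L (\<mu> n) g - integral\<^sup>L (normal_law (V n)) g) \<longlonglongrightarrow> 0)"

definition conv_in_prob_0 :: "(nat \<Rightarrow> 'w measure) \<Rightarrow> (nat \<Rightarrow> 'w \<Rightarrow> real) \<Rightarrow> bool" where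
  "conv_in_prob_0 Q R \<longleftrightarrow>
     (\<forall>e>0. (\<lambda>n. measure (Q n) {\<omega> \<in> space (Q n). e < \<bar>R n \<omega>\<bar>}) \<longlonglongrightarrow> 0)"

definition std_normal_quantile :: "real \<Rightarrow> real" where
  "std_normal_quantile q = Inf {z. q \<le> cdf std_normal_distribution z}"

text \<open>
  The laws, the dictionary and its size may all change with \<open>n\<close>.  The squares of the treated
  potential outcome are required to be uniformly integrable along such an array; for a law that
  does not change with \<open>n\<close> this follows from the other assumptions
  (\<open>unif_sq_integrable_fixed_law\<close> below).
\<close>

definition unif_sq_integrable :: "(nat \<Rightarrow> ('a, 'x) population) \<Rightarrow> bool" where
  "unif_sq_integrable D \<longleftrightarrow>
     (\<forall>e>0. \<exists>K. \<forall>\<^sub>F n in sequentially.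
        (\<integral>\<^sup>+\<omega>. ennreal ((Y_trt (D n) \<omega>)\<^sup>2) * indicator {\<omega>. K < \<bar>Y_trt (D n) \<omega>\<bar>} \<omega> \<partial>pop_space (D n)) \<le> ennreal e)"

lemma real_distribution_normal_law: "real_distribution (normal_law v)"
proof -
  interpret real_distribution std_normal_distribution by (rule real_dist_normal_dist)
  show ?thesis unfolding normal_law_def by (rule real_distribution_distr) simp
qed

lemma normal_law_tendsto:
  assumes V: "V \<longlonglongrightarrow> v" and g: "\<And>x. isCont g x" and B: "\<And>x. \<bar>g x\<bar> \<le> (B::real)"
  shows "(\<lambda>n. integral\<^sup>L (normal_law (V n)) g) \<longlonglongrightarrow> integral\<^sup>L (normal_law v) g"
proof -
  interpret real_distribution std_normal_distribution by (rule real_dist_normal_dist)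
  have [measurable]: "g \<in> borel_measurable borel"
    using g by (intro borel_measurable_continuous_onI continuous_at_imp_continuous_on) auto
  have "(\<lambda>n. \<integral>z. g (sqrt (V n) * z) \<partial>std_normal_distribution)
        \<longlonglongrightarrow> (\<integral>z. g (sqrt v * z) \<partial>std_normal_distribution)"
  proof (rule integral_dominated_convergence[where w="\<lambda>_. B"])
    show "AE z in std_normal_distribution. (\<lambda>n. g (sqrt (V n) * z)) \<longlonglongrightarrow> g (sqrt v * z)"
      by (intro AE_I2 isCont_tendsto_compose[OF g] tendsto_intros V)
  qed (use B in auto)
  then show ?thesis
    unfolding normal_law_def by (simp add: integral_distr)
qed

lemma asymp_normal_iff:
  assumes \<mu>: "\<And>n. real_distribution (\<mu> n)" and V: "V \<longlonglongrightarrow> v"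
  shows "asymp_normal \<mu> V \<longleftrightarrow> weak_conv_m \<mu> (normal_law v)"
proof
  assume L: "asymp_normal \<mu> V"
  show "weak_conv_m \<mu> (normal_law v)"
  proof (rule integral_bdd_continuous_conv_imp_weak_conv[OF \<mu> real_distribution_normal_law])
    fix g :: "real \<Rightarrow> real"
    assume g: "\<And>x. isCont g x" "\<And>x. \<bar>g x\<bar> \<le> 1"
    have "(\<lambda>n. (integral\<^sup>L (\<mu> n) g - integral\<^sup>L (normal_law (V n)) g) + integral\<^sup>L (normal_law (V n)) g)
          \<longlonglongrightarrow> 0 + integral\<^sup>L (normal_law v) g"
      using L g unfolding asymp_normal_def by (intro tendsto_add normal_law_tendsto[OF V, where B=1]) auto
    then show "(\<lambda>n. integral\<^sup>L (\<mu> n) g) \<longlonglongrightarrow> integral\<^sup>L (normal_law v) g" by simp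
  qed
next
  assume R: "weak_conv_m \<mu> (normal_law v)"
  show "asymp_normal \<mu> V"
    unfolding asymp_normal_def
  proof (intro allI impI, elim conjE exE)
    fix g :: "real \<Rightarrow> real" and B
    assume g: "\<forall>x. isCont g x" "\<forall>x. \<bar>g x\<bar> \<le> B"
    have "(\<lambda>n. integral\<^sup>L (\<mu> n) g) \<longlonglongrightarrow> integral\<^sup>L (normal_law v) g"
      using g by (intro weak_conv_imp_integral_bdd_continuous_conv[OF \<mu> real_distribution_normal_law R, where B=B]) auto
    moreover have "(\<lambda>n. integral\<^sup>L (normal_law (V n)) g) \<longlonglongrightarrow> integral\<^sup>L (normal_law v) g"
      using g by (intro normal_law_tendsto[OF V, where B=B]) auto
    ultimately show "(\<lambda>n. integral\<^sup>L (\<mu> n) g - integral\<^sup>L (normal_law (V n)) g) \<longlonglongrightarrow> 0"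
      using tendsto_diff by fastforce
  qed
qed

lemma unif_sq_integrable_fixed_law:
  assumes D: "\<And>n. population_model (D n)"
    and law: "\<And>n. distr (pop_space (D n)) borel (Y_trt (D n)) = L"
    and \<psi>: "mono \<psi>" and D0: "0 < D0"
    and A1: "assumption1 (D m) n gb C0 B0 \<nu>0 \<xi>0 \<eta>0"
    and A2: "assumption2 \<psi> (D m) n gb ab C0 B0 D0 D1 \<nu>1 \<xi>1 \<eta>1"
  shows "unif_sq_integrable D"
proof -
  let ?M = "pop_space (D m)" and ?F = "cov_algebra (D m)"
  have meas [measurable]: "Y_trt (D n) \<in> borel_measurable (pop_space (D n))" for n
    using D[of n] by (auto simp: population_model_def)
  have [measurable]: "Cov (D m) \<in> measurable ?M (cov_space (D m))"
    using D[of m] by (auto simp: population_model_def)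
  have dict_meas: "dict (D m) j \<in> borel_measurable (cov_space (D m))" if "j \<le> dict_dim (D m)" for j
    using D[of m] that by (auto simp: population_model_def)
  have [measurable]: "\<psi> \<in> borel_measurable borel"
    using \<psi> by (rule borel_measurable_mono)
  have [measurable]: "lin (D m) ab \<in> borel_measurable (cov_space (D m))"
    unfolding lin_def by (intro borel_measurable_sum borel_measurable_times dict_meas) auto
  interpret prob_space ?M using D[of m] by (auto simp: population_model_def)
  have "Cov (D m) \<in> space ?M \<rightarrow> space (cov_space (D m))"
    by (auto intro: measurable_space[of "Cov (D m)" ?M])
  then have sub: "subalgebra ?M ?F"
    unfolding subalgebra_def cov_algebra_def
    by (auto simp: sets_vimage_algebra2 intro!: measurable_sets)
  interpret F: finite_measure_subalgebra ?M ?F by unfold_locales (rule sub)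
  let ?h = "\<lambda>\<omega>. \<psi> (lin (D m) ab (Cov (D m) \<omega>))"
  let ?g = "\<lambda>\<omega>. ennreal (exp ((Y_trt (D m) \<omega> - ?h \<omega>)\<^sup>2 / D0\<^sup>2) - 1)"
  define K where "K = (\<Sum>j\<le>dict_dim (D m). \<bar>ab j\<bar> * C0)"
  define K' where "K' = max \<bar>\<psi> K\<bar> \<bar>\<psi> (- K)\<bar>"
  have bdd: "AE \<omega> in ?M. \<bar>?h \<omega>\<bar> \<le> K'"
  proof -
    have "AE \<omega> in ?M. \<forall>j \<le> dict_dim (D m). \<bar>dict (D m) j (Cov (D m) \<omega>)\<bar> \<le> C0"
      using A1 by (auto simp: assumption1_def)
    then show ?thesis
    proof eventually_elim
      case (elim \<omega>)
      have "\<bar>lin (D m) ab (Cov (D m) \<omega>)\<bar> \<le> K"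
        unfolding lin_def K_def using elim
        by (intro order_trans[OF sum_abs] sum_mono) (auto simp: abs_mult intro!: mult_left_mono)
      then have "\<psi> (- K) \<le> ?h \<omega>" "?h \<omega> \<le> \<psi> K"
        using \<psi> by (auto intro!: monoD[OF \<psi>] simp: abs_le_iff)
      then show ?case unfolding K'_def by linarith
    qed
  qed
  have "(\<integral>\<^sup>+\<omega>. ennreal (D0\<^sup>2) * ?g \<omega> \<partial>?M) = ennreal (D0\<^sup>2) * (\<integral>\<^sup>+\<omega>. nn_cond_exp ?M ?F ?g \<omega> \<partial>?M)"
    using F.nn_cond_exp_intg[of "\<lambda>_. 1" ?g] by (simp add: nn_integral_cmult)
  also have "\<dots> = (\<integral>\<^sup>+\<omega>. ennreal (D0\<^sup>2) * nn_cond_exp ?M ?F ?g \<omega> \<partial>?M)"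
    by (simp add: nn_integral_cmult)
  also have "\<dots> \<le> (\<integral>\<^sup>+\<omega>. ennreal (D1\<^sup>2) \<partial>?M)"
    using A2 by (intro nn_integral_mono_AE) (auto simp: assumption2_def)
  also have "\<dots> = ennreal (D1\<^sup>2)" by (simp add: emeasure_space_1)
  finally have g: "(\<integral>\<^sup>+\<omega>. ennreal (D0\<^sup>2) * ?g \<omega> \<partial>?M) \<le> ennreal (D1\<^sup>2)" .
  have "(\<integral>\<^sup>+\<omega>. ennreal ((Y_trt (D m) \<omega>)\<^sup>2) \<partial>?M)
        \<le> (\<integral>\<^sup>+\<omega>. 2 * (ennreal (D0\<^sup>2) * ?g \<omega>) + ennreal (2 * K'\<^sup>2) \<partial>?M)"
  proof (rule nn_integral_mono_AE, use bdd in eventually_elim)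
    case (elim \<omega>)
    let ?e = "Y_trt (D m) \<omega> - ?h \<omega>"
    have "1 + ?e\<^sup>2 / D0\<^sup>2 \<le> exp (?e\<^sup>2 / D0\<^sup>2)" by (rule exp_ge_add_one_self)
    then have e: "?e\<^sup>2 \<le> D0\<^sup>2 * (exp (?e\<^sup>2 / D0\<^sup>2) - 1)"
      using D0 by (simp add: field_simps)
    have h: "(?h \<omega>)\<^sup>2 \<le> K'\<^sup>2" using elim by (metis abs_ge_zero power2_abs power_mono)
    have "0 \<le> (?e - ?h \<omega>)\<^sup>2" by simp
    then have "(Y_trt (D m) \<omega>)\<^sup>2 \<le> 2 * ?e\<^sup>2 + 2 * (?h \<omega>)\<^sup>2"
      by (simp add: power2_eq_square algebra_simps)
    then have "(Y_trt (D m) \<omega>)\<^sup>2 \<le> 2 * (D0\<^sup>2 * (exp (?e\<^sup>2 / D0\<^sup>2) - 1)) + 2 * K'\<^sup>2"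
      using e h by linarith
    then have "ennreal ((Y_trt (D m) \<omega>)\<^sup>2) \<le> ennreal (2 * (D0\<^sup>2 * (exp (?e\<^sup>2 / D0\<^sup>2) - 1)) + 2 * K'\<^sup>2)"
      by (rule ennreal_leI)
    also have "\<dots> = 2 * (ennreal (D0\<^sup>2) * ?g \<omega>) + ennreal (2 * K'\<^sup>2)"
      by (simp add: ennreal_plus ennreal_mult)
    finally show ?case .
  qed
  also have "\<dots> = 2 * (\<integral>\<^sup>+\<omega>. ennreal (D0\<^sup>2) * ?g \<omega> \<partial>?M) + ennreal (2 * K'\<^sup>2)"
    by (subst nn_integral_add) (auto simp: nn_integral_cmult emeasure_space_1)
  also have "\<dots> \<le> 2 * ennreal (D1\<^sup>2) + ennreal (2 * K'\<^sup>2)"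
    using g by (intro add_mono mult_left_mono) auto
  also have "\<dots> < \<infinity>" by (simp add: ennreal_mult_less_top)
  finally have fin: "(\<integral>\<^sup>+\<omega>. ennreal ((Y_trt (D m) \<omega>)\<^sup>2) \<partial>?M) < \<infinity>" .

  have tr: "(\<integral>\<^sup>+\<omega>. ennreal ((Y_trt (D n) \<omega>)\<^sup>2) * indicator {\<omega>. k < \<bar>Y_trt (D n) \<omega>\<bar>} \<omega> \<partial>pop_space (D n))
      = (\<integral>\<^sup>+y. ennreal (y\<^sup>2) * indicator {y. k < \<bar>y\<bar>} y \<partial>L)" for n k
    unfolding law[of n, symmetric] by (subst nn_integral_distr) (auto simp: indicator_def)
  have [measurable_cong]: "sets L = sets borel" using law[of m] by auto
  have finL: "(\<integral>\<^sup>+y. ennreal (y\<^sup>2) \<partial>L) < \<infinity>"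
    using fin unfolding law[of m, symmetric] by (subst nn_integral_distr) auto
  then have intL: "integrable L (\<lambda>y. y\<^sup>2)"
    by (intro integrableI_nonneg) auto
  have "(\<lambda>k. \<integral>y. y\<^sup>2 * indicator {y. real k < \<bar>y\<bar>} y \<partial>L) \<longlonglongrightarrow> (\<integral>y. 0 \<partial>L)"
  proof (rule integral_dominated_convergence[where w="\<lambda>y. y\<^sup>2"])
    show "AE y in L. (\<lambda>k. y\<^sup>2 * indicator {y. real k < \<bar>y\<bar>} y) \<longlonglongrightarrow> 0"
    proof (intro AE_I2 tendsto_eventually)
      fix y :: real
      show "\<forall>\<^sub>F k in sequentially. y\<^sup>2 * indicator {y. real k < \<bar>y\<bar>} y = 0"
        using eventually_ge_at_top[of "nat \<lceil>\<bar>y\<bar>\<rceil>"]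
        by eventually_elim (auto simp: indicator_def nat_le_iff ceiling_le_iff)
    qed
  qed (use intL in \<open>auto simp: indicator_def\<close>)
  then have lim: "(\<lambda>k. \<integral>y. y\<^sup>2 * indicator {y. real k < \<bar>y\<bar>} y \<partial>L) \<longlonglongrightarrow> 0" by simp
  show ?thesis
    unfolding unif_sq_integrable_def tr
  proof (intro allI impI)
    fix e :: real assume "0 < e"
    with lim have "\<forall>\<^sub>F k in sequentially. (\<integral>y. y\<^sup>2 * indicator {y. real k < \<bar>y\<bar>} y \<partial>L) < e"
      by (auto dest: order_tendstoD)
    then obtain k :: nat where k: "(\<integral>y. y\<^sup>2 * indicator {y. real k < \<bar>y\<bar>} y \<partial>L) < e"
      by (auto dest: eventually_happens)
    have int: "integrable L (\<lambda>y. y\<^sup>2 * indicator {y. real k < \<bar>y\<bar>} y)"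
      by (rule Bochner_Integration.integrable_bound[OF intL]) (auto simp: indicator_def)
    have "(\<integral>\<^sup>+y. ennreal (y\<^sup>2) * indicator {y. real k < \<bar>y\<bar>} y \<partial>L)
        = (\<integral>\<^sup>+y. ennreal (y\<^sup>2 * indicator {y. real k < \<bar>y\<bar>} y) \<partial>L)"
      by (intro nn_integral_cong) (auto simp: indicator_def)
    also have "\<dots> = ennreal (\<integral>y. y\<^sup>2 * indicator {y. real k < \<bar>y\<bar>} y \<partial>L)"
      by (rule nn_integral_eq_integral[OF int]) auto
    also have "\<dots> \<le> ennreal e" using k by (intro ennreal_leI) simp
    finally show "\<exists>K. \<forall>\<^sub>F n in sequentially. (\<integral>\<^sup>+y. ennreal (y\<^sup>2) * indicator {y. K < \<bar>y\<bar>} y \<partial>L) \<le> ennreal e"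
      by (intro exI[of _ "real k"]) simp
  qed
qed

end

theory Submission
  imports Defs
begin

text \<open>
  The fitted augmented estimator is asymptotically linear, with influence function
  \<open>\<phi> = aipw (\<psi> (lin D ab)) (ps D gb)\<close> formed at the targets of the two regressions. To see why, write
  \<open>w = exp (- lin D gb)\<close>, let \<open>W\<close> and \<open>M\<close> be the changes of the weight and of the fitted outcome
  regression when targets are replaced by estimates, and let \<open>e\<close> be the residual at the target. Then
  exactly
    \<open>fitted - \<phi> = (1 - t - t w) M + t W e - t W M\<close>.
  The factor of \<open>M\<close> has conditional mean zero given the covariates, because the propensity model is
  correct. To first order \<open>t W e\<close> is linear in the error of the propensity coefficients, with coefficient
  vector the score of the weighted outcome regression; its mean vanishes because the target minimizes
  the weighted loss, whether or not the outcome model is true. So both first-order terms are products of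
  an estimation error, of order \<open>s L\<close> in the \<open>l1\<close> norm, with averages of centred variables, of order
  \<open>L = sqrt (log p / n)\<close>, and all other terms are quadratic in the errors (lemmas \<open>aipw_expansion\<close> and
  \<open>remainder_rates\<close>). Their total is of order \<open>s L\<^sup>2\<close>, which is \<open>o(1 / sqrt n)\<close> under the sparsity assumption.

  The error rates come from one deterministic statement, \<open>lasso_rate\<close>: if a loss dominates a Huber-type
  function of the error, its noise is dominated by a small multiple of the penalty, and the population
  Gram form is compatible with the support, then a penalized estimator attains the rates \<open>s L\<close> in
  \<open>l1\<close> norm and \<open>s L\<^sup>2\<close> in quadratic norm. It is applied first to the calibrated propensity estimator
  (\<open>cal_rate\<close>) and then to the outcome regression with estimated weights (\<open>wl_rate\<close>), where the effect of
  estimating the weights is a further noise term, bounded by Cauchy-Schwarz.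

  The tuning constants are fixed, yet all of this must hold with probability tending to one. A union
  bound over the \<open>1 + p\<close> coordinates fails with a probability that is a power of \<open>1 / (1 + p)\<close>, which does
  not vanish if \<open>p\<close> stays bounded. In that case the noise is instead measured in the geometry of the Gram
  form: by \<open>mahalanobis_noise\<close> it is small in all directions simultaneously, outside an event whose
  probability is as small as desired, at the price of a constant that affects the rates but not the tuning
  constants. Lemma \<open>noise_event\<close> combines the two cases.

  The populations may change with the sample size, so the limit theorem is one for triangular arrays.
  The square of the influence function inherits uniform integrability from the treated outcome
  (\<open>phi_tail\<close>), which gives a central limit theorem through characteristic functions (\<open>char_mean\<close>) and a
  law of large numbers for the variance estimator (\<open>truncated_lln\<close>). The asymptotic variance need not
  converge; it is bounded, and limits are taken along subsequences on which it does. When it is bounded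
  away from zero, \<open>self_normalized_coverage\<close> turns both results into coverage of the confidence interval.
\<close>

section \<open>Deterministic rates for penalized convex losses\<close>

lemma exp_le_quadratic:
  fixes x :: real
  shows "exp x \<le> 1 + x + x\<^sup>2 * exp \<bar>x\<bar> / 2"
proof -
  obtain t where t: "\<bar>t\<bar> \<le> \<bar>x\<bar>" "exp x = (\<Sum>m<2. x ^ m / fact m) + exp t / fact 2 * x ^ 2"
    using Maclaurin_exp_le[of x 2] by blast
  have "exp t * x\<^sup>2 \<le> exp \<bar>x\<bar> * x\<^sup>2"
    using t(1) by (intro mult_right_mono) auto
  with t(2) show ?thesis by (simp add: numeral_2_eq_2 mult_ac)
qed

lemma exp_minus_diff_le:
  fixes t :: real
  shows "\<bar>exp (- t) - 1\<bar> \<le> \<bar>t\<bar> * exp \<bar>t\<bar>"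
    and "\<bar>exp (- t) - 1 + t\<bar> \<le> t\<^sup>2 * exp \<bar>t\<bar>"
proof -
  obtain s where s: "\<bar>s\<bar> \<le> \<bar>- t\<bar>" "exp (- t) = (\<Sum>m<1. (- t) ^ m / fact m) + exp s / fact 1 * (- t) ^ 1"
    using Maclaurin_exp_le[of "- t" 1] by blast
  have "exp s \<le> exp \<bar>t\<bar>" using s(1) by auto
  moreover have "\<bar>exp (- t) - 1\<bar> = exp s * \<bar>t\<bar>" using s(2) by (simp add: abs_mult)
  ultimately show "\<bar>exp (- t) - 1\<bar> \<le> \<bar>t\<bar> * exp \<bar>t\<bar>"
    by (simp add: mult.commute mult_left_mono)
  have "exp (- t) - 1 + t \<le> t\<^sup>2 * exp \<bar>t\<bar> / 2" using exp_le_quadratic[of "- t"] by simp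
  moreover have "0 \<le> exp (- t) - 1 + t" using exp_ge_add_one_self[of "- t"] by simp
  moreover have "0 \<le> t\<^sup>2 * exp \<bar>t\<bar>" by simp
  ultimately show "\<bar>exp (- t) - 1 + t\<bar> \<le> t\<^sup>2 * exp \<bar>t\<bar>" by linarith
qed

text \<open>
  Integrating an exponentially decaying curvature once gives the right-hand side below; replacing it by
  a rational function yields bounds that stay manageable after a second integration.
\<close>

lemma one_minus_exp_ge:
  fixes c t :: real
  assumes "0 < c" "0 \<le> t"
  shows "t / (1 + c * t) \<le> (1 - exp (- c * t)) / c"
proof -
  have "1 + c * t \<le> exp (c * t)" by (rule exp_ge_add_one_self)
  moreover have "0 < 1 + c * t" using assms by (simp add: add_pos_nonneg)
  ultimately have "exp (- c * t) \<le> 1 / (1 + c * t)"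
    by (simp add: exp_minus field_simps)
  then have "1 - 1 / (1 + c * t) \<le> 1 - exp (- c * t)" by simp
  also have "1 - 1 / (1 + c * t) = c * t / (1 + c * t)"
    using \<open>0 < 1 + c * t\<close> by (simp add: field_simps)
  finally show ?thesis using assms by (simp add: field_simps)
qed

text \<open>
  The curvature is integrated over the segment from \<open>u\<close> to \<open>u + t\<close>; the case of negative \<open>t\<close> is the
  mirror image.
\<close>

lemma deriv_gap_ge:
  fixes r' r'' :: "real \<Rightarrow> real"
  assumes r'': "\<And>u. (r' has_real_derivative r'' u) (at u)"
    and C: "0 < C" and c: "0 \<le> c" and curv: "\<And>t. c * exp (- C * \<bar>t\<bar>) \<le> r'' (u + t)"
  shows "c * t\<^sup>2 / (1 + C * \<bar>t\<bar>) \<le> (r' (u + t) - r' u) * t"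
proof -
  have pos: "c * t / (1 + C * t) \<le> r' (u + t) - r' u"
    if r'': "\<And>u. (r' has_real_derivative r'' u) (at u)"
      and curv: "\<And>t. c * exp (- C * \<bar>t\<bar>) \<le> r'' (u + t)" and t: "0 \<le> t"
    for r' r'' :: "real \<Rightarrow> real" and u t :: real
  proof -
    let ?k = "\<lambda>t. r' (u + t) - r' u - c * (1 - exp (- C * t)) / C"
    have "?k 0 \<le> ?k t"
    proof (rule DERIV_nonneg_imp_nondecreasing[OF t])
      fix x assume x: "0 \<le> x" "x \<le> t"
      have "((\<lambda>t. r' (u + t)) has_real_derivative r'' (u + x) * 1) (at x)"
        by (rule DERIV_chain2[OF r'']) (auto intro!: derivative_eq_intros)
      then have "(?k has_real_derivative r'' (u + x) - c * exp (- C * x)) (at x)"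
        using C by (auto intro!: derivative_eq_intros)
      moreover have "0 \<le> r'' (u + x) - c * exp (- C * x)" using curv[of x] x by simp
      ultimately show "\<exists>y. (?k has_real_derivative y) (at x) \<and> 0 \<le> y" by blast
    qed
    then have "c * ((1 - exp (- C * t)) / C) \<le> r' (u + t) - r' u" by simp
    moreover have "c * (t / (1 + C * t)) \<le> c * ((1 - exp (- C * t)) / C)"
      using one_minus_exp_ge[OF C t] c by (intro mult_left_mono) auto
    ultimately show ?thesis by simp
  qed
  show ?thesis
  proof (cases "0 \<le> t")
    case True
    have "c * t / (1 + C * t) * t \<le> (r' (u + t) - r' u) * t"
      using pos[OF r'' curv True] True by (intro mult_right_mono) auto
    then show ?thesis using True by (simp add: power2_eq_square mult_ac)
  next
    case False
    have *: "((\<lambda>x. - r' (- x)) has_real_derivative r'' (- x)) (at x)" for x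
      by (rule derivative_eq_intros DERIV_chain2[OF r''] refl | simp)+
    have "c * (- t) / (1 + C * (- t)) \<le> - r' (- (- u + - t)) - - r' (- (- u))"
      by (rule pos[OF *]) (use curv[of "- x" for x] False in \<open>auto simp: add.commute\<close>)
    then have "c * (- t) / (1 + C * (- t)) * (- t) \<le> (r' u - r' (u + t)) * (- t)"
      using False by (intro mult_right_mono) (auto simp: add.commute)
    then show ?thesis using False by (simp add: power2_eq_square algebra_simps)
  qed
qed

text \<open>
  A loss whose curvature decays at most exponentially away from the target dominates a
  Huber-type function of the distance: quadratic near the target, linear far away.
\<close>

lemma bregman_ge:
  fixes r r' r'' :: "real \<Rightarrow> real"
  assumes r': "\<And>u. (r has_real_derivative r' u) (at u)"
    and r'': "\<And>u. (r' has_real_derivative r'' u) (at u)"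
    and C: "0 < C" and c: "0 \<le> c" and curv: "\<And>t. c * exp (- C * \<bar>t\<bar>) \<le> r'' (u + t)"
  shows "c * t\<^sup>2 / (2 * (1 + C * \<bar>t\<bar>)) \<le> r (u + t) - r u - r' u * t"
proof -
  define q where "q = c * t\<^sup>2 / (1 + C * \<bar>t\<bar>)"
  let ?k = "\<lambda>s. r (u + s * t) - r u - r' u * (s * t) - q * s\<^sup>2 / 2"
  have "?k 0 \<le> ?k 1"
  proof (rule DERIV_nonneg_imp_nondecreasing[where f="?k"])
    fix s :: real assume s: "0 \<le> s" "s \<le> 1"
    have "((\<lambda>s. r (u + s * t)) has_real_derivative r' (u + s * t) * t) (at s)"
      by (rule DERIV_chain2[OF r']) (auto intro!: derivative_eq_intros)
    then have d: "(?k has_real_derivative (r' (u + s * t) - r' u) * t - q * s) (at s)"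
      by (auto intro!: derivative_eq_intros simp: algebra_simps)
    have "q * s \<le> (r' (u + s * t) - r' u) * t"
    proof (cases "s = 0")
      case False
      have "c * (s * t)\<^sup>2 / (1 + C * \<bar>t\<bar>) \<le> c * (s * t)\<^sup>2 / (1 + C * \<bar>s * t\<bar>)"
        using s C c by (intro divide_left_mono)
          (auto simp: abs_mult mult_left_le_one_le add_pos_nonneg intro!: mult_left_mono mult_pos_pos)
      also have "\<dots> \<le> (r' (u + s * t) - r' u) * (s * t)"
        by (rule deriv_gap_ge[OF r'' C c curv])
      finally have "(q * s) * s \<le> ((r' (u + s * t) - r' u) * t) * s"
        by (simp add: q_def power2_eq_square mult_ac)
      with s False show ?thesis by (simp add: mult_le_cancel_right)
    qed simp
    with d show "\<exists>y. (?k has_real_derivative y) (at s) \<and> 0 \<le> y" by force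
  qed simp
  then show ?thesis by (simp add: q_def field_simps)
qed

text \<open>
  The probabilistic content of a lasso proof, reduced to numbers. Here \<open>L\<close> is the noise level, \<open>s\<close> the
  sparsity, \<open>r\<close> the \<open>l1\<close> norm of the estimation error and \<open>dS\<close> its part on the support, \<open>x\<close> and \<open>y\<close> are
  its empirical and population quadratic norms, and \<open>k L\<close> is the penalty. The premises are:
  \<open>y\<^sup>2\<close> exceeds \<open>x\<^sup>2\<close> by at most \<open>K L r\<^sup>2\<close>; the basic inequality of a penalized minimizer with noise \<open>nz\<close>; the
  noise is at most a fraction \<open>a\<close> of the penalty plus a term in the quadratic norms; and
  compatibility on the cone with constant \<open>\<xi>\<close>.
\<close>

definition lasso_rate_holds :: "real \<Rightarrow> real \<Rightarrow> real \<Rightarrow> real \<Rightarrow> real \<Rightarrow> real \<Rightarrow> real \<Rightarrow> real \<Rightarrow> real \<Rightarrow> bool" where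
  "lasso_rate_holds a c C K k \<nu> \<xi> \<rho> B \<longleftrightarrow> (\<forall>L s r x y dS nz :: real.
    0 < L \<and> 1 \<le> s \<and> s * L \<le> \<rho> \<and> 0 \<le> x \<and> 0 \<le> y \<and> 0 \<le> dS \<and> dS \<le> r \<and>
    y\<^sup>2 \<le> x\<^sup>2 + K * L * r\<^sup>2 \<and>
    c * x\<^sup>2 / (2 * (1 + C * r)) \<le> nz + k * L * (2 * dS - r) \<and>
    nz \<le> a * (k * L) * r + K * L * sqrt s * (x + y) \<and>
    (r - dS \<le> \<xi> * dS \<longrightarrow> \<nu> * dS \<le> sqrt s * y)
    \<longrightarrow> r \<le> B * (s * L) \<and> x\<^sup>2 \<le> B * (s * L\<^sup>2) \<and> y\<^sup>2 \<le> B * (s * L\<^sup>2))"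

text \<open>
  The error satisfies a quadratic inequality whose right-hand side is at most \<open>M L sqrt s (x + y)\<close>: on the
  cone the penalty difference is controlled by compatibility, off the cone it is negative. The excess of
  \<open>y\<close> over \<open>x\<close> is absorbed by the penalty because \<open>s L\<close> is small. The Huber denominator \<open>1 + C r\<close> is
  harmless, since the same inequality bounds \<open>r\<close> first and thereby the denominator by 2. The point of the
  formulation is that \<open>\<rho>\<close> and \<open>B\<close> depend only on the constants.
\<close>

lemma lasso_rate:
  fixes a c C K k \<nu> \<xi> :: real
  assumes a: "0 < a" "2 * a < 1" and c: "0 < c" and C: "0 < C" and K: "0 < K" and k: "0 < k" and \<nu>: "0 < \<nu>"
    and \<xi>: "1 + 2 * a \<le> \<xi> * (1 - 2 * a)"
  shows "\<exists>\<rho>>0. \<exists>B>0. lasso_rate_holds a c C K k \<nu> \<xi> \<rho> B"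
proof -
  (* M collects the coefficients of L * sqrt s * (x + y), B1 and B2 are the constants that result for r and
     x^2. The four terms of \<rho> serve, in order, to bound s L by 1, to absorb y - x into the penalty, to absorb
     C r into the penalty, and to bound the Huber denominator by 2. *)
  define M where "M = 2 * k / \<nu> + K"
  define B1 where "B1 = 16 * M\<^sup>2 / (c * a * k)"
  define B2 where "B2 = 32 * M\<^sup>2 / c\<^sup>2"
  define \<rho> where "\<rho> = min (min 1 ((a * k / (2 * M))\<^sup>2 / K)) (min (c * a * k / (16 * M\<^sup>2 * C)) (1 / (C * B1)))"
  define B where "B = B1 + B2 + K * B1\<^sup>2 * \<rho>"
  have M: "0 < M" using k \<nu> K by (simp add: M_def add_pos_pos)
  have B1: "0 < B1" using M a c k by (simp add: B1_def)
  have B2: "0 < B2" using M c by (simp add: B2_def)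
  have \<rho>: "0 < \<rho>" using M a k K c C B1 by (simp add: \<rho>_def)
  have B: "0 < B" using B1 B2 K \<rho> by (simp add: B_def add_pos_pos)
  have \<rho>1: "\<rho> \<le> (a * k / (2 * M))\<^sup>2 / K" and \<rho>2: "\<rho> \<le> c * a * k / (16 * M\<^sup>2 * C)" and \<rho>3: "\<rho> \<le> 1 / (C * B1)"
    by (auto simp: \<rho>_def)
  have "r \<le> B * (s * L) \<and> x\<^sup>2 \<le> B * (s * L\<^sup>2) \<and> y\<^sup>2 \<le> B * (s * L\<^sup>2)"
    if L: "0 < L" and s: "1 \<le> s" and sL: "s * L \<le> \<rho>" and x: "0 \<le> x" and y: "0 \<le> y" and dS: "0 \<le> dS" "dS \<le> r"
      and xy: "y\<^sup>2 \<le> x\<^sup>2 + K * L * r\<^sup>2"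
      and basic: "c * x\<^sup>2 / (2 * (1 + C * r)) \<le> nz + k * L * (2 * dS - r)"
      and nz: "nz \<le> a * (k * L) * r + K * L * sqrt s * (x + y)"
      and cone: "r - dS \<le> \<xi> * dS \<longrightarrow> \<nu> * dS \<le> sqrt s * y"
    for L s r x y dS nz :: real
  proof -
    have r: "0 \<le> r" using dS by simp
    define Y where "Y = 1 + C * r"
    have Y: "1 \<le> Y" using C r by (simp add: Y_def)
    have cone': "2 * dS - r + 2 * a * r \<le> 2 * sqrt s * y / \<nu>"
    proof (cases "r - dS \<le> \<xi> * dS")
      case True
      have "2 * dS - r + 2 * a * r = (1 + 2 * a) * dS - (1 - 2 * a) * (r - dS)" by (simp add: algebra_simps)
      also have "\<dots> \<le> (1 + 2 * a) * dS" using a dS by simp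
      also have "\<dots> \<le> 2 * dS" using a dS by (intro mult_right_mono) auto
      also have "\<dots> \<le> 2 * (sqrt s * y / \<nu>)" using cone True \<nu> by (simp add: field_simps)
      finally show ?thesis by simp
    next
      case False
      have "2 * dS - r + 2 * a * r = (1 + 2 * a) * dS - (1 - 2 * a) * (r - dS)" by (simp add: algebra_simps)
      also have "\<dots> \<le> \<xi> * (1 - 2 * a) * dS - (1 - 2 * a) * (\<xi> * dS)"
        using \<xi> False a dS by (intro diff_mono mult_right_mono mult_left_mono) auto
      also have "\<dots> = 0" by simp
      also have "0 \<le> 2 * sqrt s * y / \<nu>" using s y \<nu> by simp
      finally show ?thesis .
    qed
    have "y \<le> sqrt (x\<^sup>2 + K * L * r\<^sup>2)" using xy by (simp add: real_le_rsqrt)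
    also have "\<dots> \<le> sqrt (x\<^sup>2) + sqrt (K * L * r\<^sup>2)" using K L by (intro sqrt_add_le_add_sqrt) auto
    also have "\<dots> = x + sqrt (K * L) * r" using x r by (simp add: real_sqrt_mult)
    finally have yx: "y \<le> x + sqrt (K * L) * r" .
    have sqrtb: "sqrt s * sqrt (K * L) \<le> a * k / (2 * M)"
    proof -
      have "sqrt s * sqrt (K * L) = sqrt (K * (s * L))" by (simp add: real_sqrt_mult[symmetric] mult_ac)
      also have "\<dots> \<le> sqrt ((a * k / (2 * M))\<^sup>2)"
      proof (rule real_sqrt_le_mono)
        have "s * L \<le> (a * k / (2 * M))\<^sup>2 / K" using sL \<rho>1 by linarith
        then show "K * (s * L) \<le> (a * k / (2 * M))\<^sup>2"
          using K by (subst (asm) pos_le_divide_eq) (simp_all add: mult.commute)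
      qed
      also have "\<dots> = a * k / (2 * M)" using a k M by simp
      finally show ?thesis .
    qed
    have "c * x\<^sup>2 / (2 * Y) + a * (k * L) * r \<le> K * L * sqrt s * (x + y) + (k * L) * (2 * dS - r + 2 * a * r)"
      using basic nz by (simp add: Y_def algebra_simps)
    also have "\<dots> \<le> K * L * sqrt s * (x + y) + (k * L) * (2 * sqrt s * y / \<nu>)"
      using cone' k L by (intro add_left_mono mult_left_mono) auto
    also have "\<dots> \<le> K * L * sqrt s * (x + y) + (k * L) * (2 * sqrt s * (x + y) / \<nu>)"
      using x s k L \<nu> by (intro add_left_mono mult_left_mono divide_right_mono) auto
    also have "\<dots> = M * L * sqrt s * (x + y)"
      using \<nu> by (simp add: M_def field_simps)
    also have "\<dots> \<le> M * L * sqrt s * (2 * x + sqrt (K * L) * r)"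
      using yx M L s by (intro mult_left_mono) auto
    also have "\<dots> = 2 * M * L * sqrt s * x + M * L * r * (sqrt s * sqrt (K * L))" by (simp add: algebra_simps)
    also have "\<dots> \<le> 2 * M * L * sqrt s * x + M * L * r * (a * k / (2 * M))"
      using sqrtb M L r by (intro add_left_mono mult_left_mono) auto
    also have "\<dots> = 2 * M * L * sqrt s * x + a * (k * L) * r / 2" using M by simp
    finally have 1: "c * x\<^sup>2 / (2 * Y) + a * (k * L) * r / 2 \<le> 2 * M * L * sqrt s * x" by simp
    (* Young inequality, balanced so that half of the quadratic term survives. *)
    have am: "2 * M * L * sqrt s * x \<le> c * x\<^sup>2 / (4 * Y) + (2 * M * L * sqrt s)\<^sup>2 * Y / c"
    proof -
      have "0 \<le> (sqrt (c / Y) * x / 2 - 2 * M * L * sqrt s * sqrt (Y / c))\<^sup>2" by simp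
      also have "\<dots> = (c / Y) * x\<^sup>2 / 4 + (2 * M * L * sqrt s)\<^sup>2 * (Y / c) - (2 * M * L * sqrt s) * x * (sqrt (c / Y) * sqrt (Y / c))"
        using c Y by (simp add: power2_diff power_mult_distrib power_divide)
      also have "sqrt (c / Y) * sqrt (Y / c) = 1" using c Y by (simp add: real_sqrt_mult[symmetric])
      finally show ?thesis by simp
    qed
    have sq: "(2 * M * L * sqrt s)\<^sup>2 = 4 * M\<^sup>2 * (s * L\<^sup>2)" using s by (simp add: power_mult_distrib)
    have cx: "c * x\<^sup>2 / (2 * Y) = 2 * (c * x\<^sup>2 / (4 * Y))" by simp
    have 2: "c * x\<^sup>2 / (4 * Y) + a * (k * L) * r / 2 \<le> 4 * M\<^sup>2 * (s * L\<^sup>2) * (1 + C * r) / c"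
      using 1 am unfolding cx sq by (simp add: Y_def)
    have "4 * M\<^sup>2 * (s * L\<^sup>2) * (C * r) / c = (s * L) * (4 * M\<^sup>2 * C / c) * (L * r)"
      by (simp add: power2_eq_square)
    also have "\<dots> \<le> \<rho> * (4 * M\<^sup>2 * C / c) * (L * r)"
      using sL C c L r by (intro mult_right_mono) auto
    also have "\<dots> \<le> (c * a * k / (16 * M\<^sup>2 * C)) * (4 * M\<^sup>2 * C / c) * (L * r)"
      using \<rho>2 C c L r by (intro mult_right_mono) auto
    also have "\<dots> = a * (k * L) * r / 4" using C c M by (simp add: field_simps)
    finally have 3: "c * x\<^sup>2 / (4 * Y) + a * (k * L) * r / 4 \<le> 4 * M\<^sup>2 * (s * L\<^sup>2) / c"
      using 2 by (simp add: distrib_left add_divide_distrib)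
    have "a * (k * L) * r / 4 \<le> 4 * M\<^sup>2 * (s * L\<^sup>2) / c"
      using 3 c Y by (smt (verit) divide_nonneg_nonneg mult_nonneg_nonneg zero_le_power2)
    then have rb: "r \<le> B1 * (s * L)"
      using a k L c by (simp add: B1_def field_simps power2_eq_square)
    have "C * r \<le> C * (B1 * \<rho>)" using rb sL B1 C by (smt (verit) mult_left_mono)
    also have "\<dots> \<le> 1" using \<rho>3 C B1 by (simp add: field_simps)
    finally have Y2: "Y \<le> 2" by (simp add: Y_def)
    have "c * x\<^sup>2 / 8 \<le> c * x\<^sup>2 / (4 * Y)" using Y2 Y c by (intro divide_left_mono) auto
    moreover have "0 \<le> a * (k * L) * r / 4" using a k L r by simp
    ultimately have "c * x\<^sup>2 / 8 \<le> 4 * M\<^sup>2 * (s * L\<^sup>2) / c" using 3 by linarith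
    then have xb: "x\<^sup>2 \<le> B2 * (s * L\<^sup>2)"
      using c by (simp add: B2_def field_simps power2_eq_square)
    have "K * L * r\<^sup>2 \<le> K * L * (B1 * (s * L))\<^sup>2"
      using rb r K L by (intro mult_left_mono power_mono) auto
    also have "\<dots> = K * B1\<^sup>2 * (s * L) * (s * L\<^sup>2)" by (simp add: power2_eq_square)
    also have "\<dots> \<le> K * B1\<^sup>2 * \<rho> * (s * L\<^sup>2)"
      using sL K s by (intro mult_right_mono mult_left_mono) auto
    finally have "y\<^sup>2 \<le> (B2 + K * B1\<^sup>2 * \<rho>) * (s * L\<^sup>2)" using xy xb by (simp add: distrib_right)
    moreover have "(B2 + K * B1\<^sup>2 * \<rho>) * (s * L\<^sup>2) \<le> B * (s * L\<^sup>2)"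
      using B1 s by (intro mult_right_mono) (auto simp: B_def)
    moreover have "B2 * (s * L\<^sup>2) \<le> B * (s * L\<^sup>2)"
      using B1 s K \<rho> by (intro mult_right_mono) (auto simp: B_def)
    moreover have "B1 * (s * L) \<le> B * (s * L)"
      using B2 s K \<rho> L by (intro mult_right_mono) (auto simp: B_def)
    ultimately show ?thesis using rb xb by linarith
  qed
  then have "lasso_rate_holds a c C K k \<nu> \<xi> \<rho> B" unfolding lasso_rate_holds_def by blast
  then show ?thesis using \<rho> B by blast
qed

section \<open>Averages of independent observations and Bernstein bounds\<close>

locale iid_obs = prob_space Q for Q :: "'w measure" +
  fixes P :: "'x obs measure" and Z :: "nat \<Rightarrow> 'w \<Rightarrow> 'x obs" and n :: nat
  assumes indep: "indep_vars (\<lambda>_. P) Z {..<n}"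
    and law: "\<And>i. i < n \<Longrightarrow> distr Q P (Z i) = P"
    and n_pos: "0 < n"
begin

abbreviation mean :: "('x obs \<Rightarrow> real) \<Rightarrow> 'w \<Rightarrow> real" where
  "mean g \<omega> \<equiv> samp_mean n (\<lambda>i. Z i \<omega>) g"

lemma Z_measurable: "i < n \<Longrightarrow> Z i \<in> measurable Q P"
  using indep by (auto simp: indep_vars_def2)

lemma prob_space_P: "prob_space P"
  using prob_space_distr[OF Z_measurable[OF n_pos]] law[OF n_pos] by simp

sublocale P: prob_space P by (rule prob_space_P)

lemma obs_measurable:
  "g \<in> borel_measurable P \<Longrightarrow> i < n \<Longrightarrow> (\<lambda>\<omega>. g (Z i \<omega>)) \<in> borel_measurable Q"
  using Z_measurable by (rule measurable_compose)

lemma mean_measurable: "g \<in> borel_measurable P \<Longrightarrow> mean g \<in> borel_measurable Q"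
  unfolding samp_mean_def by (intro borel_measurable_divide borel_measurable_sum) (auto intro: obs_measurable)

lemma integrable_obs:
  assumes "integrable P g" "i < n"
  shows "integrable Q (\<lambda>\<omega>. g (Z i \<omega>) :: real)"
  using assms Z_measurable[of i] law[of i] by (metis integrable_distr)

lemma integral_obs:
  assumes "g \<in> borel_measurable P" "i < n"
  shows "(\<integral>\<omega>. g (Z i \<omega>) \<partial>Q) = (\<integral>z. g z \<partial>P :: real)"
  using assms Z_measurable[of i] law[of i] integral_distr[of "Z i" Q P g] by simp

lemma AE_obs:
  assumes "AE z in P. R z"
  shows "AE \<omega> in Q. \<forall>i<n. R (Z i \<omega>)"
proof -
  have "AE \<omega> in Q. R (Z i \<omega>)" if "i < n" for i
  proof -
    have "AE z in distr Q P (Z i). R z" unfolding law[OF that] by (rule assms)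
    then show ?thesis by (rule AE_distrD[OF Z_measurable[OF that]])
  qed
  then have "AE \<omega> in Q. \<forall>i\<in>{..<n}. R (Z i \<omega>)" by (intro AE_finite_allI) auto
  then show ?thesis by (simp only: Ball_def lessThan_iff)
qed

lemma indep_obs:
  assumes "\<And>i. i < n \<Longrightarrow> g i \<in> borel_measurable P"
  shows "indep_vars (\<lambda>_. borel) (\<lambda>i \<omega>. g i (Z i \<omega>)) {..<n}"
  using assms by (intro indep_vars_compose2[OF indep]) auto

lemma integral_mean:
  assumes "integrable P g"
  shows "integrable Q (mean g)" "(\<integral>\<omega>. mean g \<omega> \<partial>Q) = (\<integral>z. g z \<partial>P)"
proof -
  show "integrable Q (mean g)"
    unfolding samp_mean_def
    by (intro integrable_divide_zero Bochner_Integration.integrable_sum integrable_obs[OF assms]) auto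
  show "(\<integral>\<omega>. mean g \<omega> \<partial>Q) = (\<integral>z. g z \<partial>P)"
    unfolding samp_mean_def using n_pos borel_measurable_integrable[OF assms]
    by (subst Bochner_Integration.integral_divide_zero, subst Bochner_Integration.integral_sum)
       (simp_all add: integral_obs integrable_obs[OF assms])
qed

lemma second_moment_mean:
  assumes g: "g \<in> borel_measurable P" and g2: "integrable P (\<lambda>z. (g z)\<^sup>2)" and g0: "(\<integral>z. g z \<partial>P) = 0"
  shows "integrable Q (\<lambda>\<omega>. (mean g \<omega>)\<^sup>2)" "(\<integral>\<omega>. (mean g \<omega>)\<^sup>2 \<partial>Q) = (\<integral>z. (g z)\<^sup>2 \<partial>P) / n"
proof -
  have g1: "integrable P g" by (rule P.square_integrable_imp_integrable[OF g g2])
  let ?X = "\<lambda>i \<omega>. g (Z i \<omega>)"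
  have cross: "integrable Q (\<lambda>\<omega>. ?X i \<omega> * ?X j \<omega>) \<and>
      (\<integral>\<omega>. ?X i \<omega> * ?X j \<omega> \<partial>Q) = (if i = j then \<integral>z. (g z)\<^sup>2 \<partial>P else 0)"
    if "i < n" "j < n" for i j
  proof (cases "i = j")
    case True
    have "integrable Q (\<lambda>\<omega>. (?X i \<omega>)\<^sup>2)" by (rule integrable_obs[OF g2 \<open>i < n\<close>])
    moreover have "(\<integral>\<omega>. (?X i \<omega>)\<^sup>2 \<partial>Q) = (\<integral>z. (g z)\<^sup>2 \<partial>P)"
      using g by (intro integral_obs[OF _ \<open>i < n\<close>]) auto
    ultimately show ?thesis using True by (simp add: power2_eq_square)
  next
    case False
    have "indep_vars (\<lambda>_. borel) ?X {i, j}"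
      by (rule indep_vars_subset[OF indep_obs]) (use g that in auto)
    then have "(\<integral>\<omega>. (\<Prod>k\<in>{i,j}. ?X k \<omega>) \<partial>Q) = (\<Prod>k\<in>{i,j}. \<integral>\<omega>. ?X k \<omega> \<partial>Q)"
      and "integrable Q (\<lambda>\<omega>. (\<Prod>k\<in>{i,j}. ?X k \<omega>))"
      using that g1
      by (intro indep_vars_lebesgue_integral indep_vars_integrable; auto intro: integrable_obs)+
    with False that show ?thesis by (simp add: integral_obs g g0)
  qed
  have eq: "(mean g \<omega>)\<^sup>2 = (\<Sum>i<n. \<Sum>j<n. ?X i \<omega> * ?X j \<omega>) / (real n)\<^sup>2" for \<omega>
    by (simp add: samp_mean_def power_divide power2_eq_square sum_product)
  show "integrable Q (\<lambda>\<omega>. (mean g \<omega>)\<^sup>2)"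
    unfolding eq using cross
    by (intro integrable_divide_zero Bochner_Integration.integrable_sum) blast
  have "(\<integral>\<omega>. (mean g \<omega>)\<^sup>2 \<partial>Q) = (\<Sum>i<n. \<Sum>j<n. if i = j then \<integral>z. (g z)\<^sup>2 \<partial>P else 0) / (real n)\<^sup>2"
  proof -
    have "(\<integral>\<omega>. (\<Sum>i<n. \<Sum>j<n. ?X i \<omega> * ?X j \<omega>) \<partial>Q) = (\<Sum>i<n. \<integral>\<omega>. (\<Sum>j<n. ?X i \<omega> * ?X j \<omega>) \<partial>Q)"
      using cross by (intro Bochner_Integration.integral_sum Bochner_Integration.integrable_sum) blast
    also have "\<dots> = (\<Sum>i<n. \<Sum>j<n. \<integral>\<omega>. ?X i \<omega> * ?X j \<omega> \<partial>Q)"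
      using cross by (intro sum.cong refl Bochner_Integration.integral_sum) blast
    also have "\<dots> = (\<Sum>i<n. \<Sum>j<n. if i = j then \<integral>z. (g z)\<^sup>2 \<partial>P else 0)"
      using cross by (intro sum.cong refl) auto
    finally show ?thesis unfolding eq by simp
  qed
  also have "\<dots> = (\<integral>z. (g z)\<^sup>2 \<partial>P) / n"
    using n_pos by (simp add: power2_eq_square)
  finally show "(\<integral>\<omega>. (mean g \<omega>)\<^sup>2 \<partial>Q) = (\<integral>z. (g z)\<^sup>2 \<partial>P) / n" .
qed

end

text \<open>
  A sub-exponential bound in Orlicz form. The nonnegative integral makes it entail finiteness.
\<close>

definition subexp :: "'b measure \<Rightarrow> real \<Rightarrow> real \<Rightarrow> ('b \<Rightarrow> real) \<Rightarrow> bool" where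
  "subexp P v c g \<longleftrightarrow> g \<in> borel_measurable P \<and> (\<integral>\<^sup>+z. ennreal (exp (\<bar>g z\<bar> / v)) \<partial>P) \<le> ennreal c"

lemma exp_moment_le:
  fixes x v :: real
  assumes "0 < v"
  shows "x\<^sup>2 \<le> 8 * v\<^sup>2 * exp (\<bar>x\<bar> / (2 * v))" "\<bar>x\<bar> \<le> v * exp (\<bar>x\<bar> / v)"
proof -
  have "(\<bar>x\<bar> / (2 * v))\<^sup>2 / 2 \<le> exp (\<bar>x\<bar> / (2 * v))"
    using exp_lower_Taylor_quadratic[of "\<bar>x\<bar> / (2 * v)"] assms
    by (smt (verit) divide_nonneg_nonneg abs_ge_zero)
  then show "x\<^sup>2 \<le> 8 * v\<^sup>2 * exp (\<bar>x\<bar> / (2 * v))"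
    using assms by (simp add: power_divide power_mult_distrib field_simps)
  have "\<bar>x\<bar> / v \<le> exp (\<bar>x\<bar> / v)"
    using exp_ge_add_one_self[of "\<bar>x\<bar> / v"] by linarith
  then show "\<bar>x\<bar> \<le> v * exp (\<bar>x\<bar> / v)" using assms by (simp add: field_simps)
qed

lemma subexp_exp_integrable:
  assumes "subexp P v c g" "0 \<le> c"
  shows "integrable P (\<lambda>z. exp (\<bar>g z\<bar> / v))" "(\<integral>z. exp (\<bar>g z\<bar> / v) \<partial>P) \<le> c"
proof -
  have [measurable]: "g \<in> borel_measurable P" using assms by (simp add: subexp_def)
  have "(\<integral>\<^sup>+z. ennreal (exp (\<bar>g z\<bar> / v)) \<partial>P) < \<infinity>"
    using assms by (auto simp: subexp_def intro: le_less_trans)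
  then show int: "integrable P (\<lambda>z. exp (\<bar>g z\<bar> / v))"
    by (intro integrableI_nonneg) auto
  show "(\<integral>z. exp (\<bar>g z\<bar> / v) \<partial>P) \<le> c"
    using assms nn_integral_eq_integral[OF int] by (simp add: subexp_def)
qed

lemma subexp_integrable:
  assumes "subexp P v c g" "0 \<le> c" "0 < v"
  shows "integrable P g"
proof -
  have g: "g \<in> borel_measurable P" using assms by (simp add: subexp_def)
  have "integrable P (\<lambda>z. v * exp (\<bar>g z\<bar> / v))" using subexp_exp_integrable[OF assms(1,2)] by simp
  then show ?thesis
    by (rule Bochner_Integration.integrable_bound[OF _ g]) (use exp_moment_le(2)[OF assms(3)] assms(3) in auto)
qed

text \<open>
  A second-order Taylor bound for the exponential, whose remainder \<open>x\<^sup>2 exp \<bar>t x\<bar>\<close> is absorbed into the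
  exponential moment since \<open>\<bar>t\<bar>\<close> is at most half of the critical value.
\<close>

lemma (in prob_space) subexp_mgf:
  assumes g: "subexp M v c g" and v: "0 < v" and c: "0 \<le> c" and t: "\<bar>t\<bar> \<le> 1 / (2 * v)"
  shows "integrable M (\<lambda>z. exp (t * (g z - expectation g)))"
    and "expectation (\<lambda>z. exp (t * (g z - expectation g))) \<le> exp (4 * t\<^sup>2 * v\<^sup>2 * c)"
proof -
  have [measurable]: "g \<in> borel_measurable M" using g by (simp add: subexp_def)
  note int = subexp_exp_integrable[OF g c]
  have g1: "integrable M g" by (rule subexp_integrable[OF g c v])
  have pt: "exp (t * x) \<le> 1 + t * x + 4 * t\<^sup>2 * v\<^sup>2 * exp (\<bar>x\<bar> / v)" for x
  proof -
    have "\<bar>t * x\<bar> \<le> \<bar>x\<bar> / (2 * v)"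
      using mult_right_mono[OF t, of "\<bar>x\<bar>"] by (simp add: abs_mult)
    then have "(t * x)\<^sup>2 * exp \<bar>t * x\<bar> \<le> (t * x)\<^sup>2 * exp (\<bar>x\<bar> / (2 * v))"
      by (intro mult_left_mono) auto
    also have "\<dots> = t\<^sup>2 * exp (\<bar>x\<bar> / (2 * v)) * x\<^sup>2" by (simp add: power_mult_distrib)
    also have "\<dots> \<le> t\<^sup>2 * exp (\<bar>x\<bar> / (2 * v)) * (8 * v\<^sup>2 * exp (\<bar>x\<bar> / (2 * v)))"
      by (intro mult_left_mono exp_moment_le v) auto
    also have "\<dots> = 8 * t\<^sup>2 * v\<^sup>2 * exp (\<bar>x\<bar> / v)"
      using v by (simp add: mult_exp_exp field_simps)
    finally show ?thesis using exp_le_quadratic[of "t * x"] by linarith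
  qed
  let ?b = "\<lambda>z. 1 + t * g z + 4 * t\<^sup>2 * v\<^sup>2 * exp (\<bar>g z\<bar> / v)"
  have b: "integrable M ?b" using int g1 by auto
  have e1: "integrable M (\<lambda>z. exp (t * g z))"
    by (rule Bochner_Integration.integrable_bound[OF b]) (use pt in \<open>auto intro!: AE_I2 order_trans[OF pt]\<close>)
  have eq: "exp (t * (g z - expectation g)) = exp (- t * expectation g) * exp (t * g z)" for z
    by (simp add: mult_exp_exp algebra_simps)
  show "integrable M (\<lambda>z. exp (t * (g z - expectation g)))" unfolding eq using e1 by simp
  have "expectation (\<lambda>z. exp (t * g z)) \<le> expectation ?b"
    by (rule integral_mono[OF e1 b pt])
  also have "\<dots> = 1 + t * expectation g + 4 * t\<^sup>2 * v\<^sup>2 * expectation (\<lambda>z. exp (\<bar>g z\<bar> / v))"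
    using int g1 by (simp add: prob_space)
  also have "\<dots> \<le> 1 + (t * expectation g + 4 * t\<^sup>2 * v\<^sup>2 * c)"
    using int(2) mult_left_mono[OF int(2), of "4 * t\<^sup>2 * v\<^sup>2"] by simp
  also have "\<dots> \<le> exp (t * expectation g + 4 * t\<^sup>2 * v\<^sup>2 * c)" by (rule exp_ge_add_one_self)
  finally have "exp (- t * expectation g) * expectation (\<lambda>z. exp (t * g z))
      \<le> exp (- t * expectation g) * exp (t * expectation g + 4 * t\<^sup>2 * v\<^sup>2 * c)"
    by (intro mult_left_mono) auto
  then show "expectation (\<lambda>z. exp (t * (g z - expectation g))) \<le> exp (4 * t\<^sup>2 * v\<^sup>2 * c)"
    unfolding eq by (simp only: integral_mult_right_zero) (simp add: mult_exp_exp)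
qed

context iid_obs
begin

text \<open>
  Chernoff's bound with the optimal exponent of the quadratic regime; the bound on \<open>u\<close> keeps that exponent
  in the range of \<open>subexp_mgf\<close>. The sign \<open>\<sigma>\<close> covers both tails.
\<close>

lemma bernstein_one_sided:
  fixes u \<sigma> :: real
  assumes g: "subexp P v c g" and v: "0 < v" and c: "0 < c" and u: "0 < u" "u \<le> 4 * v * c" and \<sigma>: "\<bar>\<sigma>\<bar> = 1"
  shows "prob {\<omega> \<in> space Q. u \<le> \<sigma> * (mean g \<omega> - (\<integral>z. g z \<partial>P))} \<le> exp (- (n * u\<^sup>2 / (16 * v\<^sup>2 * c)))"
proof -
  have gm[measurable]: "g \<in> borel_measurable P" using g by (simp add: subexp_def)
  let ?m = "\<integral>z. g z \<partial>P"
  define t where "t = \<sigma> * (u / (8 * v\<^sup>2 * c))"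
  have \<sigma>2: "\<sigma>\<^sup>2 = 1" using \<sigma> by (metis one_power2 power2_abs)
  have "u / (8 * v\<^sup>2 * c) \<le> (4 * v * c) / (8 * v\<^sup>2 * c)" using u v c by (intro divide_right_mono) auto
  also have "\<dots> = 1 / (2 * v)" using v c by (simp add: field_simps power2_eq_square)
  finally have t: "\<bar>t\<bar> \<le> 1 / (2 * v)" using \<sigma> u v c by (simp add: t_def abs_mult)
  note mgf = P.subexp_mgf[OF g v less_imp_le[OF c] t]
  let ?X = "\<lambda>i \<omega>. exp (t * (g (Z i \<omega>) - ?m))"
  have int: "integrable Q (?X i)" if "i < n" for i by (rule integrable_obs[OF mgf(1) that])
  have ind: "indep_vars (\<lambda>_. borel) ?X {..<n}" by (intro indep_obs) auto
  have prodeq: "(\<Prod>i<n. ?X i \<omega>) = exp (t * (n * (mean g \<omega> - ?m)))" for \<omega>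
    using n_pos by (simp add: exp_sum[symmetric] samp_mean_def sum_distrib_left[symmetric] sum_subtractf field_simps)
  have I: "integrable Q (\<lambda>\<omega>. \<Prod>i<n. ?X i \<omega>)" using ind int by (intro indep_vars_integrable) auto
  have E: "(\<integral>\<omega>. (\<Prod>i<n. ?X i \<omega>) \<partial>Q) \<le> exp (4 * t\<^sup>2 * v\<^sup>2 * c) ^ n"
  proof -
    have "(\<integral>\<omega>. (\<Prod>i<n. ?X i \<omega>) \<partial>Q) = (\<Prod>i<n. \<integral>\<omega>. ?X i \<omega> \<partial>Q)"
      using ind int by (intro indep_vars_lebesgue_integral) auto
    also have "\<dots> = (\<Prod>i<n. \<integral>z. exp (t * (g z - ?m)) \<partial>P)"
      by (intro prod.cong refl integral_obs) auto
    also have "\<dots> \<le> (\<Prod>i<n. exp (4 * t\<^sup>2 * v\<^sup>2 * c))"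
      using mgf(2) by (intro prod_mono) auto
    finally show ?thesis by simp
  qed
  define A where "A = exp (n * (u\<^sup>2 / (8 * v\<^sup>2 * c)))"
  have tn: "t * (real n * y) = \<sigma> * y * (n * (u / (8 * v\<^sup>2 * c)))" for y by (simp add: t_def)
  have "{\<omega> \<in> space Q. u \<le> \<sigma> * (mean g \<omega> - ?m)} \<subseteq> {\<omega> \<in> space Q. A \<le> (\<Prod>i<n. ?X i \<omega>)}"
  proof safe
    fix \<omega> assume "u \<le> \<sigma> * (mean g \<omega> - ?m)"
    then have "u * (n * (u / (8 * v\<^sup>2 * c))) \<le> \<sigma> * (mean g \<omega> - ?m) * (n * (u / (8 * v\<^sup>2 * c)))"
      using u v c by (intro mult_right_mono) auto
    then show "A \<le> (\<Prod>i<n. ?X i \<omega>)"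
      unfolding prodeq A_def tn by (simp add: power2_eq_square mult_ac)
  qed
  moreover have "{\<omega> \<in> space Q. A \<le> (\<Prod>i<n. ?X i \<omega>)} \<in> events"
    using borel_measurable_integrable[OF I] unfolding borel_measurable_iff_ge by blast
  ultimately have "prob {\<omega> \<in> space Q. u \<le> \<sigma> * (mean g \<omega> - ?m)} \<le> prob {\<omega> \<in> space Q. A \<le> (\<Prod>i<n. ?X i \<omega>)}"
    by (intro finite_measure_mono) auto
  also have "\<dots> \<le> (\<integral>\<omega>. (\<Prod>i<n. ?X i \<omega>) \<partial>Q) / A"
    by (rule integral_Markov_inequality_measure[OF I, where A="{}"]) (auto simp: A_def prod_nonneg)
  also have "\<dots> \<le> exp (4 * t\<^sup>2 * v\<^sup>2 * c) ^ n / A"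
    using E by (intro divide_right_mono) (auto simp: A_def)
  also have "\<dots> = exp (- (n * u\<^sup>2 / (16 * v\<^sup>2 * c)))"
  proof -
    have "t\<^sup>2 = (u / (8 * v\<^sup>2 * c))\<^sup>2" by (simp only: t_def power_mult_distrib \<sigma>2 mult_1_left)
    then have "4 * t\<^sup>2 * v\<^sup>2 * c = u\<^sup>2 / (16 * v\<^sup>2 * c)"
      using v c by (simp add: power_divide power_mult_distrib field_simps power2_eq_square)
    then show ?thesis unfolding A_def
      by (simp add: exp_of_nat_mult[symmetric] exp_diff[symmetric] field_simps)
  qed
  finally show ?thesis .
qed

lemma bernstein_sup:
  assumes J: "finite J" "real (card J) \<le> N" and g: "\<And>j. j \<in> J \<Longrightarrow> subexp P v c (g j)"
    and v: "0 < v" and c: "0 < c" and q: "0 < q" "q \<le> c * n"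
  shows "\<exists>E\<in>events. 1 - 2 * N * exp (- q) \<le> prob E \<and>
    (\<forall>\<omega>\<in>E. \<forall>j\<in>J. \<bar>mean (g j) \<omega> - (\<integral>z. g j z \<partial>P)\<bar> \<le> v * sqrt (16 * c * q / n))"
proof -
  define u where "u = v * sqrt (16 * c * q / n)"
  have u0: "0 < u" using v c q n_pos by (simp add: u_def)
  have u2: "u\<^sup>2 = v\<^sup>2 * (16 * c * q / n)" using c q by (simp add: u_def power_mult_distrib)
  have "u \<le> v * sqrt ((4 * c)\<^sup>2)"
    unfolding u_def using v c q n_pos
    by (intro mult_left_mono real_sqrt_le_mono) (auto simp: field_simps power2_eq_square)
  also have "sqrt ((4 * c)\<^sup>2) = 4 * c" using c by (intro real_sqrt_unique) auto
  finally have u: "u \<le> 4 * v * c" by (simp only: mult_ac)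
  have "n * u\<^sup>2 / (16 * v\<^sup>2 * c) = (n / n) * (v\<^sup>2 / v\<^sup>2) * (c / c) * q" unfolding u2 by simp
  then have q': "n * u\<^sup>2 / (16 * v\<^sup>2 * c) = q" using v c n_pos by simp
  let ?m = "\<lambda>j. \<integral>z. g j z \<partial>P"
  define B where "B \<sigma> j = {\<omega> \<in> space Q. u \<le> \<sigma> * (mean (g j) \<omega> - ?m j)}" for \<sigma> :: real and j
  have Bm: "B \<sigma> j \<in> events" if "j \<in> J" for \<sigma> j
  proof -
    have [measurable]: "mean (g j) \<in> borel_measurable Q" using g[OF that] by (intro mean_measurable) (simp add: subexp_def)
    show ?thesis unfolding B_def by measurable
  qed
  have Bp: "prob (B \<sigma> j) \<le> exp (- q)" if "j \<in> J" "\<sigma> = 1 \<or> \<sigma> = -1" for \<sigma> j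
    using bernstein_one_sided[OF g[OF that(1)] v c u0 u, of \<sigma>] that(2) unfolding B_def q' by auto
  define E where "E = space Q - (\<Union>(\<sigma>, j) \<in> {1, -1} \<times> J. B \<sigma> j)"
  have U: "(\<Union>(\<sigma>, j) \<in> {1, -1} \<times> J. B \<sigma> j) \<in> events" using J Bm by (intro sets.finite_UN) auto
  have "prob (\<Union>(\<sigma>, j) \<in> {1, -1} \<times> J. B \<sigma> j) \<le> (\<Sum>(\<sigma>, j) \<in> {1, -1} \<times> J. prob (B \<sigma> j))"
    unfolding case_prod_beta by (rule finite_measure_subadditive_finite) (use J Bm in auto)
  also have "\<dots> \<le> (\<Sum>(\<sigma>, j) \<in> {1, -1 :: real} \<times> J. exp (- q))"
    using Bp by (intro sum_mono) auto
  also have "\<dots> = 2 * card J * exp (- q)" by (simp add: card_cartesian_product)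
  also have "\<dots> \<le> 2 * N * exp (- q)" using J by (intro mult_right_mono) auto
  finally have "1 - 2 * N * exp (- q) \<le> prob E"
    unfolding E_def prob_compl[OF U] by simp
  moreover have "E \<in> events" unfolding E_def using U by auto
  moreover have "\<bar>mean (g j) \<omega> - ?m j\<bar> \<le> u" if "\<omega> \<in> E" "j \<in> J" for \<omega> j
  proof -
    have "\<omega> \<in> space Q" "\<omega> \<notin> B 1 j" "\<omega> \<notin> B (-1) j" using that by (auto simp: E_def)
    then show ?thesis unfolding B_def by auto
  qed
  ultimately show ?thesis unfolding u_def by blast
qed

end

section \<open>Noise in the geometry of a positive semidefinite form\<close>

definition qform :: "nat \<Rightarrow> (nat \<Rightarrow> nat \<Rightarrow> real) \<Rightarrow> (nat \<Rightarrow> real) \<Rightarrow> (nat \<Rightarrow> real) \<Rightarrow> real" where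
  "qform p G b c = (\<Sum>j\<le>p. \<Sum>k\<le>p. b j * G j k * c k)"

lemma qform_add: "qform p G (\<lambda>j. b j + x * b' j) c = qform p G b c + x * qform p G b' c"
  by (simp add: qform_def algebra_simps sum.distrib sum_distrib_left)

lemma qform_sum: "qform p G (\<lambda>j. \<Sum>i\<in>I. t i * e i j) c = (\<Sum>i\<in>I. t i * qform p G (e i) c)"
proof (induction I rule: infinite_finite_induct)
  case (insert i I)
  then show ?case
    using qform_add[of p G "\<lambda>j. \<Sum>i\<in>I. t i * e i j" "t i" "e i" c] by (simp add: add.commute)
qed (simp_all add: qform_def)

lemma qform_sym:
  assumes "\<And>j k. j \<le> p \<Longrightarrow> k \<le> p \<Longrightarrow> G j k = G k j"
  shows "qform p G b c = qform p G c b"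
proof -
  have "qform p G b c = (\<Sum>k\<le>p. \<Sum>j\<le>p. b j * G j k * c k)" unfolding qform_def by (rule sum.swap)
  also have "\<dots> = qform p G c b"
    unfolding qform_def using assms by (intro sum.cong refl) (simp add: mult_ac)
  finally show ?thesis .
qed

lemma qform_cong: "(\<And>j. j \<le> p \<Longrightarrow> b j = b' j) \<Longrightarrow> qform p G b c = qform p G b' c"
  unfolding qform_def by (intro sum.cong refl) auto

text \<open>
  Cauchy-Schwarz for a semidefinite form in the degenerate case: a null direction is in the radical.
\<close>

lemma qform_null:
  assumes sym: "\<And>j k. j \<le> p \<Longrightarrow> k \<le> p \<Longrightarrow> G j k = G k j"
    and psd: "\<And>b. 0 \<le> qform p G b b" and e: "qform p G e e = 0"
  shows "qform p G u e = 0"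
proof (rule ccontr)
  define B where "B = qform p G u e"
  assume "qform p G u e \<noteq> 0"
  then have B: "B \<noteq> 0" by (simp add: B_def)
  have eu: "qform p G e u = B" using qform_sym[of p G e u] sym by (simp add: B_def)
  (* Moving from u along the null direction e changes the form linearly; this step makes it equal to -1. *)
  define s where "s = - (qform p G u u + 1) / (2 * B)"
  have exp: "qform p G (\<lambda>j. u j + s * e j) (\<lambda>j. u j + s * e j) = qform p G u u + 2 * s * B"
  proof -
    have "qform p G u (\<lambda>j. u j + s * e j) = qform p G u u + s * B"
      using qform_sym[of p G u "\<lambda>j. u j + s * e j"] sym eu by (simp add: qform_add)
    moreover have "qform p G e (\<lambda>j. u j + s * e j) = B"
      using qform_sym[of p G e "\<lambda>j. u j + s * e j"] sym e by (simp add: qform_add B_def)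
    ultimately show ?thesis by (simp add: qform_add)
  qed
  have "2 * s * B = - (qform p G u u + 1)" using B by (simp add: s_def)
  then have "qform p G (\<lambda>j. u j + s * e j) (\<lambda>j. u j + s * e j) = -1" using exp by simp
  with psd[of "\<lambda>j. u j + s * e j"] show False by simp
qed

text \<open>
  The form may be degenerate, so the directions are orthogonal but not normalized: some may have length
  zero, which \<open>qform_null\<close> shows to be no obstacle to projecting along them. The argument is an induction
  over the leading coordinates.
\<close>

lemma gram_schmidt:
  assumes sym: "\<And>j k. j \<le> p \<Longrightarrow> k \<le> p \<Longrightarrow> G j k = G k j"
    and psd: "\<And>b. 0 \<le> qform p G b b"
  obtains e where "\<And>i k. i \<le> p \<Longrightarrow> k \<le> p \<Longrightarrow> i \<noteq> k \<Longrightarrow> qform p G (e i) (e k) = 0"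
    and "\<And>b. \<exists>t. \<forall>j\<le>p. b j = (\<Sum>i\<le>p. t i * e i j)"
proof -
  have "\<exists>e. (\<forall>i<m. \<forall>k<m. i \<noteq> k \<longrightarrow> qform p G (e i) (e k) = 0) \<and>
      (\<forall>b. (\<forall>j\<le>p. m \<le> j \<longrightarrow> b j = 0) \<longrightarrow> (\<exists>t. \<forall>j\<le>p. b j = (\<Sum>i<m. t i * e i j)))" for m
  proof (induction m)
    case 0
    then show ?case by simp
  next
    case (Suc m)
    then obtain e where
      orth: "\<And>i k. i < m \<Longrightarrow> k < m \<Longrightarrow> i \<noteq> k \<Longrightarrow> qform p G (e i) (e k) = 0" and
      span: "\<And>b. (\<forall>j\<le>p. m \<le> j \<longrightarrow> b j = 0) \<Longrightarrow> \<exists>t. \<forall>j\<le>p. b j = (\<Sum>i<m. t i * e i j)"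
      by blast
    define u :: "nat \<Rightarrow> real" where "u j = (if j = m then 1 else 0)" for j
    define a where "a i = qform p G u (e i) / qform p G (e i) (e i)" for i
    define v where "v j = u j + (-1) * (\<Sum>i<m. a i * e i j)" for j
    have v_orth: "qform p G v (e k) = 0" if "k < m" for k
    proof -
      have "qform p G v (e k) = qform p G u (e k) + (-1) * (\<Sum>i<m. a i * qform p G (e i) (e k))"
        unfolding v_def by (simp only: qform_add qform_sum)
      also have "(\<Sum>i<m. a i * qform p G (e i) (e k)) = (\<Sum>i<m. if i = k then a k * qform p G (e k) (e k) else 0)"
        using orth that by (intro sum.cong refl) auto
      also have "\<dots> = a k * qform p G (e k) (e k)" using that by simp
      also have "\<dots> = qform p G u (e k)"
        using qform_null[of p G "e k" u] sym psd by (cases "qform p G (e k) (e k) = 0") (auto simp: a_def)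
      finally show ?thesis by simp
    qed
    define e' where "e' = e(m := v)"
    have "qform p G (e' i) (e' k) = 0" if "i < Suc m" "k < Suc m" "i \<noteq> k" for i k
      using that orth v_orth qform_sym[of p G "e i" v] sym by (auto simp: e'_def less_Suc_eq)
    moreover have "\<exists>t. \<forall>j\<le>p. b j = (\<Sum>i<Suc m. t i * e' i j)" if b: "\<forall>j\<le>p. Suc m \<le> j \<longrightarrow> b j = 0" for b
    proof -
      have "\<forall>j\<le>p. m \<le> j \<longrightarrow> b j - b m * u j = 0" using b by (auto simp: u_def Suc_le_eq)
      from span[OF this] obtain t where t: "\<And>j. j \<le> p \<Longrightarrow> b j - b m * u j = (\<Sum>i<m. t i * e i j)" by blast
      have "b j = (\<Sum>i<Suc m. (if i = m then b m else t i + b m * a i) * e' i j)" if "j \<le> p" for j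
      proof -
        have "(\<Sum>i<Suc m. (if i = m then b m else t i + b m * a i) * e' i j) =
            (\<Sum>i<m. (t i + b m * a i) * e i j) + b m * v j"
          by (simp add: e'_def)
        also have "\<dots> = (\<Sum>i<m. t i * e i j) + b m * u j"
          by (simp add: v_def algebra_simps sum.distrib sum_distrib_left sum_negf)
        finally show ?thesis using t[OF that] by simp
      qed
      then show ?thesis by (intro exI allI impI)
    qed
    ultimately show ?case by (intro exI[of _ e'] conjI allI impI)
  qed
  from this[of "Suc p"] obtain e where
    orth: "\<And>i k. i < Suc p \<Longrightarrow> k < Suc p \<Longrightarrow> i \<noteq> k \<Longrightarrow> qform p G (e i) (e k) = 0" and
    span: "\<And>b. (\<forall>j\<le>p. Suc p \<le> j \<longrightarrow> b j = 0) \<Longrightarrow> \<exists>t. \<forall>j\<le>p. b j = (\<Sum>i<Suc p. t i * e i j)"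
    by blast
  have "\<exists>t. \<forall>j\<le>p. b j = (\<Sum>i\<le>p. t i * e i j)" for b
    using span[of b] by (simp add: lessThan_Suc_atMost)
  moreover have "qform p G (e i) (e k) = 0" if "i \<le> p" "k \<le> p" "i \<noteq> k" for i k
    using orth that by simp
  ultimately show ?thesis by (rule that[rotated])
qed

text \<open>
  In a basis that is orthogonal for \<open>G\<close>, the supremum over all directions \<open>b\<close> of \<open>(l b)\<^sup>2 / G(b, b)\<close> is at most
  the sum \<open>W\<close> of the squared normalized coordinates (Cauchy-Schwarz). The mean of \<open>W\<close> is at most \<open>(p + 1) C\<close>, so
  Markov's inequality controls all directions at once, and no exponential moments enter. Directions of
  length zero carry no noise almost surely.
\<close>

lemma (in prob_space) mahalanobis_noise:
  fixes s :: "nat \<Rightarrow> 'a \<Rightarrow> real" and p :: nat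
  defines "l b \<omega> \<equiv> \<Sum>j\<le>p. b j * s j \<omega>"
  assumes int: "\<And>b. integrable M (\<lambda>\<omega>. (l b \<omega>)\<^sup>2)" and s: "\<And>j. j \<le> p \<Longrightarrow> s j \<in> borel_measurable M"
    and sym: "\<And>j k. j \<le> p \<Longrightarrow> k \<le> p \<Longrightarrow> G j k = G k j"
    and C: "0 < C" and bound: "\<And>b. expectation (\<lambda>\<omega>. (l b \<omega>)\<^sup>2) \<le> C * qform p G b b" and R: "0 < R"
  shows "\<exists>E\<in>events. 1 - (real p + 1) / R \<le> prob E \<and> (\<forall>\<omega>\<in>E. \<forall>b. (l b \<omega>)\<^sup>2 \<le> C * R * qform p G b b)"
proof -
  have [measurable]: "l b \<in> borel_measurable M" for b
    unfolding l_def using s by (intro borel_measurable_sum borel_measurable_times) auto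
  have psd: "0 \<le> qform p G b b" for b
  proof -
    have "0 \<le> expectation (\<lambda>\<omega>. (l b \<omega>)\<^sup>2)" by simp
    with bound[of b] have "0 \<le> C * qform p G b b" by linarith
    then show ?thesis using C by (simp add: zero_le_mult_iff)
  qed
  obtain e where orth: "\<And>i k. i \<le> p \<Longrightarrow> k \<le> p \<Longrightarrow> i \<noteq> k \<Longrightarrow> qform p G (e i) (e k) = 0"
    and span: "\<And>b. \<exists>t. \<forall>j\<le>p. b j = (\<Sum>i\<le>p. t i * e i j)"
  proof (rule gram_schmidt[OF sym psd])
    fix e assume e: "\<And>i k. i \<le> p \<Longrightarrow> k \<le> p \<Longrightarrow> i \<noteq> k \<Longrightarrow> qform p G (e i) (e k) = 0"
      "\<And>b. \<exists>t. \<forall>j\<le>p. b j = (\<Sum>i\<le>p. t i * e i j)"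
    show thesis by (rule that[OF e])
  qed
  define q where "q i = qform p G (e i) (e i)" for i
  define I where "I = {i. i \<le> p \<and> 0 < q i}"
  have I_sub: "I \<subseteq> {..p}" by (auto simp: I_def)
  from card_mono[OF _ I_sub] finite_subset[OF I_sub] have I: "finite I" "card I \<le> p + 1" by auto
  define W where "W \<omega> = (\<Sum>i\<in>I. (l (e i) \<omega>)\<^sup>2 / q i)" for \<omega>
  have W_int: "integrable M W" unfolding W_def using int by auto
  have "expectation W = (\<Sum>i\<in>I. expectation (\<lambda>\<omega>. (l (e i) \<omega>)\<^sup>2) / q i)"
    unfolding W_def using int by (subst Bochner_Integration.integral_sum) auto
  also have "\<dots> \<le> (\<Sum>i\<in>I. C)"
  proof (intro sum_mono)
    fix i assume "i \<in> I"
    then show "expectation (\<lambda>\<omega>. (l (e i) \<omega>)\<^sup>2) / q i \<le> C"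
      using bound[of "e i"] by (simp add: I_def q_def field_simps)
  qed
  also have "\<dots> \<le> (real p + 1) * C" using I C by simp
  finally have EW: "expectation W \<le> (real p + 1) * C" .
  have W0: "0 \<le> W \<omega>" for \<omega> unfolding W_def I_def by (intro sum_nonneg) auto
  have "AE \<omega> in M. l (e i) \<omega> = 0" if "i \<le> p" "i \<notin> I" for i
  proof -
    have "q i = 0" using that psd[of "e i"] by (auto simp: I_def q_def)
    then have "expectation (\<lambda>\<omega>. (l (e i) \<omega>)\<^sup>2) = 0"
      using bound[of "e i"] by (intro antisym) (auto simp: q_def)
    then have "AE \<omega> in M. (l (e i) \<omega>)\<^sup>2 = 0"
      using int by (subst (asm) integral_nonneg_eq_0_iff_AE) auto
    then show ?thesis by simp
  qed
  then have "AE \<omega> in M. \<forall>i\<in>{..p} - I. l (e i) \<omega> = 0" by (intro AE_finite_allI) auto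
  then obtain N where N: "{\<omega> \<in> space M. \<not> (\<forall>i\<in>{..p} - I. l (e i) \<omega> = 0)} \<subseteq> N" "N \<in> events" "emeasure M N = 0"
    by (rule AE_E)
  define F where "F = {\<omega> \<in> space M. C * R \<le> W \<omega>}"
  have F: "F \<in> events" using borel_measurable_integrable[OF W_int] unfolding F_def borel_measurable_iff_ge by blast
  have "prob F \<le> expectation W / (C * R)"
    unfolding F_def by (rule integral_Markov_inequality_measure[OF W_int, where A="{}"]) (use W0 C R in auto)
  also have "\<dots> \<le> (real p + 1) * C / (C * R)" using EW C R by (intro divide_right_mono) auto
  also have "\<dots> = (real p + 1) / R" using C by simp
  finally have pF: "prob F \<le> (real p + 1) / R" .
  define E where "E = space M - (F \<union> N)"
  have E: "E \<in> events" unfolding E_def using F N by auto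
  have "prob (F \<union> N) \<le> prob F + prob N" by (rule measure_Un_le) (use F N in auto)
  also have "prob N = 0" using N by (simp add: measure_def)
  finally have "1 - (real p + 1) / R \<le> prob E"
    unfolding E_def using pF F N by (subst prob_compl) auto
  moreover have "(l b \<omega>)\<^sup>2 \<le> C * R * qform p G b b" if \<omega>: "\<omega> \<in> E" for \<omega> b
  proof -
    have W: "W \<omega> \<le> C * R" and null: "\<And>i. i \<le> p \<Longrightarrow> i \<notin> I \<Longrightarrow> l (e i) \<omega> = 0"
      using \<omega> N(1) by (auto simp: E_def F_def)
    obtain t where t: "\<And>j. j \<le> p \<Longrightarrow> b j = (\<Sum>i\<le>p. t i * e i j)" using span by blast
    have "l b \<omega> = (\<Sum>j\<le>p. (\<Sum>i\<le>p. t i * e i j) * s j \<omega>)"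
      unfolding l_def by (intro sum.cong refl) (simp only: t atMost_iff)
    also have "\<dots> = (\<Sum>i\<le>p. t i * l (e i) \<omega>)"
      unfolding l_def sum_distrib_left sum_distrib_right by (subst sum.swap) (simp only: mult.assoc)
    also have "\<dots> = (\<Sum>i\<in>I. t i * l (e i) \<omega>)"
      using null by (intro sum.mono_neutral_right) (auto simp: I_def)
    also have "\<dots> = (\<Sum>i\<in>I. (t i * sqrt (q i)) * (l (e i) \<omega> / sqrt (q i)))"
      by (intro sum.cong refl) (auto simp: I_def)
    finally have lb: "l b \<omega> = (\<Sum>i\<in>I. (t i * sqrt (q i)) * (l (e i) \<omega> / sqrt (q i)))" .
    have "(l b \<omega>)\<^sup>2 \<le> (\<Sum>i\<in>I. (t i * sqrt (q i))\<^sup>2) * (\<Sum>i\<in>I. (l (e i) \<omega> / sqrt (q i))\<^sup>2)"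
      unfolding lb by (rule Cauchy_Schwarz_ineq_sum)
    also have "(\<Sum>i\<in>I. (l (e i) \<omega> / sqrt (q i))\<^sup>2) = W \<omega>"
      unfolding W_def by (intro sum.cong refl) (auto simp: I_def power_divide)
    also have "(\<Sum>i\<in>I. (t i * sqrt (q i))\<^sup>2) = (\<Sum>i\<in>I. (t i)\<^sup>2 * q i)"
      by (intro sum.cong refl) (auto simp: I_def power_mult_distrib)
    also have "\<dots> = (\<Sum>i\<le>p. (t i)\<^sup>2 * q i)"
    proof (rule sum.mono_neutral_left[OF finite_atMost I_sub], rule ballI)
      fix i assume "i \<in> {..p} - I"
      then have "q i = 0" using psd[of "e i"] by (auto simp: I_def q_def)
      then show "(t i)\<^sup>2 * q i = 0" by simp
    qed
    also have "\<dots> = qform p G b b"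
    proof -
      have "qform p G b b = qform p G (\<lambda>j. \<Sum>i\<le>p. t i * e i j) b" by (rule qform_cong) (rule t)
      also have "\<dots> = (\<Sum>i\<le>p. t i * qform p G b (e i))"
        unfolding qform_sum using sym by (intro sum.cong refl arg_cong2[where f=times] qform_sym) auto
      also have "\<dots> = (\<Sum>i\<le>p. (t i)\<^sup>2 * q i)"
      proof (rule sum.cong[OF refl])
        fix i assume i: "i \<in> {..p}"
        have "qform p G b (e i) = qform p G (\<lambda>j. \<Sum>k\<le>p. t k * e k j) (e i)" by (rule qform_cong) (rule t)
        also have "\<dots> = (\<Sum>k\<le>p. t k * qform p G (e k) (e i))" by (rule qform_sum)
        also have "\<dots> = (\<Sum>k\<le>p. if k = i then t i * q i else 0)"
          using orth i by (intro sum.cong) (auto simp: q_def)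
        finally show "t i * qform p G b (e i) = (t i)\<^sup>2 * q i" using i by (simp add: power2_eq_square)
      qed
      finally show ?thesis by simp
    qed
    finally have "(l b \<omega>)\<^sup>2 \<le> qform p G b b * W \<omega>" .
    also have "\<dots> \<le> qform p G b b * (C * R)" using W psd by (intro mult_left_mono) auto
    finally show ?thesis by (simp add: mult_ac)
  qed
  ultimately show ?thesis using E by blast
qed

section \<open>Identification of treated averages\<close>

definition obs_law :: "('a, 'x) population \<Rightarrow> 'x obs measure" where
  "obs_law D = distr (pop_space D) (obs_space D) (observe D)"

locale causal_population =
  fixes D :: "('a, 'x) population"
  assumes model: "population_model D"
begin

abbreviation "M \<equiv> pop_space D"
abbreviation "X \<equiv> Cov D"
abbreviation "T \<equiv> Trt D"
abbreviation "Y1 \<equiv> Y_trt D"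
abbreviation "p \<equiv> dict_dim D"
abbreviation "F \<equiv> cov_algebra D"

lemma measurable_model [measurable]:
  "Y1 \<in> borel_measurable M" "Y_ctl D \<in> borel_measurable M" "T \<in> borel_measurable M"
  "X \<in> measurable M (cov_space D)" "true_ps D \<in> borel_measurable (cov_space D)"
  using model by (auto simp: population_model_def)

lemma dict_measurable: "j \<le> p \<Longrightarrow> dict D j \<in> borel_measurable (cov_space D)"
  using model by (auto simp: population_model_def)

lemma lin_measurable [measurable]: "lin D b \<in> borel_measurable (cov_space D)"
  unfolding lin_def using dict_measurable by (intro borel_measurable_sum borel_measurable_times) auto

lemma outcome_measurable [measurable]: "outcome D \<in> borel_measurable M"
  unfolding outcome_def[abs_def] by measurable

lemma observe_measurable [measurable]: "observe D \<in> measurable M (obs_space D)"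
  unfolding observe_def[abs_def] obs_space_def by measurable

lemma prob_space_M: "prob_space M" using model by (auto simp: population_model_def)

sublocale prob_space M by (rule prob_space_M)

lemma subalgebra_F: "subalgebra M F"
proof -
  have "X \<in> space M \<rightarrow> space (cov_space D)"
    by (auto intro: measurable_space[of X M])
  then show ?thesis
    unfolding subalgebra_def cov_algebra_def
    by (auto simp: sets_vimage_algebra2 intro!: measurable_sets)
qed

sublocale F: finite_measure_subalgebra M F by unfold_locales (rule subalgebra_F)

lemma X_measurable_F: "X \<in> measurable F (cov_space D)"
  unfolding cov_algebra_def by (rule measurable_vimage_algebra1) (auto intro: measurable_space[of X M])

lemma fun_X_measurable_F: "k \<in> borel_measurable (cov_space D) \<Longrightarrow> (\<lambda>\<omega>. k (X \<omega>)) \<in> borel_measurable F"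
  by (rule measurable_compose[OF X_measurable_F])

lemma T_cases: "\<omega> \<in> space M \<Longrightarrow> T \<omega> = 0 \<or> T \<omega> = 1"
  using model by (auto simp: population_model_def)

lemma true_ps_bounds: "\<omega> \<in> space M \<Longrightarrow> 0 < true_ps D (X \<omega>) \<and> true_ps D (X \<omega>) < 1"
  using model measurable_space[OF measurable_model(4)] by (simp add: population_model_def)

text \<open>
  Conditioning on the covariates, the treatment indicator factors out of the product with an event of
  the treated outcome, by conditional independence, and is replaced by the propensity score.
\<close>

lemma treated_rectangle:
  assumes B: "B \<in> sets borel" and A: "A \<in> sets (cov_space D)"
  shows "(\<integral>\<omega>. T \<omega> * indicator (B \<times> A) (Y1 \<omega>, X \<omega>) \<partial>M)
    = (\<integral>\<omega>. true_ps D (X \<omega>) * indicator (B \<times> A) (Y1 \<omega>, X \<omega>) \<partial>M)"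
proof -
  let ?t = "T -` {1} \<inter> space M" and ?y = "Y1 -` B \<inter> space M"
  have ty: "?t \<in> events" "?y \<in> events" using B by (auto intro!: measurable_sets)
  have "AE \<omega> in M. cond_prob_on M F (T -` {1} \<inter> Y1 -` B) \<omega> = cond_prob_on M F (T -` {1}) \<omega> * cond_prob_on M F (Y1 -` B) \<omega>"
  proof -
    have "cond_indep M F T Y1" using model by (simp add: population_model_def)
    from this[unfolded cond_indep_def, rule_format, of "{1}" B] B show ?thesis by simp
  qed
  moreover have "AE \<omega> in M. true_ps D (X \<omega>) = cond_prob_on M F (T -` {1}) \<omega>"
    using model by (auto simp: population_model_def)
  ultimately have ci: "AE \<omega> in M. real_cond_exp M F (indicator (T -` {1} \<inter> Y1 -` B \<inter> space M)) \<omega>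
      = true_ps D (X \<omega>) * real_cond_exp M F (indicator ?y) \<omega>"
    unfolding cond_prob_on_def by eventually_elim auto
  let ?a = "\<lambda>\<omega>. indicator A (X \<omega>) :: real"
  have aF: "?a \<in> borel_measurable F" using A by (intro fun_X_measurable_F) auto
  have pF: "(\<lambda>\<omega>. ?a \<omega> * true_ps D (X \<omega>)) \<in> borel_measurable F"
    using A by (intro fun_X_measurable_F borel_measurable_times) auto
  have [measurable]: "?a \<in> borel_measurable M" using A by simp
  have "(\<integral>\<omega>. T \<omega> * indicator (B \<times> A) (Y1 \<omega>, X \<omega>) \<partial>M) = (\<integral>\<omega>. ?a \<omega> * indicator (T -` {1} \<inter> Y1 -` B \<inter> space M) \<omega> \<partial>M)"
    by (intro Bochner_Integration.integral_cong refl) (auto simp: indicator_def dest: T_cases)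
  also have "\<dots> = (\<integral>\<omega>. ?a \<omega> * real_cond_exp M F (indicator (T -` {1} \<inter> Y1 -` B \<inter> space M)) \<omega> \<partial>M)"
  proof (rule F.real_cond_exp_intg(2)[symmetric, OF _ aF])
    have "T -` {1} \<inter> Y1 -` B \<inter> space M = ?t \<inter> ?y" by auto
    then show m: "indicator (T -` {1} \<inter> Y1 -` B \<inter> space M) \<in> borel_measurable M" using ty by auto
    show "integrable M (\<lambda>x. ?a x * indicator (T -` {1} \<inter> Y1 -` B \<inter> space M) x)"
    proof (rule integrable_const_bound[where B=1])
      show "(\<lambda>x. ?a x * indicator (T -` {1} \<inter> Y1 -` B \<inter> space M) x) \<in> borel_measurable M"
        using m by (intro borel_measurable_times) simp_all
    qed (auto simp: indicator_def)
  qed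
  also have "\<dots> = (\<integral>\<omega>. (?a \<omega> * true_ps D (X \<omega>)) * real_cond_exp M F (indicator ?y) \<omega> \<partial>M)"
    by (intro integral_cong_AE) (use ci in auto)
  also have "\<dots> = (\<integral>\<omega>. (?a \<omega> * true_ps D (X \<omega>)) * indicator ?y \<omega> \<partial>M)"
  proof (rule F.real_cond_exp_intg(2)[OF _ pF])
    show "indicator ?y \<in> borel_measurable M" using ty by auto
    show "integrable M (\<lambda>\<omega>. (?a \<omega> * true_ps D (X \<omega>)) * indicator ?y \<omega>)"
    proof (rule integrable_const_bound[where B=1])
      show "AE \<omega> in M. norm ((?a \<omega> * true_ps D (X \<omega>)) * indicator ?y \<omega>) \<le> 1"
        by (intro AE_I2) (auto simp: indicator_def dest!: true_ps_bounds)
      show "(\<lambda>\<omega>. (?a \<omega> * true_ps D (X \<omega>)) * indicator ?y \<omega>) \<in> borel_measurable M"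
        using ty by (intro borel_measurable_times) simp_all
    qed
  qed
  also have "\<dots> = (\<integral>\<omega>. true_ps D (X \<omega>) * indicator (B \<times> A) (Y1 \<omega>, X \<omega>) \<partial>M)"
    by (intro Bochner_Integration.integral_cong refl) (auto simp: indicator_def)
  finally show ?thesis .
qed

text \<open>
  The two sides are integrals of \<open>H\<close> against two finite measures on pairs of outcome and covariate,
  which agree on rectangles by \<open>treated_rectangle\<close>.
\<close>

lemma treated_nn_integral:
  assumes H[measurable]: "H \<in> borel_measurable (borel \<Otimes>\<^sub>M cov_space D)"
  shows "(\<integral>\<^sup>+\<omega>. ennreal (T \<omega>) * H (Y1 \<omega>, X \<omega>) \<partial>M) = (\<integral>\<^sup>+\<omega>. ennreal (true_ps D (X \<omega>)) * H (Y1 \<omega>, X \<omega>) \<partial>M)"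
proof -
  let ?S = "borel \<Otimes>\<^sub>M cov_space D" and ?Z = "\<lambda>\<omega>. (Y1 \<omega>, X \<omega>)"
  let ?N1 = "distr (density M (\<lambda>\<omega>. ennreal (T \<omega>))) ?S ?Z"
  let ?N2 = "distr (density M (\<lambda>\<omega>. ennreal (true_ps D (X \<omega>)))) ?S ?Z"
  let ?E = "{B \<times> A | (B :: real set) A. B \<in> sets borel \<and> A \<in> sets (cov_space D)}"
  have Zm: "?Z \<in> measurable M ?S" by measurable
  have psm: "(\<lambda>\<omega>. true_ps D (X \<omega>)) \<in> borel_measurable M" by measurable
  have T01: "AE \<omega> in M. 0 \<le> T \<omega> \<and> T \<omega> \<le> 1" by (intro AE_I2) (auto dest: T_cases)
  have emN: "emeasure (distr (density M (\<lambda>\<omega>. ennreal (k \<omega>))) ?S ?Z) (B \<times> A)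
      = ennreal (\<integral>\<omega>. k \<omega> * indicator (B \<times> A) (Y1 \<omega>, X \<omega>) \<partial>M)"
    if BA: "B \<in> sets borel" "A \<in> sets (cov_space D)" and k[measurable]: "k \<in> borel_measurable M"
      and k01: "AE \<omega> in M. 0 \<le> k \<omega> \<and> k \<omega> \<le> 1" for B A k
  proof -
    have BA': "B \<times> A \<in> sets ?S" using BA by auto
    have "emeasure (distr (density M (\<lambda>\<omega>. ennreal (k \<omega>))) ?S ?Z) (B \<times> A)
        = emeasure (density M (\<lambda>\<omega>. ennreal (k \<omega>))) (?Z -` (B \<times> A) \<inter> space M)"
      using Zm by (subst emeasure_distr[OF _ BA']) simp_all
    also have "\<dots> = (\<integral>\<^sup>+\<omega>. ennreal (k \<omega>) * indicator (?Z -` (B \<times> A) \<inter> space M) \<omega> \<partial>M)"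
      by (rule emeasure_density) (simp_all add: measurable_sets[OF Zm BA'])
    also have "\<dots> = (\<integral>\<^sup>+\<omega>. ennreal (k \<omega> * indicator (B \<times> A) (Y1 \<omega>, X \<omega>)) \<partial>M)"
      by (intro nn_integral_cong) (auto simp: indicator_def)
    also have "\<dots> = ennreal (\<integral>\<omega>. k \<omega> * indicator (B \<times> A) (Y1 \<omega>, X \<omega>) \<partial>M)"
    proof (rule nn_integral_eq_integral)
      have im: "(\<lambda>\<omega>. indicator (B \<times> A) (Y1 \<omega>, X \<omega>) :: real) \<in> borel_measurable M"
        by (rule measurable_compose[OF Zm borel_measurable_indicator[OF BA']])
      show "integrable M (\<lambda>\<omega>. k \<omega> * indicator (B \<times> A) (Y1 \<omega>, X \<omega>))"
      proof (rule integrable_const_bound[where B=1])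
        show "AE \<omega> in M. norm (k \<omega> * indicator (B \<times> A) (Y1 \<omega>, X \<omega>)) \<le> 1"
          using k01 by eventually_elim (auto simp: indicator_def)
        show "(\<lambda>\<omega>. k \<omega> * indicator (B \<times> A) (Y1 \<omega>, X \<omega>)) \<in> borel_measurable M"
          by (rule borel_measurable_times[OF k im])
      qed
      show "AE \<omega> in M. 0 \<le> k \<omega> * indicator (B \<times> A) (Y1 \<omega>, X \<omega>)"
        using k01 by eventually_elim (auto simp: indicator_def)
    qed
    finally show ?thesis .
  qed
  have ps01: "AE \<omega> in M. 0 \<le> true_ps D (X \<omega>) \<and> true_ps D (X \<omega>) \<le> 1"
    using true_ps_bounds by (intro AE_I2) (simp add: less_imp_le)
  have "?N1 = ?N2"
  proof (rule measure_eqI_generator_eq[where E="?E" and \<Omega>="UNIV \<times> space (cov_space D)" and A="\<lambda>_. UNIV \<times> space (cov_space D)"])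
    show "Int_stable ?E" by (rule Int_stable_pair_measure_generator)
    show "?E \<subseteq> Pow (UNIV \<times> space (cov_space D))" using pair_measure_closed[of borel "cov_space D"] by simp
    show "sets ?N1 = sigma_sets (UNIV \<times> space (cov_space D)) ?E" by (simp add: sets_pair_measure)
    show "sets ?N2 = sigma_sets (UNIV \<times> space (cov_space D)) ?E" by (simp add: sets_pair_measure)
    fix R assume "R \<in> ?E"
    then obtain B A where R: "R = B \<times> A" "B \<in> sets borel" "A \<in> sets (cov_space D)" by blast
    show "emeasure ?N1 R = emeasure ?N2 R"
      unfolding R(1) emN[OF R(2,3) measurable_model(3) T01] emN[OF R(2,3) psm ps01]
        treated_rectangle[OF R(2,3)] ..
  next
    have "UNIV \<times> space (cov_space D) \<in> ?E"
      by (intro CollectI exI[of _ UNIV] exI[of _ "space (cov_space D)"] conjI) simp_all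
    then show "range (\<lambda>_::nat. UNIV \<times> space (cov_space D)) \<subseteq> ?E" by (intro image_subsetI)
    show "emeasure ?N1 (UNIV \<times> space (cov_space D)) \<noteq> \<infinity>"
      by (subst emN[OF _ _ measurable_model(3) T01]) simp_all
    show "(\<Union>i::nat. UNIV \<times> space (cov_space D)) = UNIV \<times> space (cov_space D)" by simp
  qed
  have dens: "(\<integral>\<^sup>+z. H z \<partial>distr (density M (\<lambda>\<omega>. ennreal (k \<omega>))) ?S ?Z) = (\<integral>\<^sup>+\<omega>. ennreal (k \<omega>) * H (Y1 \<omega>, X \<omega>) \<partial>M)"
    if k: "k \<in> borel_measurable M" for k
  proof -
    have "(\<integral>\<^sup>+z. H z \<partial>distr (density M (\<lambda>\<omega>. ennreal (k \<omega>))) ?S ?Z)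
        = (\<integral>\<^sup>+\<omega>. H (Y1 \<omega>, X \<omega>) \<partial>density M (\<lambda>\<omega>. ennreal (k \<omega>)))"
      using Zm H by (subst nn_integral_distr) simp_all
    also have "\<dots> = (\<integral>\<^sup>+\<omega>. ennreal (k \<omega>) * H (Y1 \<omega>, X \<omega>) \<partial>M)"
      using k measurable_compose[OF Zm H] by (intro nn_integral_density) simp_all
    finally show ?thesis .
  qed
  show ?thesis
    using dens[OF measurable_model(3)] dens[OF psm] \<open>?N1 = ?N2\<close> by (simp only:)
qed

lemma treated_integral:
  fixes H :: "real \<times> 'x \<Rightarrow> real"
  assumes H[measurable]: "H \<in> borel_measurable (borel \<Otimes>\<^sub>M cov_space D)"
    and int: "integrable M (\<lambda>\<omega>. H (Y1 \<omega>, X \<omega>))"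
  shows "integrable M (\<lambda>\<omega>. T \<omega> * H (Y1 \<omega>, X \<omega>))"
    and "(\<integral>\<omega>. T \<omega> * H (Y1 \<omega>, X \<omega>) \<partial>M) = (\<integral>\<omega>. true_ps D (X \<omega>) * H (Y1 \<omega>, X \<omega>) \<partial>M)"
proof -
  let ?H = "\<lambda>\<omega>. H (Y1 \<omega>, X \<omega>)"
  have [measurable]: "?H \<in> borel_measurable M" by measurable
  show intT: "integrable M (\<lambda>\<omega>. T \<omega> * ?H \<omega>)"
    by (rule Bochner_Integration.integrable_bound[OF int]) (simp, auto intro!: AE_I2 dest: T_cases)
  have intp: "integrable M (\<lambda>\<omega>. true_ps D (X \<omega>) * ?H \<omega>)"
    by (rule Bochner_Integration.integrable_bound[OF int])
       (use true_ps_bounds in \<open>auto intro!: AE_I2 mult_left_le_one_le simp: abs_mult less_imp_le\<close>)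
  have eq: "(\<integral>\<^sup>+\<omega>. ennreal (\<sigma> * (T \<omega> * ?H \<omega>)) \<partial>M) = (\<integral>\<^sup>+\<omega>. ennreal (\<sigma> * (true_ps D (X \<omega>) * ?H \<omega>)) \<partial>M)" for \<sigma> :: real
  proof -
    have "(\<integral>\<^sup>+\<omega>. ennreal (\<sigma> * (T \<omega> * ?H \<omega>)) \<partial>M) = (\<integral>\<^sup>+\<omega>. ennreal (T \<omega>) * ennreal (\<sigma> * H (Y1 \<omega>, X \<omega>)) \<partial>M)"
      by (intro nn_integral_cong) (auto dest: T_cases)
    also have "\<dots> = (\<integral>\<^sup>+\<omega>. ennreal (true_ps D (X \<omega>)) * ennreal (\<sigma> * H (Y1 \<omega>, X \<omega>)) \<partial>M)"
      by (rule treated_nn_integral) measurable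
    also have "\<dots> = (\<integral>\<^sup>+\<omega>. ennreal (\<sigma> * (true_ps D (X \<omega>) * ?H \<omega>)) \<partial>M)"
      using true_ps_bounds by (intro nn_integral_cong) (simp add: ennreal_mult'[symmetric] less_imp_le mult_ac)
    finally show ?thesis .
  qed
  show "(\<integral>\<omega>. T \<omega> * ?H \<omega> \<partial>M) = (\<integral>\<omega>. true_ps D (X \<omega>) * ?H \<omega> \<partial>M)"
    using eq[of 1] eq[of "-1"] by (simp add: real_lebesgue_integral_def intT intp)
qed

end

section \<open>Regular populations and the calibrated propensity score\<close>

context causal_population
begin

abbreviation "P \<equiv> obs_law D"

lemma sets_P [measurable_cong, simp]: "sets P = sets (obs_space D)"
  by (simp add: obs_law_def)

lemma space_P [simp]: "space P = space (obs_space D)"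
  by (simp add: obs_law_def)

lemma prob_space_obs_law: "prob_space P"
  unfolding obs_law_def by (rule prob_space_distr) simp

lemma obs_integral:
  fixes k :: "'x obs \<Rightarrow> real"
  assumes "k \<in> borel_measurable (obs_space D)"
  shows "(\<integral>z. k z \<partial>P) = (\<integral>\<omega>. k (observe D \<omega>) \<partial>M)" "integrable P k \<longleftrightarrow> integrable M (\<lambda>\<omega>. k (observe D \<omega>))"
  using assms by (simp_all add: obs_law_def integral_distr integrable_distr_eq)

lemma pop_mean_eq:
  "k \<in> borel_measurable (obs_space D) \<Longrightarrow> pop_mean D k = (\<integral>z. k z \<partial>P)"
  by (simp add: pop_mean_def obs_integral)

lemma obs_nn_integral:
  fixes k :: "'x obs \<Rightarrow> ennreal"
  assumes "k \<in> borel_measurable (obs_space D)"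
  shows "(\<integral>\<^sup>+z. k z \<partial>P) = (\<integral>\<^sup>+\<omega>. k (observe D \<omega>) \<partial>M)"
  using assms by (simp add: obs_law_def nn_integral_distr)

lemma treated_outcome: "\<omega> \<in> space M \<Longrightarrow> T \<omega> * k (outcome D \<omega>) = T \<omega> * (k (Y1 \<omega>) :: real)"
  using T_cases[of \<omega>] by (auto simp: outcome_def)

text \<open>
  Observed treated outcomes are treated potential outcomes, so \<open>treated_integral\<close> expresses averages of
  observable quantities by averages of the treated potential outcome weighted by the propensity score.
\<close>

lemma obs_treated_integral:
  assumes H[measurable]: "H \<in> borel_measurable (borel \<Otimes>\<^sub>M cov_space D)"
    and int: "integrable M (\<lambda>\<omega>. H (Y1 \<omega>, X \<omega>))"
  shows "integrable P (\<lambda>(y, t, x). t * H (y, x))"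
    and "(\<integral>z. (case z of (y, t, x) \<Rightarrow> t * H (y, x)) \<partial>P) = (\<integral>\<omega>. true_ps D (X \<omega>) * H (Y1 \<omega>, X \<omega>) \<partial>M)"
proof -
  have m: "(\<lambda>(y, t, x). t * H (y, x)) \<in> borel_measurable (obs_space D)"
    unfolding obs_space_def by measurable
  have eq: "(case observe D \<omega> of (y, t, x) \<Rightarrow> t * H (y, x)) = T \<omega> * H (Y1 \<omega>, X \<omega>)" if "\<omega> \<in> space M" for \<omega>
    using treated_outcome[OF that, of "\<lambda>y. H (y, X \<omega>)"] by (simp add: observe_def)
  show "integrable P (\<lambda>(y, t, x). t * H (y, x))"
    unfolding obs_integral(2)[OF m] using treated_integral(1)[OF H int] eq
    by (subst Bochner_Integration.integrable_cong[OF refl eq]) auto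
  show "(\<integral>z. (case z of (y, t, x) \<Rightarrow> t * H (y, x)) \<partial>P) = (\<integral>\<omega>. true_ps D (X \<omega>) * H (Y1 \<omega>, X \<omega>) \<partial>M)"
    unfolding obs_integral(1)[OF m]
    by (subst Bochner_Integration.integral_cong[OF refl eq]) (auto simp: treated_integral(2)[OF H int])
qed

lemma obs_treated_nn_integral:
  assumes q[measurable]: "q \<in> borel_measurable (borel \<Otimes>\<^sub>M cov_space D)"
  shows "(\<integral>\<^sup>+z. ennreal (case z of (y, t, x) \<Rightarrow> t * q (y, x)) \<partial>P)
    = (\<integral>\<^sup>+\<omega>. ennreal (true_ps D (X \<omega>) * q (Y1 \<omega>, X \<omega>)) \<partial>M)"
proof -
  have m: "(\<lambda>z. ennreal (case z of (y, t, x) \<Rightarrow> t * q (y, x))) \<in> borel_measurable (obs_space D)"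
    unfolding obs_space_def by measurable
  have eq: "(case observe D \<omega> of (y, t, x) \<Rightarrow> t * q (y, x)) = T \<omega> * q (Y1 \<omega>, X \<omega>)" if "\<omega> \<in> space M" for \<omega>
    using treated_outcome[OF that, of "\<lambda>y. q (y, X \<omega>)"] by (simp add: observe_def)
  have "(\<integral>\<^sup>+z. ennreal (case z of (y, t, x) \<Rightarrow> t * q (y, x)) \<partial>P)
      = (\<integral>\<^sup>+\<omega>. ennreal (case observe D \<omega> of (y, t, x) \<Rightarrow> t * q (y, x)) \<partial>M)"
    by (rule obs_nn_integral[OF m])
  also have "\<dots> = (\<integral>\<^sup>+\<omega>. ennreal (T \<omega>) * ennreal (q (Y1 \<omega>, X \<omega>)) \<partial>M)"
    by (intro nn_integral_cong) (auto simp: eq dest: T_cases)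
  also have "\<dots> = (\<integral>\<^sup>+\<omega>. ennreal (true_ps D (X \<omega>)) * ennreal (q (Y1 \<omega>, X \<omega>)) \<partial>M)"
    by (rule treated_nn_integral) measurable
  also have "\<dots> = (\<integral>\<^sup>+\<omega>. ennreal (true_ps D (X \<omega>) * q (Y1 \<omega>, X \<omega>)) \<partial>M)"
    by (intro nn_integral_cong) (simp add: ennreal_mult' true_ps_bounds less_imp_le)
  finally show ?thesis .
qed

lemma AE_obs_law_cov:
  assumes "AE \<omega> in M. R (X \<omega>)" "Measurable.pred (cov_space D) R"
  shows "AE z in P. R (snd (snd z))"
proof -
  have "AE z in distr M (obs_space D) (observe D). R (snd (snd z))"
  proof (subst AE_distr_iff[OF observe_measurable])
    have "Measurable.pred (obs_space D) (\<lambda>z. R (snd (snd z)))"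
      by (rule measurable_compose[OF _ assms(2)]) (simp add: obs_space_def)
    then show "{z \<in> space (obs_space D). R (snd (snd z))} \<in> sets (obs_space D)" by (rule predE)
    show "AE \<omega> in M. R (snd (snd (observe D \<omega>)))" using assms(1) by (simp add: observe_def)
  qed
  then show ?thesis unfolding obs_law_def .
qed

lemma AE_obs_law_trt: "AE z in P. fst (snd z) = 0 \<or> fst (snd z) = 1"
proof -
  have "AE z in distr M (obs_space D) (observe D). fst (snd z) = 0 \<or> fst (snd z) = 1"
  proof (subst AE_distr_iff[OF observe_measurable])
    have "Measurable.pred (obs_space D) (\<lambda>z. fst (snd z) = (0::real) \<or> fst (snd z) = 1)"
      unfolding obs_space_def by measurable
    then show "{z \<in> space (obs_space D). fst (snd z) = 0 \<or> fst (snd z) = 1} \<in> sets (obs_space D)" by (rule predE)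
    show "AE \<omega> in M. fst (snd (observe D \<omega>)) = 0 \<or> fst (snd (observe D \<omega>)) = 1"
      by (intro AE_I2) (auto simp: observe_def dest: T_cases)
  qed
  then show ?thesis unfolding obs_law_def .
qed

end

text \<open>
  A population with the targets \<open>gb\<close> and \<open>ab\<close> of the two regressions, under the conditions whose constants
  determine the rates.
\<close>

locale regular_population = causal_population D
  for D :: "('a, 'x) population" +
  fixes gb ab :: "nat \<Rightarrow> real" and \<psi> \<psi>2 :: "real \<Rightarrow> real" and C0 B0 D0 D1 C1 C2 C3 :: real
  assumes correct: "correct_ps D" and cal: "target_cal D gb" and wl: "target_wl \<psi> D gb ab"
    and mono_link: "mono \<psi>" and deriv_link: "\<And>u. (\<psi> has_real_derivative \<psi>2 u) (at u)"
    and dict_bound: "AE \<omega> in pop_space D. \<forall>j \<le> dict_dim D. \<bar>dict D j (Cov D \<omega>)\<bar> \<le> C0"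
    and overlap: "AE \<omega> in pop_space D. B0 \<le> lin D gb (Cov D \<omega>)"
    and curv_le: "AE \<omega> in pop_space D. \<psi>2 (lin D ab (Cov D \<omega>)) \<le> C1"
    and curv_ge: "AE \<omega> in pop_space D. C2 \<le> \<psi>2 (lin D ab (Cov D \<omega>))"
    and curv_lip: "\<And>u u'. \<psi>2 u \<le> \<psi>2 u' * exp (C3 * \<bar>u - u'\<bar>)"
    and tail: "AE \<omega> in pop_space D.
        ennreal (D0\<^sup>2) *
          nn_cond_exp (pop_space D) (cov_algebra D)
            (\<lambda>\<omega>. ennreal (exp ((Y_trt D \<omega> - \<psi> (lin D ab (Cov D \<omega>)))\<^sup>2 / D0\<^sup>2) - 1)) \<omega>
        \<le> ennreal (D1\<^sup>2)"
    and const_pos: "1 \<le> C0" "0 < D0" "0 < D1" "0 < C1" "0 < C2" "0 \<le> C3"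
begin

abbreviation "w \<equiv> wt D gb"
abbreviation "m x \<equiv> \<psi> (lin D ab x)"

lemma link_measurable [measurable]: "\<psi> \<in> borel_measurable borel"
  using mono_link by (rule borel_measurable_mono)

lemma wt_measurable [measurable]: "wt D b \<in> borel_measurable (cov_space D)"
  unfolding wt_def[abs_def] by measurable

lemma link_curv_nonneg: "0 \<le> \<psi>2 u"
proof (rule ccontr)
  assume "\<not> 0 \<le> \<psi>2 u"
  then obtain d where d: "0 < d" "\<And>h. 0 < h \<Longrightarrow> h < d \<Longrightarrow> \<psi> (u + h) < \<psi> u"
    using DERIV_neg_dec_right[OF deriv_link[of u]] by auto
  from d(2)[of "d / 2"] d(1) monoD[OF mono_link, of u "u + d / 2"] show False by auto
qed

lemma link_curv_continuous: "continuous_on UNIV \<psi>2"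
proof (rule continuous_at_imp_continuous_on, intro ballI)
  fix u
  have "(\<lambda>v. \<psi>2 u * exp (- C3 * \<bar>v - u\<bar>)) \<midarrow>u\<rightarrow> \<psi>2 u * exp (- C3 * \<bar>u - u\<bar>)"
    by (intro tendsto_intros)
  then have lo: "(\<lambda>v. \<psi>2 u * exp (- C3 * \<bar>v - u\<bar>)) \<midarrow>u\<rightarrow> \<psi>2 u" by simp
  have "(\<lambda>v. \<psi>2 u * exp (C3 * \<bar>v - u\<bar>)) \<midarrow>u\<rightarrow> \<psi>2 u * exp (C3 * \<bar>u - u\<bar>)"
    by (intro tendsto_intros)
  then have hi: "(\<lambda>v. \<psi>2 u * exp (C3 * \<bar>v - u\<bar>)) \<midarrow>u\<rightarrow> \<psi>2 u" by simp
  have "\<psi>2 u * exp (- C3 * \<bar>v - u\<bar>) \<le> \<psi>2 v" for v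
    using curv_lip[of u v] by (simp add: exp_minus field_simps abs_minus_commute)
  then show "isCont \<psi>2 u"
    unfolding isCont_def using curv_lip[of _ u]
    by (intro tendsto_sandwich[OF _ _ lo hi]) (auto intro!: always_eventually)
qed

lemma link_curv_measurable [measurable]: "\<psi>2 \<in> borel_measurable borel"
  by (rule borel_measurable_continuous_onI[OF link_curv_continuous])

lemma lin_bound: "AE \<omega> in M. \<bar>lin D b (X \<omega>)\<bar> \<le> (\<Sum>j\<le>p. \<bar>b j\<bar> * C0)"
  using dict_bound
proof eventually_elim
  case (elim \<omega>)
  then show ?case
    unfolding lin_def
    by (intro order_trans[OF sum_abs] sum_mono) (auto simp: abs_mult intro!: mult_left_mono)
qed

lemma bounded_integrable:
  fixes k :: "'x \<Rightarrow> real"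
  assumes "k \<in> borel_measurable (cov_space D)" "AE \<omega> in M. \<bar>k (X \<omega>)\<bar> \<le> B"
  shows "integrable M (\<lambda>\<omega>. k (X \<omega>))"
  using assms by (intro integrable_const_bound[where B=B]) auto

lemma link_bound: "\<exists>B. AE \<omega> in M. \<bar>m (X \<omega>)\<bar> \<le> B"
proof -
  let ?K = "\<Sum>j\<le>p. \<bar>ab j\<bar> * C0"
  have "AE \<omega> in M. \<bar>m (X \<omega>)\<bar> \<le> \<bar>\<psi> ?K\<bar> + \<bar>\<psi> (- ?K)\<bar>"
    using lin_bound[of ab]
  proof eventually_elim
    case (elim \<omega>)
    then have "\<psi> (- ?K) \<le> m (X \<omega>)" "m (X \<omega>) \<le> \<psi> ?K"
      by (auto intro!: monoD[OF mono_link] simp: abs_le_iff)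
    then show ?case by linarith
  qed
  then show ?thesis by blast
qed

text \<open>
  The calibration target recovers the true propensity score. The difference of the population losses
  at \<open>gb\<close> and at the true coefficient is the mean of \<open>(1 - \<pi>) (exp (- d) - 1 + d)\<close>, where \<open>d\<close> is the
  difference of the linear predictors; it is nonnegative and vanishes only for \<open>d = 0\<close>.
\<close>

lemma ps_correct: "AE \<omega> in M. true_ps D (X \<omega>) = ps D gb (X \<omega>)"
proof -
  obtain \<gamma> where \<gamma>: "AE \<omega> in M. true_ps D (X \<omega>) = ps D \<gamma> (X \<omega>)"
    using correct by (auto simp: correct_ps_def)
  have int: "integrable M (\<lambda>\<omega>. lin D b (X \<omega>))" "integrable M (\<lambda>\<omega>. exp (- lin D b (X \<omega>)) - lin D b (X \<omega>))" for b
  proof -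
    show i: "integrable M (\<lambda>\<omega>. lin D b (X \<omega>))" by (rule bounded_integrable[OF _ lin_bound]) measurable
    have "integrable M (\<lambda>\<omega>. exp (- lin D b (X \<omega>)))"
    proof (rule bounded_integrable)
      show "AE \<omega> in M. \<bar>exp (- lin D b (X \<omega>))\<bar> \<le> exp (\<Sum>j\<le>p. \<bar>b j\<bar> * C0)"
        using lin_bound[of b] by eventually_elim auto
    qed measurable
    with i show "integrable M (\<lambda>\<omega>. exp (- lin D b (X \<omega>)) - lin D b (X \<omega>))" by simp
  qed
  let ?\<pi> = "\<lambda>\<omega>. true_ps D (X \<omega>)"
  let ?J = "\<lambda>b \<omega>. ?\<pi> \<omega> * (exp (- lin D b (X \<omega>)) - lin D b (X \<omega>)) + lin D b (X \<omega>)"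
  have intJ: "integrable M (?J b)" for b
  proof (rule Bochner_Integration.integrable_add[OF Bochner_Integration.integrable_bound[OF int(2)] int(1)])
    show "AE \<omega> in M. norm (?\<pi> \<omega> * (exp (- lin D b (X \<omega>)) - lin D b (X \<omega>))) \<le> norm (exp (- lin D b (X \<omega>)) - lin D b (X \<omega>))"
      by (intro AE_I2) (auto simp: abs_mult intro!: mult_left_le_one_le dest!: true_ps_bounds)
  qed measurable
  have loss: "pop_mean D (loss_cal D b) = (\<integral>\<omega>. ?J b \<omega> \<partial>M)" for b
  proof -
    let ?H = "\<lambda>(y :: real, x). exp (- lin D b x) - lin D b x"
    have H: "?H \<in> borel_measurable (borel \<Otimes>\<^sub>M cov_space D)" by measurable
    have i2: "integrable M (\<lambda>\<omega>. ?H (Y1 \<omega>, X \<omega>))" using int(2) by simp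
    note tr = treated_integral[OF H i2]
    have "pop_mean D (loss_cal D b) = (\<integral>\<omega>. T \<omega> * ?H (Y1 \<omega>, X \<omega>) + lin D b (X \<omega>) \<partial>M)"
      unfolding pop_mean_def by (intro Bochner_Integration.integral_cong refl) (simp add: loss_cal_def observe_def algebra_simps)
    also have "\<dots> = (\<integral>\<omega>. T \<omega> * ?H (Y1 \<omega>, X \<omega>) \<partial>M) + (\<integral>\<omega>. lin D b (X \<omega>) \<partial>M)"
      by (rule Bochner_Integration.integral_add[OF tr(1) int(1)])
    also have "\<dots> = (\<integral>\<omega>. ?\<pi> \<omega> * ?H (Y1 \<omega>, X \<omega>) \<partial>M) + (\<integral>\<omega>. lin D b (X \<omega>) \<partial>M)" unfolding tr(2) ..
    also have "\<dots> = (\<integral>\<omega>. ?J b \<omega> \<partial>M)"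
    proof -
      have "integrable M (\<lambda>\<omega>. ?J b \<omega> - lin D b (X \<omega>))" by (intro Bochner_Integration.integrable_diff intJ int)
      then show ?thesis by (subst Bochner_Integration.integral_add) (simp_all add: int)
    qed
    finally show ?thesis .
  qed
  have "(\<integral>\<omega>. ?J gb \<omega> \<partial>M) \<le> (\<integral>\<omega>. ?J \<gamma> \<omega> \<partial>M)"
    using cal unfolding target_cal_def is_arg_min_linorder loss by blast
  then have le: "(\<integral>\<omega>. ?J gb \<omega> - ?J \<gamma> \<omega> \<partial>M) \<le> 0"
    by (subst Bochner_Integration.integral_diff[OF intJ intJ]) simp
  let ?d = "\<lambda>\<omega>. lin D gb (X \<omega>) - lin D \<gamma> (X \<omega>)"
  have eq: "AE \<omega> in M. ?J gb \<omega> - ?J \<gamma> \<omega> = (1 - ?\<pi> \<omega>) * (exp (- ?d \<omega>) - 1 + ?d \<omega>)"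
    using \<gamma>
  proof eventually_elim
    case (elim \<omega>)
    have "0 < 1 + exp (- lin D \<gamma> (X \<omega>))" by (simp add: add_pos_pos)
    then have "?\<pi> \<omega> * exp (- lin D \<gamma> (X \<omega>)) = 1 - ?\<pi> \<omega>"
      unfolding elim ps_def by (simp add: field_simps)
    moreover have "exp (- lin D gb (X \<omega>)) = exp (- lin D \<gamma> (X \<omega>)) * exp (- ?d \<omega>)"
      by (simp add: mult_exp_exp)
    ultimately have "?\<pi> \<omega> * exp (- lin D gb (X \<omega>)) = (1 - ?\<pi> \<omega>) * exp (- ?d \<omega>)"
      by (simp only: mult.assoc[symmetric])
    then show ?case using \<open>?\<pi> \<omega> * exp (- lin D \<gamma> (X \<omega>)) = 1 - ?\<pi> \<omega>\<close> by (simp only: right_diff_distrib) (simp add: algebra_simps)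
  qed
  have nn: "AE \<omega> in M. 0 \<le> ?J gb \<omega> - ?J \<gamma> \<omega>"
    using eq AE_space
  proof eventually_elim
    case (elim \<omega>)
    have "0 \<le> exp (- ?d \<omega>) - 1 + ?d \<omega>" using exp_ge_add_one_self[of "- ?d \<omega>"] by linarith
    then show ?case using elim true_ps_bounds[of \<omega>] by (simp only: elim(1)) (simp add: mult_nonneg_nonneg)
  qed
  have "(\<integral>\<omega>. ?J gb \<omega> - ?J \<gamma> \<omega> \<partial>M) = 0"
    using le integral_nonneg_AE[OF nn] by linarith
  then have "AE \<omega> in M. ?J gb \<omega> - ?J \<gamma> \<omega> = 0"
    using integral_nonneg_eq_0_iff_AE[OF Bochner_Integration.integrable_diff[OF intJ intJ] nn] by simp
  then show ?thesis
    using eq \<gamma> AE_space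
  proof eventually_elim
    case (elim \<omega>)
    then have "exp (- ?d \<omega>) - 1 + ?d \<omega> = 0" using true_ps_bounds[of \<omega>] by auto
    then have e: "1 - ?d \<omega> = exp (- ?d \<omega>)" by linarith
    then have "0 < 1 - ?d \<omega>" by (simp only: exp_gt_zero)
    moreover have "ln (1 - ?d \<omega>) = (1 - ?d \<omega>) - 1" by (simp only: e ln_exp) (use e in linarith)
    ultimately have "?d \<omega> = 0" using ln_eq_minus_one[of "1 - ?d \<omega>"] by simp
    then show ?case using elim by (simp add: ps_def)
  qed
qed

end

lemma (in causal_population) lin_measurable_obs [measurable]:
  "(\<lambda>z. lin D b (snd (snd z))) \<in> borel_measurable (obs_space D)"
  unfolding obs_space_def by measurable

context regular_population
begin

lemma w_pos: "0 < w x" by (simp add: wt_def)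

lemma w_bound: "AE \<omega> in M. w (X \<omega>) \<le> exp (- B0)"
  using overlap by eventually_elim (simp add: wt_def)

text \<open>
  Weighting the treated by \<open>w\<close> reproduces the covariate distribution of the untreated. This is what
  makes calibration scores centred, and hence what makes the first-order effect of the outcome
  regression vanish.
\<close>

lemma ps_w: "AE \<omega> in M. true_ps D (X \<omega>) * w (X \<omega>) = 1 - true_ps D (X \<omega>)"
  using ps_correct
proof eventually_elim
  case (elim \<omega>)
  have "0 < 1 + exp (- lin D gb (X \<omega>))" by (simp add: add_pos_pos)
  then show ?case unfolding elim ps_def wt_def by (simp add: field_simps)
qed

lemma balance_integral:
  assumes k[measurable]: "k \<in> borel_measurable (cov_space D)" and B: "AE \<omega> in M. \<bar>k (X \<omega>)\<bar> \<le> B"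
  shows "integrable P (\<lambda>(y, t, x). t * w x * k x)" "integrable P (\<lambda>(y, t, x). (1 - t) * k x)"
    and "(\<integral>z. (case z of (y, t, x) \<Rightarrow> (1 - t) * k x) \<partial>P) = (\<integral>z. (case z of (y, t, x) \<Rightarrow> t * w x * k x) \<partial>P)"
proof -
  have ki: "integrable M (\<lambda>\<omega>. k (X \<omega>))" by (rule bounded_integrable[OF k B])
  let ?H = "\<lambda>(y :: real, x). w x * k x" and ?G = "\<lambda>(y :: real, x). k x"
  have H: "?H \<in> borel_measurable (borel \<Otimes>\<^sub>M cov_space D)" and G: "?G \<in> borel_measurable (borel \<Otimes>\<^sub>M cov_space D)"
    by measurable
  have "integrable M (\<lambda>\<omega>. (\<lambda>x. w x * k x) (X \<omega>))"
  proof (rule bounded_integrable)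
    show "AE \<omega> in M. \<bar>w (X \<omega>) * k (X \<omega>)\<bar> \<le> exp (- B0) * B"
      using w_bound B
    proof eventually_elim
      case (elim \<omega>)
      then show ?case using w_pos[of "X \<omega>"] unfolding abs_mult by (intro mult_mono) auto
    qed
  qed measurable
  then have Hi: "integrable M (\<lambda>\<omega>. ?H (Y1 \<omega>, X \<omega>))" by simp
  have Gi: "integrable M (\<lambda>\<omega>. ?G (Y1 \<omega>, X \<omega>))" using ki by simp
  note trH = obs_treated_integral[OF H Hi] and trG = obs_treated_integral[OF G Gi]
  show "integrable P (\<lambda>(y, t, x). t * w x * k x)" using trH(1) by (simp add: mult.assoc)
  have km: "(\<lambda>z. k (snd (snd z))) \<in> borel_measurable (obs_space D)"
    by (rule measurable_compose[OF _ k]) (simp add: obs_space_def)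
  have kP: "integrable P (\<lambda>z. k (snd (snd z)))" "(\<integral>z. k (snd (snd z)) \<partial>P) = (\<integral>\<omega>. k (X \<omega>) \<partial>M)"
    using obs_integral[OF km] ki by (simp_all add: observe_def)
  have eq: "(\<lambda>(y, t, x). (1 - t) * k x) = (\<lambda>z. k (snd (snd z)) - (case z of (y, t, x) \<Rightarrow> t * ?G (y, x)))"
    by (auto simp: fun_eq_iff algebra_simps)
  show "integrable P (\<lambda>(y, t, x). (1 - t) * k x)"
    unfolding eq by (intro Bochner_Integration.integrable_diff kP trG)
  have pint: "integrable M (\<lambda>\<omega>. true_ps D (X \<omega>) * k (X \<omega>))"
    by (rule Bochner_Integration.integrable_bound[OF ki])
       (simp, auto intro!: AE_I2 mult_left_le_one_le simp: abs_mult dest!: true_ps_bounds)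
  have "(\<integral>z. (case z of (y, t, x) \<Rightarrow> (1 - t) * k x) \<partial>P)
      = (\<integral>\<omega>. k (X \<omega>) \<partial>M) - (\<integral>\<omega>. true_ps D (X \<omega>) * ?G (Y1 \<omega>, X \<omega>) \<partial>M)"
    unfolding eq by (subst Bochner_Integration.integral_diff[OF kP(1) trG(1)]) (simp only: kP(2) trG(2))
  also have "\<dots> = (\<integral>\<omega>. k (X \<omega>) - true_ps D (X \<omega>) * k (X \<omega>) \<partial>M)"
    using ki pint by (subst Bochner_Integration.integral_diff) auto
  also have "\<dots> = (\<integral>\<omega>. true_ps D (X \<omega>) * ?H (Y1 \<omega>, X \<omega>) \<partial>M)"
  proof (rule integral_cong_AE)
    show "AE \<omega> in M. k (X \<omega>) - true_ps D (X \<omega>) * k (X \<omega>) = true_ps D (X \<omega>) * ?H (Y1 \<omega>, X \<omega>)"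
      using ps_w
    proof eventually_elim
      case (elim \<omega>)
      have "true_ps D (X \<omega>) * (w (X \<omega>) * k (X \<omega>)) = (1 - true_ps D (X \<omega>)) * k (X \<omega>)"
        unfolding elim[symmetric] by simp
      then show ?case by (simp add: left_diff_distrib)
    qed
  qed measurable
  also have "\<dots> = (\<integral>z. (case z of (y, t, x) \<Rightarrow> t * ?H (y, x)) \<partial>P)" by (rule trH(2)[symmetric])
  finally show "(\<integral>z. (case z of (y, t, x) \<Rightarrow> (1 - t) * k x) \<partial>P) = (\<integral>z. (case z of (y, t, x) \<Rightarrow> t * w x * k x) \<partial>P)"
    by (simp add: mult.assoc)
qed

lemma score_mean:
  assumes k: "k \<in> borel_measurable (cov_space D)" and B: "AE \<omega> in M. \<bar>k (X \<omega>)\<bar> \<le> B"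
  shows "(\<integral>z. (case z of (y, t, x) \<Rightarrow> (- t * w x + (1 - t)) * k x) \<partial>P) = 0"
proof -
  note b = balance_integral[OF k B]
  have eq: "(\<lambda>(y, t, x). (- t * w x + (1 - t)) * k x)
      = (\<lambda>z. (case z of (y, t, x) \<Rightarrow> (1 - t) * k x) - (case z of (y, t, x) \<Rightarrow> t * w x * k x))"
    by (auto simp: fun_eq_iff algebra_simps)
  show ?thesis
    unfolding eq by (subst Bochner_Integration.integral_diff[OF b(2,1)]) (simp add: b(3))
qed

lemma residual_exp:
  "(\<integral>\<^sup>+\<omega>. ennreal (exp ((Y1 \<omega> - m (X \<omega>))\<^sup>2 / D0\<^sup>2) - 1) \<partial>M) \<le> ennreal (D1\<^sup>2 / D0\<^sup>2)"
proof -
  let ?g = "\<lambda>\<omega>. ennreal (exp ((Y1 \<omega> - m (X \<omega>))\<^sup>2 / D0\<^sup>2) - 1)"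
  have "ennreal (D0\<^sup>2) * (\<integral>\<^sup>+\<omega>. ?g \<omega> \<partial>M) = ennreal (D0\<^sup>2) * (\<integral>\<^sup>+\<omega>. nn_cond_exp M F ?g \<omega> \<partial>M)"
    using F.nn_cond_exp_intg[of "\<lambda>_. 1" ?g] by simp
  also have "\<dots> = (\<integral>\<^sup>+\<omega>. ennreal (D0\<^sup>2) * nn_cond_exp M F ?g \<omega> \<partial>M)"
    by (simp add: nn_integral_cmult)
  also have "\<dots> \<le> (\<integral>\<^sup>+\<omega>. ennreal (D1\<^sup>2) \<partial>M)"
    using tail by (rule nn_integral_mono_AE)
  also have "\<dots> = ennreal (D1\<^sup>2)" by (simp add: emeasure_space_1)
  finally have *: "ennreal (D0\<^sup>2) * (\<integral>\<^sup>+\<omega>. ?g \<omega> \<partial>M) \<le> ennreal (D1\<^sup>2)" .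
  have "(\<integral>\<^sup>+\<omega>. ?g \<omega> \<partial>M) = ennreal (1 / D0\<^sup>2) * (ennreal (D0\<^sup>2) * (\<integral>\<^sup>+\<omega>. ?g \<omega> \<partial>M))"
    using const_pos by (simp add: mult.assoc[symmetric] ennreal_mult[symmetric])
  also have "\<dots> \<le> ennreal (1 / D0\<^sup>2) * ennreal (D1\<^sup>2)" using * by (rule mult_left_mono) simp
  also have "\<dots> = ennreal (D1\<^sup>2 / D0\<^sup>2)" by (simp add: ennreal_mult[symmetric])
  finally show ?thesis .
qed

text \<open>
  Since \<open>x \<le> exp x - 1\<close>, the conditional exponential moment of the residual bounds its conditional second
  moment by \<open>D1\<^sup>2\<close>, so that the squared residual can be replaced by \<open>D1\<^sup>2\<close> under any nonnegative
  covariate weight.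
\<close>

lemma residual_square_weighted:
  assumes k[measurable]: "k \<in> borel_measurable (cov_space D)" and k0: "\<And>x. 0 \<le> k x" and B: "AE \<omega> in M. \<bar>k (X \<omega>)\<bar> \<le> B"
  shows "integrable P (\<lambda>(y, t, x). t * w x * (y - m x)\<^sup>2 * k x)"
    and "(\<integral>z. (case z of (y, t, x) \<Rightarrow> t * w x * (y - m x)\<^sup>2 * k x) \<partial>P) \<le> D1\<^sup>2 * (\<integral>z. (case z of (y, t, x) \<Rightarrow> t * w x * k x) \<partial>P)"
proof -
  let ?g = "\<lambda>\<omega>. ennreal (exp ((Y1 \<omega> - m (X \<omega>))\<^sup>2 / D0\<^sup>2) - 1)"
  let ?f = "\<lambda>(y, t, x). t * w x * (y - m x)\<^sup>2 * k x" and ?den = "\<lambda>(y :: real, t, x). t * w x * k x"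
  let ?c = "\<lambda>\<omega>. ennreal (true_ps D (X \<omega>) * (w (X \<omega>) * k (X \<omega>)))"
  have fm: "?f \<in> borel_measurable P" "?den \<in> borel_measurable P"
    by (simp_all add: obs_space_def cong: measurable_cong_sets)
  have t0: "AE z in P. 0 \<le> ?f z" "AE z in P. 0 \<le> ?den z"
    using AE_obs_law_trt by (eventually_elim, auto simp: k0 less_imp_le[OF w_pos] split: prod.splits)+
  have nn1: "(\<integral>\<^sup>+z. ennreal (?f z) \<partial>P) = (\<integral>\<^sup>+\<omega>. ?c \<omega> * ennreal ((Y1 \<omega> - m (X \<omega>))\<^sup>2) \<partial>M)"
  proof -
    have "(\<integral>\<^sup>+z. ennreal (?f z) \<partial>P)
        = (\<integral>\<^sup>+z. ennreal (case z of (y, t, x) \<Rightarrow> t * (\<lambda>(y, x). w x * k x * (y - m x)\<^sup>2) (y, x)) \<partial>P)"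
      by (intro nn_integral_cong) (simp add: mult_ac split: prod.splits)
    also have "\<dots> = (\<integral>\<^sup>+\<omega>. ennreal (true_ps D (X \<omega>) * (\<lambda>(y, x). w x * k x * (y - m x)\<^sup>2) (Y1 \<omega>, X \<omega>)) \<partial>M)"
      by (rule obs_treated_nn_integral) measurable
    also have "\<dots> = (\<integral>\<^sup>+\<omega>. ?c \<omega> * ennreal ((Y1 \<omega> - m (X \<omega>))\<^sup>2) \<partial>M)"
      by (intro nn_integral_cong)
         (simp add: ennreal_mult''[symmetric] mult.assoc)
    finally show ?thesis .
  qed
  have nn0: "(\<integral>\<^sup>+z. ennreal (?den z) \<partial>P) = (\<integral>\<^sup>+\<omega>. ?c \<omega> \<partial>M)"
  proof -
    have "(\<integral>\<^sup>+z. ennreal (?den z) \<partial>P)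
        = (\<integral>\<^sup>+z. ennreal (case z of (y, t, x) \<Rightarrow> t * (\<lambda>(y, x). w x * k x) (y, x)) \<partial>P)"
      by (intro nn_integral_cong) (simp add: mult_ac split: prod.splits)
    also have "\<dots> = (\<integral>\<^sup>+\<omega>. ennreal (true_ps D (X \<omega>) * (\<lambda>(y, x). w x * k x) (Y1 \<omega>, X \<omega>)) \<partial>M)"
      by (rule obs_treated_nn_integral) measurable
    finally show ?thesis by simp
  qed
  have cF: "?c \<in> borel_measurable F"
    by (rule measurable_compose[OF X_measurable_F, of "\<lambda>x. ennreal (true_ps D x * (w x * k x))"]) measurable
  have cF': "(\<lambda>\<omega>. ?c \<omega> * ennreal (D0\<^sup>2)) \<in> borel_measurable F" using cF by measurable
  have sq: "e\<^sup>2 \<le> D0\<^sup>2 * (exp (e\<^sup>2 / D0\<^sup>2) - 1)" for e :: real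
    using exp_ge_add_one_self[of "e\<^sup>2 / D0\<^sup>2"] const_pos by (simp add: field_simps)
  have "(\<integral>\<^sup>+z. ennreal (?f z) \<partial>P) \<le> (\<integral>\<^sup>+\<omega>. ?c \<omega> * (ennreal (D0\<^sup>2) * ?g \<omega>) \<partial>M)"
    unfolding nn1 using sq
    by (intro nn_integral_mono mult_left_mono) (auto simp: ennreal_mult'[symmetric] intro!: ennreal_leI)
  also have "\<dots> = (\<integral>\<^sup>+\<omega>. (?c \<omega> * ennreal (D0\<^sup>2)) * ?g \<omega> \<partial>M)" by (simp only: mult.assoc)
  also have "\<dots> = (\<integral>\<^sup>+\<omega>. (?c \<omega> * ennreal (D0\<^sup>2)) * nn_cond_exp M F ?g \<omega> \<partial>M)"
    by (rule F.nn_cond_exp_intg[symmetric, OF cF']) measurable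
  also have "\<dots> \<le> (\<integral>\<^sup>+\<omega>. ?c \<omega> * ennreal (D1\<^sup>2) \<partial>M)"
  proof (rule nn_integral_mono_AE, use tail in eventually_elim)
    case (elim \<omega>)
    then show ?case unfolding mult.assoc by (rule mult_left_mono) simp
  qed
  also have "\<dots> = (\<integral>\<^sup>+z. ennreal (?den z) \<partial>P) * ennreal (D1\<^sup>2)"
    unfolding nn0 by (rule nn_integral_multc) measurable
  also have "\<dots> = ennreal (\<integral>z. ?den z \<partial>P) * ennreal (D1\<^sup>2)"
    using balance_integral(1)[OF k B] t0(2) by (subst nn_integral_eq_integral) auto
  also have "\<dots> = ennreal (D1\<^sup>2 * (\<integral>z. ?den z \<partial>P))"
    using t0(2) by (simp add: ennreal_mult[symmetric] integral_nonneg_AE mult.commute)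
  finally have le: "(\<integral>\<^sup>+z. ennreal (?f z) \<partial>P) \<le> ennreal (D1\<^sup>2 * (\<integral>z. ?den z \<partial>P))" .
  show int: "integrable P ?f"
    using fm(1) t0(1) le_less_trans[OF le ennreal_less_top] by (intro integrableI_nonneg) auto
  show "(\<integral>z. ?f z \<partial>P) \<le> D1\<^sup>2 * (\<integral>z. ?den z \<partial>P)"
    using le t0 by (subst (asm) nn_integral_eq_integral[OF int]) (auto simp: integral_nonneg_AE)
qed

end

section \<open>Exponential moments of the scores\<close>

text \<open>
  A common scale for all scores below: the product of bounds for the weight, for the link curvature,
  for the conversion of residuals to multiples of \<open>D0\<close>, and for two dictionary entries.
\<close>

definition moment_scale :: "real \<Rightarrow> real \<Rightarrow> real \<Rightarrow> real \<Rightarrow> real" where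
  "moment_scale C0 B0 D0 C1 = (1 + exp (- B0)) * (1 + C1) * (1 + D0)\<^sup>2 * C0\<^sup>2"

definition moment_bound :: "real \<Rightarrow> real \<Rightarrow> real" where
  "moment_bound D0 D1 = exp 1 * (1 + D1\<^sup>2 / D0\<^sup>2)"

context regular_population
begin

abbreviation "v0 \<equiv> moment_scale C0 B0 D0 C1"
abbreviation "c0 \<equiv> moment_bound D0 D1"

lemma scale_pos: "0 < v0" "0 < c0" "1 \<le> c0"
proof -
  show "0 < v0" using const_pos by (simp add: moment_scale_def add_pos_pos)
  show "1 \<le> c0" unfolding moment_bound_def
    using mult_mono[of 1 "exp 1 :: real" 1 "1 + D1\<^sup>2 / D0\<^sup>2"] by simp
  then show "0 < c0" by simp
qed

lemma obs_regular:
  "AE z in P. case z of (y, t, x) \<Rightarrow> (t = 0 \<or> t = 1) \<and> (\<forall>j\<le>p. \<bar>dict D j x\<bar> \<le> C0) \<and> dict D 0 x = 1 \<and>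
     w x \<le> exp (- B0) \<and> \<psi>2 (lin D ab x) \<le> C1 \<and> C2 \<le> \<psi>2 (lin D ab x)"
proof -
  have [measurable]: "Measurable.pred (cov_space D) (\<lambda>x. \<bar>dict D j x\<bar> \<le> C0)" if "j \<le> p" for j
    using dict_measurable[OF that] by measurable
  have 1: "AE z in P. \<forall>j\<in>{..p}. \<bar>dict D j (snd (snd z))\<bar> \<le> C0"
  proof (intro AE_finite_allI)
    fix j assume "j \<in> {..p}"
    then have j: "j \<le> p" by simp
    have "AE \<omega> in M. \<bar>dict D j (X \<omega>)\<bar> \<le> C0" using dict_bound by eventually_elim (use j in auto)
    then show "AE z in P. \<bar>dict D j (snd (snd z))\<bar> \<le> C0"
      by (rule AE_obs_law_cov) (use dict_measurable[OF j] in measurable)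
  qed simp
  have 2: "AE z in P. w (snd (snd z)) \<le> exp (- B0)" by (rule AE_obs_law_cov[OF w_bound]) measurable
  have 3: "AE z in P. \<psi>2 (lin D ab (snd (snd z))) \<le> C1" by (rule AE_obs_law_cov[OF curv_le]) measurable
  have 4: "AE z in P. C2 \<le> \<psi>2 (lin D ab (snd (snd z)))" by (rule AE_obs_law_cov[OF curv_ge]) measurable
  have 5: "AE z in P. snd (snd z) \<in> space (cov_space D)"
    by (intro AE_I2) (auto simp: obs_space_def space_pair_measure)
  show ?thesis
    using 1 2 3 4 5 AE_obs_law_trt
  proof eventually_elim
    case (elim z)
    have "dict D 0 (snd (snd z)) = 1" using elim model by (auto simp: population_model_def)
    with elim show ?case by (auto split: prod.splits)
  qed
qed

lemma residual_exp_obs: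
  "(\<integral>\<^sup>+z. ennreal (case z of (y, t, x) \<Rightarrow> exp (t * ((y - m x) / D0)\<^sup>2)) \<partial>P) \<le> ennreal (1 + D1\<^sup>2 / D0\<^sup>2)"
proof -
  let ?q = "\<lambda>(y, x). exp ((y - m x)\<^sup>2 / D0\<^sup>2) - 1"
  have q: "?q \<in> borel_measurable (borel \<Otimes>\<^sub>M cov_space D)" by measurable
  have qz: "(\<lambda>z. ennreal (case z of (y, t, x) \<Rightarrow> t * ?q (y, x))) \<in> borel_measurable P"
    by (simp add: obs_space_def cong: measurable_cong_sets)
  interpret P: prob_space P by (rule prob_space_obs_law)
  have "(\<integral>\<^sup>+z. ennreal (case z of (y, t, x) \<Rightarrow> exp (t * ((y - m x) / D0)\<^sup>2)) \<partial>P)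
      = (\<integral>\<^sup>+z. 1 + ennreal (case z of (y, t, x) \<Rightarrow> t * ?q (y, x)) \<partial>P)"
  proof (rule nn_integral_cong_AE, use AE_obs_law_trt in eventually_elim)
    case (elim z)
    obtain y t x where z: "z = (y, t, x)" by (cases z) auto
    have "0 \<le> exp ((y - m x)\<^sup>2 / D0\<^sup>2) - 1" by simp
    with elim show ?case
      by (auto simp: z power_divide ennreal_1[symmetric] ennreal_plus[symmetric] simp del: ennreal_1 ennreal_plus)
  qed
  also have "\<dots> = 1 + (\<integral>\<^sup>+\<omega>. ennreal (true_ps D (X \<omega>) * ?q (Y1 \<omega>, X \<omega>)) \<partial>M)"
    by (subst nn_integral_add[OF _ qz])
       (simp, simp only: obs_treated_nn_integral[OF q] nn_integral_const P.emeasure_space_1 mult_1)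
  also have "\<dots> \<le> 1 + (\<integral>\<^sup>+\<omega>. ennreal (exp ((Y1 \<omega> - m (X \<omega>))\<^sup>2 / D0\<^sup>2) - 1) \<partial>M)"
    by (intro add_left_mono nn_integral_mono ennreal_leI)
       (auto intro!: mult_left_le_one_le dest!: true_ps_bounds)
  also have "\<dots> \<le> 1 + ennreal (D1\<^sup>2 / D0\<^sup>2)" by (intro add_left_mono residual_exp)
  also have "\<dots> = ennreal (1 + D1\<^sup>2 / D0\<^sup>2)" by simp
  finally show ?thesis .
qed

text \<open>
  Every score grows at most quadratically in the residual, and the square of the residual has an
  exponential moment at scale \<open>D0\<close>.
\<close>

lemma subexpI:
  assumes g: "g \<in> borel_measurable P"
    and b: "AE z in P. case z of (y, t, x) \<Rightarrow> \<bar>g z\<bar> \<le> v0 * (1 + t * ((y - m x) / D0)\<^sup>2)"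
  shows "subexp P v0 c0 g"
  unfolding subexp_def
proof
  show "g \<in> borel_measurable P" by fact
  have em: "(\<lambda>z. ennreal (case z of (y, t, x) \<Rightarrow> exp (t * ((y - m x) / D0)\<^sup>2))) \<in> borel_measurable P"
    by (simp add: obs_space_def cong: measurable_cong_sets)
  have "(\<integral>\<^sup>+z. ennreal (exp (\<bar>g z\<bar> / v0)) \<partial>P)
      \<le> (\<integral>\<^sup>+z. ennreal (exp 1) * ennreal (case z of (y, t, x) \<Rightarrow> exp (t * ((y - m x) / D0)\<^sup>2)) \<partial>P)"
  proof (rule nn_integral_mono_AE, use b in eventually_elim)
    case (elim z)
    obtain y t x where z: "z = (y, t, x)" by (cases z) auto
    have "\<bar>g z\<bar> / v0 \<le> 1 + t * ((y - m x) / D0)\<^sup>2"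
      using elim scale_pos(1) by (simp add: z pos_divide_le_eq mult.commute)
    then have "exp (\<bar>g z\<bar> / v0) \<le> exp 1 * exp (t * ((y - m x) / D0)\<^sup>2)"
      by (simp add: mult_exp_exp)
    then have "ennreal (exp (\<bar>g z\<bar> / v0)) \<le> ennreal (exp 1 * exp (t * ((y - m x) / D0)\<^sup>2))"
      by (rule ennreal_leI)
    then show ?case by (simp only: z prod.case) (simp add: ennreal_mult)
  qed
  also have "\<dots> = ennreal (exp 1) * (\<integral>\<^sup>+z. ennreal (case z of (y, t, x) \<Rightarrow> exp (t * ((y - m x) / D0)\<^sup>2)) \<partial>P)"
    by (rule nn_integral_cmult[OF em])
  also have "\<dots> \<le> ennreal (exp 1) * ennreal (1 + D1\<^sup>2 / D0\<^sup>2)"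
    by (intro mult_left_mono residual_exp_obs) simp
  also have "\<dots> = ennreal c0" by (simp add: moment_bound_def ennreal_mult del: ennreal_plus)
  finally show "(\<integral>\<^sup>+z. ennreal (exp (\<bar>g z\<bar> / v0)) \<partial>P) \<le> ennreal c0" .
qed

text \<open>
  The scores are the gradient of the calibration loss, the same vector weighted by the link curvature, as it
  occurs in the expansion of the augmented estimator, and the gradient of the weighted outcome loss. The two
  Gram forms are those of the untreated and of the treated weighted by squared residuals.
\<close>

definition cal_score :: "nat \<Rightarrow> 'x obs \<Rightarrow> real" where
  "cal_score j = (\<lambda>(y, t, x). (- t * w x + (1 - t)) * dict D j x)"
definition cal_score_curv :: "nat \<Rightarrow> 'x obs \<Rightarrow> real" where
  "cal_score_curv j = (\<lambda>(y, t, x). (- t * w x + (1 - t)) * \<psi>2 (lin D ab x) * dict D j x)"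
definition wl_score :: "nat \<Rightarrow> 'x obs \<Rightarrow> real" where
  "wl_score j = (\<lambda>(y, t, x). t * w x * (m x - y) * dict D j x)"
definition gram_ctl :: "nat \<Rightarrow> nat \<Rightarrow> 'x obs \<Rightarrow> real" where
  "gram_ctl j k = (\<lambda>(y, t, x). (1 - t) * dict D j x * dict D k x)"
definition gram_res :: "nat \<Rightarrow> nat \<Rightarrow> 'x obs \<Rightarrow> real" where
  "gram_res j k = (\<lambda>(y, t, x). t * w x * (y - m x)\<^sup>2 * dict D j x * dict D k x)"

lemma score_measurable:
  assumes "j \<le> p" "k \<le> p"
  shows "cal_score j \<in> borel_measurable P" "cal_score_curv j \<in> borel_measurable P" "wl_score j \<in> borel_measurable P"
    "gram_ctl j k \<in> borel_measurable P" "gram_res j k \<in> borel_measurable P" "gram D gb j k \<in> borel_measurable P"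
proof -
  note [measurable] = dict_measurable[OF assms(1)] dict_measurable[OF assms(2)]
  show "cal_score j \<in> borel_measurable P" "cal_score_curv j \<in> borel_measurable P" "wl_score j \<in> borel_measurable P"
    "gram_ctl j k \<in> borel_measurable P" "gram_res j k \<in> borel_measurable P" "gram D gb j k \<in> borel_measurable P"
    by (simp_all add: cal_score_def cal_score_curv_def wl_score_def gram_ctl_def gram_res_def gram_def obs_space_def
        cong: measurable_cong_sets)
qed

lemma scale_ge:
  assumes a: "0 \<le> a" "a \<le> 1 + exp (- B0)" and b: "0 \<le> b" "b \<le> 1 + C1" and d: "0 \<le> d" "d \<le> (1 + D0)\<^sup>2"
    and f: "0 \<le> f" "f \<le> C0\<^sup>2"
  shows "a * b * d * f \<le> v0"
  unfolding moment_scale_def using assms const_pos by (intro mult_mono mult_nonneg_nonneg) auto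

lemma abs_le_one_add_square: "\<bar>r\<bar> \<le> 1 + r\<^sup>2" for r :: real
proof -
  have "0 \<le> (\<bar>r\<bar> - 1)\<^sup>2" by simp
  then have "2 * \<bar>r\<bar> \<le> 1 + r\<^sup>2" by (simp add: power2_diff)
  then show ?thesis by linarith
qed

lemma score_subexp:
  assumes j: "j \<le> p" and k: "k \<le> p"
  shows "subexp P v0 c0 (cal_score j)" "subexp P v0 c0 (cal_score_curv j)" "subexp P v0 c0 (wl_score j)"
    "subexp P v0 c0 (gram_ctl j k)" "subexp P v0 c0 (gram_res j k)" "subexp P v0 c0 (gram D gb j k)"
proof -
  note sm = score_measurable[OF j k]
  have C02: "C0 \<le> C0\<^sup>2" using const_pos by (simp add: power2_eq_square)
  have D02: "1 \<le> (1 + D0)\<^sup>2" "D0 \<le> (1 + D0)\<^sup>2" "D0\<^sup>2 \<le> (1 + D0)\<^sup>2"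
    using const_pos by (auto simp: power2_eq_square algebra_simps)
  have key: "\<bar>cal_score j z\<bar> \<le> v0 * (1 + t * ((y - m x) / D0)\<^sup>2) \<and>
      \<bar>cal_score_curv j z\<bar> \<le> v0 * (1 + t * ((y - m x) / D0)\<^sup>2) \<and>
      \<bar>wl_score j z\<bar> \<le> v0 * (1 + t * ((y - m x) / D0)\<^sup>2) \<and>
      \<bar>gram_ctl j k z\<bar> \<le> v0 * (1 + t * ((y - m x) / D0)\<^sup>2) \<and>
      \<bar>gram_res j k z\<bar> \<le> v0 * (1 + t * ((y - m x) / D0)\<^sup>2) \<and>
      \<bar>gram D gb j k z\<bar> \<le> v0 * (1 + t * ((y - m x) / D0)\<^sup>2)"
    if z: "z = (y, t, x)" and t: "t = 0 \<or> t = 1" and f: "\<forall>j\<le>p. \<bar>dict D j x\<bar> \<le> C0"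
      and w: "w x \<le> exp (- B0)" and c: "\<psi>2 (lin D ab x) \<le> C1" for z y t x
  proof -
    let ?e = "(y - m x) / D0" and ?fj = "\<bar>dict D j x\<bar>" and ?fk = "\<bar>dict D k x\<bar>"
    have fj: "?fj \<le> C0\<^sup>2" using f j C02 by (meson order_trans)
    have fjk: "?fj * ?fk \<le> C0\<^sup>2" unfolding power2_eq_square using f j k const_pos by (intro mult_mono) auto
    have wp: "0 < w x" by (rule w_pos)
    have e1: "1 * v0 \<le> v0 * (1 + t * ?e\<^sup>2)" using t scale_pos by auto
    have "v0 * \<bar>?e\<bar> \<le> v0 * (1 + ?e\<^sup>2)"
      by (intro mult_left_mono abs_le_one_add_square less_imp_le[OF scale_pos(1)])
    then have "1 * \<bar>?e\<bar> * v0 \<le> v0 * (1 + 1 * ?e\<^sup>2)" by (simp only: mult_1 mult.commute[of "\<bar>?e\<bar>" v0])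
    then have e2: "t * \<bar>?e\<bar> * v0 \<le> v0 * (1 + t * ?e\<^sup>2)" using t scale_pos(1) by (elim disjE) simp_all
    have e3: "t * ?e\<^sup>2 * v0 \<le> v0 * (1 + t * ?e\<^sup>2)" using t scale_pos by auto
    have sc: "\<bar>- t * w x + (1 - t)\<bar> \<le> 1 + exp (- B0)" using t wp w by (auto intro: add_increasing)
    have tw: "0 \<le> t * w x" "t * w x \<le> 1 + exp (- B0)" using t wp w by (auto intro: add_increasing)
    have t1: "\<bar>1 - t\<bar> \<le> 1 + exp (- B0)" using t by (auto intro: add_increasing2)
    have c': "0 \<le> \<psi>2 (lin D ab x)" "\<psi>2 (lin D ab x) \<le> 1 + C1" using c link_curv_nonneg by (auto intro: add_increasing)
    have C1: "1 \<le> 1 + C1" using const_pos by simp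
    have De: "y - m x = D0 * ?e" using const_pos by simp
    have 1: "\<bar>cal_score j z\<bar> \<le> v0"
      using scale_ge[OF abs_ge_zero sc zero_le_one C1 zero_le_one D02(1) abs_ge_zero fj]
      by (simp add: z cal_score_def abs_mult)
    have 2: "\<bar>cal_score_curv j z\<bar> \<le> v0"
      using scale_ge[OF abs_ge_zero sc c' zero_le_one D02(1) abs_ge_zero fj] c'
      by (simp add: z cal_score_curv_def abs_mult)
    have "\<bar>wl_score j z\<bar> = t * \<bar>?e\<bar> * ((t * w x) * 1 * D0 * ?fj)"
      using t wp const_pos unfolding z wl_score_def prod.case abs_mult abs_minus_commute[of "m x"] by auto
    also have "\<dots> \<le> t * \<bar>?e\<bar> * v0"
      using scale_ge[OF tw zero_le_one C1 _ D02(2) abs_ge_zero fj] const_pos t by (intro mult_left_mono) auto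
    finally have 3: "\<bar>wl_score j z\<bar> \<le> t * \<bar>?e\<bar> * v0" .
    have 4: "\<bar>gram_ctl j k z\<bar> \<le> v0"
      using scale_ge[OF abs_ge_zero t1 zero_le_one C1 zero_le_one D02(1) _ fjk]
      by (simp add: z gram_ctl_def abs_mult mult.assoc)
    have "\<bar>gram_res j k z\<bar> = t * ?e\<^sup>2 * ((t * w x) * 1 * D0\<^sup>2 * (?fj * ?fk))"
      using t wp const_pos unfolding z gram_res_def prod.case abs_mult by (auto simp: power_divide)
    also have "\<dots> \<le> t * ?e\<^sup>2 * v0"
      using scale_ge[OF tw zero_le_one C1 _ D02(3) _ fjk] const_pos t by (intro mult_left_mono) auto
    finally have 5: "\<bar>gram_res j k z\<bar> \<le> t * ?e\<^sup>2 * v0" .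
    have 6: "\<bar>gram D gb j k z\<bar> \<le> v0"
      using scale_ge[OF tw zero_le_one C1 zero_le_one D02(1) _ fjk] tw
      by (simp add: z gram_def abs_mult mult.assoc abs_of_nonneg[OF less_imp_le[OF wp]]) (use t in auto)
    show ?thesis using 1 2 3 4 5 6 e1 e2 e3 by linarith
  qed
  have all: "AE z in P. case z of (y, t, x) \<Rightarrow> \<bar>g z\<bar> \<le> v0 * (1 + t * ((y - m x) / D0)\<^sup>2)"
    if "g \<in> {cal_score j, cal_score_curv j, wl_score j, gram_ctl j k, gram_res j k, gram D gb j k}" for g
    using obs_regular
  proof eventually_elim
    case (elim z)
    obtain y t x where z: "z = (y, t, x)" by (cases z) auto
    show ?case using key[OF z] elim that by (auto simp: z)
  qed
  show "subexp P v0 c0 (cal_score j)" "subexp P v0 c0 (cal_score_curv j)" "subexp P v0 c0 (wl_score j)"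
    "subexp P v0 c0 (gram_ctl j k)" "subexp P v0 c0 (gram_res j k)" "subexp P v0 c0 (gram D gb j k)"
    by (rule subexpI; fact sm all[simplified] | rule subexpI[OF _ all]; simp add: sm)+
qed

end

section \<open>First-order conditions of the targets\<close>

context regular_population
begin

text \<open>
  Mean value theorem, with the curvature at the intermediate point compared to that at \<open>u\<close>.
\<close>

lemma link_diff:
  shows "\<bar>\<psi> (u + t) - \<psi> u\<bar> \<le> \<psi>2 u * exp (C3 * \<bar>t\<bar>) * \<bar>t\<bar>"
    and "\<bar>\<psi> (u + t) - \<psi> u - \<psi>2 u * t\<bar> \<le> \<psi>2 u * C3 * exp (C3 * \<bar>t\<bar>) * t\<^sup>2"
proof -
  have "\<exists>\<zeta>. \<bar>\<zeta> - u\<bar> \<le> \<bar>t\<bar> \<and> \<psi> (u + t) - \<psi> u = t * \<psi>2 \<zeta>"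
  proof (cases "t = 0")
    case False
    then consider "0 < t" | "t < 0" by linarith
    then show ?thesis
    proof cases
      case 1
      then obtain z where "u < z" "z < u + t" "\<psi> (u + t) - \<psi> u = (u + t - u) * \<psi>2 z"
        using MVT2[of u "u + t" \<psi> \<psi>2] deriv_link by auto
      then show ?thesis by (intro exI[of _ z]) auto
    next
      case 2
      then obtain z where "u + t < z" "z < u" "\<psi> u - \<psi> (u + t) = (u - (u + t)) * \<psi>2 z"
        using MVT2[of "u + t" u \<psi> \<psi>2] deriv_link by auto
      then show ?thesis by (intro exI[of _ z]) (auto simp: algebra_simps)
    qed
  qed (intro exI[of _ u], simp)
  then obtain z where z: "\<bar>z - u\<bar> \<le> \<bar>t\<bar>" "\<psi> (u + t) - \<psi> u = t * \<psi>2 z" by blast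
  have C3: "0 \<le> C3" using const_pos by simp
  have C3z: "C3 * \<bar>z - u\<bar> \<le> C3 * \<bar>t\<bar>" using z C3 by (intro mult_left_mono) auto
  have up: "\<psi>2 z \<le> \<psi>2 u * exp (C3 * \<bar>t\<bar>)"
  proof -
    have "\<psi>2 z \<le> \<psi>2 u * exp (C3 * \<bar>z - u\<bar>)" by (rule curv_lip)
    also have "\<dots> \<le> \<psi>2 u * exp (C3 * \<bar>t\<bar>)" using C3z link_curv_nonneg by (intro mult_left_mono) auto
    finally show ?thesis .
  qed
  have lo: "\<psi>2 u * exp (- (C3 * \<bar>t\<bar>)) \<le> \<psi>2 z"
  proof -
    have "\<psi>2 u \<le> \<psi>2 z * exp (C3 * \<bar>u - z\<bar>)" by (rule curv_lip)
    also have "\<dots> \<le> \<psi>2 z * exp (C3 * \<bar>t\<bar>)"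
      using C3z link_curv_nonneg by (intro mult_left_mono) (auto simp: abs_minus_commute)
    finally show ?thesis by (simp add: exp_minus field_simps)
  qed
  show "\<bar>\<psi> (u + t) - \<psi> u\<bar> \<le> \<psi>2 u * exp (C3 * \<bar>t\<bar>) * \<bar>t\<bar>"
    using mult_right_mono[OF up, of "\<bar>t\<bar>"] link_curv_nonneg[of z] by (simp add: z(2) abs_mult mult.commute)
  define s where "s = C3 * \<bar>t\<bar>"
  have s0: "0 \<le> s" using C3 by (simp add: s_def)
  have hi2: "\<psi>2 z - \<psi>2 u \<le> \<psi>2 u * (s * exp s)"
  proof -
    have "exp s - 1 \<le> s * exp s" using exp_minus_diff_le(1)[of "- s"] s0 by simp
    then have "\<psi>2 u * (exp s - 1) \<le> \<psi>2 u * (s * exp s)" using link_curv_nonneg by (intro mult_left_mono)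
    with up show ?thesis by (simp add: s_def algebra_simps)
  qed
  have lo2: "\<psi>2 u - \<psi>2 z \<le> \<psi>2 u * (s * exp s)"
  proof -
    have "1 - exp (- s) \<le> s * exp s" using exp_minus_diff_le(1)[of s] s0 by simp
    then have "\<psi>2 u * (1 - exp (- s)) \<le> \<psi>2 u * (s * exp s)" using link_curv_nonneg by (intro mult_left_mono)
    with lo show ?thesis by (simp add: s_def algebra_simps)
  qed
  have "\<psi> (u + t) - \<psi> u - \<psi>2 u * t = t * (\<psi>2 z - \<psi>2 u)" unfolding z(2) by (simp add: algebra_simps)
  then have "\<bar>\<psi> (u + t) - \<psi> u - \<psi>2 u * t\<bar> = \<bar>t\<bar> * \<bar>\<psi>2 z - \<psi>2 u\<bar>" by (simp add: abs_mult)
  also have "\<dots> \<le> \<bar>t\<bar> * (\<psi>2 u * (s * exp s))" using hi2 lo2 by (intro mult_left_mono) auto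
  also have "\<dots> = \<psi>2 u * C3 * exp (C3 * \<bar>t\<bar>) * t\<^sup>2" by (simp add: s_def power2_eq_square)
  finally show "\<bar>\<psi> (u + t) - \<psi> u - \<psi>2 u * t\<bar> \<le> \<psi>2 u * C3 * exp (C3 * \<bar>t\<bar>) * t\<^sup>2" .
qed

lemma deriv_link_primitive: "(link_primitive \<psi> has_real_derivative \<psi> u) (at u)"
proof -
  let ?a = "min 0 u - 1" and ?b = "max 0 u + 1"
  have c: "continuous_on {?a..?b} \<psi>"
    using deriv_link DERIV_isCont by (intro continuous_at_imp_continuous_on) blast
  have "((\<lambda>u. LBINT y=(0::real)..u. \<psi> y) has_vector_derivative \<psi> u) (at u within {?a..?b})"
    by (rule interval_integral_FTC2[OF _ _ c]) auto
  then have "((\<lambda>u. LBINT y=(0::real)..u. \<psi> y) has_vector_derivative \<psi> u) (at u within {?a<..<?b})"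
    by (rule has_vector_derivative_within_subset) auto
  then have "((\<lambda>u. LBINT y=(0::real)..u. \<psi> y) has_vector_derivative \<psi> u) (at u)"
    by (subst (asm) has_vector_derivative_within_open) auto
  moreover have "link_primitive \<psi> = (\<lambda>u. LBINT y=(0::real)..u. \<psi> y)"
    by (simp add: fun_eq_iff link_primitive_def)
  ultimately show ?thesis by (simp add: has_real_derivative_iff_has_vector_derivative)
qed

lemma link_primitive_continuous: "continuous_on UNIV (link_primitive \<psi>)"
  using deriv_link_primitive DERIV_isCont by (intro continuous_at_imp_continuous_on) blast

lemma link_primitive_measurable [measurable]: "link_primitive \<psi> \<in> borel_measurable borel"
  by (rule borel_measurable_continuous_onI[OF link_primitive_continuous])

lemma link_primitive_convex: "link_primitive \<psi> (u + d) - link_primitive \<psi> u \<le> d * \<psi> (u + d)"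
proof -
  have "0 * (- d)\<^sup>2 / (2 * (1 + 1 * \<bar>- d\<bar>))
      \<le> link_primitive \<psi> ((u + d) + - d) - link_primitive \<psi> (u + d) - \<psi> (u + d) * - d"
    by (rule bregman_ge[OF deriv_link_primitive deriv_link]) (use link_curv_nonneg in auto)
  then show ?thesis by (simp add: mult.commute)
qed

lemma outcome_loss_integrable:
  "integrable P (loss_wl \<psi> D b gb)"
proof -
  let ?K = "\<Sum>j\<le>p. \<bar>b j\<bar> * C0"
  let ?H = "\<lambda>(y, x). w x * (- y * lin D b x + link_primitive \<psi> (lin D b x))"
  have H: "?H \<in> borel_measurable (borel \<Otimes>\<^sub>M cov_space D)" by measurable
  have "compact (link_primitive \<psi> ` {- ?K..?K})"
    by (intro compact_continuous_image continuous_on_subset[OF link_primitive_continuous]) auto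
  then obtain B where B: "\<And>u. u \<in> {- ?K..?K} \<Longrightarrow> \<bar>link_primitive \<psi> u\<bar> \<le> B"
    using compact_imp_bounded bounded_iff by (metis imageI real_norm_def)
  have iY: "integrable M Y1" using model by (auto simp: population_model_def)
  have "integrable M (\<lambda>\<omega>. exp (- B0) * (\<bar>Y1 \<omega>\<bar> * ?K + B))" using iY by auto
  then have i: "integrable M (\<lambda>\<omega>. ?H (Y1 \<omega>, X \<omega>))"
  proof (rule Bochner_Integration.integrable_bound)
    show "AE \<omega> in M. norm (?H (Y1 \<omega>, X \<omega>)) \<le> norm (exp (- B0) * (\<bar>Y1 \<omega>\<bar> * ?K + B))"
      using w_bound lin_bound[of b]
    proof eventually_elim
      case (elim \<omega>)
      have "\<bar>link_primitive \<psi> (lin D b (X \<omega>))\<bar> \<le> B" using elim(2) by (intro B) auto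
      moreover have "\<bar>- Y1 \<omega> * lin D b (X \<omega>)\<bar> \<le> \<bar>Y1 \<omega>\<bar> * ?K"
        unfolding abs_mult using elim(2) by (intro mult_mono) auto
      ultimately have "\<bar>- Y1 \<omega> * lin D b (X \<omega>) + link_primitive \<psi> (lin D b (X \<omega>))\<bar> \<le> \<bar>Y1 \<omega>\<bar> * ?K + B"
        by linarith
      then have "\<bar>?H (Y1 \<omega>, X \<omega>)\<bar> \<le> exp (- B0) * (\<bar>Y1 \<omega>\<bar> * ?K + B)"
        unfolding prod.case abs_mult[of "w _"] using elim(1) w_pos[of "X \<omega>"] by (intro mult_mono) auto
      then show ?case unfolding real_norm_def by linarith
    qed
  qed measurable
  have "loss_wl \<psi> D b gb = (\<lambda>(y, t, x). t * ?H (y, x))" by (auto simp: fun_eq_iff loss_wl_def)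
  then show ?thesis using obs_treated_integral(1)[OF H i] by simp
qed

lemma wl_score_integrable: "j \<le> p \<Longrightarrow> integrable P (wl_score j)"
  using subexp_integrable[OF score_subexp(3)] scale_pos by simp

lemma loss_wl_measurable: "loss_wl \<psi> D b gb \<in> borel_measurable (obs_space D)"
  using borel_measurable_integrable[OF outcome_loss_integrable[of b]] by (simp cong: measurable_cong_sets)

text \<open>
  First-order condition at the minimizer. Differentiation under the integral is avoided: moving the target
  by \<open>\<epsilon>\<close> along a coordinate in the direction \<open>\<sigma>\<close> changes the loss pointwise by at most
  \<open>\<epsilon> \<sigma> wl_score + K \<epsilon>\<^sup>2\<close>, and the change of the mean loss is nonnegative for both signs.
\<close>

lemma wl_score_mean:
  assumes j: "j \<le> p"
  shows "(\<integral>z. wl_score j z \<partial>P) = 0"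
proof -
  interpret P: prob_space P by (rule prob_space_obs_law)
  define I where "I = (\<integral>z. wl_score j z \<partial>P)"
  define K where "K = exp (- B0) * (C1 * exp (C3 * C0)) * C0\<^sup>2"
  have K: "0 < K" using const_pos by (simp add: K_def)
  have main: "0 \<le> \<sigma> * I + K * \<epsilon>" if \<sigma>: "\<sigma> = 1 \<or> \<sigma> = -1" and \<epsilon>: "0 < \<epsilon>" "\<epsilon> \<le> 1" for \<sigma> \<epsilon> :: real
  proof -
    define b where "b i = ab i + (if i = j then \<epsilon> * \<sigma> else 0)" for i
    have lin_b: "lin D b x = lin D ab x + \<epsilon> * \<sigma> * dict D j x" for x
      unfolding lin_def b_def using j by (simp add: distrib_right sum.distrib if_distrib[of "\<lambda>c. c * _"] cong: if_cong)
    have "pop_mean D (loss_wl \<psi> D ab gb) \<le> pop_mean D (loss_wl \<psi> D b gb)"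
      using wl unfolding target_wl_def is_arg_min_linorder by blast
    then have "0 \<le> (\<integral>z. loss_wl \<psi> D b gb z - loss_wl \<psi> D ab gb z \<partial>P)"
      by (subst Bochner_Integration.integral_diff)
         (simp_all add: outcome_loss_integrable pop_mean_eq loss_wl_measurable)
    also have "\<dots> \<le> (\<integral>z. \<epsilon> * \<sigma> * wl_score j z + K * \<epsilon>\<^sup>2 \<partial>P)"
    proof (rule integral_mono_AE)
      show "integrable P (\<lambda>z. loss_wl \<psi> D b gb z - loss_wl \<psi> D ab gb z)"
        by (intro Bochner_Integration.integrable_diff outcome_loss_integrable)
      show "integrable P (\<lambda>z. \<epsilon> * \<sigma> * wl_score j z + K * \<epsilon>\<^sup>2)"
        using wl_score_integrable[OF j] by auto
      show "AE z in P. loss_wl \<psi> D b gb z - loss_wl \<psi> D ab gb z \<le> \<epsilon> * \<sigma> * wl_score j z + K * \<epsilon>\<^sup>2"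
        using obs_regular
      proof eventually_elim
        case (elim z)
        obtain y t x where z: "z = (y, t, x)" by (cases z) auto
        let ?h = "lin D ab x" and ?d = "\<epsilon> * \<sigma> * dict D j x"
        have t: "t = 0 \<or> t = 1" and f: "\<bar>dict D j x\<bar> \<le> C0" and wb: "w x \<le> exp (- B0)" and c: "\<psi>2 ?h \<le> C1"
          using elim j by (auto simp: z)
        have "\<bar>?d\<bar> = \<epsilon> * \<bar>dict D j x\<bar>" using \<sigma> \<epsilon> by (auto simp: abs_mult)
        also have "\<dots> \<le> \<epsilon> * C0" using f \<epsilon> by (intro mult_left_mono) auto
        finally have d: "\<bar>?d\<bar> \<le> \<epsilon> * C0" .
        also have "\<dots> \<le> 1 * C0" using \<epsilon> const_pos by (intro mult_right_mono) auto
        finally have d1: "\<bar>?d\<bar> \<le> C0" by simp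
        have "?d * (\<psi> (?h + ?d) - \<psi> ?h) \<le> \<bar>?d\<bar> * \<bar>\<psi> (?h + ?d) - \<psi> ?h\<bar>"
          by (metis abs_ge_self abs_mult)
        also have "\<dots> \<le> \<bar>?d\<bar> * (\<psi>2 ?h * exp (C3 * \<bar>?d\<bar>) * \<bar>?d\<bar>)"
          by (intro mult_left_mono link_diff) auto
        also have "\<dots> = (\<psi>2 ?h * exp (C3 * \<bar>?d\<bar>)) * \<bar>?d\<bar>\<^sup>2" by (simp add: power2_eq_square)
        also have "\<dots> \<le> (C1 * exp (C3 * C0)) * (\<epsilon> * C0)\<^sup>2"
          using c d d1 const_pos link_curv_nonneg
          by (intro mult_mono power_mono) (auto intro!: mult_left_mono)
        finally have A: "?d * (\<psi> (?h + ?d) - \<psi> ?h) \<le> (C1 * exp (C3 * C0)) * (\<epsilon> * C0)\<^sup>2" .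
        have "w x * (?d * (\<psi> (?h + ?d) - \<psi> ?h)) \<le> w x * ((C1 * exp (C3 * C0)) * (\<epsilon> * C0)\<^sup>2)"
          using A w_pos[of x] by (intro mult_left_mono) auto
        also have "\<dots> \<le> exp (- B0) * ((C1 * exp (C3 * C0)) * (\<epsilon> * C0)\<^sup>2)"
          using wb const_pos by (intro mult_right_mono) auto
        also have "\<dots> = K * \<epsilon>\<^sup>2" by (simp add: K_def power_mult_distrib)
        finally have B: "w x * (?d * (\<psi> (?h + ?d) - \<psi> ?h)) \<le> K * \<epsilon>\<^sup>2" .
        have "w x * (link_primitive \<psi> (?h + ?d) - link_primitive \<psi> ?h) \<le> w x * (?d * \<psi> (?h + ?d))"
          using link_primitive_convex[of ?h ?d] w_pos[of x] by (intro mult_left_mono) auto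
        then have C: "w x * (link_primitive \<psi> (?h + ?d) - link_primitive \<psi> ?h) - w x * y * ?d
            \<le> ?d * (w x * (m x - y)) + K * \<epsilon>\<^sup>2"
          using B by (simp add: algebra_simps)
        have "0 \<le> K * \<epsilon>\<^sup>2" using K by simp
        then show ?case using t C
          unfolding z loss_wl_def wl_score_def prod.case lin_b by (auto simp: algebra_simps)
      qed
    qed
    also have "\<dots> = \<epsilon> * \<sigma> * I + K * \<epsilon>\<^sup>2"
      using wl_score_integrable[OF j] P.prob_space[unfolded space_P] by (simp add: I_def)
    also have "\<dots> = \<epsilon> * (\<sigma> * I + K * \<epsilon>)" by (simp add: power2_eq_square algebra_simps)
    finally show ?thesis using \<epsilon> by (simp add: zero_le_mult_iff)
  qed
  have nn: "0 \<le> \<sigma> * I" if \<sigma>: "\<sigma> = 1 \<or> \<sigma> = -1" for \<sigma> :: real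
  proof (rule ccontr)
    assume neg: "\<not> 0 \<le> \<sigma> * I"
    define \<epsilon> where "\<epsilon> = min 1 (- (\<sigma> * I) / (2 * K))"
    have "0 < \<epsilon>" "\<epsilon> \<le> 1" using neg K by (auto simp: \<epsilon>_def divide_neg_pos)
    moreover have "K * \<epsilon> \<le> K * (- (\<sigma> * I) / (2 * K))" using K by (intro mult_left_mono) (auto simp: \<epsilon>_def)
    then have "K * \<epsilon> \<le> - (\<sigma> * I) / 2" using K by simp
    ultimately show False using main[OF \<sigma>, of \<epsilon>] neg by linarith
  qed
  show ?thesis using nn[of 1] nn[of "-1"] by (simp add: I_def)
qed

lemma cal_score_mean:
  assumes j: "j \<le> p"
  shows "(\<integral>z. cal_score j z \<partial>P) = 0" "(\<integral>z. cal_score_curv j z \<partial>P) = 0"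
proof -
  have jb: "AE \<omega> in M. \<bar>dict D j (X \<omega>)\<bar> \<le> C0" using dict_bound by eventually_elim (use j in auto)
  show "(\<integral>z. cal_score j z \<partial>P) = 0"
    unfolding cal_score_def by (rule score_mean[OF dict_measurable[OF j] jb])
  note [measurable] = dict_measurable[OF j]
  have "AE \<omega> in M. \<bar>\<psi>2 (lin D ab (X \<omega>)) * dict D j (X \<omega>)\<bar> \<le> C1 * C0"
    using jb curv_le
  proof eventually_elim
    case (elim \<omega>)
    then show ?case unfolding abs_mult using link_curv_nonneg const_pos by (intro mult_mono) auto
  qed
  then have "(\<integral>z. (case z of (y, t, x) \<Rightarrow> (- t * w x + (1 - t)) * (\<psi>2 (lin D ab x) * dict D j x)) \<partial>P) = 0"
    by (intro score_mean) measurable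
  then show "(\<integral>z. cal_score_curv j z \<partial>P) = 0"
    unfolding cal_score_curv_def by (simp add: mult.assoc)
qed

end

section \<open>Gram forms and the influence function\<close>

context regular_population
begin

abbreviation "Sig \<equiv> Sigma_pop D gb"

lemma gram_measurable_obs: "j \<le> p \<Longrightarrow> k \<le> p \<Longrightarrow> gram D gb j k \<in> borel_measurable (obs_space D)"
  using score_measurable(6) by (simp cong: measurable_cong_sets)

lemma Sigma_pop_eq: "j \<le> p \<Longrightarrow> k \<le> p \<Longrightarrow> Sig j k = (\<integral>z. gram D gb j k z \<partial>P)"
  by (simp add: Sigma_pop_def pop_mean_eq gram_measurable_obs)

lemma Sigma_pop_sym: "Sig j k = Sig k j"
  by (simp add: Sigma_pop_def gram_def mult_ac)

text \<open>
  Calibration weights match the second moments of the dictionary among treated and untreated.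
\<close>

lemma gram_ctl_integral:
  assumes j: "j \<le> p" and k: "k \<le> p"
  shows "(\<integral>z. gram_ctl j k z \<partial>P) = Sig j k"
proof -
  note [measurable] = dict_measurable[OF j] dict_measurable[OF k]
  have "AE \<omega> in M. \<bar>dict D j (X \<omega>) * dict D k (X \<omega>)\<bar> \<le> C0 * C0"
    using dict_bound by eventually_elim (use j k const_pos in \<open>auto simp: abs_mult intro!: mult_mono\<close>)
  from balance_integral(3)[OF _ this]
  have "(\<integral>z. (case z of (y, t, x) \<Rightarrow> (1 - t) * (dict D j x * dict D k x)) \<partial>P)
      = (\<integral>z. (case z of (y, t, x) \<Rightarrow> t * w x * (dict D j x * dict D k x)) \<partial>P)" by measurable
  then show ?thesis
    using Sigma_pop_eq[OF j k] by (simp add: gram_ctl_def gram_def mult.assoc)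
qed

lemma qform_integral:
  assumes "\<And>j k. j \<le> p \<Longrightarrow> k \<le> p \<Longrightarrow> integrable P (g j k)"
  shows "integrable P (\<lambda>z. qform p (\<lambda>j k. g j k z) b b)"
    and "(\<integral>z. qform p (\<lambda>j k. g j k z) b b \<partial>P) = qform p (\<lambda>j k. \<integral>z. g j k z \<partial>P) b b"
proof -
  show "integrable P (\<lambda>z. qform p (\<lambda>j k. g j k z) b b)"
    unfolding qform_def using assms
    by (intro Bochner_Integration.integrable_sum integrable_mult_left integrable_mult_right) auto
  have "(\<integral>z. (\<Sum>j\<le>p. \<Sum>k\<le>p. b j * g j k z * b k) \<partial>P) = (\<Sum>j\<le>p. \<integral>z. (\<Sum>k\<le>p. b j * g j k z * b k) \<partial>P)"
    using assms by (intro Bochner_Integration.integral_sum Bochner_Integration.integrable_sum integrable_mult_left integrable_mult_right) auto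
  also have "\<dots> = (\<Sum>j\<le>p. \<Sum>k\<le>p. \<integral>z. b j * g j k z * b k \<partial>P)"
    using assms by (intro sum.cong refl Bochner_Integration.integral_sum integrable_mult_left integrable_mult_right) auto
  finally show "(\<integral>z. qform p (\<lambda>j k. g j k z) b b \<partial>P) = qform p (\<lambda>j k. \<integral>z. g j k z \<partial>P) b b"
    unfolding qform_def by simp
qed

lemma qform_dict:
  "qform p (\<lambda>j k. a * dict D j x * dict D k x) b b = a * (lin D b x)\<^sup>2"
proof -
  have "a * (lin D b x)\<^sup>2 = (\<Sum>j\<le>p. \<Sum>k\<le>p. a * ((b j * dict D j x) * (b k * dict D k x)))"
    unfolding lin_def power2_eq_square sum_product by (simp only: sum_distrib_left)
  then show ?thesis unfolding qform_def by (simp only: mult_ac)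
qed

lemma qform_gram: "qform p (\<lambda>j k. gram D gb j k (y, t, x)) b b = t * w x * (lin D b x)\<^sup>2"
  and qform_gram_ctl: "qform p (\<lambda>j k. gram_ctl j k (y, t, x)) b b = (1 - t) * (lin D b x)\<^sup>2"
  and qform_gram_res: "qform p (\<lambda>j k. gram_res j k (y, t, x)) b b = t * w x * (y - m x)\<^sup>2 * (lin D b x)\<^sup>2"
  using qform_dict[of "t * w x" x b] qform_dict[of "1 - t" x b] qform_dict[of "t * w x * (y - m x)\<^sup>2" x b]
  by (simp_all add: gram_def gram_ctl_def gram_res_def)

lemma gram_integrable:
  assumes "j \<le> p" "k \<le> p"
  shows "integrable P (gram D gb j k)" "integrable P (gram_ctl j k)" "integrable P (gram_res j k)"
  using subexp_integrable[OF score_subexp(6)[OF assms]] subexp_integrable[OF score_subexp(4)[OF assms]]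
    subexp_integrable[OF score_subexp(5)[OF assms]] scale_pos by simp_all

lemma lin_square_bound: "AE \<omega> in M. \<bar>(lin D b (X \<omega>))\<^sup>2\<bar> \<le> (\<Sum>j\<le>p. \<bar>b j\<bar> * C0)\<^sup>2"
  using lin_bound[of b] by eventually_elim (simp add: abs_le_square_iff[symmetric])

lemma qform_Sigma:
  "qform p Sig b b = (\<integral>z. (case z of (y, t, x) \<Rightarrow> t * w x * (lin D b x)\<^sup>2) \<partial>P)"
proof -
  have "qform p Sig b b = qform p (\<lambda>j k. \<integral>z. gram D gb j k z \<partial>P) b b"
    unfolding qform_def by (intro sum.cong refl) (simp add: Sigma_pop_eq)
  also have "\<dots> = (\<integral>z. qform p (\<lambda>j k. gram D gb j k z) b b \<partial>P)"
    using gram_integrable by (intro qform_integral(2)[symmetric])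
  also have "\<dots> = (\<integral>z. (case z of (y, t, x) \<Rightarrow> t * w x * (lin D b x)\<^sup>2) \<partial>P)"
    by (intro Bochner_Integration.integral_cong refl) (auto simp: qform_gram split: prod.splits)
  finally show ?thesis .
qed

lemma qform_Sigma_nonneg: "0 \<le> qform p Sig b b"
  unfolding qform_Sigma
proof (rule integral_nonneg_AE, use AE_obs_law_trt in eventually_elim)
  case (elim z)
  then show ?case by (auto simp: less_imp_le[OF w_pos] split: prod.splits)
qed

lemma qform_gram_res_le:
  "qform p (\<lambda>j k. \<integral>z. gram_res j k z \<partial>P) b b \<le> D1\<^sup>2 * qform p Sig b b"
proof -
  have "qform p (\<lambda>j k. \<integral>z. gram_res j k z \<partial>P) b b = (\<integral>z. qform p (\<lambda>j k. gram_res j k z) b b \<partial>P)"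
    using gram_integrable by (intro qform_integral(2)[symmetric])
  also have "\<dots> = (\<integral>z. (case z of (y, t, x) \<Rightarrow> t * w x * (y - m x)\<^sup>2 * (lin D b x)\<^sup>2) \<partial>P)"
    by (intro Bochner_Integration.integral_cong refl) (auto simp: qform_gram_res split: prod.splits)
  also have "\<dots> \<le> D1\<^sup>2 * (\<integral>z. (case z of (y, t, x) \<Rightarrow> t * w x * (lin D b x)\<^sup>2) \<partial>P)"
    by (rule residual_square_weighted(2)[OF _ _ lin_square_bound]) auto
  finally show ?thesis unfolding qform_Sigma .
qed

abbreviation "Cq \<equiv> (1 + exp (- B0)) * (1 + D1\<^sup>2)"

lemma sum_cal_score: "(\<Sum>j\<le>p. b j * cal_score j (y, t, x)) = (- t * w x + (1 - t)) * lin D b x"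
  and sum_wl_score: "(\<Sum>j\<le>p. b j * wl_score j (y, t, x)) = t * w x * (m x - y) * lin D b x"
  and sum_cal_score_curv: "(\<Sum>j\<le>p. b j * cal_score_curv j (y, t, x)) = (- t * w x + (1 - t)) * \<psi>2 (lin D ab x) * lin D b x"
  unfolding cal_score_def wl_score_def cal_score_curv_def lin_def sum_distrib_left prod.case
  by (intro sum.cong refl; simp add: mult_ac)+

lemma score_sum_measurable:
  "(\<lambda>z. \<Sum>j\<le>p. b j * cal_score j z) \<in> borel_measurable P" "(\<lambda>z. \<Sum>j\<le>p. b j * wl_score j z) \<in> borel_measurable P"
  using score_measurable by (auto intro!: borel_measurable_sum borel_measurable_times)

text \<open>
  These two variance bounds are what \<open>mahalanobis_noise\<close> asks for: the noise in a direction is measured by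
  the same Gram form that occurs in the compatibility condition.
\<close>

lemma cal_score_variance:
  shows "integrable P (\<lambda>z. (\<Sum>j\<le>p. b j * cal_score j z)\<^sup>2)"
    and "(\<integral>z. (\<Sum>j\<le>p. b j * cal_score j z)\<^sup>2 \<partial>P) \<le> Cq * qform p Sig b b"
proof -
  note bal = balance_integral[OF _ lin_square_bound[of b]]
  let ?u = "\<lambda>z. exp (- B0) * (case z of (y, t, x) \<Rightarrow> t * w x * (lin D b x)\<^sup>2) + (case z of (y, t, x) \<Rightarrow> (1 - t) * (lin D b x)\<^sup>2)"
  have u: "integrable P ?u"
    using bal(1,2) by (intro Bochner_Integration.integrable_add integrable_mult_right) measurable
  have le: "AE z in P. (\<Sum>j\<le>p. b j * cal_score j z)\<^sup>2 \<le> ?u z"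
    using obs_regular
  proof eventually_elim
    case (elim z)
    obtain y t x where z: "z = (y, t, x)" by (cases z) auto
    have t: "t = 0 \<or> t = 1" and wb: "w x \<le> exp (- B0)" using elim by (auto simp: z)
    have "w x * (w x * (lin D b x)\<^sup>2) \<le> exp (- B0) * (w x * (lin D b x)\<^sup>2)"
      using wb w_pos[of x] by (intro mult_right_mono) auto
    then show ?case using t unfolding z sum_cal_score by (auto simp: power_mult_distrib power2_eq_square mult_ac)
  qed
  show int: "integrable P (\<lambda>z. (\<Sum>j\<le>p. b j * cal_score j z)\<^sup>2)"
    by (rule Bochner_Integration.integrable_bound[OF u])
       (use score_sum_measurable le in \<open>auto elim!: eventually_mono\<close>)
  have "(\<integral>z. (\<Sum>j\<le>p. b j * cal_score j z)\<^sup>2 \<partial>P) \<le> (\<integral>z. ?u z \<partial>P)"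
    by (rule integral_mono_AE[OF int u le])
  also have "\<dots> = (1 + exp (- B0)) * qform p Sig b b"
    unfolding qform_Sigma using bal
    by (subst Bochner_Integration.integral_add) (auto simp: algebra_simps)
  also have "\<dots> \<le> (1 + exp (- B0)) * (1 + D1\<^sup>2) * qform p Sig b b"
    using qform_Sigma_nonneg[of b] by (intro mult_right_mono) (auto simp: algebra_simps)
  finally show "(\<integral>z. (\<Sum>j\<le>p. b j * cal_score j z)\<^sup>2 \<partial>P) \<le> Cq * qform p Sig b b" .
qed

lemma wl_score_variance:
  shows "integrable P (\<lambda>z. (\<Sum>j\<le>p. b j * wl_score j z)\<^sup>2)"
    and "(\<integral>z. (\<Sum>j\<le>p. b j * wl_score j z)\<^sup>2 \<partial>P) \<le> Cq * qform p Sig b b"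
proof -
  have k: "(\<lambda>x. (lin D b x)\<^sup>2) \<in> borel_measurable (cov_space D)" by measurable
  note res = residual_square_weighted[OF k _ lin_square_bound[of b], simplified]
  let ?u = "\<lambda>z. exp (- B0) * (case z of (y, t, x) \<Rightarrow> t * w x * (y - m x)\<^sup>2 * (lin D b x)\<^sup>2)"
  have u: "integrable P ?u" using res(1) by (intro integrable_mult_right)
  have le: "AE z in P. (\<Sum>j\<le>p. b j * wl_score j z)\<^sup>2 \<le> ?u z"
    using obs_regular
  proof eventually_elim
    case (elim z)
    obtain y t x where z: "z = (y, t, x)" by (cases z) auto
    have t: "t = 0 \<or> t = 1" and wb: "w x \<le> exp (- B0)" using elim by (auto simp: z)
    have "w x * (w x * ((y - m x)\<^sup>2 * (lin D b x)\<^sup>2)) \<le> exp (- B0) * (w x * ((y - m x)\<^sup>2 * (lin D b x)\<^sup>2))"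
      using wb w_pos[of x] by (intro mult_right_mono) auto
    then show ?case using t unfolding z sum_wl_score power_mult_distrib power2_commute[of "m x"]
      by (auto simp: power2_eq_square[of "w x"] mult.assoc)
  qed
  show int: "integrable P (\<lambda>z. (\<Sum>j\<le>p. b j * wl_score j z)\<^sup>2)"
    by (rule Bochner_Integration.integrable_bound[OF u])
       (use score_sum_measurable le in \<open>auto elim!: eventually_mono\<close>)
  have "(\<integral>z. (\<Sum>j\<le>p. b j * wl_score j z)\<^sup>2 \<partial>P) \<le> (\<integral>z. ?u z \<partial>P)"
    by (rule integral_mono_AE[OF int u le])
  also have "\<dots> \<le> exp (- B0) * (D1\<^sup>2 * qform p Sig b b)"
    unfolding qform_Sigma using res(2) by simp
  also have "\<dots> \<le> Cq * qform p Sig b b"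
    unfolding mult.assoc[symmetric] using qform_Sigma_nonneg[of b]
    by (intro mult_right_mono mult_mono) auto
  finally show "(\<integral>z. (\<Sum>j\<le>p. b j * wl_score j z)\<^sup>2 \<partial>P) \<le> Cq * qform p Sig b b" .
qed

abbreviation "\<phi> \<equiv> fitted_aipw \<psi> D gb ab"

lemma aipw_eq: "fitted_aipw \<psi> D \<gamma> \<alpha> (y, t, x) = \<psi> (lin D \<alpha> x) + t * (1 + wt D \<gamma> x) * (y - \<psi> (lin D \<alpha> x))"
proof -
  have "1 + exp (- lin D \<gamma> x) \<noteq> 0" by (metis add_pos_pos exp_gt_zero less_irrefl zero_less_one)
  then show ?thesis by (simp add: aipw_def ps_def wt_def divide_inverse algebra_simps)
qed

lemma phi_measurable: "\<phi> \<in> borel_measurable P"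
proof -
  have "\<phi> = (\<lambda>(y, t, x). m x + t * (1 + w x) * (y - m x))" by (auto simp: fun_eq_iff aipw_eq)
  then show ?thesis by (simp add: obs_space_def cong: measurable_cong_sets)
qed

lemma phi_bound:
  "AE \<omega> in M. \<bar>\<phi> (observe D \<omega>)\<bar> \<le> \<bar>Y1 \<omega>\<bar> + (1 + exp (- B0)) * \<bar>Y1 \<omega> - m (X \<omega>)\<bar>"
  using w_bound AE_space
proof eventually_elim
  case (elim \<omega>)
  let ?e = "Y1 \<omega> - m (X \<omega>)"

  show ?case
  proof (cases "T \<omega> = 0")
    case True
    then have "\<phi> (observe D \<omega>) = Y1 \<omega> - ?e" by (simp add: observe_def aipw_eq)
    then have "\<bar>\<phi> (observe D \<omega>)\<bar> \<le> \<bar>Y1 \<omega>\<bar> + \<bar>?e\<bar>" by (simp only: abs_triangle_ineq4)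
    also have "\<bar>?e\<bar> \<le> (1 + exp (- B0)) * \<bar>?e\<bar>"
      using mult_right_mono[of 1 "1 + exp (- B0)" "\<bar>?e\<bar>"] by simp
    finally show ?thesis by simp
  next
    case False
    then have "\<phi> (observe D \<omega>) = Y1 \<omega> + w (X \<omega>) * ?e"
      using T_cases[OF elim(2)] by (simp add: observe_def aipw_eq outcome_def algebra_simps)
    also have "\<bar>\<dots>\<bar> \<le> \<bar>Y1 \<omega>\<bar> + w (X \<omega>) * \<bar>?e\<bar>"
      using w_pos[of "X \<omega>"] by (intro order_trans[OF abs_triangle_ineq]) (simp add: abs_mult)
    also have "w (X \<omega>) * \<bar>?e\<bar> \<le> (1 + exp (- B0)) * \<bar>?e\<bar>"
      using elim(1) by (intro mult_right_mono) auto
    finally show ?thesis by simp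
  qed
qed

text \<open>
  The estimating function has the right mean as soon as the propensity score is correct, because
  \<open>\<pi> (1 + w) = 1\<close>; the outcome regression cancels.
\<close>

lemma phi_mean:
  shows "integrable P \<phi>" "(\<integral>z. \<phi> z \<partial>P) = mu1 D"
proof -
  obtain B where B: "AE \<omega> in M. \<bar>m (X \<omega>)\<bar> \<le> B" using link_bound by blast
  have mi: "integrable M (\<lambda>\<omega>. m (X \<omega>))" by (rule bounded_integrable[OF _ B]) measurable
  have Yi: "integrable M Y1" using model by (auto simp: population_model_def)
  let ?H = "\<lambda>(y, x). (1 + w x) * (y - m x)"
  have H: "?H \<in> borel_measurable (borel \<Otimes>\<^sub>M cov_space D)" by measurable
  have Hi: "integrable M (\<lambda>\<omega>. ?H (Y1 \<omega>, X \<omega>))"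
  proof (rule Bochner_Integration.integrable_bound)
    show "integrable M (\<lambda>\<omega>. (1 + exp (- B0)) * (\<bar>Y1 \<omega>\<bar> + \<bar>m (X \<omega>)\<bar>))" using mi Yi by auto
    show "AE \<omega> in M. norm (?H (Y1 \<omega>, X \<omega>)) \<le> norm ((1 + exp (- B0)) * (\<bar>Y1 \<omega>\<bar> + \<bar>m (X \<omega>)\<bar>))"
      using w_bound
    proof eventually_elim
      case (elim \<omega>)
      then have "\<bar>1 + w (X \<omega>)\<bar> * \<bar>Y1 \<omega> - m (X \<omega>)\<bar> \<le> (1 + exp (- B0)) * (\<bar>Y1 \<omega>\<bar> + \<bar>m (X \<omega>)\<bar>)"
        using w_pos[of "X \<omega>"] by (intro mult_mono) auto
      then show ?case by (simp add: abs_mult)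
    qed
  qed measurable
  note tr = obs_treated_integral[OF H Hi]
  have mm: "(\<lambda>z. m (snd (snd z))) \<in> borel_measurable (obs_space D)"
    unfolding obs_space_def by measurable
  have mP: "integrable P (\<lambda>z. m (snd (snd z)))" "(\<integral>z. m (snd (snd z)) \<partial>P) = (\<integral>\<omega>. m (X \<omega>) \<partial>M)"
    using obs_integral[OF mm] mi by (simp_all add: observe_def)
  have eq: "\<phi> = (\<lambda>z. m (snd (snd z)) + (case z of (y, t, x) \<Rightarrow> t * ?H (y, x)))"
    by (auto simp: fun_eq_iff aipw_eq mult.assoc)
  show "integrable P \<phi>" unfolding eq by (intro Bochner_Integration.integrable_add mP tr)
  have "(\<integral>z. \<phi> z \<partial>P) = (\<integral>\<omega>. m (X \<omega>) \<partial>M) + (\<integral>\<omega>. true_ps D (X \<omega>) * ?H (Y1 \<omega>, X \<omega>) \<partial>M)"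
    unfolding eq by (subst Bochner_Integration.integral_add[OF mP(1) tr(1)]) (simp only: mP(2) tr(2))
  also have "(\<integral>\<omega>. true_ps D (X \<omega>) * ?H (Y1 \<omega>, X \<omega>) \<partial>M) = (\<integral>\<omega>. Y1 \<omega> - m (X \<omega>) \<partial>M)"
  proof (rule integral_cong_AE)
    show "AE \<omega> in M. true_ps D (X \<omega>) * ?H (Y1 \<omega>, X \<omega>) = Y1 \<omega> - m (X \<omega>)"
      using ps_w
    proof eventually_elim
      case (elim \<omega>)
      then have "true_ps D (X \<omega>) * (1 + w (X \<omega>)) = 1" by (simp add: distrib_left)
      then show ?case by (simp add: mult.assoc[symmetric])
    qed
  qed measurable
  finally show "(\<integral>z. \<phi> z \<partial>P) = mu1 D" using mi Yi by (simp add: mu1_def)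
qed

lemma asy_var_eq: "asy_var \<psi> D gb ab = (\<integral>z. (\<phi> z - mu1 D)\<^sup>2 \<partial>P)"
proof -
  have phim: "\<phi> \<in> borel_measurable (obs_space D)" using phi_measurable by (simp cong: measurable_cong_sets)
  have "expectation (\<lambda>\<omega>. \<phi> (observe D \<omega>)) = mu1 D"
    using phi_mean(2) obs_integral(1)[OF phim] by simp
  then show ?thesis
    unfolding asy_var_def using phim by (subst obs_integral(1)) auto
qed

end

section \<open>The event on which all averages are close to their means\<close>

lemma exp_neg_mult_ln:
  assumes "0 < x"
  shows "exp (- (real m * ln x)) = (1 / x) ^ m"
  using assms by (simp add: exp_minus exp_of_nat_mult power_one_over inverse_eq_divide)

lemma abs_le_square_imp: "x\<^sup>2 \<le> y\<^sup>2 \<Longrightarrow> 0 \<le> y \<Longrightarrow> \<bar>x\<bar> \<le> (y :: real)"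
  using abs_le_square_iff[of x y] by simp

text \<open>
  The first term comes from the union bounds, the second from \<open>mahalanobis_noise\<close>. The level grows with \<open>k\<close>,
  that is, with the confidence \<open>1 - 12 / 2^k\<close>; it enters the rates but not the tuning parameters.
\<close>

definition noise_level :: "real \<Rightarrow> real \<Rightarrow> real \<Rightarrow> real \<Rightarrow> real \<Rightarrow> nat \<Rightarrow> real" where
  "noise_level C0 B0 D0 D1 C1 k =
     moment_scale C0 B0 D0 C1 * sqrt (8 * moment_bound D0 D1 * real (2 + k)) + sqrt ((1 + exp (- B0)) * (1 + D1\<^sup>2)) * 2 ^ k"

locale regular_sample = regular_population D gb ab \<psi> \<psi>2 C0 B0 D0 D1 C1 C2 C3
  for D :: "('a, 'x) population" and gb ab \<psi> \<psi>2 C0 B0 D0 D1 C1 C2 C3 +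
  fixes n :: nat and Q :: "'w measure" and Z :: "nat \<Rightarrow> 'w \<Rightarrow> 'x obs"
  assumes sample: "iid_sample D n Q Z" and n_pos: "0 < n"
begin

sublocale S: iid_obs Q P Z n
proof -
  interpret Q: prob_space Q using sample by (simp add: iid_sample_def)
  have "Q.indep_vars (\<lambda>_. P) Z {..<n}"
    using sample unfolding iid_sample_def Q.indep_vars_def2 by (simp cong: measurable_cong_sets)
  moreover have "distr Q P (Z i) = P" if "i < n" for i
  proof -
    have "distr Q P (Z i) = distr Q (obs_space D) (Z i)" by (rule distr_cong) simp_all
    also have "\<dots> = P" using sample that by (simp add: iid_sample_def obs_law_def)
    finally show ?thesis .
  qed
  ultimately show "iid_obs Q P Z n" by unfold_locales (use n_pos in auto)
qed

definition L :: real where "L = sqrt (2 * ln (1 + real p) / real n)"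

lemma p_ge_1: "1 \<le> p" using model by (simp add: population_model_def)

lemma ln_p_ge: "1 \<le> 2 * ln (1 + real p)"
proof -
  have "ln 2 \<le> ln (1 + real p)" using p_ge_1 by simp
  with ln2_ge_two_thirds show ?thesis by linarith
qed

lemma L_pos: "0 < L" and L_square: "L\<^sup>2 = 2 * ln (1 + real p) / n" and inv_n_le: "1 / real n \<le> L\<^sup>2"
proof -
  show "0 < L" unfolding L_def using n_pos ln_p_ge
    by (intro real_sqrt_gt_zero divide_pos_pos) linarith+
  show sq: "L\<^sup>2 = 2 * ln (1 + real p) / n" unfolding L_def using ln_p_ge by simp
  show "1 / real n \<le> L\<^sup>2" unfolding sq using ln_p_ge by (intro divide_right_mono) auto
qed

text \<open>
  Bernstein's bound over \<open>(1 + p)^d\<close> averages with failure probability \<open>2 / (1 + p)^k\<close> costs a deviation of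
  \<open>sqrt ((d + k) log (1 + p) / n)\<close>, a fixed multiple of \<open>L\<close>.
\<close>

lemma deviation_event:
  assumes J: "finite J" "real (card J) \<le> (1 + real p) ^ d" and g: "\<And>j. j \<in> J \<Longrightarrow> subexp P v0 c0 (g j)"
    and mL: "real (d + k) * L\<^sup>2 \<le> 2" and dk: "0 < d + k"
  shows "\<exists>E\<in>sets Q. 1 - 2 * (1 / (1 + real p)) ^ k \<le> measure Q E \<and>
    (\<forall>\<omega>\<in>E. \<forall>j\<in>J. \<bar>S.mean (g j) \<omega> - (\<integral>z. g j z \<partial>P)\<bar> \<le> v0 * sqrt (8 * c0 * real (d + k)) * L)"
proof -
  define q where "q = real (d + k) * ln (1 + real p)"
  have "0 < ln (1 + real p)" using ln_p_ge by linarith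
  then have q: "0 < q" using dk unfolding q_def by (intro mult_pos_pos) auto
  have "q = real (d + k) * L\<^sup>2 * n / 2" using n_pos by (simp add: q_def L_square)
  also have "\<dots> \<le> 2 * real n / 2" by (rule divide_right_mono[OF mult_right_mono[OF mL]]) simp_all
  also have "\<dots> \<le> c0 * n" using scale_pos(3) mult_right_mono[of 1 c0 n] by simp
  finally have q2: "q \<le> c0 * n" .
  have e: "exp (- q) = (1 / (1 + real p)) ^ (d + k)" unfolding q_def by (rule exp_neg_mult_ln) simp
  have "2 * (1 + real p) ^ d * exp (- q) = 2 * (1 / (1 + real p)) ^ k"
    unfolding e by (simp add: power_add power_one_over)
  moreover have "v0 * sqrt (16 * c0 * q / n) = v0 * sqrt (8 * c0 * real (d + k)) * L"
  proof -
    have "16 * c0 * q / n = (8 * c0 * real (d + k)) * L\<^sup>2" unfolding L_square q_def by simp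
    then have "sqrt (16 * c0 * q / n) = sqrt (8 * c0 * real (d + k)) * L"
      using L_pos by (simp add: real_sqrt_mult)
    then show ?thesis by simp
  qed
  moreover have "\<exists>E\<in>sets Q. 1 - 2 * (1 + real p) ^ d * exp (- q) \<le> measure Q E \<and>
    (\<forall>\<omega>\<in>E. \<forall>j\<in>J. \<bar>S.mean (g j) \<omega> - (\<integral>z. g j z \<partial>P)\<bar> \<le> v0 * sqrt (16 * c0 * q / n))"
    by (rule S.bernstein_sup[OF J g scale_pos(1,2) q q2])
  ultimately show ?thesis by (simp only:)
qed

lemma mean_sum: "S.mean (\<lambda>z. \<Sum>j\<le>p. b j * g j z) \<omega> = (\<Sum>j\<le>p. b j * S.mean (g j) \<omega>)"
proof -
  have "(\<Sum>i<n. \<Sum>j\<le>p. b j * g j (Z i \<omega>)) = (\<Sum>j\<le>p. b j * (\<Sum>i<n. g j (Z i \<omega>)))"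
    by (subst sum.swap) (simp only: sum_distrib_left)
  then show ?thesis unfolding samp_mean_def by (simp only: sum_divide_distrib[symmetric] times_divide_eq_right)
qed

text \<open>
  Either \<open>1 + p\<close> is at least \<open>2^k\<close>, and a union bound over the coordinates holds at a fixed multiple of the
  rate with the confidence required, or it is smaller, and the factor \<open>p + 1\<close> lost in \<open>mahalanobis_noise\<close> is
  bounded by \<open>2^k\<close>. The multiple \<open>a\<close> of the \<open>l1\<close> norm, which the penalty has to dominate, does not depend on
  \<open>k\<close>; only the second term does.
\<close>

lemma noise_event:
  assumes g: "\<And>j. j \<le> p \<Longrightarrow> subexp P v0 c0 (g j)" and g0: "\<And>j. j \<le> p \<Longrightarrow> (\<integral>z. g j z \<partial>P) = 0"
    and var: "\<And>b. (\<integral>z. (\<Sum>j\<le>p. b j * g j z)\<^sup>2 \<partial>P) \<le> Cq * qform p Sig b b"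
    and int: "\<And>b. integrable P (\<lambda>z. (\<Sum>j\<le>p. b j * g j z)\<^sup>2)"
    and a: "v0 * sqrt (24 * c0) \<le> a" and L: "3 * L\<^sup>2 \<le> 2"
  shows "\<exists>E\<in>sets Q. 1 - 2 * (1 / 2) ^ k \<le> measure Q E \<and>
    (\<forall>\<omega>\<in>E. \<forall>b. \<bar>\<Sum>j\<le>p. b j * S.mean (g j) \<omega>\<bar>
       \<le> a * L * (\<Sum>j\<le>p. \<bar>b j\<bar>) + sqrt Cq * 2 ^ k * L * sqrt (qform p Sig b b))"
proof (cases "2 ^ k \<le> 1 + real p")
  case True
  obtain E where E: "E \<in> sets Q" "1 - 2 * (1 / (1 + real p)) ^ 2 \<le> measure Q E"
    and dev: "\<And>\<omega> j. \<omega> \<in> E \<Longrightarrow> j \<le> p \<Longrightarrow> \<bar>S.mean (g j) \<omega> - (\<integral>z. g j z \<partial>P)\<bar> \<le> v0 * sqrt (8 * c0 * real (1 + 2)) * L"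
    using deviation_event[of "{..p}" 1 g 2] g L by auto
  have "(1 / (1 + real p)) ^ 2 \<le> (1 / (1 + real p)) ^ 1" by (rule power_decreasing) auto
  also have "\<dots> \<le> (1 / 2) ^ k" using True by (simp add: power_one_over field_simps)
  finally have pr: "1 - 2 * (1 / 2) ^ k \<le> measure Q E" using E(2) by simp
  have "\<bar>\<Sum>j\<le>p. b j * S.mean (g j) \<omega>\<bar> \<le> a * L * (\<Sum>j\<le>p. \<bar>b j\<bar>) + sqrt Cq * 2 ^ k * L * sqrt (qform p Sig b b)"
    if \<omega>: "\<omega> \<in> E" for \<omega> b
  proof -
    have "\<bar>S.mean (g j) \<omega>\<bar> \<le> a * L" if "j \<le> p" for j
    proof -
      have "\<bar>S.mean (g j) \<omega>\<bar> \<le> v0 * sqrt (24 * c0) * L" using dev[OF \<omega> that] g0[OF that] by simp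
      also have "\<dots> \<le> a * L" using a L_pos by (intro mult_right_mono) auto
      finally show ?thesis .
    qed
    then have "\<bar>\<Sum>j\<le>p. b j * S.mean (g j) \<omega>\<bar> \<le> (\<Sum>j\<le>p. \<bar>b j\<bar> * (a * L))"
      by (intro order_trans[OF sum_abs] sum_mono) (auto simp: abs_mult intro!: mult_left_mono)
    also have "\<dots> = a * L * (\<Sum>j\<le>p. \<bar>b j\<bar>)" by (simp add: sum_distrib_left mult.commute)
    finally have "\<bar>\<Sum>j\<le>p. b j * S.mean (g j) \<omega>\<bar> \<le> a * L * (\<Sum>j\<le>p. \<bar>b j\<bar>)" .
    moreover have "0 \<le> sqrt Cq * 2 ^ k * L * sqrt (qform p Sig b b)"
      using L_pos qform_Sigma_nonneg by (intro mult_nonneg_nonneg) auto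
    ultimately show ?thesis by linarith
  qed
  with E pr show ?thesis by blast
next
  case False
  have gm: "(\<lambda>z. \<Sum>j\<le>p. b j * g j z) \<in> borel_measurable P" for b
    using g by (auto intro!: borel_measurable_sum borel_measurable_times simp: subexp_def)
  have gi: "integrable P (g j)" if "j \<le> p" for j using subexp_integrable[OF g[OF that]] scale_pos by simp
  have g00: "(\<integral>z. (\<Sum>j\<le>p. b j * g j z) \<partial>P) = 0" for b
    using gi g0 by (subst Bochner_Integration.integral_sum) auto
  have C: "0 < Cq / n" using n_pos by (simp add: add_pos_nonneg)
  have "\<exists>E\<in>sets Q. 1 - (real p + 1) / 4 ^ k \<le> measure Q E \<and>
      (\<forall>\<omega>\<in>E. \<forall>b. (\<Sum>j\<le>p. b j * S.mean (g j) \<omega>)\<^sup>2 \<le> Cq / n * 4 ^ k * qform p Sig b b)"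
  proof (rule S.mahalanobis_noise[OF _ _ _ C])
    fix b
    show "integrable Q (\<lambda>\<omega>. (\<Sum>j\<le>p. b j * S.mean (g j) \<omega>)\<^sup>2)"
      using S.second_moment_mean(1)[OF gm int g00] by (simp add: mean_sum)
    have "(\<integral>\<omega>. (\<Sum>j\<le>p. b j * S.mean (g j) \<omega>)\<^sup>2 \<partial>Q) = (\<integral>z. (\<Sum>j\<le>p. b j * g j z)\<^sup>2 \<partial>P) / n"
      using S.second_moment_mean(2)[OF gm int g00] by (simp add: mean_sum)
    also have "\<dots> \<le> Cq * qform p Sig b b / n" using var by (intro divide_right_mono) auto
    finally show "(\<integral>\<omega>. (\<Sum>j\<le>p. b j * S.mean (g j) \<omega>)\<^sup>2 \<partial>Q) \<le> Cq / n * qform p Sig b b" by simp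
  next
    show "S.mean (g j) \<in> borel_measurable Q" if "j \<le> p" for j
      using g[OF that] by (intro S.mean_measurable) (simp add: subexp_def)
  qed (simp_all add: Sigma_pop_sym)
  then obtain E where E: "E \<in> sets Q" "1 - (real p + 1) / 4 ^ k \<le> measure Q E"
    and dev: "\<And>\<omega> b. \<omega> \<in> E \<Longrightarrow> (\<Sum>j\<le>p. b j * S.mean (g j) \<omega>)\<^sup>2 \<le> Cq / n * 4 ^ k * qform p Sig b b"
    by blast
  have "(real p + 1) / 4 ^ k \<le> 2 ^ k / 4 ^ k" using False by (intro divide_right_mono) auto
  also have "\<dots> = (1 / 2) ^ k" by (simp add: power_divide[symmetric])
  finally have pr: "1 - 2 * (1 / 2) ^ k \<le> measure Q E" using E(2) by (smt (verit) zero_le_power divide_nonneg_nonneg)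
  have "\<bar>\<Sum>j\<le>p. b j * S.mean (g j) \<omega>\<bar> \<le> a * L * (\<Sum>j\<le>p. \<bar>b j\<bar>) + sqrt Cq * 2 ^ k * L * sqrt (qform p Sig b b)"
    if \<omega>: "\<omega> \<in> E" for \<omega> b
  proof -
    have q: "0 \<le> qform p Sig b b" by (rule qform_Sigma_nonneg)
    have C0: "0 \<le> Cq" by (simp add: add_nonneg_nonneg)
    have "(\<Sum>j\<le>p. b j * S.mean (g j) \<omega>)\<^sup>2 \<le> (1 / n) * (Cq * 4 ^ k * qform p Sig b b)"
      using dev[OF \<omega>, of b] by simp
    also have "\<dots> \<le> L\<^sup>2 * (Cq * 4 ^ k * qform p Sig b b)"
      using inv_n_le q C0 by (intro mult_right_mono mult_nonneg_nonneg) auto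
    also have "\<dots> = (sqrt Cq * 2 ^ k * L * sqrt (qform p Sig b b))\<^sup>2"
      using q C0 by (simp add: power_mult_distrib power_mult[symmetric] mult.commute[of k 2] power_mult[of 2 2 k])
    finally have sq: "(\<Sum>j\<le>p. b j * S.mean (g j) \<omega>)\<^sup>2 \<le> (sqrt Cq * 2 ^ k * L * sqrt (qform p Sig b b))\<^sup>2" .
    have "0 \<le> sqrt Cq * 2 ^ k * L * sqrt (qform p Sig b b)"
      using L_pos q C0 by (intro mult_nonneg_nonneg) auto
    with sq have "\<bar>\<Sum>j\<le>p. b j * S.mean (g j) \<omega>\<bar> \<le> sqrt Cq * 2 ^ k * L * sqrt (qform p Sig b b)"
      by (rule abs_le_square_imp)
    moreover have "0 \<le> v0 * sqrt (24 * c0)" using scale_pos by (intro mult_nonneg_nonneg) auto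
    then have "0 \<le> a * L * (\<Sum>j\<le>p. \<bar>b j\<bar>)" using a L_pos by (intro mult_nonneg_nonneg sum_nonneg) auto
    ultimately show ?thesis by linarith
  qed
  with E pr show ?thesis by blast
qed

definition regular_obs :: "'x obs \<Rightarrow> bool" where
  "regular_obs = (\<lambda>(y, t, x). (t = 0 \<or> t = 1) \<and> (\<forall>j\<le>p. \<bar>dict D j x\<bar> \<le> C0) \<and> dict D 0 x = 1 \<and>
     w x \<le> exp (- B0) \<and> \<psi>2 (lin D ab x) \<le> C1 \<and> C2 \<le> \<psi>2 (lin D ab x))"

definition good :: "real \<Rightarrow> real \<Rightarrow> real \<Rightarrow> 'w \<Rightarrow> bool" where
  "good K a0 a1 \<omega> \<longleftrightarrow>
     (\<forall>i<n. regular_obs (Z i \<omega>)) \<and>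
     (\<forall>j\<le>p. \<forall>k\<le>p. \<bar>S.mean (gram D gb j k) \<omega> - Sig j k\<bar> \<le> K * L \<and>
        \<bar>S.mean (gram_ctl j k) \<omega> - Sig j k\<bar> \<le> K * L \<and>
        \<bar>S.mean (gram_res j k) \<omega> - (\<integral>z. gram_res j k z \<partial>P)\<bar> \<le> K * L) \<and>
     (\<forall>j\<le>p. \<bar>S.mean (cal_score_curv j) \<omega>\<bar> \<le> K * L) \<and>
     (\<forall>b. \<bar>\<Sum>j\<le>p. b j * S.mean (cal_score j) \<omega>\<bar> \<le> a0 * L * (\<Sum>j\<le>p. \<bar>b j\<bar>) + K * L * sqrt (qform p Sig b b)) \<and>
     (\<forall>b. \<bar>\<Sum>j\<le>p. b j * S.mean (wl_score j) \<omega>\<bar> \<le> a1 * L * (\<Sum>j\<le>p. \<bar>b j\<bar>) + K * L * sqrt (qform p Sig b b))"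

abbreviation "noise k \<equiv> noise_level C0 B0 D0 D1 C1 k"

lemma good_event:
  assumes a0: "v0 * sqrt (24 * c0) \<le> a0" and a1: "v0 * sqrt (24 * c0) \<le> a1" and kL: "real (3 + k) * L\<^sup>2 \<le> 2"
  shows "\<exists>E\<in>sets Q. 1 - 12 * (1 / 2) ^ k \<le> measure Q E \<and> (\<forall>\<omega>\<in>E. good (noise k) a0 a1 \<omega>)"
proof -
  let ?K = "noise k" and ?u = "v0 * sqrt (8 * c0 * real (2 + k))"
  have L0: "0 \<le> L\<^sup>2" by simp
  have kL2: "real (2 + k) * L\<^sup>2 \<le> 2" "3 * L\<^sup>2 \<le> 2"
    using order_trans[OF mult_right_mono[of "real (2 + k)" "real (3 + k)" "L\<^sup>2"] kL]
      order_trans[OF mult_right_mono[of 3 "real (3 + k)" "L\<^sup>2"] kL] by simp_all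
  have v0c: "0 \<le> ?u" using scale_pos by (intro mult_nonneg_nonneg) auto
  have Cq0: "0 \<le> sqrt Cq * 2 ^ k" by (simp add: add_nonneg_nonneg)
  have uK: "?u * L \<le> ?K * L" "sqrt Cq * 2 ^ k * L \<le> ?K * L"
    unfolding noise_level_def using v0c Cq0 L_pos by (intro mult_right_mono; simp)+
  have pk: "(1 / (1 + real p)) ^ k \<le> (1 / 2) ^ k"
    using p_ge_1 by (intro power_mono) (auto simp: field_simps)
  have cardJ: "real (card ({..p} \<times> {..p})) \<le> (1 + real p) ^ 2"
    by (simp add: card_cartesian_product power2_eq_square algebra_simps)
  have pair: "\<exists>E\<in>sets Q. 1 - 2 * (1 / 2) ^ k \<le> measure Q E \<and>
      (\<forall>\<omega>\<in>E. \<forall>j\<le>p. \<forall>l\<le>p. \<bar>S.mean (g j l) \<omega> - (\<integral>z. g j l z \<partial>P)\<bar> \<le> ?K * L)"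
    if g: "\<And>j l. j \<le> p \<Longrightarrow> l \<le> p \<Longrightarrow> subexp P v0 c0 (g j l)" for g
  proof -
    have "\<exists>E\<in>sets Q. 1 - 2 * (1 / (1 + real p)) ^ k \<le> measure Q E \<and>
        (\<forall>\<omega>\<in>E. \<forall>jl\<in>{..p} \<times> {..p}. \<bar>S.mean (case_prod g jl) \<omega> - (\<integral>z. case_prod g jl z \<partial>P)\<bar> \<le> ?u * L)"
      by (rule deviation_event[OF _ cardJ]) (use g kL2(1) in auto)
    then obtain E where E: "E \<in> sets Q" "1 - 2 * (1 / (1 + real p)) ^ k \<le> measure Q E"
      and dev: "\<forall>\<omega>\<in>E. \<forall>jl\<in>{..p} \<times> {..p}. \<bar>S.mean (case_prod g jl) \<omega> - (\<integral>z. case_prod g jl z \<partial>P)\<bar> \<le> ?u * L"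
      by blast
    have "\<bar>S.mean (g j l) \<omega> - (\<integral>z. g j l z \<partial>P)\<bar> \<le> ?K * L" if "\<omega> \<in> E" "j \<le> p" "l \<le> p" for \<omega> j l
      using bspec[OF bspec[OF dev that(1)], of "(j, l)"] that uK(1) by auto
    moreover have "1 - 2 * (1 / 2) ^ k \<le> measure Q E" using E(2) pk by linarith
    ultimately show ?thesis using E(1) by (intro bexI[of _ E] conjI ballI allI impI)
  qed
  have "\<exists>E\<in>sets Q. 1 - 2 * (1 / 2) ^ k \<le> measure Q E \<and>
      (\<forall>\<omega>\<in>E. \<forall>j\<le>p. \<forall>l\<le>p. \<bar>S.mean (gram D gb j l) \<omega> - (\<integral>z. gram D gb j l z \<partial>P)\<bar> \<le> ?K * L)"
    by (rule pair) (rule score_subexp(6))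
  then obtain E1 where E1: "E1 \<in> sets Q" "1 - 2 * (1 / 2) ^ k \<le> measure Q E1"
    and dev1: "\<And>\<omega> j l. \<omega> \<in> E1 \<Longrightarrow> j \<le> p \<Longrightarrow> l \<le> p \<Longrightarrow> \<bar>S.mean (gram D gb j l) \<omega> - (\<integral>z. gram D gb j l z \<partial>P)\<bar> \<le> ?K * L"
    by blast
  have "\<exists>E\<in>sets Q. 1 - 2 * (1 / 2) ^ k \<le> measure Q E \<and>
      (\<forall>\<omega>\<in>E. \<forall>j\<le>p. \<forall>l\<le>p. \<bar>S.mean (gram_ctl j l) \<omega> - (\<integral>z. gram_ctl j l z \<partial>P)\<bar> \<le> ?K * L)"
    by (rule pair) (rule score_subexp(4))
  then obtain E2 where E2: "E2 \<in> sets Q" "1 - 2 * (1 / 2) ^ k \<le> measure Q E2"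
    and dev2: "\<And>\<omega> j l. \<omega> \<in> E2 \<Longrightarrow> j \<le> p \<Longrightarrow> l \<le> p \<Longrightarrow> \<bar>S.mean (gram_ctl j l) \<omega> - (\<integral>z. gram_ctl j l z \<partial>P)\<bar> \<le> ?K * L"
    by blast
  have "\<exists>E\<in>sets Q. 1 - 2 * (1 / 2) ^ k \<le> measure Q E \<and>
      (\<forall>\<omega>\<in>E. \<forall>j\<le>p. \<forall>l\<le>p. \<bar>S.mean (gram_res j l) \<omega> - (\<integral>z. gram_res j l z \<partial>P)\<bar> \<le> ?K * L)"
    by (rule pair) (rule score_subexp(5))
  then obtain E3 where E3: "E3 \<in> sets Q" "1 - 2 * (1 / 2) ^ k \<le> measure Q E3"
    and dev3: "\<And>\<omega> j l. \<omega> \<in> E3 \<Longrightarrow> j \<le> p \<Longrightarrow> l \<le> p \<Longrightarrow> \<bar>S.mean (gram_res j l) \<omega> - (\<integral>z. gram_res j l z \<partial>P)\<bar> \<le> ?K * L"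
    by blast
  have "\<exists>E\<in>sets Q. 1 - 2 * (1 / 2) ^ k \<le> measure Q E \<and>
      (\<forall>\<omega>\<in>E. \<forall>j\<le>p. \<forall>l\<le>p. \<bar>S.mean (cal_score_curv j) \<omega> - (\<integral>z. cal_score_curv j z \<partial>P)\<bar> \<le> ?K * L)"
    by (rule pair) (rule score_subexp(2))
  then obtain E4 where E4: "E4 \<in> sets Q" "1 - 2 * (1 / 2) ^ k \<le> measure Q E4"
    and dev4: "\<And>\<omega> j. \<omega> \<in> E4 \<Longrightarrow> j \<le> p \<Longrightarrow> \<bar>S.mean (cal_score_curv j) \<omega> - (\<integral>z. cal_score_curv j z \<partial>P)\<bar> \<le> ?K * L"
    using p_ge_1 by blast
  have "\<exists>E\<in>sets Q. 1 - 2 * (1 / 2) ^ k \<le> measure Q E \<and>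
      (\<forall>\<omega>\<in>E. \<forall>b. \<bar>\<Sum>j\<le>p. b j * S.mean (cal_score j) \<omega>\<bar>
         \<le> a0 * L * (\<Sum>j\<le>p. \<bar>b j\<bar>) + sqrt Cq * 2 ^ k * L * sqrt (qform p Sig b b))"
    by (rule noise_event[OF score_subexp(1) cal_score_mean(1) cal_score_variance(2,1) a0 kL2(2)])
  then obtain E5 where E5: "E5 \<in> sets Q" "1 - 2 * (1 / 2) ^ k \<le> measure Q E5"
    and dev5: "\<And>\<omega> b. \<omega> \<in> E5 \<Longrightarrow> \<bar>\<Sum>j\<le>p. b j * S.mean (cal_score j) \<omega>\<bar>
       \<le> a0 * L * (\<Sum>j\<le>p. \<bar>b j\<bar>) + sqrt Cq * 2 ^ k * L * sqrt (qform p Sig b b)"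
    by blast
  have "\<exists>E\<in>sets Q. 1 - 2 * (1 / 2) ^ k \<le> measure Q E \<and>
      (\<forall>\<omega>\<in>E. \<forall>b. \<bar>\<Sum>j\<le>p. b j * S.mean (wl_score j) \<omega>\<bar>
         \<le> a1 * L * (\<Sum>j\<le>p. \<bar>b j\<bar>) + sqrt Cq * 2 ^ k * L * sqrt (qform p Sig b b))"
    by (rule noise_event[OF score_subexp(3) wl_score_mean wl_score_variance(2,1) a1 kL2(2)])
  then obtain E6 where E6: "E6 \<in> sets Q" "1 - 2 * (1 / 2) ^ k \<le> measure Q E6"
    and dev6: "\<And>\<omega> b. \<omega> \<in> E6 \<Longrightarrow> \<bar>\<Sum>j\<le>p. b j * S.mean (wl_score j) \<omega>\<bar>
       \<le> a1 * L * (\<Sum>j\<le>p. \<bar>b j\<bar>) + sqrt Cq * 2 ^ k * L * sqrt (qform p Sig b b)"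
    by blast
  have "AE \<omega> in Q. \<forall>i<n. regular_obs (Z i \<omega>)"
    using S.AE_obs[OF obs_regular] by (simp add: regular_obs_def)
  then obtain N where N: "{\<omega> \<in> space Q. \<not> (\<forall>i<n. regular_obs (Z i \<omega>))} \<subseteq> N" "N \<in> sets Q" "emeasure Q N = 0"
    by (rule AE_E)
  define E where "E = E1 \<inter> E2 \<inter> E3 \<inter> E4 \<inter> E5 \<inter> E6 - N"
  note s2 = sets.Int[OF E1(1) E2(1)]
  note s3 = sets.Int[OF s2 E3(1)]
  note s4 = sets.Int[OF s3 E4(1)]
  note s5 = sets.Int[OF s4 E5(1)]
  note s6 = sets.Int[OF s5 E6(1)]
  have E: "E \<in> sets Q" unfolding E_def by (rule sets.Diff[OF s6 N(2)])
  have inter: "measure Q A + measure Q B - 1 \<le> measure Q (A \<inter> B)" if "A \<in> sets Q" "B \<in> sets Q" for A B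
    using measure_Un3[of A Q B] S.prob_le_1[of "A \<union> B"] that S.fmeasurable_eq_sets by simp
  have "measure Q N = 0" using N by (simp add: measure_def)
  then have "measure Q E = measure Q (E1 \<inter> E2 \<inter> E3 \<inter> E4 \<inter> E5 \<inter> E6)"
    unfolding E_def by (intro measure_Diff_null_set null_setsI N(2,3) s6)
  moreover have "measure Q E1 + measure Q E2 + measure Q E3 + measure Q E4 + measure Q E5 + measure Q E6 - 5
      \<le> measure Q (E1 \<inter> E2 \<inter> E3 \<inter> E4 \<inter> E5 \<inter> E6)"
    using inter[OF E1(1) E2(1)] inter[OF s2 E3(1)] inter[OF s3 E4(1)] inter[OF s4 E5(1)] inter[OF s5 E6(1)]
    by linarith
  ultimately have pr: "1 - 12 * (1 / 2) ^ k \<le> measure Q E"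
    using E1(2) E2(2) E3(2) E4(2) E5(2) E6(2) by linarith
  have "good ?K a0 a1 \<omega>" if \<omega>: "\<omega> \<in> E" for \<omega>
  proof -
    have \<omega>s: "\<omega> \<in> E1" "\<omega> \<in> E2" "\<omega> \<in> E3" "\<omega> \<in> E4" "\<omega> \<in> E5" "\<omega> \<in> E6" "\<omega> \<notin> N" "\<omega> \<in> space Q"
      using \<omega> sets.sets_into_space[OF E1(1)] by (auto simp: E_def)
    have q: "sqrt Cq * 2 ^ k * L * sqrt (qform p Sig b b) \<le> ?K * L * sqrt (qform p Sig b b)" for b
      by (rule mult_right_mono[OF uK(2) real_sqrt_ge_zero[OF qform_Sigma_nonneg]])
    have reg: "\<forall>i<n. regular_obs (Z i \<omega>)"
    proof (rule ccontr)
      assume "\<not> (\<forall>i<n. regular_obs (Z i \<omega>))"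
      then have "\<omega> \<in> {\<omega> \<in> space Q. \<not> (\<forall>i<n. regular_obs (Z i \<omega>))}" using \<omega>s(8) by (intro CollectI conjI)
      from subsetD[OF N(1) this] \<omega>s(7) show False by contradiction
    qed
    show ?thesis
      unfolding good_def
    proof (intro conjI allI impI)
      show "regular_obs (Z i \<omega>)" if "i < n" for i using reg that by simp
      show "\<bar>S.mean (gram D gb j l) \<omega> - Sig j l\<bar> \<le> ?K * L" if "j \<le> p" "l \<le> p" for j l
        using dev1[OF \<omega>s(1) that] by (simp only: Sigma_pop_eq[OF that])
      show "\<bar>S.mean (gram_ctl j l) \<omega> - Sig j l\<bar> \<le> ?K * L" if "j \<le> p" "l \<le> p" for j l
        using dev2[OF \<omega>s(2) that] by (simp only: gram_ctl_integral[OF that])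
      show "\<bar>S.mean (gram_res j l) \<omega> - (\<integral>z. gram_res j l z \<partial>P)\<bar> \<le> ?K * L" if "j \<le> p" "l \<le> p" for j l
        by (rule dev3[OF \<omega>s(3) that])
      show "\<bar>S.mean (cal_score_curv j) \<omega>\<bar> \<le> ?K * L" if "j \<le> p" for j
        using dev4[OF \<omega>s(4) that] by (simp only: cal_score_mean(2)[OF that] diff_0_right)
      show "\<bar>\<Sum>j\<le>p. b j * S.mean (cal_score j) \<omega>\<bar> \<le> a0 * L * (\<Sum>j\<le>p. \<bar>b j\<bar>) + ?K * L * sqrt (qform p Sig b b)" for b
        by (rule order_trans[OF dev5[OF \<omega>s(5)] add_left_mono[OF q]])
      show "\<bar>\<Sum>j\<le>p. b j * S.mean (wl_score j) \<omega>\<bar> \<le> a1 * L * (\<Sum>j\<le>p. \<bar>b j\<bar>) + ?K * L * sqrt (qform p Sig b b)" for b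
        by (rule order_trans[OF dev6[OF \<omega>s(6)] add_left_mono[OF q]])
    qed
  qed
  with E pr show ?thesis by (intro bexI[of _ E] conjI ballI)
qed

end

section \<open>Sample averages, penalties and tuning parameters\<close>

text \<open>
  Only finitely many coordinates matter, so it suffices to minimize over a box, which is compact in
  the product topology. The point is that a sublevel set is bounded; for a lasso criterion this comes from
  the very argument that gives the rate.
\<close>

lemma exists_minimizer:
  fixes F :: "(nat \<Rightarrow> real) \<Rightarrow> real"
  assumes cont: "continuous_on UNIV F"
    and dep: "\<And>b b'. (\<forall>j\<le>p. b j = b' j) \<Longrightarrow> F b = F b'"
    and bdd: "\<And>b. F b \<le> F b0 \<Longrightarrow> (\<Sum>j\<le>p. \<bar>b j - b0 j\<bar>) \<le> R"
  shows "\<exists>b. minimizes F b"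
proof -
  define I where "I j = (if j \<le> p then {b0 j - R..b0 j + R} else {0})" for j
  define K where "K = PiE UNIV I"
  have R: "0 \<le> R" using bdd[of b0] by simp
  have "compactin (product_topology (\<lambda>i. euclidean) UNIV) K"
    unfolding K_def compactin_PiE by (auto simp: I_def)
  then have K: "compact K" by (simp add: euclidean_product_topology)
  define tr where "tr b j = (if j \<le> p then b j else (0::real))" for b j
  have F_tr: "F (tr b) = F b" for b by (rule dep) (simp add: tr_def)
  have tr_K: "tr b \<in> K" if "F b \<le> F b0" for b
  proof -
    have "\<bar>b j - b0 j\<bar> \<le> R" if "j \<le> p" for j
    proof -
      have "\<bar>b j - b0 j\<bar> \<le> (\<Sum>j\<le>p. \<bar>b j - b0 j\<bar>)"
        using that by (intro member_le_sum) auto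
      also have "\<dots> \<le> R" by (rule bdd) fact
      finally show ?thesis .
    qed
    then show ?thesis by (fastforce simp: K_def I_def tr_def abs_le_iff)
  qed
  have "K \<noteq> {}" using tr_K[of b0] by auto
  then obtain b where b: "b \<in> K" "\<And>b'. b' \<in> K \<Longrightarrow> F b \<le> F b'"
    using continuous_attains_inf[OF K] continuous_on_subset[OF cont] by blast
  have "F b \<le> F b'" for b'
  proof (cases "F b' \<le> F b0")
    case True
    from b(2)[OF tr_K[OF this]] show ?thesis by (simp add: F_tr)
  next
    case False
    from b(2)[OF tr_K[of b0]] False show ?thesis by (simp add: F_tr)
  qed
  then show ?thesis by (auto simp: is_arg_min_linorder)
qed

lemma qform_diff_le:
  assumes "\<And>j k. j \<le> p \<Longrightarrow> k \<le> p \<Longrightarrow> \<bar>G j k - H j k\<bar> \<le> e"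
  shows "\<bar>qform p G b b - qform p H b b\<bar> \<le> e * (\<Sum>j\<le>p. \<bar>b j\<bar>)\<^sup>2"
proof -
  have "qform p G b b - qform p H b b = (\<Sum>j\<le>p. \<Sum>k\<le>p. b j * (G j k - H j k) * b k)"
    unfolding qform_def by (simp add: sum_subtractf[symmetric] algebra_simps)
  also have "\<bar>\<dots>\<bar> \<le> (\<Sum>j\<le>p. \<Sum>k\<le>p. \<bar>b j\<bar> * e * \<bar>b k\<bar>)"
    using assms
    by (intro order_trans[OF sum_abs] sum_mono) (auto simp: abs_mult intro!: mult_right_mono mult_left_mono)
  also have "\<dots> = e * (\<Sum>j\<le>p. \<bar>b j\<bar>)\<^sup>2"
  proof -
    have "e * (\<Sum>j\<le>p. \<bar>b j\<bar>)\<^sup>2 = (\<Sum>j\<le>p. \<Sum>k\<le>p. e * (\<bar>b j\<bar> * \<bar>b k\<bar>))"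
      unfolding power2_eq_square sum_product by (simp only: sum_distrib_left)
    then show ?thesis by (simp only: mult_ac)
  qed
  finally show ?thesis .
qed

lemma samp_mean_mono: "(\<And>i. i < n \<Longrightarrow> g (z i) \<le> h (z i)) \<Longrightarrow> samp_mean n z g \<le> samp_mean n z h"
  unfolding samp_mean_def by (intro divide_right_mono sum_mono) auto

lemma samp_mean_cong: "(\<And>i. i < n \<Longrightarrow> g (z i) = h (z i)) \<Longrightarrow> samp_mean n z g = samp_mean n z h"
  unfolding samp_mean_def by (intro arg_cong2[where f=divide] sum.cong) auto

lemma samp_mean_add: "samp_mean n z (\<lambda>x. g x + h x) = samp_mean n z g + samp_mean n z h"
  and samp_mean_diff: "samp_mean n z (\<lambda>x. g x - h x) = samp_mean n z g - samp_mean n z h"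
  and samp_mean_cmult: "samp_mean n z (\<lambda>x. c * g x) = c * samp_mean n z g"
  by (simp_all add: samp_mean_def sum.distrib sum_subtractf sum_distrib_left add_divide_distrib diff_divide_distrib)

lemma samp_mean_abs: "\<bar>samp_mean n z g\<bar> \<le> samp_mean n z (\<lambda>x. \<bar>g x\<bar>)"
  unfolding samp_mean_def abs_divide by (intro order_trans[OF divide_right_mono[OF sum_abs]]) auto

lemma samp_mean_nonneg: "(\<And>i. i < n \<Longrightarrow> 0 \<le> g (z i)) \<Longrightarrow> 0 \<le> samp_mean n z g"
  unfolding samp_mean_def by (intro divide_nonneg_nonneg sum_nonneg) auto

lemma samp_mean_CS:
  assumes "\<And>i. i < n \<Longrightarrow> \<bar>g (z i)\<bar> \<le> a (z i) * b (z i)"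
  shows "\<bar>samp_mean n z g\<bar> \<le> sqrt (samp_mean n z (\<lambda>x. (a x)\<^sup>2)) * sqrt (samp_mean n z (\<lambda>x. (b x)\<^sup>2))"
proof -
  have "\<bar>\<Sum>i<n. g (z i)\<bar> \<le> (\<Sum>i<n. a (z i) * b (z i))"
    using assms by (intro order_trans[OF sum_abs] sum_mono) auto
  also have "\<dots> \<le> sqrt ((\<Sum>i<n. (a (z i))\<^sup>2) * (\<Sum>i<n. (b (z i))\<^sup>2))"
    by (rule real_le_rsqrt) (rule Cauchy_Schwarz_ineq_sum)
  finally have "\<bar>\<Sum>i<n. g (z i)\<bar> / real n \<le> sqrt (\<Sum>i<n. (a (z i))\<^sup>2) * sqrt (\<Sum>i<n. (b (z i))\<^sup>2) / real n"
    by (intro divide_right_mono) (simp_all add: real_sqrt_mult)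
  also have "\<dots> = sqrt ((\<Sum>i<n. (a (z i))\<^sup>2) / real n) * sqrt ((\<Sum>i<n. (b (z i))\<^sup>2) / real n)"
    by (simp add: real_sqrt_divide)
  finally show ?thesis by (simp add: samp_mean_def)
qed

lemma samp_mean_sum: "samp_mean n z (\<lambda>x. \<Sum>j\<in>J. g j x) = (\<Sum>j\<in>J. samp_mean n z (g j))"
  unfolding samp_mean_def by (subst sum.swap) (simp only: sum_divide_distrib)

lemma samp_mean_qform:
  "qform p (\<lambda>j k. samp_mean n z (g j k)) b b = samp_mean n z (\<lambda>x. qform p (\<lambda>j k. g j k x) b b)"
proof -
  have "qform p (\<lambda>j k. samp_mean n z (g j k)) b b = (\<Sum>j\<le>p. \<Sum>k\<le>p. samp_mean n z (\<lambda>x. (b j * b k) * g j k x))"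
    unfolding qform_def samp_mean_cmult by (simp only: mult_ac)
  also have "\<dots> = samp_mean n z (\<lambda>x. \<Sum>j\<le>p. \<Sum>k\<le>p. (b j * b k) * g j k x)"
    by (simp only: samp_mean_sum)
  finally show ?thesis unfolding qform_def by (simp only: mult_ac)
qed

lemma lin_diff: "lin D (\<lambda>j. b j - c j) x = lin D b x - lin D c x"
  by (simp add: lin_def left_diff_distrib sum_subtractf)

lemma lin_continuous: "continuous_on UNIV (\<lambda>b. lin D b x)"
  unfolding lin_def by (intro continuous_intros continuous_on_product_coordinates)

lemma penalty_continuous: "continuous_on UNIV (penalty D)"
  unfolding penalty_def[abs_def] by (intro continuous_intros continuous_on_product_coordinates)

text \<open>
  The intercept is unpenalized but belongs to \<open>supp0\<close>, where its error is counted with a favourable sign.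
\<close>

lemma penalty_diff:
  fixes b bb :: "nat \<Rightarrow> real"
  defines "\<delta> \<equiv> \<lambda>j. b j - bb j"
  shows "penalty D bb - penalty D b \<le> 2 * (\<Sum>j\<in>supp0 D bb. \<bar>\<delta> j\<bar>) - l1_norm D \<delta>"
proof -
  let ?p = "dict_dim D" and ?S = "supp0 D bb"
  have S: "?S \<subseteq> {..?p}" "finite ?S" "0 \<in> ?S" by (auto simp: supp0_def)
  have p: "{..?p} = insert 0 {1..?p}" by auto
  have "penalty D bb - penalty D b = (\<Sum>j\<in>{1..?p}. \<bar>bb j\<bar> - \<bar>b j\<bar>)"
    by (simp add: penalty_def sum_subtractf)
  also have "\<dots> \<le> (\<Sum>j\<in>{1..?p}. if j \<in> ?S then \<bar>\<delta> j\<bar> else - \<bar>\<delta> j\<bar>)"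
    by (intro sum_mono) (auto simp: \<delta>_def supp0_def)
  also have "\<dots> \<le> (\<Sum>j\<le>?p. if j \<in> ?S then \<bar>\<delta> j\<bar> else - \<bar>\<delta> j\<bar>)"
    unfolding p using S(3) by simp
  also have "\<dots> = (\<Sum>j\<le>?p. (if j \<in> ?S then 2 * \<bar>\<delta> j\<bar> else 0) - \<bar>\<delta> j\<bar>)"
    by (intro sum.cong) auto
  also have "\<dots> = 2 * (\<Sum>j\<in>?S. \<bar>\<delta> j\<bar>) - l1_norm D \<delta>"
  proof -
    have "(\<Sum>j\<le>?p. if j \<in> ?S then 2 * \<bar>\<delta> j\<bar> else 0) = (\<Sum>j\<in>?S. 2 * \<bar>\<delta> j\<bar>)"
      using S by (subst sum.inter_restrict[symmetric]) (auto simp: Int_absorb1)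
    then show ?thesis by (simp add: sum_subtractf l1_norm_def sum_distrib_left)
  qed
  finally show ?thesis .
qed

lemma compatibility_cone:
  assumes comp: "compatibility (dict_dim D) G S \<nu> \<xi>" and \<nu>: "0 < \<nu>" and S: "S \<subseteq> {..dict_dim D}" "real (card S) \<le> s"
    and q: "0 \<le> qform (dict_dim D) G \<delta> \<delta>"
    and cone: "l1_norm D \<delta> - (\<Sum>j\<in>S. \<bar>\<delta> j\<bar>) \<le> \<xi> * (\<Sum>j\<in>S. \<bar>\<delta> j\<bar>)"
  shows "\<nu> * (\<Sum>j\<in>S. \<bar>\<delta> j\<bar>) \<le> sqrt s * sqrt (qform (dict_dim D) G \<delta> \<delta>)"
proof -
  have "(\<Sum>j\<in>{..dict_dim D} - S. \<bar>\<delta> j\<bar>) = l1_norm D \<delta> - (\<Sum>j\<in>S. \<bar>\<delta> j\<bar>)"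
    using S by (simp add: l1_norm_def sum_diff)
  then have "\<nu>\<^sup>2 * (\<Sum>j\<in>S. \<bar>\<delta> j\<bar>)\<^sup>2 \<le> real (card S) * qform (dict_dim D) G \<delta> \<delta>"
    using comp cone unfolding compatibility_def qform_def by simp
  also have "\<dots> \<le> s * qform (dict_dim D) G \<delta> \<delta>" using S q by (intro mult_right_mono) auto
  finally have "(\<nu> * (\<Sum>j\<in>S. \<bar>\<delta> j\<bar>))\<^sup>2 \<le> s * qform (dict_dim D) G \<delta> \<delta>" by (simp add: power_mult_distrib)
  then have "\<nu> * (\<Sum>j\<in>S. \<bar>\<delta> j\<bar>) \<le> sqrt (s * qform (dict_dim D) G \<delta> \<delta>)" by (rule real_le_rsqrt)
  then show ?thesis by (simp add: real_sqrt_mult)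
qed

lemma lam0_eq: "lam0 C0 B0 p n = C01 C0 B0 * sqrt (2 * ln (1 + real p) / n)"
proof -
  have "(1 + real p) / eps p = (1 + real p)\<^sup>2" by (simp add: eps_def power2_eq_square)
  then have "ln ((1 + real p) / eps p) = 2 * ln (1 + real p)" by (simp add: ln_realpow)
  then show ?thesis by (simp add: lam0_def)
qed

text \<open>
  The factor of the common rate in the tuning parameter of the outcome regression.
\<close>

definition C11 :: "real \<Rightarrow> real \<Rightarrow> real \<Rightarrow> real \<Rightarrow> real" where
  "C11 C0 B0 D0 D1 = max (C01 C0 B0) (exp (- B0) * C0 * sqrt (8 * (D0\<^sup>2 + D1\<^sup>2)))"

lemma lam1_eq: "lam1 C0 B0 D0 D1 p n = C11 C0 B0 D0 D1 * sqrt (2 * ln (1 + real p) / n)"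
proof -
  have "(1 + real p) / eps p = (1 + real p)\<^sup>2" by (simp add: eps_def power2_eq_square)
  then have "ln ((1 + real p) / eps p) = 2 * ln (1 + real p)" by (simp add: ln_realpow)
  moreover have "0 \<le> sqrt (2 * ln (1 + real p) / n)" by simp
  ultimately show ?thesis by (simp add: lam1_def lam0_eq C11_def max_mult_distrib_right)
qed

section \<open>Rate of the calibrated propensity estimator\<close>

context regular_sample
begin

abbreviation "emp \<omega> \<equiv> samp_mean n (\<lambda>i. Z i \<omega>)"
abbreviation "wnorm2 \<omega> b \<equiv> emp \<omega> (\<lambda>(y, t, x). t * w x * (lin D b x)\<^sup>2)"

lemma good_obs:
  assumes "good K a0 a1 \<omega>" "i < n" "Z i \<omega> = (y, t, x)"
  shows "t = 0 \<or> t = 1" "\<And>j. j \<le> p \<Longrightarrow> \<bar>dict D j x\<bar> \<le> C0" "dict D 0 x = 1" "w x \<le> exp (- B0)"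
    "\<psi>2 (lin D ab x) \<le> C1" "C2 \<le> \<psi>2 (lin D ab x)" "\<bar>lin D b x\<bar> \<le> C0 * l1_norm D b"
proof -
  have reg: "regular_obs (y, t, x)" using assms by (auto simp: good_def)
  then show "t = 0 \<or> t = 1" "\<And>j. j \<le> p \<Longrightarrow> \<bar>dict D j x\<bar> \<le> C0" "dict D 0 x = 1" "w x \<le> exp (- B0)"
    "\<psi>2 (lin D ab x) \<le> C1" "C2 \<le> \<psi>2 (lin D ab x)"
    by (auto simp: regular_obs_def)
  have "\<bar>b j * dict D j x\<bar> \<le> C0 * \<bar>b j\<bar>" if "j \<le> p" for j
    using mult_right_mono[of "\<bar>dict D j x\<bar>" C0 "\<bar>b j\<bar>"] reg that by (auto simp: regular_obs_def abs_mult mult.commute)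
  then have "\<bar>lin D b x\<bar> \<le> (\<Sum>j\<le>p. C0 * \<bar>b j\<bar>)"
    unfolding lin_def by (intro order_trans[OF sum_abs] sum_mono) simp
  then show "\<bar>lin D b x\<bar> \<le> C0 * l1_norm D b" by (simp add: l1_norm_def sum_distrib_left)
qed

lemma l1_nonneg: "0 \<le> l1_norm D b" by (simp add: l1_norm_def sum_nonneg)

text \<open>
  Entrywise closeness of two matrices bounds the difference of their forms by the squared \<open>l1\<close> norm.
\<close>

lemma good_gram:
  assumes good: "good K a0 a1 \<omega>"
  shows "\<bar>wnorm2 \<omega> b - qform p Sig b b\<bar> \<le> K * L * (l1_norm D b)\<^sup>2"
    and "\<bar>emp \<omega> (\<lambda>(y, t, x). (1 - t) * (lin D b x)\<^sup>2) - qform p Sig b b\<bar> \<le> K * L * (l1_norm D b)\<^sup>2"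
    and "emp \<omega> (\<lambda>(y, t, x). t * w x * (y - m x)\<^sup>2 * (lin D b x)\<^sup>2) \<le> D1\<^sup>2 * qform p Sig b b + K * L * (l1_norm D b)\<^sup>2"
proof -
  have e: "\<And>j k. j \<le> p \<Longrightarrow> k \<le> p \<Longrightarrow> \<bar>emp \<omega> (gram D gb j k) - Sig j k\<bar> \<le> K * L"
     "\<And>j k. j \<le> p \<Longrightarrow> k \<le> p \<Longrightarrow> \<bar>emp \<omega> (gram_ctl j k) - Sig j k\<bar> \<le> K * L"
     "\<And>j k. j \<le> p \<Longrightarrow> k \<le> p \<Longrightarrow> \<bar>emp \<omega> (gram_res j k) - (\<integral>z. gram_res j k z \<partial>P)\<bar> \<le> K * L"
    using good unfolding good_def by auto
  have q1: "qform p (\<lambda>j k. emp \<omega> (gram D gb j k)) b b = wnorm2 \<omega> b"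
    unfolding samp_mean_qform by (intro samp_mean_cong) (auto simp: qform_gram split: prod.splits)
  have q2: "qform p (\<lambda>j k. emp \<omega> (gram_ctl j k)) b b = emp \<omega> (\<lambda>(y, t, x). (1 - t) * (lin D b x)\<^sup>2)"
    unfolding samp_mean_qform by (intro samp_mean_cong) (auto simp: qform_gram_ctl split: prod.splits)
  have q3: "qform p (\<lambda>j k. emp \<omega> (gram_res j k)) b b = emp \<omega> (\<lambda>(y, t, x). t * w x * (y - m x)\<^sup>2 * (lin D b x)\<^sup>2)"
    unfolding samp_mean_qform by (intro samp_mean_cong) (auto simp: qform_gram_res split: prod.splits)
  show "\<bar>wnorm2 \<omega> b - qform p Sig b b\<bar> \<le> K * L * (l1_norm D b)\<^sup>2"
  proof -
    have "\<bar>qform p (\<lambda>j k. emp \<omega> (gram D gb j k)) b b - qform p (\<lambda>j k. Sig j k) b b\<bar> \<le> K * L * (\<Sum>j\<le>p. \<bar>b j\<bar>)\<^sup>2"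
      by (rule qform_diff_le) (rule e(1))
    then show ?thesis by (simp only: q1 l1_norm_def)
  qed
  show "\<bar>emp \<omega> (\<lambda>(y, t, x). (1 - t) * (lin D b x)\<^sup>2) - qform p Sig b b\<bar> \<le> K * L * (l1_norm D b)\<^sup>2"
  proof -
    have "\<bar>qform p (\<lambda>j k. emp \<omega> (gram_ctl j k)) b b - qform p (\<lambda>j k. Sig j k) b b\<bar> \<le> K * L * (\<Sum>j\<le>p. \<bar>b j\<bar>)\<^sup>2"
      by (rule qform_diff_le) (rule e(2))
    then show ?thesis by (simp only: q2 l1_norm_def)
  qed
  have "\<bar>emp \<omega> (\<lambda>(y, t, x). t * w x * (y - m x)\<^sup>2 * (lin D b x)\<^sup>2) - qform p (\<lambda>j k. \<integral>z. gram_res j k z \<partial>P) b b\<bar>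
      \<le> K * L * (l1_norm D b)\<^sup>2"
  proof -
    have "\<bar>qform p (\<lambda>j k. emp \<omega> (gram_res j k)) b b - qform p (\<lambda>j k. (\<integral>z. gram_res j k z \<partial>P)) b b\<bar> \<le> K * L * (\<Sum>j\<le>p. \<bar>b j\<bar>)\<^sup>2"
      by (rule qform_diff_le) (rule e(3))
    then show ?thesis by (simp only: q3 l1_norm_def)
  qed
  then show "emp \<omega> (\<lambda>(y, t, x). t * w x * (y - m x)\<^sup>2 * (lin D b x)\<^sup>2) \<le> D1\<^sup>2 * qform p Sig b b + K * L * (l1_norm D b)\<^sup>2"
    using qform_gram_res_le[of b] by linarith
qed

lemma wnorm2_nonneg:
  assumes "good K a0 a1 \<omega>"
  shows "0 \<le> wnorm2 \<omega> b"
proof (rule samp_mean_nonneg)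
  fix i assume i: "i < n"
  obtain y t x where z: "Z i \<omega> = (y, t, x)" by (cases "Z i \<omega>") auto
  show "0 \<le> (case Z i \<omega> of (y, t, x) \<Rightarrow> t * w x * (lin D b x)\<^sup>2)"
    using good_obs(1)[OF assms i z] w_pos[of x] unfolding z by (elim disjE) simp_all
qed

abbreviation "cal_crit \<kappa> \<omega> g \<equiv> samp_mean n (\<lambda>i. Z i \<omega>) (loss_cal D g) + \<kappa> * penalty D g"

text \<open>
  The basic inequality of the lasso. The calibration loss has curvature \<open>w exp (- \<bar>d\<bar>)\<close> among the treated, so
  \<open>bregman_ge\<close> bounds its excess from below pointwise; \<open>\<bar>d\<bar>\<close> is bounded by \<open>C0\<close> times the \<open>l1\<close> norm
  to make the denominator common to all observations. The factor 1 is the curvature constant.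
\<close>

lemma cal_basic:
  assumes good: "good K a0 a1 \<omega>" and \<kappa>: "0 \<le> \<kappa>" and min: "cal_crit \<kappa> \<omega> b \<le> cal_crit \<kappa> \<omega> gb"
  defines "\<delta> \<equiv> \<lambda>j. b j - gb j"
  shows "1 * wnorm2 \<omega> \<delta> / (2 * (1 + C0 * l1_norm D \<delta>))
    \<le> \<bar>\<Sum>j\<le>p. \<delta> j * emp \<omega> (cal_score j)\<bar> + \<kappa> * (2 * (\<Sum>j\<in>supp0 D gb. \<bar>\<delta> j\<bar>) - l1_norm D \<delta>)"
proof -
  let ?r = "l1_norm D \<delta>" and ?Y = "2 * (1 + C0 * l1_norm D \<delta>)"
  have Y: "0 < ?Y" using const_pos l1_nonneg[of \<delta>] by (simp add: add_pos_nonneg)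
  have lin_b: "lin D b x = lin D gb x + lin D \<delta> x" for x unfolding \<delta>_def lin_diff by simp
  have pt: "(\<Sum>j\<le>p. \<delta> j * cal_score j z) + (1 / ?Y) * (case z of (y, t, x) \<Rightarrow> t * w x * (lin D \<delta> x)\<^sup>2)
      \<le> loss_cal D b z - loss_cal D gb z" if i: "i < n" and z: "z = Z i \<omega>" for i z
  proof -
    obtain y t x where z': "z = (y, t, x)" by (cases z) auto
    note o = good_obs[OF good i z[symmetric, unfolded z']]
    let ?d = "lin D \<delta> x" and ?g = "lin D gb x"
    have e1: "((\<lambda>u. exp (- u)) has_real_derivative - exp (- u)) (at u)" for u :: real
      by (auto intro!: derivative_eq_intros)
    have e2: "((\<lambda>u. - exp (- u)) has_real_derivative exp (- u)) (at u)" for u :: real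
      by (auto intro!: derivative_eq_intros)
    have "exp (- ?g) * ?d\<^sup>2 / (2 * (1 + 1 * \<bar>?d\<bar>)) \<le> exp (- (?g + ?d)) - exp (- ?g) - (- exp (- ?g)) * ?d"
      by (rule bregman_ge[OF e1 e2]) (auto simp: mult_exp_exp)
    then have br: "w x * ?d\<^sup>2 / (2 * (1 + \<bar>?d\<bar>)) \<le> exp (- (?g + ?d)) - w x + w x * ?d" by (simp add: wt_def)
    have "w x * ?d\<^sup>2 / ?Y \<le> w x * ?d\<^sup>2 / (2 * (1 + \<bar>?d\<bar>))"
      using o(7)[of \<delta>] w_pos[of x] Y by (intro divide_left_mono) auto
    with br have br': "w x * ?d\<^sup>2 / ?Y \<le> exp (- (?g + ?d)) - w x + w x * ?d" by linarith
    show ?thesis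
      using o(1) br' unfolding z' sum_cal_score loss_cal_def prod.case lin_b
      by (auto simp: wt_def algebra_simps)
  qed
  have "emp \<omega> (\<lambda>z. (\<Sum>j\<le>p. \<delta> j * cal_score j z) + (1 / ?Y) * (case z of (y, t, x) \<Rightarrow> t * w x * (lin D \<delta> x)\<^sup>2))
      \<le> emp \<omega> (\<lambda>z. loss_cal D b z - loss_cal D gb z)"
    by (rule samp_mean_mono) (rule pt, assumption, rule refl)
  then have "(\<Sum>j\<le>p. \<delta> j * emp \<omega> (cal_score j)) + (1 / ?Y) * wnorm2 \<omega> \<delta> \<le> emp \<omega> (loss_cal D b) - emp \<omega> (loss_cal D gb)"
    by (simp only: samp_mean_add samp_mean_cmult samp_mean_diff mean_sum)
  moreover have "emp \<omega> (loss_cal D b) - emp \<omega> (loss_cal D gb) \<le> \<kappa> * (penalty D gb - penalty D b)"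
    using min by (simp add: right_diff_distrib)
  moreover have "\<kappa> * (penalty D gb - penalty D b) \<le> \<kappa> * (2 * (\<Sum>j\<in>supp0 D gb. \<bar>\<delta> j\<bar>) - l1_norm D \<delta>)"
    unfolding \<delta>_def by (intro mult_left_mono penalty_diff \<kappa>)
  moreover have "- \<bar>\<Sum>j\<le>p. \<delta> j * emp \<omega> (cal_score j)\<bar> \<le> (\<Sum>j\<le>p. \<delta> j * emp \<omega> (cal_score j))" by simp
  moreover have "1 * wnorm2 \<omega> \<delta> / ?Y = (1 / ?Y) * wnorm2 \<omega> \<delta>" by simp
  ultimately show ?thesis by linarith
qed

lemma good_score:
  assumes good: "good K a0 a1 \<omega>"
  shows "\<bar>\<Sum>j\<le>p. b j * emp \<omega> (cal_score j)\<bar> \<le> a0 * L * l1_norm D b + K * L * sqrt (qform p Sig b b)"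
    and "\<bar>\<Sum>j\<le>p. b j * emp \<omega> (wl_score j)\<bar> \<le> a1 * L * l1_norm D b + K * L * sqrt (qform p Sig b b)"
  using good unfolding good_def l1_norm_def by auto

lemma supp0_subset: "supp0 D b \<subseteq> {..p}" "finite (supp0 D b)" "1 \<le> card (supp0 D b)"
proof -
  show s: "supp0 D b \<subseteq> {..p}" by (auto simp: supp0_def)
  then show f: "finite (supp0 D b)" by (rule finite_subset) simp
  have "card {0 :: nat} \<le> card (supp0 D b)" by (rule card_mono[OF f]) (auto simp: supp0_def)
  then show "1 \<le> card (supp0 D b)" by simp
qed

lemma apply_lasso_rate:
  assumes rate: "lasso_rate_holds a c C K k \<nu> \<xi> \<rho> B" and K: "0 \<le> K'" "K' \<le> K" and good: "good K' a0 a1 \<omega>"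
    and s: "real (card (supp0 D bb)) \<le> s" and sL: "s * L \<le> \<rho>"
    and comp: "compatibility p Sig (supp0 D bb) \<nu> \<xi>" and \<nu>: "0 < \<nu>"
    and basic: "c * wnorm2 \<omega> \<delta> / (2 * (1 + C * l1_norm D \<delta>)) \<le> nz + k * L * (2 * (\<Sum>j\<in>supp0 D bb. \<bar>\<delta> j\<bar>) - l1_norm D \<delta>)"
    and nz: "nz \<le> a * (k * L) * l1_norm D \<delta> + K * L * sqrt s * (sqrt (wnorm2 \<omega> \<delta>) + sqrt (qform p Sig \<delta> \<delta>))"
  shows "l1_norm D \<delta> \<le> B * (s * L) \<and> wnorm2 \<omega> \<delta> \<le> B * (s * L\<^sup>2) \<and> qform p Sig \<delta> \<delta> \<le> B * (s * L\<^sup>2)"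
proof -
  let ?x = "sqrt (wnorm2 \<omega> \<delta>)" and ?y = "sqrt (qform p Sig \<delta> \<delta>)" and ?dS = "\<Sum>j\<in>supp0 D bb. \<bar>\<delta> j\<bar>"
  have x2: "?x\<^sup>2 = wnorm2 \<omega> \<delta>" using wnorm2_nonneg[OF good] by simp
  have y2: "?y\<^sup>2 = qform p Sig \<delta> \<delta>" using qform_Sigma_nonneg by simp
  have xy: "?y\<^sup>2 \<le> ?x\<^sup>2 + K * L * (l1_norm D \<delta>)\<^sup>2"
  proof -
    have "K' * L * (l1_norm D \<delta>)\<^sup>2 \<le> K * L * (l1_norm D \<delta>)\<^sup>2"
      using K L_pos by (intro mult_right_mono) auto
    then show ?thesis unfolding x2 y2 using good_gram(1)[OF good, of \<delta>] by linarith
  qed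
  have dS: "0 \<le> ?dS" "?dS \<le> l1_norm D \<delta>"
    unfolding l1_norm_def using supp0_subset by (auto intro!: sum_nonneg sum_mono2)
  have s1: "1 \<le> s" using supp0_subset(3)[of bb] s by linarith
  have cone: "l1_norm D \<delta> - ?dS \<le> \<xi> * ?dS \<longrightarrow> \<nu> * ?dS \<le> sqrt s * ?y"
    using compatibility_cone[OF comp \<nu> supp0_subset(1) s qform_Sigma_nonneg] by blast
  have "0 < L \<and> 1 \<le> s \<and> s * L \<le> \<rho> \<and> 0 \<le> ?x \<and> 0 \<le> ?y \<and> 0 \<le> ?dS \<and> ?dS \<le> l1_norm D \<delta> \<and>
    ?y\<^sup>2 \<le> ?x\<^sup>2 + K * L * (l1_norm D \<delta>)\<^sup>2 \<and>
    c * ?x\<^sup>2 / (2 * (1 + C * l1_norm D \<delta>)) \<le> nz + k * L * (2 * ?dS - l1_norm D \<delta>) \<and>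
    nz \<le> a * (k * L) * l1_norm D \<delta> + K * L * sqrt s * (?x + ?y) \<and>
    (l1_norm D \<delta> - ?dS \<le> \<xi> * ?dS \<longrightarrow> \<nu> * ?dS \<le> sqrt s * ?y)"
    by (intro conjI L_pos s1 sL dS xy nz cone) (use wnorm2_nonneg[OF good] qform_Sigma_nonneg basic in \<open>simp_all add: x2\<close>)
  from rate[unfolded lasso_rate_holds_def, rule_format, OF this] show ?thesis unfolding x2 y2 .
qed

text \<open>
  Stated for every point at which the criterion does not exceed its value at the target, since the
  bound also shows that a minimizer exists.
\<close>

lemma cal_rate_sublevel:
  assumes rate: "lasso_rate_holds a 1 C0 K k \<nu> \<xi> \<rho> B" and K: "0 \<le> K" and good: "good K (a * k) a1 \<omega>"
    and s: "real (card (supp0 D gb)) \<le> s" and sL: "s * L \<le> \<rho>" and k: "0 \<le> k"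
    and comp: "compatibility p Sig (supp0 D gb) \<nu> \<xi>" and \<nu>: "0 < \<nu>"
    and min: "cal_crit (k * L) \<omega> b \<le> cal_crit (k * L) \<omega> gb"
  defines "\<delta> \<equiv> \<lambda>j. b j - gb j"
  shows "l1_norm D \<delta> \<le> B * (s * L) \<and> wnorm2 \<omega> \<delta> \<le> B * (s * L\<^sup>2) \<and> qform p Sig \<delta> \<delta> \<le> B * (s * L\<^sup>2)"
proof (rule apply_lasso_rate[OF rate K order_refl good s sL comp \<nu>])
  have kL: "0 \<le> k * L" using k L_pos by simp
  show "1 * wnorm2 \<omega> \<delta> / (2 * (1 + C0 * l1_norm D \<delta>))
      \<le> \<bar>\<Sum>j\<le>p. \<delta> j * emp \<omega> (cal_score j)\<bar> + k * L * (2 * (\<Sum>j\<in>supp0 D gb. \<bar>\<delta> j\<bar>) - l1_norm D \<delta>)"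
    unfolding \<delta>_def by (rule cal_basic[OF good kL min])
  have s1: "1 \<le> s" using supp0_subset(3)[of gb] s by linarith
  have "K * L * sqrt (qform p Sig \<delta> \<delta>) \<le> K * L * (sqrt s * (sqrt (wnorm2 \<omega> \<delta>) + sqrt (qform p Sig \<delta> \<delta>)))"
  proof (rule mult_left_mono)
    have "1 * sqrt (qform p Sig \<delta> \<delta>) \<le> sqrt s * (sqrt (wnorm2 \<omega> \<delta>) + sqrt (qform p Sig \<delta> \<delta>))"
      using s1 wnorm2_nonneg[OF good] qform_Sigma_nonneg by (intro mult_mono) auto
    then show "sqrt (qform p Sig \<delta> \<delta>) \<le> sqrt s * (sqrt (wnorm2 \<omega> \<delta>) + sqrt (qform p Sig \<delta> \<delta>))" by simp
  qed (use K L_pos in simp)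
  then show "\<bar>\<Sum>j\<le>p. \<delta> j * emp \<omega> (cal_score j)\<bar>
      \<le> a * (k * L) * l1_norm D \<delta> + K * L * sqrt s * (sqrt (wnorm2 \<omega> \<delta>) + sqrt (qform p Sig \<delta> \<delta>))"
    using good_score(1)[OF good, of \<delta>] by (simp add: mult.assoc)
qed

lemma crit_dependence:
  assumes "\<forall>j\<le>p. b j = b' j"
  shows "lin D b = lin D b'" "penalty D b = penalty D b'"
  using assms by (auto simp: lin_def penalty_def fun_eq_iff intro!: sum.cong)

text \<open>
  The estimator is only known to minimize if a minimizer exists, which \<open>exists_minimizer\<close> supplies because
  the sublevel set is bounded.
\<close>

lemma cal_rate:
  assumes rate: "lasso_rate_holds a 1 C0 K k \<nu> \<xi> \<rho> B" and K: "0 \<le> K" and good: "good K (a * k) a1 \<omega>"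
    and s: "real (card (supp0 D gb)) \<le> s" and sL: "s * L \<le> \<rho>" and k: "0 \<le> k"
    and comp: "compatibility p Sig (supp0 D gb) \<nu> \<xi>" and \<nu>: "0 < \<nu>"
    and est: "estimator_cal D n Q Z (k * L) gh" and \<omega>: "\<omega> \<in> space Q"
  defines "\<delta> \<equiv> \<lambda>j. gh \<omega> j - gb j"
  shows "l1_norm D \<delta> \<le> B * (s * L) \<and> wnorm2 \<omega> \<delta> \<le> B * (s * L\<^sup>2) \<and> qform p Sig \<delta> \<delta> \<le> B * (s * L\<^sup>2)"
proof -
  note sub = cal_rate_sublevel[OF rate K good s sL k comp \<nu>]
  have "\<exists>b. minimizes (cal_crit (k * L) \<omega>) b"
  proof (rule exists_minimizer)
    have pt: "continuous_on UNIV (\<lambda>b. loss_cal D b z)" for z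
      unfolding loss_cal_def by (cases z) (auto intro!: continuous_intros lin_continuous)
    show "continuous_on UNIV (cal_crit (k * L) \<omega>)"
      unfolding samp_mean_def by (intro continuous_intros pt penalty_continuous) (use n_pos in auto)
    show "cal_crit (k * L) \<omega> b = cal_crit (k * L) \<omega> b'" if "\<forall>j\<le>p. b j = b' j" for b b'
      by (simp add: loss_cal_def crit_dependence[OF that])
    show "(\<Sum>j\<le>p. \<bar>b j - gb j\<bar>) \<le> B * (s * L)" if "cal_crit (k * L) \<omega> b \<le> cal_crit (k * L) \<omega> gb" for b
      using sub[OF that] by (simp add: l1_norm_def)
  qed
  then have "minimizes (cal_crit (k * L) \<omega>) (gh \<omega>)"
    using est \<omega> unfolding estimator_cal_def estimator_of_def by blast
  then have "cal_crit (k * L) \<omega> (gh \<omega>) \<le> cal_crit (k * L) \<omega> gb" by (simp add: is_arg_min_linorder)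
  then show ?thesis unfolding \<delta>_def by (rule sub)
qed

end

section \<open>Rate of the weighted outcome regression\<close>

lemma abs_exp_diff_le_three:
  fixes u :: real
  assumes "\<bar>u\<bar> \<le> 1"
  shows "\<bar>exp (- u) - 1\<bar> \<le> 3 * \<bar>u\<bar>" "\<bar>exp (- u) - 1 + u\<bar> \<le> 3 * u\<^sup>2" "exp (- 1) \<le> exp (- u)"
proof -
  have e: "exp \<bar>u\<bar> \<le> 3" using assms exp_le by (meson exp_le_cancel_iff order_trans)
  show "\<bar>exp (- u) - 1\<bar> \<le> 3 * \<bar>u\<bar>"
    using exp_minus_diff_le(1)[of u] mult_left_mono[OF e, of "\<bar>u\<bar>"] by simp
  show "\<bar>exp (- u) - 1 + u\<bar> \<le> 3 * u\<^sup>2"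
    using exp_minus_diff_le(2)[of u] mult_left_mono[OF e, of "u\<^sup>2"] by simp
  show "exp (- 1) \<le> exp (- u)" using assms by simp
qed

context regular_sample
begin

lemma wt_ratio: "wt D \<gamma> x = w x * exp (- lin D (\<lambda>j. \<gamma> j - gb j) x)"
  by (simp add: wt_def lin_diff mult_exp_exp)

abbreviation "res2 \<omega> b \<equiv> emp \<omega> (\<lambda>(y, t, x). t * w x * (y - m x)\<^sup>2 * (lin D b x)\<^sup>2)"

text \<open>
  Cauchy-Schwarz: the relative error of the weights is at most \<open>3 \<bar>u\<bar>\<close>, where \<open>u\<close> is the error of the
  propensity predictor, so the perturbation of the score separates into the residual-weighted norm of the
  first-stage error and the norm of the second-stage error.
\<close>

lemma weight_perturbation:
  assumes good: "good K a0 a1 \<omega>" and small: "C0 * l1_norm D (\<lambda>j. \<gamma> j - gb j) \<le> 1"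
  shows "\<bar>emp \<omega> (\<lambda>(y, t, x). t * (wt D \<gamma> x - w x) * (m x - y) * lin D b x)\<bar>
    \<le> 3 * sqrt (res2 \<omega> (\<lambda>j. \<gamma> j - gb j)) * sqrt (wnorm2 \<omega> b)"
proof -
  let ?\<delta> = "\<lambda>j. \<gamma> j - gb j"
  let ?g = "\<lambda>(y, t, x). t * (wt D \<gamma> x - w x) * (m x - y) * lin D b x"
  let ?a = "\<lambda>(y, t, x). 3 * (t * sqrt (w x) * \<bar>y - m x\<bar> * \<bar>lin D ?\<delta> x\<bar>)" and ?b = "\<lambda>(y :: real, t, x). t * sqrt (w x) * \<bar>lin D b x\<bar>"
  have key: "\<bar>?g (Z i \<omega>)\<bar> \<le> ?a (Z i \<omega>) * ?b (Z i \<omega>) \<and> (?b (Z i \<omega>))\<^sup>2 = (case Z i \<omega> of (y, t, x) \<Rightarrow> t * w x * (lin D b x)\<^sup>2)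
      \<and> (?a (Z i \<omega>))\<^sup>2 = 9 * (case Z i \<omega> of (y, t, x) \<Rightarrow> t * w x * (y - m x)\<^sup>2 * (lin D ?\<delta> x)\<^sup>2)" if i: "i < n" for i
  proof -
    obtain y t x where z: "Z i \<omega> = (y, t, x)" by (cases "Z i \<omega>") auto
    note o = good_obs[OF good i z]
    let ?u = "lin D ?\<delta> x"
    have u: "\<bar>?u\<bar> \<le> 1" using o(7)[of ?\<delta>] small by linarith
    have wd: "\<bar>wt D \<gamma> x - w x\<bar> \<le> w x * (3 * \<bar>?u\<bar>)"
    proof -
      have "wt D \<gamma> x - w x = w x * (exp (- ?u) - 1)" by (subst wt_ratio) (simp add: algebra_simps)
      then have "\<bar>wt D \<gamma> x - w x\<bar> = w x * \<bar>exp (- ?u) - 1\<bar>" using w_pos[of x] by (simp add: abs_mult)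
      then show ?thesis using abs_exp_diff_le_three(1)[OF u] w_pos[of x] by simp
    qed
    have "\<bar>wt D \<gamma> x - w x\<bar> * (\<bar>y - m x\<bar> * \<bar>lin D b x\<bar>) \<le> w x * (3 * \<bar>?u\<bar>) * (\<bar>y - m x\<bar> * \<bar>lin D b x\<bar>)"
      by (rule mult_right_mono[OF wd]) simp
    also have "w x * (3 * \<bar>?u\<bar>) * (\<bar>y - m x\<bar> * \<bar>lin D b x\<bar>)
        = 3 * (sqrt (w x) * \<bar>y - m x\<bar> * \<bar>?u\<bar>) * (sqrt (w x) * \<bar>lin D b x\<bar>)"
    proof -
      have sw2: "sqrt (w x) * sqrt (w x) = w x" using w_pos[of x] by simp
      have "3 * (sqrt (w x) * \<bar>y - m x\<bar> * \<bar>?u\<bar>) * (sqrt (w x) * \<bar>lin D b x\<bar>)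
          = (sqrt (w x) * sqrt (w x)) * (3 * \<bar>?u\<bar>) * (\<bar>y - m x\<bar> * \<bar>lin D b x\<bar>)"
        by (simp only: mult_ac)
      then show ?thesis unfolding sw2 by (rule sym)
    qed
    finally have g: "\<bar>wt D \<gamma> x - w x\<bar> * (\<bar>m x - y\<bar> * \<bar>lin D b x\<bar>)
        \<le> 3 * (sqrt (w x) * \<bar>y - m x\<bar> * \<bar>?u\<bar>) * (sqrt (w x) * \<bar>lin D b x\<bar>)"
      by (simp only: abs_minus_commute[of "m x" y])
    have sw: "(sqrt (w x))\<^sup>2 = w x" using w_pos[of x] by simp
    show ?thesis unfolding z prod.case using o(1) g
      by (elim disjE) (simp_all add: abs_mult power_mult_distrib sw mult.assoc)
  qed
  have "\<bar>emp \<omega> ?g\<bar> \<le> sqrt (emp \<omega> (\<lambda>z. (?a z)\<^sup>2)) * sqrt (emp \<omega> (\<lambda>z. (?b z)\<^sup>2))"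
    by (rule samp_mean_CS) (use key in blast)
  also have "emp \<omega> (\<lambda>z. (?b z)\<^sup>2) = wnorm2 \<omega> b" by (rule samp_mean_cong) (use key in blast)
  also have "emp \<omega> (\<lambda>z. (?a z)\<^sup>2) = emp \<omega> (\<lambda>z. 9 * (case z of (y, t, x) \<Rightarrow> t * w x * (y - m x)\<^sup>2 * (lin D ?\<delta> x)\<^sup>2))"
    by (rule samp_mean_cong) (use key in blast)
  also have "\<dots> = 9 * res2 \<omega> ?\<delta>" by (rule samp_mean_cmult)
  finally show ?thesis by (simp add: real_sqrt_mult)
qed

abbreviation "wl_crit \<kappa> \<gamma> \<omega> a \<equiv> samp_mean n (\<lambda>i. Z i \<omega>) (loss_wl \<psi> D a \<gamma>) + \<kappa> * penalty D a"

text \<open>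
  As for calibration, with the weights and scores moved to their targets: the estimated weights are at
  least \<open>exp (- 1) w\<close> since the first-stage error is small, and the change of the score is kept as a
  separate noise term. The curvature exponent is \<open>C3 + 1\<close> and not \<open>C3\<close> because \<open>bregman_ge\<close> wants it
  positive.
\<close>

lemma wl_basic:
  assumes good: "good K a0 a1 \<omega>" and \<kappa>: "0 \<le> \<kappa>" and min: "wl_crit \<kappa> \<gamma> \<omega> b \<le> wl_crit \<kappa> \<gamma> \<omega> ab"
    and small: "C0 * l1_norm D (\<lambda>j. \<gamma> j - gb j) \<le> 1"
  defines "\<delta> \<equiv> \<lambda>j. b j - ab j"
  shows "(exp (- 1) * C2) * wnorm2 \<omega> \<delta> / (2 * (1 + ((C3 + 1) * C0) * l1_norm D \<delta>))
    \<le> \<bar>\<Sum>j\<le>p. \<delta> j * emp \<omega> (wl_score j)\<bar>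
      + \<bar>emp \<omega> (\<lambda>(y, t, x). t * (wt D \<gamma> x - w x) * (m x - y) * lin D \<delta> x)\<bar>
      + \<kappa> * (2 * (\<Sum>j\<in>supp0 D ab. \<bar>\<delta> j\<bar>) - l1_norm D \<delta>)"
proof -
  let ?r = "l1_norm D \<delta>" and ?Y = "2 * (1 + ((C3 + 1) * C0) * l1_norm D \<delta>)" and ?c = "exp (- 1) * C2"
  let ?pert = "\<lambda>(y, t, x). t * (wt D \<gamma> x - w x) * (m x - y) * lin D \<delta> x"
  have Y: "0 < ?Y" using const_pos l1_nonneg[of \<delta>] by (simp add: add_pos_nonneg)
  have lin_b: "lin D b x = lin D ab x + lin D \<delta> x" for x unfolding \<delta>_def lin_diff by simp
  have pt: "((\<Sum>j\<le>p. \<delta> j * wl_score j z) + ?pert z) + (?c / ?Y) * (case z of (y, t, x) \<Rightarrow> t * w x * (lin D \<delta> x)\<^sup>2)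
      \<le> loss_wl \<psi> D b \<gamma> z - loss_wl \<psi> D ab \<gamma> z" if i: "i < n" and z: "z = Z i \<omega>" for i z
  proof -
    obtain y t x where z': "z = (y, t, x)" by (cases z) auto
    note o = good_obs[OF good i z[symmetric, unfolded z']]
    let ?d = "lin D \<delta> x" and ?h = "lin D ab x" and ?u = "lin D (\<lambda>j. \<gamma> j - gb j) x"
    have u: "\<bar>?u\<bar> \<le> 1" using o(7)[of "\<lambda>j. \<gamma> j - gb j"] small by linarith
    have "C2 * ?d\<^sup>2 / (2 * (1 + (C3 + 1) * \<bar>?d\<bar>)) \<le> link_primitive \<psi> (?h + ?d) - link_primitive \<psi> ?h - \<psi> ?h * ?d"
    proof (rule bregman_ge[OF deriv_link_primitive deriv_link])
      fix t :: real
      have "C2 \<le> \<psi>2 (?h + t) * exp (C3 * \<bar>?h - (?h + t)\<bar>)" using o(6) curv_lip[of ?h "?h + t"] by linarith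
      also have "\<dots> \<le> \<psi>2 (?h + t) * exp ((C3 + 1) * \<bar>t\<bar>)"
        using link_curv_nonneg by (intro mult_left_mono) (auto simp: distrib_right)
      finally show "C2 * exp (- (C3 + 1) * \<bar>t\<bar>) \<le> \<psi>2 (?h + t)"
        by (simp add: exp_minus field_simps del: minus_add_distrib)
    qed (use const_pos in auto)
    moreover have "C2 * ?d\<^sup>2 / ?Y \<le> C2 * ?d\<^sup>2 / (2 * (1 + (C3 + 1) * \<bar>?d\<bar>))"
    proof (rule divide_left_mono)
      have "(C3 + 1) * \<bar>?d\<bar> \<le> (C3 + 1) * (C0 * ?r)" using o(7)[of \<delta>] const_pos by (intro mult_left_mono) auto
      then show "2 * (1 + (C3 + 1) * \<bar>?d\<bar>) \<le> ?Y" by (simp add: mult.assoc)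
      show "0 < ?Y * (2 * (1 + (C3 + 1) * \<bar>?d\<bar>))" using Y const_pos by (intro mult_pos_pos) (auto intro: add_pos_nonneg)
    qed (use const_pos in auto)
    ultimately have br: "C2 * ?d\<^sup>2 / ?Y \<le> link_primitive \<psi> (?h + ?d) - link_primitive \<psi> ?h - \<psi> ?h * ?d" by linarith
    have wg: "w x * exp (- 1) \<le> wt D \<gamma> x"
      by (subst wt_ratio) (use abs_exp_diff_le_three(3)[OF u] w_pos[of x] in auto)
    have "(w x * exp (- 1)) * (C2 * ?d\<^sup>2 / ?Y) \<le> wt D \<gamma> x * (C2 * ?d\<^sup>2 / ?Y)"
      using wg Y const_pos by (intro mult_right_mono) auto
    also have "\<dots> \<le> wt D \<gamma> x * (link_primitive \<psi> (?h + ?d) - link_primitive \<psi> ?h - \<psi> ?h * ?d)"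
      using br by (intro mult_left_mono) (simp_all add: wt_def)
    finally have br': "?c / ?Y * (w x * ?d\<^sup>2) \<le> wt D \<gamma> x * (link_primitive \<psi> (?h + ?d) - link_primitive \<psi> ?h - \<psi> ?h * ?d)"
      by (simp add: mult_ac)
    show ?thesis
      using o(1) br' unfolding z' sum_wl_score loss_wl_def prod.case lin_b
      by (elim disjE) (simp_all add: algebra_simps)
  qed
  have "emp \<omega> (\<lambda>z. ((\<Sum>j\<le>p. \<delta> j * wl_score j z) + ?pert z) + (?c / ?Y) * (case z of (y, t, x) \<Rightarrow> t * w x * (lin D \<delta> x)\<^sup>2))
      \<le> emp \<omega> (\<lambda>z. loss_wl \<psi> D b \<gamma> z - loss_wl \<psi> D ab \<gamma> z)"
    by (rule samp_mean_mono) (rule pt, assumption, rule refl)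
  then have "((\<Sum>j\<le>p. \<delta> j * emp \<omega> (wl_score j)) + emp \<omega> ?pert) + (?c / ?Y) * wnorm2 \<omega> \<delta>
      \<le> emp \<omega> (loss_wl \<psi> D b \<gamma>) - emp \<omega> (loss_wl \<psi> D ab \<gamma>)"
    by (simp only: samp_mean_add samp_mean_cmult samp_mean_diff mean_sum)
  moreover have "emp \<omega> (loss_wl \<psi> D b \<gamma>) - emp \<omega> (loss_wl \<psi> D ab \<gamma>) \<le> \<kappa> * (penalty D ab - penalty D b)"
    using min by (simp add: right_diff_distrib)
  moreover have "\<kappa> * (penalty D ab - penalty D b) \<le> \<kappa> * (2 * (\<Sum>j\<in>supp0 D ab. \<bar>\<delta> j\<bar>) - l1_norm D \<delta>)"
    unfolding \<delta>_def by (intro mult_left_mono penalty_diff \<kappa>)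
  moreover have "- \<bar>\<Sum>j\<le>p. \<delta> j * emp \<omega> (wl_score j)\<bar> \<le> (\<Sum>j\<le>p. \<delta> j * emp \<omega> (wl_score j))" by simp
  moreover have "- \<bar>emp \<omega> ?pert\<bar> \<le> emp \<omega> ?pert" by simp
  moreover have "?c * wnorm2 \<omega> \<delta> / ?Y = (?c / ?Y) * wnorm2 \<omega> \<delta>" by simp
  ultimately show ?thesis by linarith
qed

lemma res2_rate:
  assumes good: "good K a0 a1 \<omega>" and K: "0 \<le> K" and s1: "1 \<le> s" and sL: "s * L \<le> 1" and B: "0 \<le> B"
    and r: "l1_norm D \<delta> \<le> B * (s * L)" and q: "qform p Sig \<delta> \<delta> \<le> B * (s * L\<^sup>2)"
  shows "K * L * (l1_norm D \<delta>)\<^sup>2 \<le> K * B\<^sup>2 * (s * L\<^sup>2)" "res2 \<omega> \<delta> \<le> (D1\<^sup>2 * B + K * B\<^sup>2) * (s * L\<^sup>2)"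
proof -
  have "K * L * (l1_norm D \<delta>)\<^sup>2 \<le> K * L * (B * (s * L))\<^sup>2"
    using r K L_pos l1_nonneg by (intro mult_left_mono power_mono) auto
  also have "\<dots> = (K * B\<^sup>2 * (s * L\<^sup>2)) * (s * L)" by (simp add: power2_eq_square mult_ac)
  also have "\<dots> \<le> (K * B\<^sup>2 * (s * L\<^sup>2)) * 1" using sL K s1 by (intro mult_left_mono) auto
  finally show 1: "K * L * (l1_norm D \<delta>)\<^sup>2 \<le> K * B\<^sup>2 * (s * L\<^sup>2)" by simp
  have "D1\<^sup>2 * qform p Sig \<delta> \<delta> \<le> D1\<^sup>2 * (B * (s * L\<^sup>2))" using q by (intro mult_left_mono) auto
  then show "res2 \<omega> \<delta> \<le> (D1\<^sup>2 * B + K * B\<^sup>2) * (s * L\<^sup>2)"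
    using good_gram(3)[OF good, of \<delta>] 1 by (simp add: distrib_right mult.assoc)
qed

text \<open>
  By \<open>weight_perturbation\<close> and \<open>res2_rate\<close> the estimated weights contribute noise of order
  \<open>L sqrt s\<close> times the quadratic norm of the error, exactly the form that \<open>lasso_rate_holds\<close> tolerates
  with an enlarged \<open>K\<close>.
\<close>

lemma wl_rate_sublevel:
  assumes rate: "lasso_rate_holds a (exp (- 1) * C2) ((C3 + 1) * C0) (K + 3 * sqrt (D1\<^sup>2 * B1 + K * B1\<^sup>2)) k \<nu> \<xi> \<rho> B"
    and K: "0 \<le> K" and good: "good K a0 (a * k) \<omega>" and B1: "0 \<le> B1"
    and s: "real (card (supp0 D ab)) \<le> s" and sL: "s * L \<le> \<rho>" "s * L \<le> 1" "C0 * B1 * (s * L) \<le> 1" and k: "0 \<le> k"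
    and comp: "compatibility p Sig (supp0 D ab) \<nu> \<xi>" and \<nu>: "0 < \<nu>"
    and r1: "l1_norm D (\<lambda>j. \<gamma> j - gb j) \<le> B1 * (s * L)" and q1: "qform p Sig (\<lambda>j. \<gamma> j - gb j) (\<lambda>j. \<gamma> j - gb j) \<le> B1 * (s * L\<^sup>2)"
    and min: "wl_crit (k * L) \<gamma> \<omega> b \<le> wl_crit (k * L) \<gamma> \<omega> ab"
  defines "\<delta> \<equiv> \<lambda>j. b j - ab j"
  shows "l1_norm D \<delta> \<le> B * (s * L) \<and> wnorm2 \<omega> \<delta> \<le> B * (s * L\<^sup>2) \<and> qform p Sig \<delta> \<delta> \<le> B * (s * L\<^sup>2)"
proof (rule apply_lasso_rate[OF rate K _ good s sL(1) comp \<nu>])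
  let ?\<delta>1 = "\<lambda>j. \<gamma> j - gb j" and ?K2 = "3 * sqrt (D1\<^sup>2 * B1 + K * B1\<^sup>2)"
  let ?x = "sqrt (wnorm2 \<omega> \<delta>)" and ?y = "sqrt (qform p Sig \<delta> \<delta>)"
  have kL: "0 \<le> k * L" using k L_pos by simp
  have s1: "1 \<le> s" using supp0_subset(3)[of ab] s by linarith
  have K2: "0 \<le> ?K2" using B1 K by simp
  then show "K \<le> K + ?K2" by simp
  have "C0 * l1_norm D ?\<delta>1 \<le> C0 * (B1 * (s * L))" by (rule mult_left_mono[OF r1]) (use const_pos in simp)
  also have "\<dots> \<le> 1" using sL(3) by (simp only: mult.assoc)
  finally have small: "C0 * l1_norm D ?\<delta>1 \<le> 1" .
  let ?pert = "\<bar>emp \<omega> (\<lambda>(y, t, x). t * (wt D \<gamma> x - w x) * (m x - y) * lin D \<delta> x)\<bar>"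
  show "exp (- 1) * C2 * wnorm2 \<omega> \<delta> / (2 * (1 + ((C3 + 1) * C0) * l1_norm D \<delta>))
      \<le> (\<bar>\<Sum>j\<le>p. \<delta> j * emp \<omega> (wl_score j)\<bar> + ?pert)
        + k * L * (2 * (\<Sum>j\<in>supp0 D ab. \<bar>\<delta> j\<bar>) - l1_norm D \<delta>)"
    unfolding \<delta>_def by (rule wl_basic[OF good kL min small])
  have xy: "0 \<le> ?x" "0 \<le> ?y" using wnorm2_nonneg[OF good] qform_Sigma_nonneg by simp_all
  have "?pert \<le> 3 * sqrt (res2 \<omega> ?\<delta>1) * ?x" by (rule weight_perturbation[OF good small])
  also have "\<dots> \<le> 3 * sqrt ((D1\<^sup>2 * B1 + K * B1\<^sup>2) * (s * L\<^sup>2)) * ?x"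
    using res2_rate(2)[OF good K s1 sL(2) B1 r1 q1] xy by (intro mult_right_mono mult_left_mono real_sqrt_le_mono) auto
  also have "\<dots> = ?K2 * L * sqrt s * ?x" using L_pos by (simp add: real_sqrt_mult)
  finally have p: "?pert \<le> ?K2 * L * sqrt s * ?x" .
  have "K * L * ?y \<le> K * L * (sqrt s * (?x + ?y))"
  proof (rule mult_left_mono)
    have "1 * ?y \<le> sqrt s * (?x + ?y)" using s1 xy by (intro mult_mono) auto
    then show "?y \<le> sqrt s * (?x + ?y)" by simp
  qed (use K L_pos in simp)
  moreover have "?K2 * L * sqrt s * ?x \<le> ?K2 * L * sqrt s * (?x + ?y)"
    using K2 L_pos s1 xy by (intro mult_left_mono) auto
  ultimately show "\<bar>\<Sum>j\<le>p. \<delta> j * emp \<omega> (wl_score j)\<bar> + ?pert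
      \<le> a * (k * L) * l1_norm D \<delta> + (K + ?K2) * L * sqrt s * (?x + ?y)"
    using good_score(2)[OF good, of \<delta>] p by (simp add: distrib_right mult.assoc)
qed

lemma wl_rate:
  assumes rate: "lasso_rate_holds a (exp (- 1) * C2) ((C3 + 1) * C0) (K + 3 * sqrt (D1\<^sup>2 * B1 + K * B1\<^sup>2)) k \<nu> \<xi> \<rho> B"
    and K: "0 \<le> K" and good: "good K a0 (a * k) \<omega>" and B1: "0 \<le> B1"
    and s: "real (card (supp0 D ab)) \<le> s" and sL: "s * L \<le> \<rho>" "s * L \<le> 1" "C0 * B1 * (s * L) \<le> 1" and k: "0 \<le> k"
    and comp: "compatibility p Sig (supp0 D ab) \<nu> \<xi>" and \<nu>: "0 < \<nu>"
    and r1: "l1_norm D (\<lambda>j. gh \<omega> j - gb j) \<le> B1 * (s * L)"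
    and q1: "qform p Sig (\<lambda>j. gh \<omega> j - gb j) (\<lambda>j. gh \<omega> j - gb j) \<le> B1 * (s * L\<^sup>2)"
    and est: "estimator_wl \<psi> D n Q Z (k * L) gh ah" and \<omega>: "\<omega> \<in> space Q"
  defines "\<delta> \<equiv> \<lambda>j. ah \<omega> j - ab j"
  shows "l1_norm D \<delta> \<le> B * (s * L) \<and> wnorm2 \<omega> \<delta> \<le> B * (s * L\<^sup>2) \<and> qform p Sig \<delta> \<delta> \<le> B * (s * L\<^sup>2)"
proof -
  note sub = wl_rate_sublevel[OF rate K good B1 s sL k comp \<nu> r1 q1]
  have "\<exists>b. minimizes (wl_crit (k * L) (gh \<omega>) \<omega>) b"
  proof (rule exists_minimizer)
    have pt: "continuous_on UNIV (\<lambda>b. loss_wl \<psi> D b (gh \<omega>) z)" for z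
      unfolding loss_wl_def
      by (cases z) (auto intro!: continuous_intros lin_continuous continuous_on_compose2[OF link_primitive_continuous])
    show "continuous_on UNIV (wl_crit (k * L) (gh \<omega>) \<omega>)"
      unfolding samp_mean_def by (intro continuous_intros pt penalty_continuous) (use n_pos in auto)
    show "wl_crit (k * L) (gh \<omega>) \<omega> b = wl_crit (k * L) (gh \<omega>) \<omega> b'" if "\<forall>j\<le>p. b j = b' j" for b b'
      by (simp add: loss_wl_def crit_dependence[OF that])
    show "(\<Sum>j\<le>p. \<bar>b j - ab j\<bar>) \<le> B * (s * L)" if "wl_crit (k * L) (gh \<omega>) \<omega> b \<le> wl_crit (k * L) (gh \<omega>) \<omega> ab" for b
      using sub[OF that] by (simp add: l1_norm_def)
  qed
  then have "minimizes (wl_crit (k * L) (gh \<omega>) \<omega>) (ah \<omega>)"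
    using est \<omega> unfolding estimator_wl_def estimator_of_def by blast
  then have "wl_crit (k * L) (gh \<omega>) \<omega> (ah \<omega>) \<le> wl_crit (k * L) (gh \<omega>) \<omega> ab" by (simp add: is_arg_min_linorder)
  then show ?thesis unfolding \<delta>_def by (rule sub)
qed

end

section \<open>Expansion of the augmented estimator\<close>

text \<open>
  The constants only need to be independent of the sample; their summands follow the order of the terms in
  \<open>aipw_expansion\<close>, after averaging.
\<close>

definition rem_mean :: "real \<Rightarrow> real \<Rightarrow> real \<Rightarrow> real \<Rightarrow> real \<Rightarrow> real \<Rightarrow> real" where
  "rem_mean C1 C3 D1 a1 K B = (K * B + a1 * B + K * (1 + B)) + (C1 * exp C3 * C3 + 3 * (C1 * exp C3)) * B
     + C1 * exp C3 * C3 * (B + K * B\<^sup>2) + (3 + 3 * (C1 * exp C3)) * B + 3 * (D1\<^sup>2 * B + K * B\<^sup>2)"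

definition rem_square :: "real \<Rightarrow> real \<Rightarrow> real \<Rightarrow> real \<Rightarrow> real \<Rightarrow> real \<Rightarrow> real \<Rightarrow> real" where
  "rem_square C0 B0 C1 C3 D1 K B =
     3 * (C1 * exp C3)\<^sup>2 * ((1 + exp (- B0))\<^sup>2 + 9 * (exp (- B0))\<^sup>2) * (C0 * B)\<^sup>2
     + 27 * exp (- B0) * (D1\<^sup>2 * B + K * B\<^sup>2)"

context regular_sample
begin

text \<open>
  With \<open>W\<close>, \<open>M\<close> and \<open>e\<close> the changes of weight and regression and the residual at the target, the difference is
  \<open>(1 - t - t w) M + t W e - t W M\<close>. Linearizing \<open>M\<close> in the first term and \<open>W\<close> in the second leaves
  quadratic remainders, and the third is a product of two errors.
\<close>

lemma aipw_expansion:
  fixes \<gamma> \<alpha> :: "nat \<Rightarrow> real"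
  assumes good: "good K a0 a1 \<omega>" and i: "i < n" and z: "Z i \<omega> = (y, t, x)"
    and u: "C0 * l1_norm D (\<lambda>j. \<gamma> j - gb j) \<le> 1" and d: "C0 * l1_norm D (\<lambda>j. \<alpha> j - ab j) \<le> 1"
  defines "\<delta>1 \<equiv> \<lambda>j. \<gamma> j - gb j" and "\<delta>2 \<equiv> \<lambda>j. \<alpha> j - ab j" and "Cm \<equiv> C1 * exp C3"
  shows "\<bar>fitted_aipw \<psi> D \<gamma> \<alpha> (y, t, x) - \<phi> (y, t, x)
      - ((\<Sum>j\<le>p. \<delta>2 j * cal_score_curv j (y, t, x)) + (\<Sum>j\<le>p. \<delta>1 j * wl_score j (y, t, x)))\<bar>
    \<le> (Cm * C3 + 3 * Cm) * (t * w x * (lin D \<delta>2 x)\<^sup>2) + Cm * C3 * ((1 - t) * (lin D \<delta>2 x)\<^sup>2)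
      + (3 + 3 * Cm) * (t * w x * (lin D \<delta>1 x)\<^sup>2) + 3 * (t * w x * (y - m x)\<^sup>2 * (lin D \<delta>1 x)\<^sup>2)" (is ?lin)
    and "(fitted_aipw \<psi> D \<gamma> \<alpha> (y, t, x) - \<phi> (y, t, x))\<^sup>2
    \<le> 3 * Cm\<^sup>2 * ((1 + exp (- B0))\<^sup>2 + 9 * (exp (- B0))\<^sup>2) * (C0 * l1_norm D \<delta>2)\<^sup>2
      + 27 * exp (- B0) * (t * w x * (y - m x)\<^sup>2 * (lin D \<delta>1 x)\<^sup>2)" (is ?sq)
proof -
  note o = good_obs[OF good i z]
  let ?u = "lin D \<delta>1 x" and ?d = "lin D \<delta>2 x" and ?h = "lin D ab x"
  define M where "M = \<psi> (lin D \<alpha> x) - m x"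
  define W where "W = wt D \<gamma> x - w x"
  define e where "e = y - m x"
  have ub: "\<bar>?u\<bar> \<le> 1" using o(7)[of \<delta>1] u unfolding \<delta>1_def by linarith
  have db: "\<bar>?d\<bar> \<le> 1" using o(7)[of \<delta>2] d unfolding \<delta>2_def by linarith
  have C3: "0 \<le> C3" and C1: "0 < C1" using const_pos by auto
  have Cm: "0 < Cm" using C1 by (simp add: Cm_def)
  have wp: "0 < w x" by (rule w_pos)
  have lin_a: "lin D \<alpha> x = ?h + ?d" by (simp add: \<delta>2_def lin_diff)
  have ex: "exp (C3 * \<bar>?d\<bar>) \<le> exp C3" using mult_left_mono[OF db C3] by simp
  have c: "0 \<le> \<psi>2 ?h" "\<psi>2 ?h \<le> C1" using link_curv_nonneg o(5) by auto
  have cx: "\<psi>2 ?h * exp (C3 * \<bar>?d\<bar>) \<le> Cm" unfolding Cm_def using c ex C1 by (intro mult_mono) auto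
  have M1: "\<bar>M\<bar> \<le> Cm * \<bar>?d\<bar>"
    using link_diff(1)[of ?h ?d] mult_right_mono[OF cx, of "\<bar>?d\<bar>"] by (simp add: M_def lin_a)
  have "\<psi>2 ?h * C3 * exp (C3 * \<bar>?d\<bar>) * ?d\<^sup>2 = (\<psi>2 ?h * exp (C3 * \<bar>?d\<bar>)) * (C3 * ?d\<^sup>2)" by simp
  also have "\<dots> \<le> Cm * (C3 * ?d\<^sup>2)" using cx C3 by (intro mult_right_mono) auto
  finally have M2: "\<bar>M - \<psi>2 ?h * ?d\<bar> \<le> Cm * C3 * ?d\<^sup>2"
    using link_diff(2)[of ?h ?d] by (simp add: M_def lin_a)
  have Weq: "W = w x * (exp (- ?u) - 1)" unfolding W_def by (subst wt_ratio) (simp add: \<delta>1_def algebra_simps)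
  have W1: "\<bar>W\<bar> \<le> w x * (3 * \<bar>?u\<bar>)"
    unfolding Weq abs_mult using abs_exp_diff_le_three(1)[OF ub] wp by simp
  have "W + w x * ?u = w x * (exp (- ?u) - 1 + ?u)" unfolding Weq by (simp add: algebra_simps)
  then have W2: "\<bar>W + w x * ?u\<bar> \<le> w x * (3 * ?u\<^sup>2)"
    using abs_exp_diff_le_three(2)[OF ub] wp by (simp add: abs_mult)
  have diff: "fitted_aipw \<psi> D \<gamma> \<alpha> (y, t, x) - \<phi> (y, t, x) = (- t * w x + (1 - t)) * M + t * W * e - t * W * M"
    unfolding aipw_eq M_def W_def e_def using o(1) by (elim disjE) (simp_all add: algebra_simps)
  have ed: "\<bar>e\<bar> \<le> 1 + e\<^sup>2" by (rule abs_le_one_add_square)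
  have u2: "0 \<le> w x * (3 * ?u\<^sup>2)" using wp by simp
  have T2: "\<bar>(W + w x * ?u) * e\<bar> \<le> 3 * (w x * ?u\<^sup>2) + 3 * (w x * e\<^sup>2 * ?u\<^sup>2)"
  proof -
    have "\<bar>(W + w x * ?u) * e\<bar> \<le> (w x * (3 * ?u\<^sup>2)) * (1 + e\<^sup>2)"
      unfolding abs_mult using W2 ed u2 by (intro mult_mono) auto
    then show ?thesis by (simp add: algebra_simps)
  qed
  have T3: "\<bar>W * M\<bar> \<le> 3 * Cm * (w x * ?u\<^sup>2) + 3 * Cm * (w x * ?d\<^sup>2)"
  proof -
    have "\<bar>W * M\<bar> \<le> (w x * (3 * \<bar>?u\<bar>)) * (Cm * \<bar>?d\<bar>)"
      unfolding abs_mult using W1 M1 wp by (intro mult_mono) auto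
    also have "\<dots> = (3 * Cm * w x) * (\<bar>?u\<bar> * \<bar>?d\<bar>)" by simp
    also have "\<dots> \<le> (3 * Cm * w x) * (?u\<^sup>2 + ?d\<^sup>2)"
    proof (rule mult_left_mono)
      have "0 \<le> (\<bar>?u\<bar> - \<bar>?d\<bar>)\<^sup>2 + (\<bar>?u\<bar>\<^sup>2 + \<bar>?d\<bar>\<^sup>2)" by simp
      then show "\<bar>?u\<bar> * \<bar>?d\<bar> \<le> ?u\<^sup>2 + ?d\<^sup>2" by (simp add: power2_diff)
    qed (use Cm wp in simp)
    finally show ?thesis by (simp add: algebra_simps)
  qed
  show ?lin
  proof (cases "t = 0")
    case True
    then show ?thesis
      unfolding diff sum_cal_score_curv sum_wl_score using M2 by simp
  next
    case False
    then have t: "t = 1" using o(1) by simp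
    have eq: "(- t * w x + (1 - t)) * M + t * W * e - t * W * M
        - ((- t * w x + (1 - t)) * \<psi>2 ?h * ?d + t * w x * (m x - y) * ?u)
        = - (w x * (M - \<psi>2 ?h * ?d)) + (W + w x * ?u) * e - W * M"
      by (simp add: t e_def algebra_simps)
    have T1: "\<bar>w x * (M - \<psi>2 ?h * ?d)\<bar> \<le> Cm * C3 * (w x * ?d\<^sup>2)"
      using mult_left_mono[OF M2, of "w x"] wp by (simp add: abs_mult mult_ac)
    have "\<bar>- (w x * (M - \<psi>2 ?h * ?d)) + (W + w x * ?u) * e - W * M\<bar>
        \<le> \<bar>w x * (M - \<psi>2 ?h * ?d)\<bar> + \<bar>(W + w x * ?u) * e\<bar> + \<bar>W * M\<bar>" by linarith
    also have "\<dots> \<le> Cm * C3 * (w x * ?d\<^sup>2) + (3 * (w x * ?u\<^sup>2) + 3 * (w x * e\<^sup>2 * ?u\<^sup>2))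
        + (3 * Cm * (w x * ?u\<^sup>2) + 3 * Cm * (w x * ?d\<^sup>2))"
      using T1 T2 T3 by linarith
    finally show ?thesis
      unfolding diff sum_cal_score_curv sum_wl_score eq by (simp add: t e_def algebra_simps)
  qed
  let ?w = "exp (- B0)"
  have d2: "?d\<^sup>2 \<le> (C0 * l1_norm D \<delta>2)\<^sup>2"
    using o(7)[of \<delta>2] by (metis abs_ge_zero power2_abs power_mono)
  have sc: "\<bar>- t * w x + (1 - t)\<bar> \<le> 1 + ?w" using o(1,4) wp by (auto intro: add_increasing)
  have M22: "M\<^sup>2 \<le> Cm\<^sup>2 * (C0 * l1_norm D \<delta>2)\<^sup>2"
  proof -
    have "M\<^sup>2 \<le> (Cm * \<bar>?d\<bar>)\<^sup>2" using M1 by (metis abs_ge_zero power2_abs power_mono)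
    also have "\<dots> = Cm\<^sup>2 * ?d\<^sup>2" by (simp add: power_mult_distrib)
    also have "\<dots> \<le> Cm\<^sup>2 * (C0 * l1_norm D \<delta>2)\<^sup>2" using d2 by (intro mult_left_mono) auto
    finally show ?thesis .
  qed
  have s1: "((- t * w x + (1 - t)) * M)\<^sup>2 \<le> (1 + ?w)\<^sup>2 * (Cm\<^sup>2 * (C0 * l1_norm D \<delta>2)\<^sup>2)"
  proof -
    have "(- t * w x + (1 - t))\<^sup>2 \<le> (1 + ?w)\<^sup>2" using sc by (metis abs_ge_zero power2_abs power_mono)
    then show ?thesis
      unfolding power_mult_distrib[of "- t * w x + (1 - t)" M] by (rule mult_mono[OF _ M22]) simp_all
  qed
  have W22: "W\<^sup>2 \<le> ?w * (9 * (w x * ?u\<^sup>2))"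
  proof -
    have "W\<^sup>2 \<le> (w x * (3 * \<bar>?u\<bar>))\<^sup>2" using W1 by (metis abs_ge_zero power2_abs power_mono)
    also have "\<dots> = w x * (9 * (w x * ?u\<^sup>2))" by (simp add: power2_eq_square)
    also have "\<dots> \<le> ?w * (9 * (w x * ?u\<^sup>2))" using o(4) wp by (intro mult_right_mono) auto
    finally show ?thesis .
  qed
  have s2: "(t * W * e)\<^sup>2 \<le> 9 * ?w * (t * w x * e\<^sup>2 * ?u\<^sup>2)"
  proof -
    have "W\<^sup>2 * e\<^sup>2 \<le> ?w * (9 * (w x * ?u\<^sup>2)) * e\<^sup>2" by (rule mult_right_mono[OF W22]) simp
    then show ?thesis using o(1) by (elim disjE) (simp_all add: power_mult_distrib mult_ac)
  qed
  have s3: "(t * W * M)\<^sup>2 \<le> 9 * ?w\<^sup>2 * (Cm\<^sup>2 * (C0 * l1_norm D \<delta>2)\<^sup>2)"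
  proof -
    have "?u\<^sup>2 \<le> 1" using ub by (simp add: abs_square_le_1)
    then have "w x * ?u\<^sup>2 \<le> ?w * 1" using o(4) wp by (intro mult_mono) auto
    then have "W\<^sup>2 \<le> ?w * (9 * ?w)" using W22 by (smt (verit) exp_gt_zero mult_left_mono)
    then have "W\<^sup>2 \<le> 9 * ?w\<^sup>2" by (simp add: power2_eq_square)
    then have "W\<^sup>2 * M\<^sup>2 \<le> 9 * ?w\<^sup>2 * (Cm\<^sup>2 * (C0 * l1_norm D \<delta>2)\<^sup>2)" using M22 by (intro mult_mono) auto
    moreover have "0 \<le> 9 * ?w\<^sup>2 * (Cm\<^sup>2 * (C0 * l1_norm D \<delta>2)\<^sup>2)" by simp
    ultimately show ?thesis using o(1) by (elim disjE) (simp_all add: power_mult_distrib)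
  qed
  have three: "(a + b - c)\<^sup>2 \<le> 3 * a\<^sup>2 + 3 * b\<^sup>2 + 3 * c\<^sup>2" for a b c :: real
  proof -
    have "0 \<le> (a - b)\<^sup>2 + (a + c)\<^sup>2 + (b + c)\<^sup>2" by simp
    then show ?thesis by (simp add: power2_eq_square algebra_simps)
  qed
  show ?sq
    unfolding diff using three[of "(- t * w x + (1 - t)) * M" "t * W * e" "t * W * M"] s1 s2 s3
    by (simp add: e_def algebra_simps)
qed

text \<open>
  The two linear terms pair an estimation error with the average of a centred score, and the good event
  bounds such a pairing by \<open>L\<close> times the \<open>l1\<close> norm of the error, up to a term of the same order \<open>s L\<^sup>2\<close>. All
  other terms are squares of the errors in norms that are at most \<open>s L\<^sup>2\<close> as well.
\<close>

lemma remainder_rates: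
  fixes \<gamma> \<alpha> :: "nat \<Rightarrow> real"
  assumes good: "good K a0 a1 \<omega>" and K: "0 \<le> K" and a1: "0 \<le> a1" and B: "0 \<le> B"
    and s1: "1 \<le> s" and sL: "s * L \<le> 1" "C0 * B * (s * L) \<le> 1"
  defines "\<delta>1 \<equiv> \<lambda>j. \<gamma> j - gb j" and "\<delta>2 \<equiv> \<lambda>j. \<alpha> j - ab j"
  assumes r1: "l1_norm D \<delta>1 \<le> B * (s * L)" "wnorm2 \<omega> \<delta>1 \<le> B * (s * L\<^sup>2)" "qform p Sig \<delta>1 \<delta>1 \<le> B * (s * L\<^sup>2)"
    and r2: "l1_norm D \<delta>2 \<le> B * (s * L)" "wnorm2 \<omega> \<delta>2 \<le> B * (s * L\<^sup>2)" "qform p Sig \<delta>2 \<delta>2 \<le> B * (s * L\<^sup>2)"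
  shows "\<bar>emp \<omega> (fitted_aipw \<psi> D \<gamma> \<alpha>) - emp \<omega> \<phi>\<bar> \<le> rem_mean C1 C3 D1 a1 K B * (s * L\<^sup>2)"
    and "emp \<omega> (\<lambda>z. (fitted_aipw \<psi> D \<gamma> \<alpha> z - \<phi> z)\<^sup>2) \<le> rem_square C0 B0 C1 C3 D1 K B * (s * L)\<^sup>2"
proof -
  define Cm where "Cm = C1 * exp C3"
  have C3: "0 \<le> C3" and Cm: "0 \<le> Cm" and C0: "0 \<le> C0" using const_pos by (auto simp: Cm_def)
  have "C0 * l1_norm D \<delta>1 \<le> C0 * (B * (s * L))" "C0 * l1_norm D \<delta>2 \<le> C0 * (B * (s * L))"
    by (intro mult_left_mono r1 r2 C0)+
  then have small: "C0 * l1_norm D \<delta>1 \<le> 1" "C0 * l1_norm D \<delta>2 \<le> 1" and d2: "C0 * l1_norm D \<delta>2 \<le> (C0 * B) * (s * L)"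
    using sL(2) by (simp_all only: mult.assoc)
  note expand = aipw_expansion[OF good _ _ small[unfolded \<delta>1_def \<delta>2_def]]
  let ?A = "\<lambda>z. (\<Sum>j\<le>p. \<delta>2 j * cal_score_curv j z) + (\<Sum>j\<le>p. \<delta>1 j * wl_score j z)"
  let ?g = "\<lambda>z. fitted_aipw \<psi> D \<gamma> \<alpha> z - \<phi> z - ?A z"
  let ?t1 = "\<lambda>(y, t, x). t * w x * (lin D \<delta>2 x)\<^sup>2" and ?t2 = "\<lambda>(y :: real, t, x). (1 - t) * (lin D \<delta>2 x)\<^sup>2"
    and ?t3 = "\<lambda>(y, t, x). t * w x * (lin D \<delta>1 x)\<^sup>2" and ?t4 = "\<lambda>(y, t, x). t * w x * (y - m x)\<^sup>2 * (lin D \<delta>1 x)\<^sup>2"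
  note rr1 = res2_rate[OF good K s1 sL(1) B r1(1) r1(3)]
  note rr2 = res2_rate(1)[OF good K s1 sL(1) B r2(1) r2(3)]
  have ctl: "emp \<omega> ?t2 \<le> (B + K * B\<^sup>2) * (s * L\<^sup>2)"
    using good_gram(2)[OF good, of \<delta>2] r2(3) rr2 by (simp add: distrib_right)
  have "\<bar>emp \<omega> ?g\<bar> \<le> emp \<omega> (\<lambda>z. \<bar>?g z\<bar>)" by (rule samp_mean_abs)
  also have "\<dots> \<le> emp \<omega> (\<lambda>z. (Cm * C3 + 3 * Cm) * ?t1 z + Cm * C3 * ?t2 z + (3 + 3 * Cm) * ?t3 z + 3 * ?t4 z)"
  proof (rule samp_mean_mono)
    fix i assume i: "i < n"
    obtain y t x where z: "Z i \<omega> = (y, t, x)" by (cases "Z i \<omega>") auto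
    show "\<bar>?g (Z i \<omega>)\<bar> \<le> (Cm * C3 + 3 * Cm) * ?t1 (Z i \<omega>) + Cm * C3 * ?t2 (Z i \<omega>) + (3 + 3 * Cm) * ?t3 (Z i \<omega>) + 3 * ?t4 (Z i \<omega>)"
      unfolding z prod.case \<delta>1_def \<delta>2_def Cm_def by (rule expand(1)[OF i z])
  qed
  also have "\<dots> = (Cm * C3 + 3 * Cm) * emp \<omega> ?t1 + Cm * C3 * emp \<omega> ?t2 + (3 + 3 * Cm) * emp \<omega> ?t3 + 3 * emp \<omega> ?t4"
    by (simp only: samp_mean_add samp_mean_cmult)
  also have "\<dots> \<le> (Cm * C3 + 3 * Cm) * (B * (s * L\<^sup>2)) + Cm * C3 * ((B + K * B\<^sup>2) * (s * L\<^sup>2))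
      + (3 + 3 * Cm) * (B * (s * L\<^sup>2)) + 3 * ((D1\<^sup>2 * B + K * B\<^sup>2) * (s * L\<^sup>2))"
    using r1(2) r2(2) ctl rr1(2) C3 Cm by (intro add_mono mult_left_mono) auto
  finally have R: "\<bar>emp \<omega> ?g\<bar> \<le> \<dots>" .
  have eqg: "emp \<omega> ?g = emp \<omega> (fitted_aipw \<psi> D \<gamma> \<alpha>) - emp \<omega> \<phi>
      - ((\<Sum>j\<le>p. \<delta>2 j * emp \<omega> (cal_score_curv j)) + (\<Sum>j\<le>p. \<delta>1 j * emp \<omega> (wl_score j)))"
    by (simp only: samp_mean_diff samp_mean_add mean_sum)
  have sL2: "L * (B * (s * L)) = B * (s * L\<^sup>2)" by (simp add: power2_eq_square)
  have A1: "\<bar>\<Sum>j\<le>p. \<delta>2 j * emp \<omega> (cal_score_curv j)\<bar> \<le> K * B * (s * L\<^sup>2)"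
  proof -
    have "\<bar>emp \<omega> (cal_score_curv j)\<bar> \<le> K * L" if "j \<le> p" for j using good that by (simp add: good_def)
    then have "\<bar>\<Sum>j\<le>p. \<delta>2 j * emp \<omega> (cal_score_curv j)\<bar> \<le> (\<Sum>j\<le>p. \<bar>\<delta>2 j\<bar> * (K * L))"
      by (intro order_trans[OF sum_abs] sum_mono) (auto simp: abs_mult intro!: mult_left_mono)
    also have "\<dots> = K * (L * l1_norm D \<delta>2)" unfolding l1_norm_def sum_distrib_left by (intro sum.cong refl) (simp only: mult_ac)
    also have "\<dots> \<le> K * (L * (B * (s * L)))" using r2(1) K L_pos by (intro mult_left_mono) auto
    finally show ?thesis by (simp only: sL2 mult.assoc)
  qed
  have A2: "\<bar>\<Sum>j\<le>p. \<delta>1 j * emp \<omega> (wl_score j)\<bar> \<le> (a1 * B + K * (1 + B)) * (s * L\<^sup>2)"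
  proof -
    have "sqrt (qform p Sig \<delta>1 \<delta>1) \<le> (1 + B) * s * L"
    proof (rule real_le_lsqrt)
      have "B \<le> (1 + B)\<^sup>2" using B by (simp add: power2_eq_square algebra_simps)
      moreover have "s \<le> s\<^sup>2" using s1 by (simp add: power2_eq_square)
      ultimately have "B * s \<le> (1 + B)\<^sup>2 * s\<^sup>2" using B s1 by (intro mult_mono) auto
      then have "(B * s) * L\<^sup>2 \<le> ((1 + B)\<^sup>2 * s\<^sup>2) * L\<^sup>2" by (intro mult_right_mono) auto
      then show "qform p Sig \<delta>1 \<delta>1 \<le> ((1 + B) * s * L)\<^sup>2" using r1(3) by (simp add: power_mult_distrib mult.assoc)
    qed (use B s1 L_pos in simp)
    then have "K * L * sqrt (qform p Sig \<delta>1 \<delta>1) \<le> K * L * ((1 + B) * s * L)"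
      using K L_pos by (intro mult_left_mono) auto
    moreover have "a1 * L * l1_norm D \<delta>1 \<le> a1 * L * (B * (s * L))"
      using r1(1) a1 L_pos by (intro mult_left_mono) auto
    ultimately have "a1 * L * l1_norm D \<delta>1 + K * L * sqrt (qform p Sig \<delta>1 \<delta>1) \<le> (a1 * B + K * (1 + B)) * (s * L\<^sup>2)"
      by (simp add: power2_eq_square algebra_simps)
    then show ?thesis using good_score(2)[OF good, of \<delta>1] by linarith
  qed
  have rm: "rem_mean C1 C3 D1 a1 K B * (s * L\<^sup>2) = K * B * (s * L\<^sup>2) + (a1 * B + K * (1 + B)) * (s * L\<^sup>2)
      + ((Cm * C3 + 3 * Cm) * (B * (s * L\<^sup>2)) + Cm * C3 * ((B + K * B\<^sup>2) * (s * L\<^sup>2))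
      + (3 + 3 * Cm) * (B * (s * L\<^sup>2)) + 3 * ((D1\<^sup>2 * B + K * B\<^sup>2) * (s * L\<^sup>2)))"
    unfolding rem_mean_def Cm_def by algebra
  show "\<bar>emp \<omega> (fitted_aipw \<psi> D \<gamma> \<alpha>) - emp \<omega> \<phi>\<bar> \<le> rem_mean C1 C3 D1 a1 K B * (s * L\<^sup>2)"
    unfolding rm using R A1 A2 unfolding eqg by linarith
  let ?c = "3 * Cm\<^sup>2 * ((1 + exp (- B0))\<^sup>2 + 9 * (exp (- B0))\<^sup>2)"
  have "emp \<omega> (\<lambda>z. (fitted_aipw \<psi> D \<gamma> \<alpha> z - \<phi> z)\<^sup>2)
      \<le> emp \<omega> (\<lambda>z. ?c * (C0 * l1_norm D \<delta>2)\<^sup>2 + 27 * exp (- B0) * ?t4 z)"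
  proof (rule samp_mean_mono)
    fix i assume i: "i < n"
    obtain y t x where z: "Z i \<omega> = (y, t, x)" by (cases "Z i \<omega>") auto
    show "(fitted_aipw \<psi> D \<gamma> \<alpha> (Z i \<omega>) - \<phi> (Z i \<omega>))\<^sup>2 \<le> ?c * (C0 * l1_norm D \<delta>2)\<^sup>2 + 27 * exp (- B0) * ?t4 (Z i \<omega>)"
      unfolding z prod.case \<delta>1_def \<delta>2_def Cm_def by (rule expand(2)[OF i z])
  qed
  also have "\<dots> = ?c * (C0 * l1_norm D \<delta>2)\<^sup>2 + 27 * exp (- B0) * emp \<omega> ?t4"
  proof -
    have "emp \<omega> (\<lambda>z. ?c * (C0 * l1_norm D \<delta>2)\<^sup>2) = ?c * (C0 * l1_norm D \<delta>2)\<^sup>2"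
      using n_pos by (simp add: samp_mean_def)
    then show ?thesis by (simp only: samp_mean_add samp_mean_cmult)
  qed
  also have "\<dots> \<le> ?c * ((C0 * B)\<^sup>2 * (s * L)\<^sup>2) + 27 * exp (- B0) * ((D1\<^sup>2 * B + K * B\<^sup>2) * (s * L)\<^sup>2)"
  proof (intro add_mono mult_left_mono)
    have "(C0 * l1_norm D \<delta>2)\<^sup>2 \<le> ((C0 * B) * (s * L))\<^sup>2"
      using d2 C0 l1_nonneg by (intro power_mono) auto
    then show "(C0 * l1_norm D \<delta>2)\<^sup>2 \<le> (C0 * B)\<^sup>2 * (s * L)\<^sup>2" by (simp only: power_mult_distrib)
    have "s * L\<^sup>2 \<le> s\<^sup>2 * L\<^sup>2" using s1 by (intro mult_right_mono) (auto simp: power2_eq_square)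
    then have "s * L\<^sup>2 \<le> (s * L)\<^sup>2" by (simp only: power_mult_distrib)
    then have "(D1\<^sup>2 * B + K * B\<^sup>2) * (s * L\<^sup>2) \<le> (D1\<^sup>2 * B + K * B\<^sup>2) * (s * L)\<^sup>2"
      using B K by (intro mult_left_mono) auto
    then show "emp \<omega> ?t4 \<le> (D1\<^sup>2 * B + K * B\<^sup>2) * (s * L)\<^sup>2" using rr1(2) by linarith
  qed auto
  also have "\<dots> = rem_square C0 B0 C1 C3 D1 K B * (s * L)\<^sup>2"
    unfolding rem_square_def Cm_def by algebra
  finally show "emp \<omega> (\<lambda>z. (fitted_aipw \<psi> D \<gamma> \<alpha> z - \<phi> z)\<^sup>2) \<le> rem_square C0 B0 C1 C3 D1 K B * (s * L)\<^sup>2" .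
qed

end

section \<open>Characteristic functions and moving normal limits\<close>

lemma char_normal_law:
  assumes "0 \<le> v"
  shows "char (normal_law v) t = complex_of_real (exp (- (t\<^sup>2 * v) / 2))"
proof -
  have "char (normal_law v) t = char std_normal_distribution (sqrt v * t)"
    unfolding char_def normal_law_def by (subst integral_distr) (auto simp: mult_ac)
  also have "\<dots> = complex_of_real (exp (- ((sqrt v * t)\<^sup>2) / 2))" by (simp add: char_std_normal_distribution)
  also have "(sqrt v * t)\<^sup>2 = t\<^sup>2 * v" using assms by (simp add: power_mult_distrib)
  finally show ?thesis .
qed

text \<open>
  Used below with subsequences along which the moving variance converges.
\<close>

lemma tendsto_subsequence_criterion:
  fixes a :: "nat \<Rightarrow> 'a :: metric_space"
  assumes "\<And>r. strict_mono (r :: nat \<Rightarrow> nat) \<Longrightarrow> \<exists>s. strict_mono (s :: nat \<Rightarrow> nat) \<and> (\<lambda>n. a (r (s n))) \<longlonglongrightarrow> l"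
  shows "a \<longlonglongrightarrow> l"
proof (rule ccontr)
  assume "\<not> a \<longlonglongrightarrow> l"
  then obtain e where e: "0 < e" "\<not> (\<forall>\<^sub>F n in sequentially. dist (a n) l < e)"
    unfolding tendsto_iff by blast
  then have "infinite {n. e \<le> dist (a n) l}"
    by (simp add: not_eventually frequently_sequentially infinite_nat_iff_unbounded_le not_less)
  then obtain r :: "nat \<Rightarrow> nat" where r: "strict_mono r" "\<And>n. r n \<in> {n. e \<le> dist (a n) l}"
    using infinite_enumerate by blast
  obtain s :: "nat \<Rightarrow> nat" where "(\<lambda>n. a (r (s n))) \<longlonglongrightarrow> l" using assms[OF r(1)] by blast
  then have "\<forall>\<^sub>F n in sequentially. dist (a (r (s n))) l < e" using e(1) by (rule tendstoD)
  then obtain n where "dist (a (r (s n))) l < e" by (auto simp: eventually_sequentially)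
  with r(2)[of "s n"] show False by simp
qed

lemma bounded_subsequence_converges:
  fixes V :: "nat \<Rightarrow> real"
  assumes "\<forall>\<^sub>F n in sequentially. 0 \<le> V n \<and> V n \<le> B" "strict_mono (r :: nat \<Rightarrow> nat)"
  obtains s v where "strict_mono (s :: nat \<Rightarrow> nat)" "(\<lambda>n. V (r (s n))) \<longlonglongrightarrow> v" "0 \<le> v" "v \<le> B"
proof -
  have ev: "\<forall>\<^sub>F n in sequentially. 0 \<le> V (r n) \<and> V (r n) \<le> B"
    by (rule eventually_subseq[OF assms(2,1)])
  then obtain N where N: "\<And>n. N \<le> n \<Longrightarrow> V (r n) \<in> {0..B}" by (auto simp: eventually_sequentially)
  have "compact {0..B}" by simp
  then obtain l s where l: "l \<in> {0..B}" "strict_mono (s :: nat \<Rightarrow> nat)" "((\<lambda>n. V (r (n + N))) \<circ> s) \<longlonglongrightarrow> l"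
    using N unfolding compact_def by (elim allE[of _ "\<lambda>n. V (r (n + N))"]) auto
  have "strict_mono (\<lambda>n. s n + N)" using l(2) by (auto simp: strict_mono_def)
  then show ?thesis using l by (intro that[of "\<lambda>n. s n + N" l]) (auto simp: o_def)
qed

text \<open>
  Every subsequence has a further one along which the bounded variances converge, and along it Levy's
  continuity theorem applies.
\<close>

lemma asymp_normal_char:
  assumes \<mu>: "\<And>n. real_distribution (\<mu> n)"
    and V: "\<forall>\<^sub>F n in sequentially. 0 \<le> V n \<and> V n \<le> B"
    and char: "\<And>t. (\<lambda>n. char (\<mu> n) t - complex_of_real (exp (- (t\<^sup>2 * V n) / 2))) \<longlonglongrightarrow> 0"
  shows "asymp_normal \<mu> V"
  unfolding asymp_normal_def
proof (intro allI impI)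
  fix g :: "real \<Rightarrow> real" assume g: "(\<forall>x. isCont g x) \<and> (\<exists>B. \<forall>x. \<bar>g x\<bar> \<le> B)"
  show "(\<lambda>n. integral\<^sup>L (\<mu> n) g - integral\<^sup>L (normal_law (V n)) g) \<longlonglongrightarrow> 0"
  proof (rule tendsto_subsequence_criterion)
    fix r :: "nat \<Rightarrow> nat" assume r: "strict_mono r"
    obtain s v where s: "strict_mono (s :: nat \<Rightarrow> nat)" "(\<lambda>n. V (r (s n))) \<longlonglongrightarrow> v" "0 \<le> v"
      using bounded_subsequence_converges[OF V r] by metis
    have rs: "strict_mono (\<lambda>n. r (s n))" using r s(1) by (auto simp: strict_mono_def)
    have "weak_conv_m (\<lambda>n. \<mu> (r (s n))) (normal_law v)"
    proof (rule levy_continuity[OF \<mu> real_distribution_normal_law])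
      fix t
      have "(\<lambda>n. (char (\<mu> (r (s n))) t - complex_of_real (exp (- (t\<^sup>2 * V (r (s n))) / 2)))
          + complex_of_real (exp (- (t\<^sup>2 * V (r (s n))) / 2))) \<longlonglongrightarrow> 0 + complex_of_real (exp (- (t\<^sup>2 * v) / 2))"
        using LIMSEQ_subseq_LIMSEQ[OF char rs] by (intro tendsto_add tendsto_intros s(2)) (auto simp: o_def)
      then show "(\<lambda>n. char (\<mu> (r (s n))) t) \<longlonglongrightarrow> char (normal_law v) t"
        by (simp add: char_normal_law[OF s(3)])
    qed
    then have "asymp_normal (\<lambda>n. \<mu> (r (s n))) (\<lambda>n. V (r (s n)))"
      by (rule asymp_normal_iff[where \<mu>="\<lambda>n. \<mu> (r (s n))", OF \<mu> s(2), THEN iffD2])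
    then have "(\<lambda>n. integral\<^sup>L (\<mu> (r (s n))) g - integral\<^sup>L (normal_law (V (r (s n)))) g) \<longlonglongrightarrow> 0"
      using g unfolding asymp_normal_def by blast
    then show "\<exists>s. strict_mono (s :: nat \<Rightarrow> nat) \<and>
        (\<lambda>n. integral\<^sup>L (\<mu> (r (s n))) g - integral\<^sup>L (normal_law (V (r (s n)))) g) \<longlonglongrightarrow> 0"
      using s(1) by blast
  qed
qed

lemma exp_power_approx:
  fixes a :: real
  assumes n: "0 < n" and a: "0 \<le> a" and that: "a \<le> n"
  shows "\<bar>(1 - a / n) ^ n - exp (- a)\<bar> \<le> a\<^sup>2 * exp a / n"
proof -
  have e: "exp (- a) = exp (- (a / n)) ^ n" using n by (simp add: exp_of_nat_mult[symmetric])
  have an: "0 \<le> a / n" "a / n \<le> 1" using that n a by auto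
  have "norm ((1 - a / n) ^ n - exp (- (a / n)) ^ n) \<le> real n * norm ((1 - a / n) - exp (- (a / n)))"
    using an by (intro norm_power_diff) auto
  also have "norm ((1 - a / n) - exp (- (a / n))) \<le> (a / n)\<^sup>2 * exp \<bar>a / n\<bar>"
    using exp_minus_diff_le(2)[of "a / n"] by (simp add: abs_minus_commute algebra_simps)
  also have "\<dots> \<le> (a / n)\<^sup>2 * exp a"
  proof (rule mult_left_mono)
    have "a / n \<le> a / 1" using a n by (intro divide_left_mono) auto
    then show "exp \<bar>a / n\<bar> \<le> exp a" using an by simp
  qed simp
  also have "real n * ((a / n)\<^sup>2 * exp a) = a\<^sup>2 * exp a / n" using n by (simp add: power2_eq_square)
  finally show ?thesis using n by (simp add: e mult_left_mono)
qed

lemma norm_power_diff':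
  fixes x y :: complex
  assumes "norm x \<le> 1" "norm y \<le> 1" "norm (x - y) \<le> e" shows "norm (x ^ n - y ^ n) \<le> n * e"
  using norm_power_diff[OF assms(1,2), of n] mult_left_mono[OF assms(3), of "real n"] by simp

text \<open>
  A quantitative central limit theorem: the characteristic function of a normalized sum is close to the
  Gaussian one as soon as the square of a summand is well approximated by its truncation.
\<close>

lemma (in iid_obs) char_mean:
  assumes g: "g \<in> borel_measurable P" and g2: "integrable P (\<lambda>z. (g z)\<^sup>2)" and g0: "(\<integral>z. g z \<partial>P) = 0"
    and tn: "t\<^sup>2 * (\<integral>z. (g z)\<^sup>2 \<partial>P) \<le> n" and K: "0 \<le> K"
  defines "v \<equiv> (\<integral>z. (g z)\<^sup>2 \<partial>P)"
  shows "cmod (char (distr Q borel (\<lambda>\<omega>. sqrt n * mean g \<omega>)) t - complex_of_real (exp (- (t\<^sup>2 * v) / 2)))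
    \<le> t\<^sup>2 * (\<integral>z. (g z)\<^sup>2 * indicator {z. K < \<bar>g z\<bar>} z \<partial>P) + \<bar>t\<bar> ^ 3 * K * v / sqrt n
      + (t\<^sup>2 * v)\<^sup>2 * exp (t\<^sup>2 * v) / n"
proof -
  let ?\<mu> = "distr P borel g" and ?s = "t / sqrt n"
  interpret \<mu>: real_distribution ?\<mu> using g by (rule P.real_distribution_distr)
  have g1: "integrable P g" by (rule P.square_integrable_imp_integrable[OF g g2])
  have v0: "0 \<le> v" by (simp add: v_def)
  have "(\<lambda>\<omega>. sqrt n * mean g \<omega>) = (\<lambda>\<omega>. \<Sum>i<n. g (Z i \<omega>) / sqrt n)"
    using n_pos by (simp add: fun_eq_iff samp_mean_def sum_divide_distrib[symmetric] field_simps)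
  then have "char (distr Q borel (\<lambda>\<omega>. sqrt n * mean g \<omega>)) t = char (distr Q borel (\<lambda>\<omega>. \<Sum>i<n. g (Z i \<omega>) / sqrt n)) t"
    by simp
  also have "\<dots> = (\<Prod>i<n. char (distr Q borel (\<lambda>\<omega>. g (Z i \<omega>) / sqrt n)) t)"
    by (rule char_distr_sum) (rule indep_obs[of "\<lambda>_ z. g z / sqrt n"], use g in simp)
  also have "\<dots> = (\<Prod>i<n. char ?\<mu> ?s)"
  proof (rule prod.cong[OF refl])
    fix i assume "i \<in> {..<n}"
    then have i: "i < n" by simp
    have gi: "(\<lambda>\<omega>. g (Z i \<omega>) / sqrt n) \<in> borel_measurable Q" using obs_measurable[OF g i] by simp
    have "char (distr Q borel (\<lambda>\<omega>. g (Z i \<omega>) / sqrt n)) t = (CLINT \<omega>|Q. iexp (t * (g (Z i \<omega>) / sqrt n)))"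
      unfolding char_def using gi by (subst integral_distr) auto
    also have "\<dots> = (CLINT z|distr Q P (Z i). iexp (t * (g z / sqrt n)))"
      using g Z_measurable[OF i] by (subst integral_distr) auto
    also have "\<dots> = char ?\<mu> ?s"
      unfolding law[OF i] char_def using g by (subst integral_distr) (auto simp: field_simps)
    finally show "char (distr Q borel (\<lambda>\<omega>. g (Z i \<omega>) / sqrt n)) t = char ?\<mu> ?s" .
  qed
  finally have ch: "char (distr Q borel (\<lambda>\<omega>. sqrt n * mean g \<omega>)) t = char ?\<mu> ?s ^ n" by simp
  have s2: "?s\<^sup>2 = t\<^sup>2 / n" by (simp add: power_divide)
  have m: "integrable ?\<mu> (\<lambda>x. x)" "\<mu>.expectation (\<lambda>x. x) = 0" "integrable ?\<mu> (\<lambda>x. x\<^sup>2)" "\<mu>.variance (\<lambda>x. x) = v"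
    using g g1 g2 g0 by (simp_all add: integrable_distr_eq integral_distr v_def)
  have ap: "cmod (char ?\<mu> ?s - (1 - ?s\<^sup>2 * v / 2)) \<le> (?s\<^sup>2 / 6) * \<mu>.expectation (\<lambda>x. min (6 * x\<^sup>2) (\<bar>?s\<bar> * \<bar>x\<bar> ^ 3))"
    by (rule \<mu>.char_approx3[OF m])
  let ?tail = "\<integral>z. (g z)\<^sup>2 * indicator {z. K < \<bar>g z\<bar>} z \<partial>P"
  have ti: "integrable P (\<lambda>z. (g z)\<^sup>2 * indicator {z. K < \<bar>g z\<bar>} z)"
    by (rule Bochner_Integration.integrable_bound[OF g2]) (use g in \<open>auto simp: indicator_def\<close>)
  have "\<mu>.expectation (\<lambda>x. min (6 * x\<^sup>2) (\<bar>?s\<bar> * \<bar>x\<bar> ^ 3)) = (\<integral>z. min (6 * (g z)\<^sup>2) (\<bar>?s\<bar> * \<bar>g z\<bar> ^ 3) \<partial>P)"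
    using g by (subst integral_distr) auto
  also have "\<dots> \<le> (\<integral>z. 6 * ((g z)\<^sup>2 * indicator {z. K < \<bar>g z\<bar>} z) + \<bar>?s\<bar> * K * (g z)\<^sup>2 \<partial>P)"
  proof (rule integral_mono)
    show "integrable P (\<lambda>z. min (6 * (g z)\<^sup>2) (\<bar>?s\<bar> * \<bar>g z\<bar> ^ 3))"
      by (rule Bochner_Integration.integrable_bound[of _ "\<lambda>z. 6 * (g z)\<^sup>2"]) (use g g2 in auto)
    show "integrable P (\<lambda>z. 6 * ((g z)\<^sup>2 * indicator {z. K < \<bar>g z\<bar>} z) + \<bar>?s\<bar> * K * (g z)\<^sup>2)"
      using ti g2 by auto
    show "min (6 * (g z)\<^sup>2) (\<bar>?s\<bar> * \<bar>g z\<bar> ^ 3) \<le> 6 * ((g z)\<^sup>2 * indicator {z. K < \<bar>g z\<bar>} z) + \<bar>?s\<bar> * K * (g z)\<^sup>2" for z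
    proof (cases "K < \<bar>g z\<bar>")
      case True
      have "0 \<le> \<bar>?s\<bar> * K * (g z)\<^sup>2" using K by simp
      moreover have "indicator {z. K < \<bar>g z\<bar>} z = (1 :: real)" using True by simp
      ultimately have "6 * (g z)\<^sup>2 \<le> 6 * ((g z)\<^sup>2 * indicator {z. K < \<bar>g z\<bar>} z) + \<bar>?s\<bar> * K * (g z)\<^sup>2" by simp
      then show ?thesis by (rule min.coboundedI1)
    next
      case False
      have "\<bar>?s\<bar> * \<bar>g z\<bar> ^ 3 = \<bar>?s\<bar> * \<bar>g z\<bar> * (g z)\<^sup>2" by (simp add: power3_eq_cube power2_eq_square)
      also have "\<dots> \<le> \<bar>?s\<bar> * K * (g z)\<^sup>2" using False by (intro mult_right_mono mult_left_mono) auto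
      finally have "\<bar>?s\<bar> * \<bar>g z\<bar> ^ 3 \<le> \<bar>?s\<bar> * K * (g z)\<^sup>2" .
      moreover have "indicator {z. K < \<bar>g z\<bar>} z = (0 :: real)" using False by simp
      ultimately have "\<bar>?s\<bar> * \<bar>g z\<bar> ^ 3 \<le> 6 * ((g z)\<^sup>2 * indicator {z. K < \<bar>g z\<bar>} z) + \<bar>?s\<bar> * K * (g z)\<^sup>2" by simp
      then show ?thesis by (rule min.coboundedI2)
    qed
  qed
  also have "\<dots> = 6 * ?tail + \<bar>?s\<bar> * K * v" using ti g2 by (simp add: v_def)
  finally have "cmod (char ?\<mu> ?s - (1 - ?s\<^sup>2 * v / 2)) \<le> (?s\<^sup>2 / 6) * (6 * ?tail + \<bar>?s\<bar> * K * v)"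
    using ap by (smt (verit) mult_left_mono zero_le_power2 divide_nonneg_pos)
  also have "\<dots> \<le> ?s\<^sup>2 * ?tail + \<bar>?s\<bar> ^ 3 * K * v"
  proof -
    have "0 \<le> \<bar>?s\<bar> ^ 3 * K * v" using K v0 by simp
    moreover have "(?s\<^sup>2 / 6) * (6 * ?tail + \<bar>?s\<bar> * K * v) = ?s\<^sup>2 * ?tail + (\<bar>?s\<bar> ^ 3 * K * v) / 6"
      by (simp add: power3_eq_cube power2_eq_square algebra_simps)
    ultimately show ?thesis by linarith
  qed
  finally have e1: "cmod (char ?\<mu> ?s - complex_of_real (1 - (t\<^sup>2 * v / 2) / n)) \<le> ?s\<^sup>2 * ?tail + \<bar>?s\<bar> ^ 3 * K * v"
    by (simp add: s2 mult.commute)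
  let ?a = "t\<^sup>2 * v / 2"
  have a: "0 \<le> ?a" "?a \<le> n" using v0 tn by (simp_all add: v_def)
  have "cmod (char ?\<mu> ?s ^ n - complex_of_real (1 - ?a / n) ^ n) \<le> n * (?s\<^sup>2 * ?tail + \<bar>?s\<bar> ^ 3 * K * v)"
  proof (rule norm_power_diff'[OF \<mu>.cmod_char_le_1 _ e1])
    have "\<bar>1 - ?a / n\<bar> \<le> 1" using a n_pos by (auto simp: abs_le_iff field_simps)
    then show "cmod (complex_of_real (1 - ?a / n)) \<le> 1" by (simp only: norm_of_real)
  qed
  also have "\<dots> = t\<^sup>2 * ?tail + \<bar>t\<bar> ^ 3 * K * v / sqrt n"
  proof -
    have "n * ?s\<^sup>2 = t\<^sup>2" using n_pos by (simp add: s2)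
    moreover have "n * \<bar>?s\<bar> ^ 3 = \<bar>t\<bar> ^ 3 / sqrt n"
      using n_pos by (simp add: power_divide abs_divide power3_eq_cube)
    ultimately have "n * (?s\<^sup>2 * ?tail) = t\<^sup>2 * ?tail" "n * (\<bar>?s\<bar> ^ 3 * K * v) = \<bar>t\<bar> ^ 3 / sqrt n * K * v"
      by (simp_all only: mult.assoc[symmetric])
    then show ?thesis by (simp only: distrib_left) simp
  qed
  finally have A: "cmod (char ?\<mu> ?s ^ n - complex_of_real (1 - ?a / n) ^ n) \<le> t\<^sup>2 * ?tail + \<bar>t\<bar> ^ 3 * K * v / sqrt n" .
  have "cmod (complex_of_real (1 - ?a / n) ^ n - complex_of_real (exp (- ?a))) = \<bar>(1 - ?a / n) ^ n - exp (- ?a)\<bar>"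
    by (metis norm_of_real of_real_diff of_real_power)
  also have "\<dots> \<le> ?a\<^sup>2 * exp ?a / n" by (rule exp_power_approx[OF n_pos a])
  also have "\<dots> \<le> (t\<^sup>2 * v)\<^sup>2 * exp (t\<^sup>2 * v) / n"
  proof (rule divide_right_mono)
    have "?a \<le> t\<^sup>2 * v" using v0 by simp
    then have "?a\<^sup>2 \<le> (t\<^sup>2 * v)\<^sup>2" "exp ?a \<le> exp (t\<^sup>2 * v)"
      using a(1) by (simp_all only: power_mono exp_le_cancel_iff)
    then show "?a\<^sup>2 * exp ?a \<le> (t\<^sup>2 * v)\<^sup>2 * exp (t\<^sup>2 * v)" by (intro mult_mono) simp_all
  qed simp
  finally have B: "cmod (complex_of_real (1 - ?a / n) ^ n - complex_of_real (exp (- ?a))) \<le> (t\<^sup>2 * v)\<^sup>2 * exp (t\<^sup>2 * v) / n" .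
  have "- (t\<^sup>2 * v) / 2 = - ?a" by simp
  then show ?thesis unfolding ch
    using A B norm_triangle_ineq[of "char ?\<mu> ?s ^ n - complex_of_real (1 - ?a / n) ^ n" "complex_of_real (1 - ?a / n) ^ n - complex_of_real (exp (- ?a))"]
    by (simp only: diff_add_cancel add_diff_eq)
qed

section \<open>Truncation and uniform integrability\<close>

context regular_population
begin

lemma mu1_bound:
  assumes K: "1 \<le> K" and e: "0 \<le> e"
    and ui: "(\<integral>\<^sup>+\<omega>. ennreal ((Y1 \<omega>)\<^sup>2) * indicator {\<omega>. K < \<bar>Y1 \<omega>\<bar>} \<omega> \<partial>M) \<le> ennreal e"
  shows "\<bar>mu1 D\<bar> \<le> K + e"
proof -
  have Yi: "integrable M Y1" using model by (auto simp: population_model_def)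
  have im: "(\<lambda>\<omega>. ennreal ((Y1 \<omega>)\<^sup>2) * indicator {\<omega>. K < \<bar>Y1 \<omega>\<bar>} \<omega>) \<in> borel_measurable M" by measurable
  have "ennreal \<bar>mu1 D\<bar> \<le> (\<integral>\<^sup>+\<omega>. ennreal \<bar>Y1 \<omega>\<bar> \<partial>M)"
    unfolding mu1_def using integral_norm_bound_ennreal[OF Yi] by simp
  also have "\<dots> \<le> (\<integral>\<^sup>+\<omega>. ennreal K + ennreal ((Y1 \<omega>)\<^sup>2) * indicator {\<omega>. K < \<bar>Y1 \<omega>\<bar>} \<omega> \<partial>M)"
  proof (rule nn_integral_mono)
    fix \<omega>
    show "ennreal \<bar>Y1 \<omega>\<bar> \<le> ennreal K + ennreal ((Y1 \<omega>)\<^sup>2) * indicator {\<omega>. K < \<bar>Y1 \<omega>\<bar>} \<omega>"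
    proof (cases "K < \<bar>Y1 \<omega>\<bar>")
      case True
      then have "1 * \<bar>Y1 \<omega>\<bar> \<le> \<bar>Y1 \<omega>\<bar> * \<bar>Y1 \<omega>\<bar>" using K by (intro mult_right_mono) auto
      then have "ennreal \<bar>Y1 \<omega>\<bar> \<le> ennreal ((Y1 \<omega>)\<^sup>2)" by (intro ennreal_leI) (simp add: power2_eq_square)
      then show ?thesis using True by (simp add: add_increasing)
    qed (auto intro: ennreal_leI)
  qed
  also have "\<dots> = ennreal K + (\<integral>\<^sup>+\<omega>. ennreal ((Y1 \<omega>)\<^sup>2) * indicator {\<omega>. K < \<bar>Y1 \<omega>\<bar>} \<omega> \<partial>M)"
    using im by (subst nn_integral_add) (simp_all add: emeasure_space_1)
  also have "\<dots> \<le> ennreal K + ennreal e" by (rule add_left_mono[OF ui])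
  also have "\<dots> = ennreal (K + e)" using K e by (subst ennreal_plus) auto
  finally show ?thesis using K e by (subst (asm) ennreal_le_iff) auto
qed

text \<open>
  If a sum of three terms exceeds \<open>3 K\<close> while the third is at most \<open>K\<close>, the larger of the other two exceeds \<open>K\<close> and
  is at least a third of the sum.
\<close>

lemma square_indicator_le:
  fixes x a b :: real
  assumes "\<bar>x\<bar> \<le> \<bar>a\<bar> + \<bar>b\<bar> + c" "c \<le> K" "0 \<le> K"
  shows "x\<^sup>2 * indicator {x. 3 * K < \<bar>x\<bar>} x \<le> 9 * (a\<^sup>2 * indicator {a. K < \<bar>a\<bar>} a) + 9 * (b\<^sup>2 * indicator {b. K < \<bar>b\<bar>} b)"
proof (cases "3 * K < \<bar>x\<bar>")
  case True
  define t where "t = max \<bar>a\<bar> \<bar>b\<bar>"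
  have t: "K < t" "\<bar>x\<bar> \<le> 3 * t" using True assms by (auto simp: t_def max_def)
  then have "\<bar>x\<bar>\<^sup>2 \<le> (3 * t)\<^sup>2" by (intro power_mono) auto
  then have x: "x\<^sup>2 \<le> 9 * t\<^sup>2" by (simp add: power_mult_distrib)
  have nn: "0 \<le> a\<^sup>2 * indicator {a. K < \<bar>a\<bar>} a" "0 \<le> b\<^sup>2 * indicator {b. K < \<bar>b\<bar>} b" by simp_all
  have ind: "indicator {x. 3 * K < \<bar>x\<bar>} x = (1 :: real)" using True by simp
  have "t = \<bar>a\<bar> \<or> t = \<bar>b\<bar>" by (auto simp: t_def max_def)
  then show ?thesis
  proof
    assume "t = \<bar>a\<bar>"
    then have "a\<^sup>2 * indicator {a. K < \<bar>a\<bar>} a = t\<^sup>2" using t by simp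
    then show ?thesis using x nn(2) unfolding ind by linarith
  next
    assume "t = \<bar>b\<bar>"
    then have "b\<^sup>2 * indicator {b. K < \<bar>b\<bar>} b = t\<^sup>2" using t by simp
    then show ?thesis using x nn(1) unfolding ind by linarith
  qed
next
  case False
  then have "indicator {x. 3 * K < \<bar>x\<bar>} x = (0 :: real)" by simp
  then show ?thesis by (simp only: mult_zero_right) (intro add_nonneg_nonneg mult_nonneg_nonneg, simp_all)
qed

text \<open>
  Beyond the level \<open>K\<close> the square is at most the fourth power divided by \<open>K\<^sup>2\<close>, and the exponential moment
  bounds the fourth power.
\<close>

lemma residual_tail:
  assumes K: "0 < K" and W: "0 \<le> W"
  shows "(\<integral>\<^sup>+\<omega>. ennreal ((W * (Y1 \<omega> - m (X \<omega>)))\<^sup>2 * indicator {b. K < \<bar>b\<bar>} (W * (Y1 \<omega> - m (X \<omega>)))) \<partial>M)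
    \<le> ennreal (2 * W ^ 4 * D0\<^sup>2 * D1\<^sup>2 / K\<^sup>2)"
proof -
  let ?g = "\<lambda>\<omega>. ennreal (exp ((Y1 \<omega> - m (X \<omega>))\<^sup>2 / D0\<^sup>2) - 1)"
  let ?c = "2 * W ^ 4 * D0 ^ 4 / K\<^sup>2"
  have c: "0 \<le> ?c" by simp
  have pt: "(W * e)\<^sup>2 * indicator {b. K < \<bar>b\<bar>} (W * e) \<le> ?c * (exp (e\<^sup>2 / D0\<^sup>2) - 1)" for e :: real
  proof (cases "K < \<bar>W * e\<bar>")
    case True
    have "K\<^sup>2 \<le> (W * e)\<^sup>2" using True K by (intro abs_le_square_iff[THEN iffD1]) auto
    then have "K\<^sup>2 * (W * e)\<^sup>2 \<le> (W * e)\<^sup>2 * (W * e)\<^sup>2" by (rule mult_right_mono) simp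
    also have "\<dots> = W ^ 4 * (e\<^sup>2)\<^sup>2" by (simp add: power_mult_distrib power4_eq_xxxx power2_eq_square mult_ac)
    also have "\<dots> \<le> W ^ 4 * (2 * D0 ^ 4 * (exp (e\<^sup>2 / D0\<^sup>2) - 1))"
    proof (rule mult_left_mono)
      have q: "x\<^sup>2 \<le> 2 * (exp x - 1)" if "0 \<le> x" for x :: real
      proof -
        have "a \<le> 2 * (b - 1)" if "1 + x + a / 2 \<le> b" for a b :: real using that \<open>0 \<le> x\<close> by argo
        then show ?thesis using exp_lower_Taylor_quadratic[OF that] by blast
      qed
      have "(e\<^sup>2 / D0\<^sup>2)\<^sup>2 \<le> 2 * (exp (e\<^sup>2 / D0\<^sup>2) - 1)" by (rule q) simp
      moreover have "(e\<^sup>2 / D0\<^sup>2)\<^sup>2 = (e\<^sup>2)\<^sup>2 / D0 ^ 4" by (simp add: power_divide power4_eq_xxxx power2_eq_square)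
      ultimately have "(e\<^sup>2)\<^sup>2 / D0 ^ 4 \<le> 2 * (exp (e\<^sup>2 / D0\<^sup>2) - 1)" by simp
      then show "(e\<^sup>2)\<^sup>2 \<le> 2 * D0 ^ 4 * (exp (e\<^sup>2 / D0\<^sup>2) - 1)"
        using const_pos by (simp only: pos_divide_le_eq[OF zero_less_power] mult_ac)
    qed simp
    finally have "K\<^sup>2 * (W * e)\<^sup>2 \<le> 2 * W ^ 4 * D0 ^ 4 * (exp (e\<^sup>2 / D0\<^sup>2) - 1)" by (simp only: mult_ac)
    then have "(W * e)\<^sup>2 \<le> 2 * W ^ 4 * D0 ^ 4 * (exp (e\<^sup>2 / D0\<^sup>2) - 1) / K\<^sup>2"
      using K by (subst pos_le_divide_eq) (simp_all add: mult.commute)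
    then show ?thesis using True by simp
  next
    case False
    then have "indicator {b. K < \<bar>b\<bar>} (W * e) = (0 :: real)" by simp
    then show ?thesis using c by (simp only: mult_zero_right) (intro mult_nonneg_nonneg, simp_all)
  qed
  have "(\<integral>\<^sup>+\<omega>. ennreal ((W * (Y1 \<omega> - m (X \<omega>)))\<^sup>2 * indicator {b. K < \<bar>b\<bar>} (W * (Y1 \<omega> - m (X \<omega>)))) \<partial>M)
      \<le> (\<integral>\<^sup>+\<omega>. ennreal ?c * ?g \<omega> \<partial>M)"
    by (intro nn_integral_mono) (simp only: ennreal_mult'[OF c, symmetric], intro ennreal_leI pt)
  also have "\<dots> = ennreal ?c * (\<integral>\<^sup>+\<omega>. ?g \<omega> \<partial>M)" by (rule nn_integral_cmult) measurable
  also have "\<dots> \<le> ennreal ?c * ennreal (D1\<^sup>2 / D0\<^sup>2)" by (intro mult_left_mono residual_exp) simp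
  also have "\<dots> = ennreal (2 * W ^ 4 * D0\<^sup>2 * D1\<^sup>2 / K\<^sup>2)"
    using const_pos by (subst ennreal_mult'[OF c, symmetric]) (simp add: power4_eq_xxxx power2_eq_square mult.assoc)
  finally show ?thesis .
qed

text \<open>
  By \<open>phi_bound\<close> the influence function is dominated by the treated potential outcome plus a multiple of its
  residual; the tail of the first is assumed to be small, that of the second is by \<open>residual_tail\<close>.
\<close>

lemma phi_tail:
  fixes K e :: real
  assumes K: "0 < K" "\<bar>mu1 D\<bar> \<le> K" and e: "0 \<le> e"
    and ui: "(\<integral>\<^sup>+\<omega>. ennreal ((Y1 \<omega>)\<^sup>2) * indicator {\<omega>. K < \<bar>Y1 \<omega>\<bar>} \<omega> \<partial>M) \<le> ennreal e"
  defines "b \<equiv> 9 * e + 18 * (1 + exp (- B0)) ^ 4 * D0\<^sup>2 * D1\<^sup>2 / K\<^sup>2"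
  shows "integrable P (\<lambda>z. (\<phi> z - mu1 D)\<^sup>2)"
    and "(\<integral>z. (\<phi> z - mu1 D)\<^sup>2 * indicator {z. 3 * K < \<bar>\<phi> z - mu1 D\<bar>} z \<partial>P) \<le> b"
    and "asy_var \<psi> D gb ab \<le> 9 * K\<^sup>2 + b"
proof -
  let ?W = "1 + exp (- B0)" and ?f = "\<lambda>z. (\<phi> z - mu1 D)\<^sup>2 * indicator {z. 3 * K < \<bar>\<phi> z - mu1 D\<bar>} z"
  interpret P: prob_space P by (rule prob_space_obs_law)
  note [measurable] = phi_measurable
  have pm: "\<phi> \<in> borel_measurable (obs_space D)" using phi_measurable by (simp cong: measurable_cong_sets)
  have W: "0 \<le> ?W" by (simp add: add_nonneg_nonneg)
  have b0: "0 \<le> b" using e by (simp add: b_def)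
  have fm: "?f \<in> borel_measurable P" by measurable
  have fm': "(\<lambda>z. ennreal (?f z)) \<in> borel_measurable (obs_space D)" using fm by (simp cong: measurable_cong_sets)
  let ?a = "\<lambda>\<omega>. (Y1 \<omega>)\<^sup>2 * indicator {a. K < \<bar>a\<bar>} (Y1 \<omega>)"
  let ?e = "\<lambda>\<omega>. (?W * (Y1 \<omega> - m (X \<omega>)))\<^sup>2 * indicator {b. K < \<bar>b\<bar>} (?W * (Y1 \<omega> - m (X \<omega>)))"
  have "(\<integral>\<^sup>+z. ennreal (?f z) \<partial>P) = (\<integral>\<^sup>+\<omega>. ennreal (?f (observe D \<omega>)) \<partial>M)" by (rule obs_nn_integral[OF fm'])
  also have "\<dots> \<le> (\<integral>\<^sup>+\<omega>. ennreal 9 * ennreal (?a \<omega>) + ennreal 9 * ennreal (?e \<omega>) \<partial>M)"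
  proof (rule nn_integral_mono_AE, use phi_bound in eventually_elim)
    case (elim \<omega>)
    have "\<bar>\<phi> (observe D \<omega>) - mu1 D\<bar> \<le> \<bar>Y1 \<omega>\<bar> + \<bar>?W * (Y1 \<omega> - m (X \<omega>))\<bar> + \<bar>mu1 D\<bar>"
      using elim W by (simp only: abs_mult abs_of_nonneg[OF W])
    from square_indicator_le[OF this K(2) less_imp_le[OF K(1)]]
    have "?f (observe D \<omega>) \<le> 9 * ?a \<omega> + 9 * ?e \<omega>" by (simp only: indicator_def mem_Collect_eq)
    then have "ennreal (?f (observe D \<omega>)) \<le> ennreal (9 * ?a \<omega> + 9 * ?e \<omega>)" by (rule ennreal_leI)
    also have "\<dots> = ennreal 9 * ennreal (?a \<omega>) + ennreal 9 * ennreal (?e \<omega>)"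
      by (subst ennreal_plus) (simp_all only: ennreal_mult' mult_nonneg_nonneg zero_le_power2 indicator_pos_le zero_le_numeral)
    finally show ?case .
  qed
  also have "\<dots> = ennreal 9 * (\<integral>\<^sup>+\<omega>. ennreal (?a \<omega>) \<partial>M) + ennreal 9 * (\<integral>\<^sup>+\<omega>. ennreal (?e \<omega>) \<partial>M)"
    by (subst nn_integral_add; (subst nn_integral_cmult)?; (subst nn_integral_cmult)?; measurable)
  also have "\<dots> \<le> ennreal 9 * ennreal e + ennreal 9 * ennreal (2 * ?W ^ 4 * D0\<^sup>2 * D1\<^sup>2 / K\<^sup>2)"
  proof (intro add_mono mult_left_mono)
    have "(\<integral>\<^sup>+\<omega>. ennreal (?a \<omega>) \<partial>M) = (\<integral>\<^sup>+\<omega>. ennreal ((Y1 \<omega>)\<^sup>2) * indicator {\<omega>. K < \<bar>Y1 \<omega>\<bar>} \<omega> \<partial>M)"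
      by (intro nn_integral_cong) (simp add: indicator_def)
    then show "(\<integral>\<^sup>+\<omega>. ennreal (?a \<omega>) \<partial>M) \<le> ennreal e" using ui by simp
    show "(\<integral>\<^sup>+\<omega>. ennreal (?e \<omega>) \<partial>M) \<le> ennreal (2 * ?W ^ 4 * D0\<^sup>2 * D1\<^sup>2 / K\<^sup>2)" by (rule residual_tail[OF K(1) W])
  qed simp_all
  also have "\<dots> = ennreal b"
    unfolding b_def using e
    by (simp only: ennreal_mult'[symmetric] zero_le_numeral) (subst ennreal_plus[symmetric], simp_all add: algebra_simps)
  finally have le: "(\<integral>\<^sup>+z. ennreal (?f z) \<partial>P) \<le> ennreal b" .
  have fi: "integrable P ?f"
    using fm le_less_trans[OF le ennreal_less_top] by (intro integrableI_nonneg) auto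
  show tail: "(\<integral>z. ?f z \<partial>P) \<le> b"
    using le b0 by (subst (asm) nn_integral_eq_integral[OF fi]) auto
  have dom: "(\<phi> z - mu1 D)\<^sup>2 \<le> 9 * K\<^sup>2 + ?f z" for z
  proof (cases "3 * K < \<bar>\<phi> z - mu1 D\<bar>")
    case False
    then have "\<bar>\<phi> z - mu1 D\<bar>\<^sup>2 \<le> (3 * K)\<^sup>2" by (intro power_mono) auto
    then show ?thesis using False by (simp add: power_mult_distrib)
  qed simp
  show si: "integrable P (\<lambda>z. (\<phi> z - mu1 D)\<^sup>2)"
  proof (rule Bochner_Integration.integrable_bound)
    show "integrable P (\<lambda>z. 9 * K\<^sup>2 + ?f z)" using fi by simp
    show "AE z in P. norm ((\<phi> z - mu1 D)\<^sup>2) \<le> norm (9 * K\<^sup>2 + ?f z)"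
    proof (intro AE_I2)
      fix z
      have "norm ((\<phi> z - mu1 D)\<^sup>2) = (\<phi> z - mu1 D)\<^sup>2" by simp
      also have "\<dots> \<le> 9 * K\<^sup>2 + ?f z" by (rule dom)
      also have "\<dots> \<le> norm (9 * K\<^sup>2 + ?f z)" unfolding real_norm_def by (rule abs_ge_self)
      finally show "norm ((\<phi> z - mu1 D)\<^sup>2) \<le> norm (9 * K\<^sup>2 + ?f z)" .
    qed
  qed measurable
  have "asy_var \<psi> D gb ab \<le> (\<integral>z. 9 * K\<^sup>2 + ?f z \<partial>P)"
    unfolding asy_var_eq using si fi dom by (intro integral_mono) auto
  also have "\<dots> = 9 * K\<^sup>2 + (\<integral>z. ?f z \<partial>P)" using fi P.prob_space[unfolded space_P] by simp
  finally show "asy_var \<psi> D gb ab \<le> 9 * K\<^sup>2 + b" using tail by linarith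
qed

end

context iid_obs
begin

text \<open>
  Chebyshev for the part of \<open>h\<close> below the level \<open>K\<close>, Markov for the part above it. Only first moments are
  assumed, since \<open>h\<close> will be the square of the influence function.
\<close>

lemma truncated_lln:
  fixes K e :: real
  assumes h: "integrable P h" and K: "0 \<le> K" and e: "0 < e"
  shows "prob {\<omega> \<in> space Q. 2 * e \<le> \<bar>mean h \<omega> - (\<integral>z. h z \<partial>P)\<bar>}
    \<le> K\<^sup>2 / (n * e\<^sup>2) + 2 * (\<integral>z. \<bar>h z\<bar> * indicator {z. K < \<bar>h z\<bar>} z \<partial>P) / e"
proof -
  have hm[measurable]: "h \<in> borel_measurable P" using h by simp
  define h1 where "h1 z = h z * indicator {z. \<bar>h z\<bar> \<le> K} z" for z
  define h2 where "h2 z = h z * indicator {z. K < \<bar>h z\<bar>} z" for z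
  have [measurable]: "h1 \<in> borel_measurable P" "h2 \<in> borel_measurable P"
    unfolding h1_def[abs_def] h2_def[abs_def] by measurable
  have split: "h = (\<lambda>z. h1 z + h2 z)" by (auto simp: fun_eq_iff h1_def h2_def indicator_def)
  have b1: "\<bar>h1 z\<bar> \<le> K" for z using K by (auto simp: h1_def indicator_def)
  have i1: "integrable P h1" by (rule P.integrable_const_bound[where B=K]) (use b1 in auto)
  have i2: "integrable P h2" by (rule Bochner_Integration.integrable_bound[OF h]) (auto simp: h2_def indicator_def)
  define g where "g z = h1 z - (\<integral>z. h1 z \<partial>P)" for z
  have [measurable]: "g \<in> borel_measurable P" unfolding g_def[abs_def] by measurable
  have sq1: "integrable P (\<lambda>z. (h1 z)\<^sup>2)"
    by (rule P.integrable_const_bound[where B="K\<^sup>2"]) (use b1 K in \<open>auto simp: abs_le_square_iff[symmetric]\<close>)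
  have g2: "integrable P (\<lambda>z. (g z)\<^sup>2)"
    unfolding g_def power2_diff using sq1 i1 by auto
  have g0: "(\<integral>z. g z \<partial>P) = 0" unfolding g_def using i1 by (simp add: P.prob_space)
  have gv: "(\<integral>z. (g z)\<^sup>2 \<partial>P) \<le> K\<^sup>2"
  proof -
    have "(\<integral>z. (g z)\<^sup>2 \<partial>P) = (\<integral>z. (h1 z)\<^sup>2 \<partial>P) - (\<integral>z. h1 z \<partial>P)\<^sup>2"
      unfolding g_def by (rule P.variance_eq[OF i1 sq1])
    also have "\<dots> \<le> (\<integral>z. (h1 z)\<^sup>2 \<partial>P)" by simp
    also have "\<dots> \<le> (\<integral>z. K\<^sup>2 \<partial>P)"
      using sq1 b1 K by (intro integral_mono) (auto simp: abs_le_square_iff[symmetric])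
    finally show ?thesis by (simp add: P.prob_space)
  qed
  let ?A = "{\<omega> \<in> space Q. e \<le> \<bar>mean g \<omega>\<bar>}" and ?B = "{\<omega> \<in> space Q. e \<le> mean (\<lambda>z. \<bar>h2 z\<bar>) \<omega> + (\<integral>z. \<bar>h2 z\<bar> \<partial>P)}"
  have [measurable]: "mean g \<in> borel_measurable Q" "mean (\<lambda>z. \<bar>h2 z\<bar>) \<in> borel_measurable Q"
    by (intro mean_measurable; measurable)+
  have AB: "?A \<in> events" "?B \<in> events" by measurable
  have sub: "{\<omega> \<in> space Q. 2 * e \<le> \<bar>mean h \<omega> - (\<integral>z. h z \<partial>P)\<bar>} \<subseteq> ?A \<union> ?B"
  proof safe
    fix \<omega> assume \<omega>: "\<omega> \<in> space Q" "2 * e \<le> \<bar>mean h \<omega> - (\<integral>z. h z \<partial>P)\<bar>" "\<not> e \<le> mean (\<lambda>z. \<bar>h2 z\<bar>) \<omega> + (\<integral>z. \<bar>h2 z\<bar> \<partial>P)"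
    have "mean h \<omega> = mean h1 \<omega> + mean h2 \<omega>"
      by (subst split) (simp add: samp_mean_def sum.distrib add_divide_distrib)
    moreover have "(\<integral>z. h z \<partial>P) = (\<integral>z. h1 z \<partial>P) + (\<integral>z. h2 z \<partial>P)" by (subst split) (simp add: i1 i2)
    moreover have "mean g \<omega> = mean h1 \<omega> - (\<integral>z. h1 z \<partial>P)"
      unfolding g_def using n_pos by (simp add: samp_mean_def sum_subtractf diff_divide_distrib)
    moreover have "\<bar>mean h2 \<omega>\<bar> \<le> mean (\<lambda>z. \<bar>h2 z\<bar>) \<omega>"
      unfolding samp_mean_def abs_divide by (intro order_trans[OF divide_right_mono[OF sum_abs]]) auto
    moreover have "\<bar>\<integral>z. h2 z \<partial>P\<bar> \<le> (\<integral>z. \<bar>h2 z\<bar> \<partial>P)" by (rule integral_abs_bound)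
    ultimately show "e \<le> \<bar>mean g \<omega>\<bar>" using \<omega>(2,3) by linarith
  qed
  have ia: "integrable P (\<lambda>z. \<bar>h2 z\<bar>)" using i2 by simp
  have pA: "prob ?A \<le> K\<^sup>2 / (n * e\<^sup>2)"
  proof -
    have "?A = {\<omega> \<in> space Q. e\<^sup>2 \<le> (mean g \<omega>)\<^sup>2}"
      using e by (auto simp: abs_le_square_iff[symmetric])
    also have "prob \<dots> \<le> (\<integral>\<omega>. (mean g \<omega>)\<^sup>2 \<partial>Q) / e\<^sup>2"
      by (rule integral_Markov_inequality_measure[where A="{}"]) (use second_moment_mean(1)[OF _ g2 g0] e in auto)
    also have "\<dots> = (\<integral>z. (g z)\<^sup>2 \<partial>P) / n / e\<^sup>2" using second_moment_mean(2)[OF _ g2 g0] by simp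
    also have "\<dots> \<le> K\<^sup>2 / n / e\<^sup>2" using gv by (intro divide_right_mono) auto
    finally show ?thesis by simp
  qed
  have pB: "prob ?B \<le> 2 * (\<integral>z. \<bar>h2 z\<bar> \<partial>P) / e"
  proof -
    have "prob ?B \<le> (\<integral>\<omega>. mean (\<lambda>z. \<bar>h2 z\<bar>) \<omega> + (\<integral>z. \<bar>h2 z\<bar> \<partial>P) \<partial>Q) / e"
      by (rule integral_Markov_inequality_measure[where A="{}"])
         (use integral_mean(1)[OF ia] e in \<open>auto intro!: AE_I2 add_nonneg_nonneg simp: samp_mean_def sum_nonneg\<close>)
    also have "\<dots> = 2 * (\<integral>z. \<bar>h2 z\<bar> \<partial>P) / e"
      using integral_mean[OF ia] by (simp add: prob_space)
    finally show ?thesis .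
  qed
  have h2a: "\<bar>h2 z\<bar> = \<bar>h z\<bar> * indicator {z. K < \<bar>h z\<bar>} z" for z by (simp add: h2_def abs_mult)
  have "prob {\<omega> \<in> space Q. 2 * e \<le> \<bar>mean h \<omega> - (\<integral>z. h z \<partial>P)\<bar>} \<le> prob (?A \<union> ?B)"
    using sub AB by (intro finite_measure_mono) auto
  also have "\<dots> \<le> prob ?A + prob ?B" by (rule measure_Un_le[OF AB])
  finally show ?thesis using pA pB unfolding h2a by linarith
qed

end

section \<open>High probability events and coverage\<close>

text \<open>
  Conditions enter through measurable events that imply them, which spares measurability arguments for
  conditions that quantify over all coefficient vectors.
\<close>

definition whp :: "(nat \<Rightarrow> 'w measure) \<Rightarrow> (nat \<Rightarrow> 'w \<Rightarrow> bool) \<Rightarrow> bool" where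
  "whp Q A \<longleftrightarrow> (\<forall>\<epsilon>>0. \<forall>\<^sub>F n in sequentially. \<exists>E\<in>sets (Q n). 1 - \<epsilon> \<le> measure (Q n) E \<and> (\<forall>\<omega>\<in>E. A n \<omega>))"

lemma whp_conj:
  assumes Q: "\<And>n. prob_space (Q n)" and A: "whp Q A" and B: "whp Q B"
  shows "whp Q (\<lambda>n \<omega>. A n \<omega> \<and> B n \<omega>)"
  unfolding whp_def
proof (intro allI impI)
  fix \<epsilon> :: real assume "0 < \<epsilon>"
  then have e2: "0 < \<epsilon> / 2" by simp
  from A e2 have "\<forall>\<^sub>F n in sequentially. \<exists>E\<in>sets (Q n). 1 - \<epsilon> / 2 \<le> measure (Q n) E \<and> (\<forall>\<omega>\<in>E. A n \<omega>)"
    unfolding whp_def by blast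
  moreover from B e2 have "\<forall>\<^sub>F n in sequentially. \<exists>E\<in>sets (Q n). 1 - \<epsilon> / 2 \<le> measure (Q n) E \<and> (\<forall>\<omega>\<in>E. B n \<omega>)"
    unfolding whp_def by blast
  ultimately show "\<forall>\<^sub>F n in sequentially. \<exists>E\<in>sets (Q n). 1 - \<epsilon> \<le> measure (Q n) E \<and> (\<forall>\<omega>\<in>E. A n \<omega> \<and> B n \<omega>)"
  proof eventually_elim
    case (elim n)
    interpret prob_space "Q n" by (rule Q)
    from elim obtain E F where E: "E \<in> sets (Q n)" "1 - \<epsilon> / 2 \<le> measure (Q n) E" "\<forall>\<omega>\<in>E. A n \<omega>"
      and F: "F \<in> sets (Q n)" "1 - \<epsilon> / 2 \<le> measure (Q n) F" "\<forall>\<omega>\<in>F. B n \<omega>" by blast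
    have "prob E + prob F - 1 \<le> prob (E \<inter> F)"
      using measure_Un3[of E "Q n" F] prob_le_1[of "E \<union> F"] E(1) F(1) fmeasurable_eq_sets by simp
    then have "1 - \<epsilon> \<le> prob (E \<inter> F)" using E(2) F(2) by linarith
    moreover have "E \<inter> F \<in> sets (Q n)" using E F by simp
    moreover have "\<forall>\<omega>\<in>E \<inter> F. A n \<omega> \<and> B n \<omega>" using E F by blast
    ultimately show ?case by blast
  qed
qed

lemma whp_measure_tendsto_0:
  assumes Q: "\<And>n. prob_space (Q n)" and A: "whp Q A"
    and B: "\<forall>\<^sub>F n in sequentially. B n \<in> sets (Q n)" and disj: "\<forall>\<^sub>F n in sequentially. \<forall>\<omega>\<in>B n. \<not> A n \<omega>"
  shows "(\<lambda>n. measure (Q n) (B n)) \<longlonglongrightarrow> 0"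
proof (rule tendstoI)
  fix e :: real assume e: "0 < e"
  then have "0 < e / 2" by simp
  with A have "\<forall>\<^sub>F n in sequentially. \<exists>E\<in>sets (Q n). 1 - e / 2 \<le> measure (Q n) E \<and> (\<forall>\<omega>\<in>E. A n \<omega>)"
    unfolding whp_def by blast
  then show "\<forall>\<^sub>F n in sequentially. dist (measure (Q n) (B n)) 0 < e"
    using B disj
  proof eventually_elim
    case (elim n)
    interpret prob_space "Q n" by (rule Q)
    from elim obtain E where E: "E \<in> sets (Q n)" "1 - e / 2 \<le> measure (Q n) E" "\<forall>\<omega>\<in>E. A n \<omega>" by blast
    have "B n \<subseteq> space (Q n) - E" using elim(3) E(3) sets.sets_into_space[OF elim(2)] by blast
    then have "prob (B n) \<le> prob (space (Q n) - E)" using E(1) by (intro finite_measure_mono) auto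
    also have "\<dots> = 1 - prob E" by (rule prob_compl[OF E(1)])
    finally show ?case using E(2) e by simp
  qed
qed

lemma whp_of_measure:
  assumes Q: "\<And>n. prob_space (Q n)"
    and B: "\<forall>\<^sub>F n in sequentially. {\<omega> \<in> space (Q n). \<not> A n \<omega>} \<in> sets (Q n)"
    and small: "\<And>\<epsilon>. 0 < \<epsilon> \<Longrightarrow> \<forall>\<^sub>F n in sequentially. measure (Q n) {\<omega> \<in> space (Q n). \<not> A n \<omega>} \<le> \<epsilon>"
  shows "whp Q A"
  unfolding whp_def
proof (intro allI impI)
  fix \<epsilon> :: real assume "0 < \<epsilon>"
  from B small[OF this] show "\<forall>\<^sub>F n in sequentially. \<exists>E\<in>sets (Q n). 1 - \<epsilon> \<le> measure (Q n) E \<and> (\<forall>\<omega>\<in>E. A n \<omega>)"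
  proof eventually_elim
    case (elim n)
    interpret prob_space "Q n" by (rule Q)
    let ?E = "space (Q n) - {\<omega> \<in> space (Q n). \<not> A n \<omega>}"
    have "1 - \<epsilon> \<le> prob ?E" using elim(2) by (simp add: prob_compl[OF elim(1)])
    moreover have "?E \<in> sets (Q n)" using elim(1) by blast
    moreover have "\<forall>\<omega>\<in>?E. A n \<omega>" by blast
    ultimately show ?case by blast
  qed
qed

text \<open>
  Slutsky's theorem in terms of characteristic functions: the distance is at most \<open>\<bar>t\<bar> e\<close> where the variables
  are within \<open>e\<close>, and at most 2 elsewhere.
\<close>

lemma (in prob_space) char_distr_diff:
  assumes X: "X \<in> borel_measurable M" and Y: "Y \<in> borel_measurable M" and e: "0 \<le> e"
  shows "cmod (char (distr M borel X) t - char (distr M borel Y) t)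
    \<le> \<bar>t\<bar> * e + 2 * prob {\<omega> \<in> space M. e < \<bar>X \<omega> - Y \<omega>\<bar>}"
proof -
  note [measurable] = X Y
  let ?B = "{\<omega> \<in> space M. e < \<bar>X \<omega> - Y \<omega>\<bar>}"
  have B: "?B \<in> events" by measurable
  have cX: "char (distr M borel X) t = (CLINT \<omega>|M. iexp (t * X \<omega>))" and cY: "char (distr M borel Y) t = (CLINT \<omega>|M. iexp (t * Y \<omega>))"
    unfolding char_def by (subst integral_distr; simp)+
  have iX: "integrable M (\<lambda>\<omega>. iexp (t * X \<omega>))" and iY: "integrable M (\<lambda>\<omega>. iexp (t * Y \<omega>))"
    by (intro integrable_const_bound[where B=1]; simp)+
  have "char (distr M borel X) t - char (distr M borel Y) t = (CLINT \<omega>|M. iexp (t * X \<omega>) - iexp (t * Y \<omega>))"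
    unfolding cX cY by (rule Bochner_Integration.integral_diff[OF iX iY, symmetric])
  then have "cmod (char (distr M borel X) t - char (distr M borel Y) t) \<le> (\<integral>\<omega>. cmod (iexp (t * X \<omega>) - iexp (t * Y \<omega>)) \<partial>M)"
    by (simp only: integral_norm_bound)
  also have "\<dots> \<le> (\<integral>\<omega>. \<bar>t\<bar> * e + 2 * indicator ?B \<omega> \<partial>M)"
  proof (rule integral_mono)
    show "integrable M (\<lambda>\<omega>. cmod (iexp (t * X \<omega>) - iexp (t * Y \<omega>)))"
      using Bochner_Integration.integrable_diff[OF iX iY] by (rule integrable_norm)
    show "integrable M (\<lambda>\<omega>. \<bar>t\<bar> * e + 2 * indicator ?B \<omega>)"
      by (intro Bochner_Integration.integrable_add integrable_const integrable_mult_right integrable_real_indicator)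
        (use B in \<open>simp_all add: emeasure_eq_measure\<close>)
    fix \<omega> assume \<omega>: "\<omega> \<in> space M"
    have "iexp (t * X \<omega>) - iexp (t * Y \<omega>) = iexp (t * Y \<omega>) * (iexp (t * (X \<omega> - Y \<omega>)) - 1)"
      by (simp add: right_diff_distrib exp_add[symmetric] algebra_simps)
    then have eq: "cmod (iexp (t * X \<omega>) - iexp (t * Y \<omega>)) = cmod (iexp (t * (X \<omega> - Y \<omega>)) - 1)"
      by (simp add: norm_mult)
    show "cmod (iexp (t * X \<omega>) - iexp (t * Y \<omega>)) \<le> \<bar>t\<bar> * e + 2 * indicator ?B \<omega>"
    proof (cases "e < \<bar>X \<omega> - Y \<omega>\<bar>")
      case True
      have "cmod (iexp (t * X \<omega>) - iexp (t * Y \<omega>)) \<le> cmod (iexp (t * X \<omega>)) + cmod (iexp (t * Y \<omega>))"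
        by (rule norm_triangle_ineq4)
      then show ?thesis using True \<omega> e by (simp add: add_increasing)
    next
      case False
      have "cmod (iexp (t * (X \<omega> - Y \<omega>)) - 1) \<le> \<bar>t * (X \<omega> - Y \<omega>)\<bar>"
        using iexp_approx1[of "t * (X \<omega> - Y \<omega>)" 0] by simp
      also have "\<dots> \<le> \<bar>t\<bar> * e" unfolding abs_mult using False by (intro mult_left_mono) auto
      finally have "cmod (iexp (t * X \<omega>) - iexp (t * Y \<omega>)) \<le> \<bar>t\<bar> * e" unfolding eq .
      moreover have "0 \<le> 2 * indicat_real ?B \<omega>" by simp
      ultimately show ?thesis by linarith
    qed
  qed
  also have "\<dots> = \<bar>t\<bar> * e + 2 * prob ?B"
  proof -
    have i: "integrable M (indicat_real ?B)" by (rule integrable_real_indicator[OF B]) (simp add: emeasure_eq_measure)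
    have "(\<integral>\<omega>. \<bar>t\<bar> * e + 2 * indicator ?B \<omega> \<partial>M) = (\<integral>\<omega>. \<bar>t\<bar> * e \<partial>M) + (\<integral>\<omega>. 2 * indicator ?B \<omega> \<partial>M)"
      by (rule Bochner_Integration.integral_add[OF integrable_const integrable_mult_right[OF i]])
    also have "(\<integral>\<omega>. 2 * indicat_real ?B \<omega> \<partial>M) = 2 * (\<integral>\<omega>. indicat_real ?B \<omega> \<partial>M)" by (rule integral_mult_right_zero)
    also have "(\<integral>\<omega>. indicat_real ?B \<omega> \<partial>M) = prob ?B" using sets.sets_into_space[OF B] by (subst Bochner_Integration.integral_indicator) (auto simp: Int_absorb2 sets.sets_into_space)
    finally show ?thesis by (simp add: prob_space)
  qed
  finally show ?thesis .
qed

abbreviation "\<Phi> \<equiv> cdf std_normal_distribution"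

interpretation std_normal: real_distribution std_normal_distribution
  by (rule real_dist_normal_dist)

lemma std_normal_point: "measure std_normal_distribution {x} = 0"
proof -
  have "{x} \<in> null_sets std_normal_distribution"
  proof (subst null_sets_density_iff)
    have "AE z in lborel. z \<in> {x} \<longrightarrow> ennreal (std_normal_density z) = 0"
      using AE_lborel_singleton[of x] by eventually_elim simp
    then show "{x} \<in> sets lborel \<and> (AE z in lborel. z \<in> {x} \<longrightarrow> ennreal (std_normal_density z) = 0)" by simp
  qed simp
  then show ?thesis by (simp add: measure_def null_sets_def)
qed

lemma std_normal_cdf_isCont: "isCont \<Phi> x"
  by (simp add: std_normal.isCont_cdf std_normal_point)

text \<open>
  The law is symmetric because its characteristic function is even.
\<close>

lemma std_normal_cdf_minus: "\<Phi> (- x) = 1 - \<Phi> x"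
proof -
  have rd: "real_distribution (distr std_normal_distribution borel uminus)"
    by (rule std_normal.real_distribution_distr) simp
  have "char (distr std_normal_distribution borel uminus) = char std_normal_distribution"
  proof
    fix t
    have "char (distr std_normal_distribution borel uminus) t = char std_normal_distribution (- t)"
      unfolding char_def by (subst integral_distr) auto
    then show "char (distr std_normal_distribution borel uminus) t = char std_normal_distribution t"
      by (simp add: char_std_normal_distribution)
  qed
  then have eq: "distr std_normal_distribution borel uminus = std_normal_distribution"
    by (rule Levy_uniqueness[OF rd real_dist_normal_dist])
  have "\<Phi> (- x) = measure (distr std_normal_distribution borel uminus) {..- x}" unfolding cdf_def eq ..
  also have "\<dots> = measure std_normal_distribution {x..}"
    by (subst measure_distr) (auto intro!: arg_cong[where f="measure std_normal_distribution"])
  also have "\<dots> = measure std_normal_distribution (space std_normal_distribution - {..<x})"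
    by (intro arg_cong[where f="measure std_normal_distribution"]) auto
  also have "\<dots> = 1 - measure std_normal_distribution {..<x}" by (rule std_normal.prob_compl) simp
  also have "measure std_normal_distribution {..<x} = \<Phi> x"
  proof -
    have "measure std_normal_distribution ({..<x} \<union> {x}) = measure std_normal_distribution {..<x} + measure std_normal_distribution {x}"
      by (rule std_normal.finite_measure_Union) auto
    moreover have "{..<x} \<union> {x} = {..x}" by auto
    ultimately show ?thesis by (simp add: cdf_def std_normal_point)
  qed
  finally show ?thesis .
qed

text \<open>
  The infimum defining the quantile is attained with equality since the distribution function is
  continuous.
\<close>

lemma std_normal_quantile_cdf:
  assumes "1 / 2 < q" "q < 1"
  shows "\<Phi> (std_normal_quantile q) = q" "0 \<le> std_normal_quantile q"
proof -
  let ?A = "{z. q \<le> \<Phi> z}" and ?z = "std_normal_quantile q"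
  have half: "\<Phi> 0 = 1 / 2" using std_normal_cdf_minus[of 0] by simp
  have "\<forall>\<^sub>F z in at_top. q < \<Phi> z"
    using std_normal.cdf_lim_at_top_prob assms(2) by (rule order_tendstoD)
  then have ne: "?A \<noteq> {}" by (auto simp: eventually_at_top_linorder intro: less_imp_le)
  have lb: "0 \<le> z" if "z \<in> ?A" for z
  proof (rule ccontr)
    assume "\<not> 0 \<le> z"
    then have "\<Phi> z \<le> \<Phi> 0" by (intro std_normal.cdf_nondecreasing) auto
    with that half assms(1) show False by simp
  qed
  have bb: "bdd_below ?A" using lb by (intro bdd_belowI[of _ 0])
  have "continuous_on UNIV \<Phi>" using std_normal_cdf_isCont by (intro continuous_at_imp_continuous_on) blast
  then have "closed ?A" by (intro closed_Collect_le) auto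
  then have zA: "?z \<in> ?A" unfolding std_normal_quantile_def by (rule closed_contains_Inf[OF ne bb])
  then show "0 \<le> ?z" by (rule lb)
  have "\<Phi> ?z \<le> q"
  proof (rule ccontr)
    assume "\<not> \<Phi> ?z \<le> q"
    then have "\<forall>\<^sub>F y in at_left ?z. q < \<Phi> y"
      using std_normal_cdf_isCont[of ?z] unfolding isCont_def
      by (intro order_tendstoD(1)[OF filterlim_mono[OF _ order_refl at_le[OF subset_UNIV]]]) auto
    then obtain b where "b < ?z" and b: "\<And>y. b < y \<Longrightarrow> y < ?z \<Longrightarrow> q < \<Phi> y"
      unfolding eventually_at_left_field by blast
    then obtain y where "b < y" "y < ?z" using dense by blast
    with b have "q < \<Phi> y" by blast
    then have "y \<in> ?A" by simp
    then have "?z \<le> y" unfolding std_normal_quantile_def by (rule cInf_lower[OF _ bb])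
    with \<open>y < ?z\<close> show False by simp
  qed
  with zA show "\<Phi> ?z = q" by simp
qed

lemma normal_law_cdf:
  assumes "0 < v"
  shows "cdf (normal_law v) x = \<Phi> (x / sqrt v)"
proof -
  have "cdf (normal_law v) x = measure std_normal_distribution ((\<lambda>z. sqrt v * z) -` {..x} \<inter> space std_normal_distribution)"
    unfolding cdf_def normal_law_def by (rule measure_distr) simp_all
  also have "(\<lambda>z. sqrt v * z) -` {..x} \<inter> space std_normal_distribution = {..x / sqrt v}"
    using assms by (auto simp: field_simps)
  finally show ?thesis by (simp add: cdf_def)
qed

text \<open>
  Along a subsequence on which \<open>V\<close> converges to some \<open>u > 0\<close>, the event is sandwiched, up to an event of small
  probability on which \<open>Vh\<close> is far from \<open>u\<close>, between intervals for \<open>S\<close> with endpoints near \<open>\<plusminus> z sqrt u\<close>. Their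
  probabilities converge since the limiting distribution function is continuous. The limit does not depend on
  \<open>u\<close>, which is why \<open>V\<close> itself need not converge.
\<close>

lemma self_normalized_coverage:
  fixes S Vh :: "nat \<Rightarrow> 'w \<Rightarrow> real"
  assumes Q: "\<And>n. prob_space (Q n)" and S: "\<And>n. S n \<in> borel_measurable (Q n)" and Vh: "\<And>n. Vh n \<in> borel_measurable (Q n)"
    and V: "0 < v" "\<forall>\<^sub>F n in sequentially. v \<le> V n" "\<forall>\<^sub>F n in sequentially. V n \<le> B"
    and normal: "asymp_normal (\<lambda>n. distr (Q n) borel (S n)) V"
    and consistent: "conv_in_prob_0 Q (\<lambda>n \<omega>. Vh n \<omega> - V n)"
    and z: "0 \<le> z"
  shows "(\<lambda>n. measure (Q n) {\<omega> \<in> space (Q n). \<bar>S n \<omega>\<bar> \<le> z * sqrt (Vh n \<omega>)}) \<longlonglongrightarrow> 2 * \<Phi> z - 1"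
proof (rule tendsto_subsequence_criterion)
  fix r :: "nat \<Rightarrow> nat" assume r: "strict_mono r"
  have "\<forall>\<^sub>F n in sequentially. 0 \<le> V n \<and> V n \<le> B" using V(2,3) by eventually_elim (use V(1) in auto)
  then obtain s u where s: "strict_mono (s :: nat \<Rightarrow> nat)" and u: "(\<lambda>n. V (r (s n))) \<longlonglongrightarrow> u"
    using bounded_subsequence_converges[OF _ r] by metis
  define R where "R n = r (s n)" for n
  have R: "strict_mono R" using r s by (auto simp: strict_mono_def R_def)
  have uR: "(\<lambda>n. V (R n)) \<longlonglongrightarrow> u" using u by (simp add: R_def)
  have "v \<le> u" by (rule tendsto_lowerbound[OF uR eventually_subseq[OF R V(2)]]) simp
  with V(1) have u0: "0 < u" by linarith
  have rd: "real_distribution (distr (Q n) borel (S n))" for n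
    by (rule prob_space.real_distribution_distr[OF Q S])
  have "asymp_normal (\<lambda>n. distr (Q (R n)) borel (S (R n))) (\<lambda>n. V (R n))"
    unfolding asymp_normal_def
  proof (intro allI impI)
    fix g :: "real \<Rightarrow> real" assume "(\<forall>x. isCont g x) \<and> (\<exists>B. \<forall>x. \<bar>g x\<bar> \<le> B)"
    then have "(\<lambda>n. integral\<^sup>L (distr (Q n) borel (S n)) g - integral\<^sup>L (normal_law (V n)) g) \<longlonglongrightarrow> 0"
      using normal unfolding asymp_normal_def by blast
    from LIMSEQ_subseq_LIMSEQ[OF this R]
    show "(\<lambda>n. integral\<^sup>L (distr (Q (R n)) borel (S (R n))) g - integral\<^sup>L (normal_law (V (R n))) g) \<longlonglongrightarrow> 0"
      by (simp add: o_def)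
  qed
  then have weak: "weak_conv_m (\<lambda>n. distr (Q (R n)) borel (S (R n))) (normal_law u)"
    by (rule asymp_normal_iff[where \<mu>="\<lambda>n. distr (Q (R n)) borel (S (R n))", OF rd uR, THEN iffD1])
  have cont: "isCont (\<lambda>x. \<Phi> (x / sqrt u)) x" for x
    by (rule isCont_o2[OF _ std_normal_cdf_isCont]) (use u0 in \<open>intro continuous_intros; simp\<close>)
  have cdf_lim: "(\<lambda>n. cdf (distr (Q (R n)) borel (S (R n))) x) \<longlonglongrightarrow> \<Phi> (x / sqrt u)" for x
  proof -
    have "cdf (normal_law u) = (\<lambda>x. \<Phi> (x / sqrt u))" by (rule ext) (rule normal_law_cdf[OF u0])
    then show ?thesis using weak cont unfolding weak_conv_m_def weak_conv_def by simp
  qed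
  let ?a = "z * sqrt u" and ?F = "\<lambda>x. \<Phi> (x / sqrt u)"
  have Fa: "?F ?a = \<Phi> z" "?F (- ?a) = 1 - \<Phi> z" using u0 by (simp_all add: std_normal_cdf_minus)
  have a0: "0 \<le> ?a" using z u0 by simp
  let ?A = "\<lambda>n. {\<omega> \<in> space (Q n). \<bar>S n \<omega>\<bar> \<le> z * sqrt (Vh n \<omega>)}"
  have lim: "(\<lambda>n. measure (Q (R n)) (?A (R n))) \<longlonglongrightarrow> 2 * \<Phi> z - 1"
  proof (rule tendstoI)
    fix e :: real assume e: "0 < e"
    have "((\<lambda>d. ?F (?a + d) - ?F (- ?a - 2 * d)) \<longlongrightarrow> ?F (?a + 0) - ?F (- ?a - 2 * 0)) (at_right 0)"
      by (intro tendsto_diff isCont_tendsto_compose[OF cont] tendsto_intros)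
    then have up: "((\<lambda>d. ?F (?a + d) - ?F (- ?a - 2 * d)) \<longlongrightarrow> 2 * \<Phi> z - 1) (at_right 0)" using Fa by simp
    have "((\<lambda>d. ?F (?a - d) - ?F (- ?a + d)) \<longlongrightarrow> ?F (?a - 0) - ?F (- ?a + 0)) (at_right 0)"
      by (intro tendsto_diff isCont_tendsto_compose[OF cont] tendsto_intros)
    then have lo: "((\<lambda>d. ?F (?a - d) - ?F (- ?a + d)) \<longlongrightarrow> 2 * \<Phi> z - 1) (at_right 0)" using Fa by simp
    have e4: "0 < e / 4" using e by simp
    have "\<forall>\<^sub>F d in at_right (0 :: real). 0 < d \<and> dist (?F (?a + d) - ?F (- ?a - 2 * d)) (2 * \<Phi> z - 1) < e / 4
        \<and> dist (?F (?a - d) - ?F (- ?a + d)) (2 * \<Phi> z - 1) < e / 4"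
      by (intro eventually_conj tendstoD[OF up e4] tendstoD[OF lo e4]) (simp add: eventually_at_right_less)
    then obtain d where d: "0 < d" "dist (?F (?a + d) - ?F (- ?a - 2 * d)) (2 * \<Phi> z - 1) < e / 4"
        "dist (?F (?a - d) - ?F (- ?a + d)) (2 * \<Phi> z - 1) < e / 4"
      using eventually_happens'[OF trivial_limit_at_right_real] by blast
    have "((\<lambda>x. z * sqrt x) \<longlongrightarrow> z * sqrt u) (nhds u)" by (intro tendsto_intros) (simp add: filterlim_ident)
    then have "\<forall>\<^sub>F x in nhds u. dist (z * sqrt x) ?a < d" using d(1) by (rule tendstoD)
    then obtain h where h: "0 < h" and close: "\<And>x. dist x u < h \<Longrightarrow> dist (z * sqrt x) ?a < d"
      unfolding eventually_nhds_metric by blast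
    define bad where "bad n = {\<omega> \<in> space (Q n). h / 2 < \<bar>Vh n \<omega> - V n\<bar>}" for n
    have "(\<lambda>n. measure (Q n) (bad n)) \<longlonglongrightarrow> 0"
      using consistent half_gt_zero[OF h] unfolding conv_in_prob_0_def bad_def by blast
    from tendstoD[OF LIMSEQ_subseq_LIMSEQ[OF this R] e4]
    have "\<forall>\<^sub>F n in sequentially. dist (measure (Q (R n)) (bad (R n))) 0 < e / 4"
      by (simp only: o_def)
    moreover have "\<forall>\<^sub>F n in sequentially. dist (V (R n)) u < h / 2" using h by (intro tendstoD[OF uR]) simp
    moreover have "\<forall>\<^sub>F n in sequentially. dist (cdf (distr (Q (R n)) borel (S (R n))) x) (?F x) < e / 8" for x
      using e by (intro tendstoD[OF cdf_lim]) simp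
    note this[of "?a + d"] this[of "- ?a - 2 * d"] this[of "?a - d"] this[of "- ?a + d"]
    ultimately show "\<forall>\<^sub>F n in sequentially. dist (measure (Q (R n)) (?A (R n))) (2 * \<Phi> z - 1) < e"
    proof eventually_elim
      case (elim n)
      let ?Q = "Q (R n)" and ?S = "S (R n)" and ?V = "Vh (R n)"
      interpret prob_space ?Q by (rule Q)
      interpret law: real_distribution "distr ?Q borel ?S" by (rule rd)
      note [measurable] = S[of "R n"] Vh[of "R n"]
      have A: "?A (R n) \<in> events" by measurable
      have bad: "bad (R n) \<in> events" unfolding bad_def by measurable
      have band: "{\<omega> \<in> space ?Q. x < ?S \<omega> \<and> ?S \<omega> \<le> y} \<in> events" for x y by measurable
      have band_prob: "prob {\<omega> \<in> space ?Q. x < ?S \<omega> \<and> ?S \<omega> \<le> y} = cdf (distr ?Q borel ?S) y - cdf (distr ?Q borel ?S) x"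
        if "x < y" for x y
      proof -
        have "prob {\<omega> \<in> space ?Q. x < ?S \<omega> \<and> ?S \<omega> \<le> y} = measure (distr ?Q borel ?S) {x<..y}"
          by (subst measure_distr) (auto intro!: arg_cong[where f=prob])
        then show ?thesis by (simp add: law.cdf_diff_eq[OF that])
      qed
      have radius: "\<bar>z * sqrt (?V \<omega>) - ?a\<bar> < d" if "\<omega> \<in> space ?Q" "\<omega> \<notin> bad (R n)" for \<omega>
      proof -
        have "\<bar>?V \<omega> - V (R n)\<bar> \<le> h / 2" using that by (simp add: bad_def)
        moreover have "\<bar>V (R n) - u\<bar> < h / 2" using elim(2) by (simp add: dist_real_def)
        ultimately have "dist (?V \<omega>) u < h" unfolding dist_real_def by linarith
        then show ?thesis using close by (simp add: dist_real_def)
      qed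
      (* Distribution functions measure half-open intervals; the factor 2 makes room for the left endpoint. *)
      have "prob (?A (R n)) \<le> prob ({\<omega> \<in> space ?Q. - ?a - 2 * d < ?S \<omega> \<and> ?S \<omega> \<le> ?a + d} \<union> bad (R n))"
      proof (rule finite_measure_mono)
        show "?A (R n) \<subseteq> {\<omega> \<in> space ?Q. - ?a - 2 * d < ?S \<omega> \<and> ?S \<omega> \<le> ?a + d} \<union> bad (R n)"
        proof
          fix \<omega> assume \<omega>: "\<omega> \<in> ?A (R n)"
          show "\<omega> \<in> {\<omega> \<in> space ?Q. - ?a - 2 * d < ?S \<omega> \<and> ?S \<omega> \<le> ?a + d} \<union> bad (R n)"
          proof (cases "\<omega> \<in> bad (R n)")
            case False
            then show ?thesis using \<omega> radius[of \<omega>] d(1) unfolding Un_iff mem_Collect_eq by linarith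
          qed simp
        qed
      qed (intro sets.Un band bad)
      also have "\<dots> \<le> prob {\<omega> \<in> space ?Q. - ?a - 2 * d < ?S \<omega> \<and> ?S \<omega> \<le> ?a + d} + prob (bad (R n))"
        by (rule measure_Un_le[OF band bad])
      also have "prob {\<omega> \<in> space ?Q. - ?a - 2 * d < ?S \<omega> \<and> ?S \<omega> \<le> ?a + d}
          = cdf (distr ?Q borel ?S) (?a + d) - cdf (distr ?Q borel ?S) (- ?a - 2 * d)"
        by (rule band_prob) (use a0 d(1) in linarith)
      finally have upper: "prob (?A (R n)) < 2 * \<Phi> z - 1 + e"
        using elim(1,3,4) d(2) unfolding dist_real_def by linarith
      have "cdf (distr ?Q borel ?S) (?a - d) - cdf (distr ?Q borel ?S) (- ?a + d)
          \<le> prob {\<omega> \<in> space ?Q. - ?a + d < ?S \<omega> \<and> ?S \<omega> \<le> ?a - d}"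
      proof (cases "- ?a + d < ?a - d")
        case True
        then show ?thesis by (simp add: band_prob)
      next
        case False
        then have "cdf (distr ?Q borel ?S) (?a - d) \<le> cdf (distr ?Q borel ?S) (- ?a + d)"
          by (intro law.cdf_nondecreasing) linarith
        then show ?thesis using measure_nonneg by (smt (verit))
      qed
      also have "\<dots> \<le> prob (?A (R n) \<union> bad (R n))"
      proof (rule finite_measure_mono)
        show "{\<omega> \<in> space ?Q. - ?a + d < ?S \<omega> \<and> ?S \<omega> \<le> ?a - d} \<subseteq> ?A (R n) \<union> bad (R n)"
        proof
          fix \<omega> assume \<omega>: "\<omega> \<in> {\<omega> \<in> space ?Q. - ?a + d < ?S \<omega> \<and> ?S \<omega> \<le> ?a - d}"
          show "\<omega> \<in> ?A (R n) \<union> bad (R n)"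
          proof (cases "\<omega> \<in> bad (R n)")
            case False
            then show ?thesis using \<omega> radius[of \<omega>] unfolding Un_iff mem_Collect_eq by linarith
          qed simp
        qed
      qed (intro sets.Un A bad)
      also have "\<dots> \<le> prob (?A (R n)) + prob (bad (R n))" by (rule measure_Un_le[OF A bad])
      finally have "2 * \<Phi> z - 1 - e < prob (?A (R n))"
        using elim(1,5,6) d(3) unfolding dist_real_def by linarith
      with upper show ?case unfolding dist_real_def by linarith
    qed
  qed
  show "\<exists>s. strict_mono (s :: nat \<Rightarrow> nat) \<and> (\<lambda>n. measure (Q (r (s n))) (?A (r (s n)))) \<longlonglongrightarrow> 2 * \<Phi> z - 1"
    by (rule exI[of _ s]) (use s lim in \<open>simp add: R_def\<close>)
qed

section \<open>The remainder, uniformly over regular populations\<close>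

text \<open>
  The solution of \<open>1 + 2 a = \<xi> (1 - 2 a)\<close>: noise of twice this fraction of the penalty still confines the error to
  the cone with constant \<open>\<xi>\<close>, so that noise of this fraction leaves something of the penalty to bound the error.
\<close>

definition cone_slack :: "real \<Rightarrow> real" where
  "cone_slack \<xi> = (\<xi> - 1) / (\<xi> + 1) / 2"

lemma cone_slack:
  assumes "1 < \<xi>"
  shows "0 < cone_slack \<xi>" "2 * cone_slack \<xi> < 1" "1 + 2 * cone_slack \<xi> \<le> \<xi> * (1 - 2 * cone_slack \<xi>)"
proof -
  have half: "2 * (x / 2) = x" for x :: real by simp
  have "2 * cone_slack \<xi> = (\<xi> - 1) / (\<xi> + 1)" unfolding cone_slack_def by (rule half)
  then have "1 + 2 * cone_slack \<xi> = 2 * \<xi> / (\<xi> + 1)" "1 - 2 * cone_slack \<xi> = 2 / (\<xi> + 1)"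
    using assms by (simp_all add: field_simps)
  then show "1 + 2 * cone_slack \<xi> \<le> \<xi> * (1 - 2 * cone_slack \<xi>)" by (simp add: mult.commute)
  show "0 < cone_slack \<xi>" "2 * cone_slack \<xi> < 1" using assms by (simp_all add: cone_slack_def field_simps)
qed

lemma noise_level_pos: "0 < noise_level C0 B0 D0 D1 C1 k" if "1 \<le> C0" "0 < C1" "0 < D0" "0 < D1"
proof -
  have "0 < moment_scale C0 B0 D0 C1" using that by (simp add: moment_scale_def add_pos_pos)
  moreover have "0 < moment_bound D0 D1" by (simp add: moment_bound_def add_pos_nonneg)
  moreover have "0 < sqrt ((1 + exp (- B0)) * (1 + D1\<^sup>2))" by (simp add: add_pos_pos add_pos_nonneg)
  ultimately show ?thesis unfolding noise_level_def by (intro add_nonneg_pos mult_nonneg_nonneg mult_pos_pos) auto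
qed

lemma (in regular_sample) fitted_aipw_close:
  fixes k :: nat and B1 B2 :: real
  defines "K \<equiv> noise k" and "B \<equiv> max B1 B2"
  assumes rate0: "lasso_rate_holds b0 1 C0 K k0 \<nu>0 \<xi>0 \<rho>0 B1"
    and rate1: "lasso_rate_holds b1 (exp (- 1) * C2) ((C3 + 1) * C0) (K + 3 * sqrt (D1\<^sup>2 * B1 + K * B1\<^sup>2)) k1 \<nu>1 \<xi>1 \<rho>1 B2"
    and pos: "0 < B1" "0 < B2" "0 \<le> k0" "0 \<le> k1" "0 < \<nu>0" "0 < \<nu>1"
    and noise: "v0 * sqrt (24 * c0) \<le> b0 * k0" "v0 * sqrt (24 * c0) \<le> b1 * k1" "real (3 + k) * L\<^sup>2 \<le> 2"
    and comp: "compatibility p Sig (supp0 D gb) \<nu>0 \<xi>0" "compatibility p Sig (supp0 D ab) \<nu>1 \<xi>1"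
    and s: "real (card (supp0 D gb)) \<le> s" "real (card (supp0 D ab)) \<le> s"
    and sL: "s * L \<le> \<rho>0" "s * L \<le> \<rho>1" "s * L \<le> 1" "C0 * B * (s * L) \<le> 1"
    and est: "estimator_cal D n Q Z (k0 * L) gh" "estimator_wl \<psi> D n Q Z (k1 * L) gh ah"
  shows "\<exists>E\<in>sets Q. 1 - 12 * (1 / 2) ^ k \<le> measure Q E \<and> (\<forall>\<omega>\<in>E.
    \<bar>emp \<omega> (fitted_aipw \<psi> D (gh \<omega>) (ah \<omega>)) - emp \<omega> \<phi>\<bar> \<le> rem_mean C1 C3 D1 (b1 * k1) K B * (s * L\<^sup>2) \<and>
    emp \<omega> (\<lambda>z. (fitted_aipw \<psi> D (gh \<omega>) (ah \<omega>) z - \<phi> z)\<^sup>2) \<le> rem_square C0 B0 C1 C3 D1 K B * (s * L)\<^sup>2)"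
proof -
  obtain E where E: "E \<in> sets Q" "1 - 12 * (1 / 2) ^ k \<le> measure Q E" and good: "\<forall>\<omega>\<in>E. good K (b0 * k0) (b1 * k1) \<omega>"
    using good_event[OF noise] unfolding K_def by blast
  have K: "0 \<le> K" unfolding K_def using noise_level_pos[of C0 C1 D0 D1 B0 k] const_pos by simp
  have s1: "1 \<le> s" using supp0_subset(3)[of gb] s(1) by linarith
  have sLn: "0 \<le> s * L" "0 \<le> s * L\<^sup>2" using s1 L_pos by auto
  have b: "0 \<le> b1 * k1"
    using noise(2) scale_pos mult_nonneg_nonneg[of v0 "sqrt (24 * c0)"] by (smt (verit) real_sqrt_ge_zero)
  have BB: "B1 \<le> B" "B2 \<le> B" "0 \<le> B" using pos by (auto simp: B_def)
  have C0: "0 \<le> C0" using const_pos by simp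
  have "C0 * B1 * (s * L) \<le> C0 * B * (s * L)" using BB C0 sLn by (intro mult_right_mono mult_left_mono) auto
  then have sB1: "C0 * B1 * (s * L) \<le> 1" using sL(4) by linarith
  have "\<bar>emp \<omega> (fitted_aipw \<psi> D (gh \<omega>) (ah \<omega>)) - emp \<omega> \<phi>\<bar> \<le> rem_mean C1 C3 D1 (b1 * k1) K B * (s * L\<^sup>2) \<and>
    emp \<omega> (\<lambda>z. (fitted_aipw \<psi> D (gh \<omega>) (ah \<omega>) z - \<phi> z)\<^sup>2) \<le> rem_square C0 B0 C1 C3 D1 K B * (s * L)\<^sup>2"
    if \<omega>: "\<omega> \<in> E" for \<omega>
  proof -
    have sp: "\<omega> \<in> space Q" using \<omega> sets.sets_into_space[OF E(1)] by blast
    have g: "good K (b0 * k0) (b1 * k1) \<omega>" using good \<omega> by blast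
    note r0 = cal_rate[OF rate0 K g s(1) sL(1) pos(3) comp(1) pos(5) est(1) sp]
    note r1 = wl_rate[OF rate1 K g less_imp_le[OF pos(1)] s(2) sL(2,3) sB1 pos(4) comp(2) pos(6)
        conjunct1[OF r0] conjunct2[OF conjunct2[OF r0]] est(2) sp]
    have up: "x \<le> B1 * (s * L) \<Longrightarrow> x \<le> B * (s * L)" "x \<le> B1 * (s * L\<^sup>2) \<Longrightarrow> x \<le> B * (s * L\<^sup>2)"
      "x \<le> B2 * (s * L) \<Longrightarrow> x \<le> B * (s * L)" "x \<le> B2 * (s * L\<^sup>2) \<Longrightarrow> x \<le> B * (s * L\<^sup>2)" for x
      using mult_right_mono[OF BB(1) sLn(1)] mult_right_mono[OF BB(1) sLn(2)]
        mult_right_mono[OF BB(2) sLn(1)] mult_right_mono[OF BB(2) sLn(2)] by linarith+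
    show ?thesis
      by (intro conjI remainder_rates[OF g K b BB(3) s1 sL(3,4)] up(1)[OF conjunct1[OF r0]]
          up(2)[OF conjunct1[OF conjunct2[OF r0]]] up(2)[OF conjunct2[OF conjunct2[OF r0]]]
          up(3)[OF conjunct1[OF r1]] up(4)[OF conjunct1[OF conjunct2[OF r1]]] up(4)[OF conjunct2[OF conjunct2[OF r1]]])
  qed
  then show ?thesis by (intro bexI[OF _ E(1)] conjI[OF E(2)] ballI)
qed

text \<open>
  The rate \<open>L\<close> of a regular sample, as a function of the dimension and the sample size alone.
\<close>

definition score_rate :: "nat \<Rightarrow> nat \<Rightarrow> real" where
  "score_rate p n = sqrt (2 * ln (1 + real p) / real n)"

text \<open>
  The nonasymptotic form of asymptotic linearity. For each confidence level \<open>k\<close> the constants \<open>\<rho>\<close> and \<open>R\<close> are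
  the same for all regular populations, dimensions and sample sizes, so the statement can be used along an
  array; the tuning constants \<open>k0\<close> and \<open>k1\<close> have to exceed a bound that does not involve \<open>k\<close>.
\<close>

lemma fitted_aipw_close_uniform:
  fixes C0 B0 D0 D1 C1 C2 C3 k0 k1 \<nu>0 \<nu>1 \<xi>0 \<xi>1 :: real and k :: nat
  assumes const: "1 \<le> C0" "0 < D0" "0 < D1" "0 < C1" "0 < C2" "0 \<le> C3"
    and \<nu>: "0 < \<nu>0" "0 < \<nu>1" and \<xi>: "1 < \<xi>0" "1 < \<xi>1" and k01: "0 < k0" "0 < k1"
    and noise: "moment_scale C0 B0 D0 C1 * sqrt (24 * moment_bound D0 D1) \<le> cone_slack \<xi>0 * k0"
      "moment_scale C0 B0 D0 C1 * sqrt (24 * moment_bound D0 D1) \<le> cone_slack \<xi>1 * k1"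
  obtains \<rho> R where "0 < \<rho>" "0 < R"
    "\<And>(D :: ('a, 'x) population) gb ab \<psi> \<psi>2 n (Q :: 'w measure) Z gh ah s.
      regular_sample D gb ab \<psi> \<psi>2 C0 B0 D0 D1 C1 C2 C3 n Q Z \<Longrightarrow>
      compatibility (dict_dim D) (Sigma_pop D gb) (supp0 D gb) \<nu>0 \<xi>0 \<Longrightarrow>
      compatibility (dict_dim D) (Sigma_pop D gb) (supp0 D ab) \<nu>1 \<xi>1 \<Longrightarrow>
      real (card (supp0 D gb)) \<le> s \<Longrightarrow> real (card (supp0 D ab)) \<le> s \<Longrightarrow> s * score_rate (dict_dim D) n \<le> \<rho> \<Longrightarrow>
      estimator_cal D n Q Z (k0 * score_rate (dict_dim D) n) gh \<Longrightarrow>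
      estimator_wl \<psi> D n Q Z (k1 * score_rate (dict_dim D) n) gh ah \<Longrightarrow>
      \<exists>E\<in>sets Q. 1 - 12 * (1 / 2) ^ k \<le> measure Q E \<and> (\<forall>\<omega>\<in>E.
        \<bar>samp_mean n (\<lambda>i. Z i \<omega>) (fitted_aipw \<psi> D (gh \<omega>) (ah \<omega>)) - samp_mean n (\<lambda>i. Z i \<omega>) (fitted_aipw \<psi> D gb ab)\<bar>
          \<le> R * (s * (score_rate (dict_dim D) n)\<^sup>2) \<and>
        samp_mean n (\<lambda>i. Z i \<omega>) (\<lambda>z. (fitted_aipw \<psi> D (gh \<omega>) (ah \<omega>) z - fitted_aipw \<psi> D gb ab z)\<^sup>2)
          \<le> R * (s * score_rate (dict_dim D) n)\<^sup>2)"
proof -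
  define K where "K = noise_level C0 B0 D0 D1 C1 k"
  have K: "0 < K" unfolding K_def using const by (intro noise_level_pos) auto
  have C0: "0 < C0" using const by simp
  obtain \<rho>0 B1 where 1: "0 < \<rho>0" "0 < B1" "lasso_rate_holds (cone_slack \<xi>0) 1 C0 K k0 \<nu>0 \<xi>0 \<rho>0 B1"
    using lasso_rate[OF cone_slack(1,2)[OF \<xi>(1)] zero_less_one C0 K k01(1) \<nu>(1) cone_slack(3)[OF \<xi>(1)]] by blast
  define K' where "K' = K + 3 * sqrt (D1\<^sup>2 * B1 + K * B1\<^sup>2)"
  have K': "0 < K'" using K 1(2) by (simp add: K'_def add_pos_nonneg)
  have c: "0 < exp (- 1) * C2" "0 < (C3 + 1) * C0" using const C0 by (auto intro!: mult_pos_pos)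
  obtain \<rho>1 B2 where 2: "0 < \<rho>1" "0 < B2" "lasso_rate_holds (cone_slack \<xi>1) (exp (- 1) * C2) ((C3 + 1) * C0) K' k1 \<nu>1 \<xi>1 \<rho>1 B2"
    using lasso_rate[OF cone_slack(1,2)[OF \<xi>(2)] c K' k01(2) \<nu>(2) cone_slack(3)[OF \<xi>(2)]] by blast
  define B where "B = max B1 B2"
  have B: "0 < B" using 1(2) by (simp add: B_def)
  (* Since 1 \<le> s, a bound on s L also bounds L, which gives the condition of good_event and s L \<le> 1. *)
  define \<rho> where "\<rho> = min (min \<rho>0 \<rho>1) (min (1 / real (3 + k)) (1 / (C0 * B)))"
  have \<rho>: "0 < \<rho>" using 1 2 C0 B by (simp add: \<rho>_def)
  let ?R1 = "rem_mean C1 C3 D1 (cone_slack \<xi>1 * k1) K B" and ?R2 = "rem_square C0 B0 C1 C3 D1 K B"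
  define R where "R = \<bar>?R1\<bar> + \<bar>?R2\<bar> + 1"
  have R: "0 < R" by (simp add: R_def add_nonneg_pos)
  show thesis
  proof (rule that[OF \<rho> R])
    fix D :: "('a, 'x) population" and gb ab \<psi> \<psi>2 n and Q :: "'w measure" and Z gh ah and s :: real
    let ?L = "score_rate (dict_dim D) n"
    assume sam: "regular_sample D gb ab \<psi> \<psi>2 C0 B0 D0 D1 C1 C2 C3 n Q Z"
      and comp: "compatibility (dict_dim D) (Sigma_pop D gb) (supp0 D gb) \<nu>0 \<xi>0"
        "compatibility (dict_dim D) (Sigma_pop D gb) (supp0 D ab) \<nu>1 \<xi>1"
      and s: "real (card (supp0 D gb)) \<le> s" "real (card (supp0 D ab)) \<le> s" and sL: "s * ?L \<le> \<rho>"
      and est: "estimator_cal D n Q Z (k0 * ?L) gh" "estimator_wl \<psi> D n Q Z (k1 * ?L) gh ah"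
    interpret regular_sample D gb ab \<psi> \<psi>2 C0 B0 D0 D1 C1 C2 C3 n Q Z by (rule sam)
    have LL: "L = ?L" by (simp add: L_def score_rate_def)
    have s1: "1 \<le> s" using supp0_subset(3)[of gb] s(1) by linarith
    have L0: "0 < ?L" using L_pos LL by simp
    have "1 * ?L \<le> s * ?L" using s1 L0 by (intro mult_right_mono) auto
    then have L\<rho>: "?L \<le> \<rho>" using sL by linarith
    have r: "\<rho> \<le> \<rho>0" "\<rho> \<le> \<rho>1" "\<rho> \<le> 1 / real (3 + k)" "\<rho> \<le> 1 / (C0 * B)" by (auto simp: \<rho>_def)
    have "1 / real (3 + k) \<le> 1" by simp
    then have r1: "\<rho> \<le> 1" using r(3) by linarith
    have "?L * ?L \<le> 1 / real (3 + k) * 1" using L\<rho> r(3) r1 L0 by (intro mult_mono) auto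
    then have "real (3 + k) * ?L\<^sup>2 \<le> 1" by (simp add: power2_eq_square field_simps)
    then have kL: "real (3 + k) * ?L\<^sup>2 \<le> 2" by linarith
    have "C0 * B * (s * ?L) \<le> C0 * B * (1 / (C0 * B))" using sL r(4) C0 B by (intro mult_left_mono) auto
    then have cB: "C0 * B * (s * ?L) \<le> 1" using C0 B by simp
    have bounds: "s * ?L \<le> \<rho>0" "s * ?L \<le> \<rho>1" "s * ?L \<le> 1" using sL r r1 by linarith+
    have sLn: "0 \<le> s * ?L\<^sup>2" using s1 by simp
    have Rs: "?R1 \<le> R" "?R2 \<le> R" unfolding R_def by linarith+
    have "\<exists>E\<in>sets Q. 1 - 12 * (1 / 2) ^ k \<le> measure Q E \<and> (\<forall>\<omega>\<in>E.
      \<bar>emp \<omega> (fitted_aipw \<psi> D (gh \<omega>) (ah \<omega>)) - emp \<omega> \<phi>\<bar> \<le> ?R1 * (s * ?L\<^sup>2) \<and>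
      emp \<omega> (\<lambda>z. (fitted_aipw \<psi> D (gh \<omega>) (ah \<omega>) z - \<phi> z)\<^sup>2) \<le> ?R2 * (s * ?L)\<^sup>2)"
      unfolding LL[symmetric] K_def B_def
      by (rule fitted_aipw_close[OF 1(3)[unfolded K_def] 2(3)[unfolded K'_def K_def] 1(2) 2(2) less_imp_le[OF k01(1)]
            less_imp_le[OF k01(2)] \<nu> noise kL[folded LL] comp s bounds[folded LL] cB[folded LL, unfolded B_def] est[folded LL]])
    then obtain E where E: "E \<in> sets Q" "1 - 12 * (1 / 2) ^ k \<le> measure Q E"
      and b1: "\<And>\<omega>. \<omega> \<in> E \<Longrightarrow> \<bar>emp \<omega> (fitted_aipw \<psi> D (gh \<omega>) (ah \<omega>)) - emp \<omega> \<phi>\<bar> \<le> ?R1 * (s * ?L\<^sup>2)"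
      and b2: "\<And>\<omega>. \<omega> \<in> E \<Longrightarrow> emp \<omega> (\<lambda>z. (fitted_aipw \<psi> D (gh \<omega>) (ah \<omega>) z - \<phi> z)\<^sup>2) \<le> ?R2 * (s * ?L)\<^sup>2"
      by blast
    show "\<exists>E\<in>sets Q. 1 - 12 * (1 / 2) ^ k \<le> measure Q E \<and> (\<forall>\<omega>\<in>E.
        \<bar>samp_mean n (\<lambda>i. Z i \<omega>) (fitted_aipw \<psi> D (gh \<omega>) (ah \<omega>)) - samp_mean n (\<lambda>i. Z i \<omega>) (fitted_aipw \<psi> D gb ab)\<bar>
          \<le> R * (s * ?L\<^sup>2) \<and>
        samp_mean n (\<lambda>i. Z i \<omega>) (\<lambda>z. (fitted_aipw \<psi> D (gh \<omega>) (ah \<omega>) z - fitted_aipw \<psi> D gb ab z)\<^sup>2)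
          \<le> R * (s * ?L)\<^sup>2)"
      by (intro bexI[OF _ E(1)] conjI ballI E(2) order_trans[OF b1 mult_right_mono[OF Rs(1) sLn]]
          order_trans[OF b2 mult_right_mono[OF Rs(2) zero_le_power2]])
  qed
qed

lemma (in causal_population) fitted_aipw_measurable:
  assumes z: "z \<in> measurable Q (obs_space D)" and \<psi>: "\<psi> \<in> borel_measurable borel"
    and g: "\<And>j. j \<le> p \<Longrightarrow> (\<lambda>\<omega>. g \<omega> j) \<in> borel_measurable Q" and a: "\<And>j. j \<le> p \<Longrightarrow> (\<lambda>\<omega>. a \<omega> j) \<in> borel_measurable Q"
  shows "(\<lambda>\<omega>. fitted_aipw \<psi> D (g \<omega>) (a \<omega>) (z \<omega>)) \<in> borel_measurable Q"
proof -
  have [measurable]: "\<psi> \<in> borel_measurable borel" by (rule \<psi>)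
  have [measurable]: "z \<in> measurable Q (borel \<Otimes>\<^sub>M borel \<Otimes>\<^sub>M cov_space D)" using z by (simp add: obs_space_def)
  have x: "(\<lambda>\<omega>. snd (snd (z \<omega>))) \<in> measurable Q (cov_space D)" by measurable
  have f: "(\<lambda>\<omega>. dict D j (snd (snd (z \<omega>)))) \<in> borel_measurable Q" if "j \<le> p" for j
    by (rule measurable_compose[OF x dict_measurable[OF that]])
  have [measurable]: "(\<lambda>\<omega>. lin D (g \<omega>) (snd (snd (z \<omega>)))) \<in> borel_measurable Q"
    "(\<lambda>\<omega>. lin D (a \<omega>) (snd (snd (z \<omega>)))) \<in> borel_measurable Q"
    unfolding lin_def using f g a by (auto intro!: borel_measurable_sum borel_measurable_times)
  have "(\<lambda>\<omega>. fitted_aipw \<psi> D (g \<omega>) (a \<omega>) (z \<omega>)) = (\<lambda>\<omega>.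
      fst (snd (z \<omega>)) * fst (z \<omega>) / inverse (1 + exp (- lin D (g \<omega>) (snd (snd (z \<omega>)))))
      - (fst (snd (z \<omega>)) / inverse (1 + exp (- lin D (g \<omega>) (snd (snd (z \<omega>))))) - 1) * \<psi> (lin D (a \<omega>) (snd (snd (z \<omega>)))))"
    by (simp add: fun_eq_iff aipw_def ps_def split: prod.split)
  also have "\<dots> \<in> borel_measurable Q" by measurable
  finally show ?thesis .
qed

section \<open>Arrays of populations\<close>

text \<open>
  For \<open>p = 1\<close> the logarithm of \<open>p\<close> vanishes, but then the sparsity is at most 4; this is the additive
  constant. Otherwise \<open>1 + p \<le> p\<^sup>2\<close>.
\<close>

lemma log_term_bound:
  assumes p: "1 \<le> p" and s: "s \<le> 2 * (1 + real p)" "0 \<le> s"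
  shows "s * (2 * ln (1 + real p)) \<le> 4 * (s * ln (real p)) + 8"
proof (cases "p = 1")
  case True
  have "ln (2 :: real) \<le> 1" using ln_le_minus_one[of "2 :: real"] by simp
  then have "s * (2 * ln 2) \<le> 4 * (2 * 1)" using True s by (intro mult_mono) auto
  then show ?thesis using True by simp
next
  case False
  then have p2: "2 \<le> real p" using p by simp
  have "1 + real p \<le> real p * real p" using mult_right_mono[OF p2, of "real p"] p2 by linarith
  then have "ln (1 + real p) \<le> ln (real p * real p)" using p2 by simp
  also have "\<dots> = 2 * ln (real p)" using p2 by (simp add: ln_mult)
  finally have "s * (2 * ln (1 + real p)) \<le> s * (2 * (2 * ln (real p)))" using s(2) by (intro mult_left_mono) auto
  then show ?thesis by simp
qed

lemma supp0_card_le: "real (card (supp0 D b)) \<le> 1 + real (dict_dim D)"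
proof -
  have "supp0 D b \<subseteq> {..dict_dim D}" by (auto simp: supp0_def)
  then have "card (supp0 D b) \<le> card {..dict_dim D}" by (intro card_mono) auto
  then show ?thesis by simp
qed

text \<open>
  The setting of the limit theorem: an array of populations and samples that are eventually regular
  with common constants. The condition \<open>noise\<close> is what sufficiently large tuning constants provide.
\<close>

locale sparse_asymptotics =
  fixes D :: "nat \<Rightarrow> ('a, 'x) population" and Q :: "nat \<Rightarrow> 'w measure" and Z :: "nat \<Rightarrow> nat \<Rightarrow> 'w \<Rightarrow> 'x obs"
    and gb ab :: "nat \<Rightarrow> nat \<Rightarrow> real" and gh ah :: "nat \<Rightarrow> 'w \<Rightarrow> nat \<Rightarrow> real" and \<psi> \<psi>2 :: "real \<Rightarrow> real"
    and C0 B0 D0 D1 C1 C2 C3 \<nu>0 \<nu>1 \<xi>0 \<xi>1 k0 k1 :: real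
  assumes model: "\<And>n. population_model (D n)" and sample: "\<And>n. iid_sample (D n) n (Q n) (Z n)"
    and link: "mono \<psi>"
    and est_cal: "\<And>n. estimator_cal (D n) n (Q n) (Z n) (k0 * score_rate (dict_dim (D n)) n) (gh n)"
    and est_wl: "\<And>n. estimator_wl \<psi> (D n) n (Q n) (Z n) (k1 * score_rate (dict_dim (D n)) n) (gh n) (ah n)"
    and regular: "\<forall>\<^sub>F n in sequentially. regular_sample (D n) (gb n) (ab n) \<psi> \<psi>2 C0 B0 D0 D1 C1 C2 C3 n (Q n) (Z n)"
    and compat: "\<forall>\<^sub>F n in sequentially. compatibility (dict_dim (D n)) (Sigma_pop (D n) (gb n)) (supp0 (D n) (gb n)) \<nu>0 \<xi>0 \<and>
      compatibility (dict_dim (D n)) (Sigma_pop (D n) (gb n)) (supp0 (D n) (ab n)) \<nu>1 \<xi>1"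
    and const: "1 \<le> C0" "0 < D0" "0 < D1" "0 < C1" "0 < C2" "0 \<le> C3"
    and \<nu>: "0 < \<nu>0" "0 < \<nu>1" and \<xi>: "1 < \<xi>0" "1 < \<xi>1" and k01: "0 < k0" "0 < k1"
    and noise: "moment_scale C0 B0 D0 C1 * sqrt (24 * moment_bound D0 D1) \<le> cone_slack \<xi>0 * k0"
      "moment_scale C0 B0 D0 C1 * sqrt (24 * moment_bound D0 D1) \<le> cone_slack \<xi>1 * k1"
    and unif: "unif_sq_integrable D"
    and sparse: "(\<lambda>n. (real (card (supp0 (D n) (gb n))) + real (card (supp0 (D n) (ab n)))) * ln (real (dict_dim (D n))))
      \<in> o(\<lambda>n. sqrt (real n))"
begin

abbreviation "avg n \<omega> \<equiv> samp_mean n (\<lambda>i. Z n i \<omega>)"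
abbreviation "\<mu> n \<equiv> mu1 (D n)"
abbreviation "V n \<equiv> asy_var \<psi> (D n) (gb n) (ab n)"
abbreviation "infl n \<equiv> fitted_aipw \<psi> (D n) (gb n) (ab n)"
abbreviation "fit n \<omega> \<equiv> fitted_aipw \<psi> (D n) (gh n \<omega>) (ah n \<omega>)"
abbreviation "muh n \<omega> \<equiv> mu_hat \<psi> (D n) n (\<lambda>i. Z n i \<omega>) (gh n \<omega>) (ah n \<omega>)"
abbreviation "Vh n \<omega> \<equiv> V_hat \<psi> (D n) n (\<lambda>i. Z n i \<omega>) (gh n \<omega>) (ah n \<omega>)"
abbreviation "s n \<equiv> real (card (supp0 (D n) (gb n))) + real (card (supp0 (D n) (ab n)))"
abbreviation "rate n \<equiv> score_rate (dict_dim (D n)) n"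

lemma prob_space_Q: "prob_space (Q n)"
  using sample by (simp add: iid_sample_def)

lemma dim_pos: "1 \<le> dict_dim (D n)"
  using model by (simp add: population_model_def)

lemma fit_measurable: "i < n \<Longrightarrow> (\<lambda>\<omega>. fit n \<omega> (Z n i \<omega>)) \<in> borel_measurable (Q n)"
proof -
  assume i: "i < n"
  interpret causal_population "D n" by unfold_locales (rule model)
  interpret Q: prob_space "Q n" by (rule prob_space_Q)
  show ?thesis
  proof (rule fitted_aipw_measurable)
    show "Z n i \<in> measurable (Q n) (obs_space (D n))"
      using sample[of n] i by (auto simp: iid_sample_def Q.indep_vars_def2)
    show "\<psi> \<in> borel_measurable borel" by (rule borel_measurable_mono[OF link])
    show "(\<lambda>\<omega>. gh n \<omega> j) \<in> borel_measurable (Q n)" if "j \<le> dict_dim (D n)" for j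
      using est_cal[of n] that by (simp add: estimator_cal_def estimator_of_def)
    show "(\<lambda>\<omega>. ah n \<omega> j) \<in> borel_measurable (Q n)" if "j \<le> dict_dim (D n)" for j
      using est_wl[of n] that by (simp add: estimator_wl_def estimator_of_def)
  qed
qed

lemma muh_measurable [measurable]: "(\<lambda>\<omega>. muh n \<omega>) \<in> borel_measurable (Q n)"
  unfolding mu_hat_def samp_mean_def by (intro borel_measurable_divide borel_measurable_sum fit_measurable) auto

lemma Vh_measurable [measurable]: "(\<lambda>\<omega>. Vh n \<omega>) \<in> borel_measurable (Q n)"
  unfolding V_hat_def samp_mean_def[of n _ "\<lambda>ob. (_ ob - _)\<^sup>2"]
  by (intro borel_measurable_divide borel_measurable_sum borel_measurable_power borel_measurable_diff fit_measurable muh_measurable) auto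

text \<open>
  With \<open>u = sqrt n s L\<^sup>2\<close>, the sparsity assumption makes \<open>u\<close> small by \<open>log_term_bound\<close>, and \<open>s L \<le> u\<close> because
  \<open>sqrt n L\<close> is at least 1.
\<close>

lemma rates: "(\<lambda>n. sqrt n * (s n * (rate n)\<^sup>2)) \<longlonglongrightarrow> 0" "(\<lambda>n. s n * rate n) \<longlonglongrightarrow> 0"
proof -
  let ?u = "\<lambda>n. sqrt n * (s n * (rate n)\<^sup>2)"
  have s0: "0 \<le> s n" for n by simp
  have ln0: "1 \<le> 2 * ln (1 + real (dict_dim (D n)))" for n
  proof -
    have "ln 2 \<le> ln (1 + real (dict_dim (D n)))" using dim_pos by simp
    with ln2_ge_two_thirds show ?thesis by linarith
  qed
  have L2: "(rate n)\<^sup>2 = 2 * ln (1 + real (dict_dim (D n))) / n" for n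
    unfolding score_rate_def using ln0[of n] by simp
  have u: "?u n = s n * (2 * ln (1 + real (dict_dim (D n)))) / sqrt n" if "0 < n" for n
  proof -
    have "sqrt n * (c / n) = c / sqrt n" for c :: real
    proof -
      have "c / sqrt n = sqrt n * (c / (sqrt n * sqrt n))" using that by (simp del: real_sqrt_mult_self abs_of_nat)
      then show ?thesis by simp
    qed
    then show ?thesis unfolding L2 by (simp only: times_divide_eq_right)
  qed
  have lim: "(\<lambda>n. 4 * (s n * ln (real (dict_dim (D n))) / sqrt n) + 8 / sqrt n) \<longlonglongrightarrow> 4 * 0 + 0"
  proof (intro tendsto_add tendsto_mult tendsto_const)
    show "(\<lambda>n. s n * ln (real (dict_dim (D n))) / sqrt n) \<longlonglongrightarrow> 0" using sparse by (rule smalloD_tendsto)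
    have "(\<lambda>n. 8 * sqrt (1 / real n)) \<longlonglongrightarrow> 8 * sqrt 0" by (intro tendsto_intros lim_1_over_n)
    then show "(\<lambda>n. 8 / sqrt (real n)) \<longlonglongrightarrow> 0" by (simp add: real_sqrt_divide)
  qed
  show u0: "?u \<longlonglongrightarrow> 0"
  proof (rule tendsto_sandwich[OF _ _ tendsto_const lim[unfolded mult_zero_right add_0]])
    show "\<forall>\<^sub>F n in sequentially. 0 \<le> ?u n" by (intro always_eventually allI mult_nonneg_nonneg) auto
    show "\<forall>\<^sub>F n in sequentially. ?u n \<le> 4 * (s n * ln (real (dict_dim (D n))) / sqrt n) + 8 / sqrt n"
      using eventually_gt_at_top[of 0]
    proof eventually_elim
      case (elim n)
      have "s n * (2 * ln (1 + real (dict_dim (D n)))) \<le> 4 * (s n * ln (real (dict_dim (D n)))) + 8"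
        using supp0_card_le[of "D n" "gb n"] supp0_card_le[of "D n" "ab n"] by (intro log_term_bound[OF dim_pos]) auto
      then have "?u n \<le> (4 * (s n * ln (real (dict_dim (D n)))) + 8) / sqrt n"
        unfolding u[OF elim] by (intro divide_right_mono) auto
      then show ?case by (simp add: add_divide_distrib)
    qed
  qed
  show "(\<lambda>n. s n * rate n) \<longlonglongrightarrow> 0"
  proof (rule tendsto_sandwich[OF _ _ tendsto_const u0])
    show "\<forall>\<^sub>F n in sequentially. 0 \<le> s n * rate n"
      by (intro always_eventually allI mult_nonneg_nonneg) (simp_all add: score_rate_def)
    show "\<forall>\<^sub>F n in sequentially. s n * rate n \<le> ?u n"
      using eventually_gt_at_top[of 0]
    proof eventually_elim
      case (elim n)
      have "s n * rate n * 1 \<le> s n * rate n * (sqrt n * rate n)"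
      proof (rule mult_left_mono)
        have "(sqrt n * rate n)\<^sup>2 = 2 * ln (1 + real (dict_dim (D n)))" using elim by (simp add: power_mult_distrib L2)
        then show "1 \<le> sqrt n * rate n"
          using ln0[of n] by (intro power2_le_imp_le[of 1]) (auto simp: score_rate_def)
      qed (simp add: score_rate_def)
      then show ?case by (simp add: power2_eq_square mult_ac)
    qed
  qed
qed

lemma fit_close:
  assumes e: "0 < e"
  shows "whp Q (\<lambda>n \<omega>. \<bar>sqrt n * (muh n \<omega> - avg n \<omega> (infl n))\<bar> \<le> e \<and> avg n \<omega> (\<lambda>z. (fit n \<omega> z - infl n z)\<^sup>2) \<le> e)"
  unfolding whp_def
proof (intro allI impI)
  fix \<epsilon> :: real assume \<epsilon>: "0 < \<epsilon>"
  have "(\<lambda>k. 12 * (1 / 2 :: real) ^ k) \<longlonglongrightarrow> 12 * 0" by (intro tendsto_intros LIMSEQ_power_zero) simp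
  then have "\<forall>\<^sub>F k in sequentially. 12 * (1 / 2 :: real) ^ k < \<epsilon>" using \<epsilon> by (intro order_tendstoD(2)) simp_all
  then obtain k :: nat where k: "12 * (1 / 2 :: real) ^ k < \<epsilon>" by (auto simp: eventually_sequentially)
  obtain \<rho> R where \<rho>: "0 < \<rho>" and R: "0 < R" and close:
    "\<And>(D :: ('a, 'x) population) gb ab \<psi> \<psi>2 n (Q :: 'w measure) Z gh ah s.
      regular_sample D gb ab \<psi> \<psi>2 C0 B0 D0 D1 C1 C2 C3 n Q Z \<Longrightarrow>
      compatibility (dict_dim D) (Sigma_pop D gb) (supp0 D gb) \<nu>0 \<xi>0 \<Longrightarrow>
      compatibility (dict_dim D) (Sigma_pop D gb) (supp0 D ab) \<nu>1 \<xi>1 \<Longrightarrow>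
      real (card (supp0 D gb)) \<le> s \<Longrightarrow> real (card (supp0 D ab)) \<le> s \<Longrightarrow> s * score_rate (dict_dim D) n \<le> \<rho> \<Longrightarrow>
      estimator_cal D n Q Z (k0 * score_rate (dict_dim D) n) gh \<Longrightarrow>
      estimator_wl \<psi> D n Q Z (k1 * score_rate (dict_dim D) n) gh ah \<Longrightarrow>
      \<exists>E\<in>sets Q. 1 - 12 * (1 / 2) ^ k \<le> measure Q E \<and> (\<forall>\<omega>\<in>E.
        \<bar>samp_mean n (\<lambda>i. Z i \<omega>) (fitted_aipw \<psi> D (gh \<omega>) (ah \<omega>)) - samp_mean n (\<lambda>i. Z i \<omega>) (fitted_aipw \<psi> D gb ab)\<bar>
          \<le> R * (s * (score_rate (dict_dim D) n)\<^sup>2) \<and>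
        samp_mean n (\<lambda>i. Z i \<omega>) (\<lambda>z. (fitted_aipw \<psi> D (gh \<omega>) (ah \<omega>) z - fitted_aipw \<psi> D gb ab z)\<^sup>2)
          \<le> R * (s * score_rate (dict_dim D) n)\<^sup>2)"
    by (rule fitted_aipw_close_uniform[OF const \<nu> \<xi> k01 noise, of k]) blast
  have "(\<lambda>n. R * (sqrt n * (s n * (rate n)\<^sup>2))) \<longlonglongrightarrow> R * 0" "(\<lambda>n. R * (s n * rate n)\<^sup>2) \<longlonglongrightarrow> R * 0\<^sup>2"
    by (intro tendsto_intros rates)+
  then have small: "\<forall>\<^sub>F n in sequentially. R * (sqrt n * (s n * (rate n)\<^sup>2)) < e"
      "\<forall>\<^sub>F n in sequentially. R * (s n * rate n)\<^sup>2 < e" "\<forall>\<^sub>F n in sequentially. s n * rate n < \<rho>"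
    by (intro order_tendstoD(2)[OF _ e] order_tendstoD(2)[OF rates(2) \<rho>]; simp)+
  show "\<forall>\<^sub>F n in sequentially. \<exists>E\<in>sets (Q n). 1 - \<epsilon> \<le> measure (Q n) E \<and> (\<forall>\<omega>\<in>E.
      \<bar>sqrt n * (muh n \<omega> - avg n \<omega> (infl n))\<bar> \<le> e \<and> avg n \<omega> (\<lambda>z. (fit n \<omega> z - infl n z)\<^sup>2) \<le> e)"
    using small regular compat
  proof eventually_elim
    case (elim n)
    have "s n * rate n \<le> \<rho>" using elim(3) by simp
    then obtain E where E: "E \<in> sets (Q n)" "1 - 12 * (1 / 2) ^ k \<le> measure (Q n) E"
      and b1: "\<And>\<omega>. \<omega> \<in> E \<Longrightarrow> \<bar>muh n \<omega> - avg n \<omega> (infl n)\<bar> \<le> R * (s n * (rate n)\<^sup>2)"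
      and b2: "\<And>\<omega>. \<omega> \<in> E \<Longrightarrow> avg n \<omega> (\<lambda>z. (fit n \<omega> z - infl n z)\<^sup>2) \<le> R * (s n * rate n)\<^sup>2"
      using close[OF elim(4) conjunct1[OF elim(5)] conjunct2[OF elim(5)] _ _ _ est_cal est_wl, of "s n"]
      unfolding mu_hat_def by auto
    have "\<bar>sqrt n * (muh n \<omega> - avg n \<omega> (infl n))\<bar> \<le> e" if "\<omega> \<in> E" for \<omega>
    proof -
      have "\<bar>sqrt n * (muh n \<omega> - avg n \<omega> (infl n))\<bar> = sqrt n * \<bar>muh n \<omega> - avg n \<omega> (infl n)\<bar>" by (simp add: abs_mult)
      also have "\<dots> \<le> sqrt n * (R * (s n * (rate n)\<^sup>2))" by (intro mult_left_mono b1 that) simp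
      also have "\<dots> = R * (sqrt n * (s n * (rate n)\<^sup>2))" by (simp add: mult_ac)
      finally show ?thesis using elim(1) by linarith
    qed
    moreover have "avg n \<omega> (\<lambda>z. (fit n \<omega> z - infl n z)\<^sup>2) \<le> e" if "\<omega> \<in> E" for \<omega> using b2[OF that] elim(2) by linarith
    moreover have "1 - \<epsilon> \<le> measure (Q n) E" using E(2) k by linarith
    ultimately show ?case using E(1) by (intro bexI[of _ E] conjI ballI)
  qed
qed

text \<open>
  Uniform integrability of the treated outcome is used twice: at level 1 to bound the target parameter
  along the array, and at level \<open>b / 18\<close> to make the tail small.
\<close>

lemma phi_unif:
  assumes b: "0 < b"
  shows "\<exists>K>0. \<forall>\<^sub>F n in sequentially. integrable (obs_law (D n)) (\<lambda>z. (infl n z - \<mu> n)\<^sup>2) \<and>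
    (\<integral>z. (infl n z - \<mu> n)\<^sup>2 * indicator {z. K < \<bar>infl n z - \<mu> n\<bar>} z \<partial>obs_law (D n)) \<le> b \<and> V n \<le> K\<^sup>2 + b"
proof -
  let ?tail = "\<lambda>K n. (\<integral>\<^sup>+\<omega>. ennreal ((Y_trt (D n) \<omega>)\<^sup>2) * indicator {\<omega>. K < \<bar>Y_trt (D n) \<omega>\<bar>} \<omega> \<partial>pop_space (D n))"
  have mono: "?tail K' n \<le> ?tail K n" if "K \<le> K'" for K K' n
    using that by (intro nn_integral_mono mult_left_mono) (auto simp: indicator_def)
  obtain K1 where K1: "\<forall>\<^sub>F n in sequentially. ?tail K1 n \<le> ennreal 1"
    using unif zero_less_one unfolding unif_sq_integrable_def by blast
  have "0 < b / 18" using b by simp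
  then obtain K2 where K2: "\<forall>\<^sub>F n in sequentially. ?tail K2 n \<le> ennreal (b / 18)"
    using unif unfolding unif_sq_integrable_def by blast
  define W where "W = (1 + exp (- B0)) ^ 4 * D0\<^sup>2 * D1\<^sup>2"
  define K where "K = max (max 1 K2) (max (max 1 K1 + 1) (36 * W / b))"
  have K: "1 \<le> K" "K2 \<le> K" "max 1 K1 + 1 \<le> K" "36 * W / b \<le> K" by (auto simp: K_def)
  have W0: "0 \<le> W" by (simp add: W_def)
  have "18 * W / K\<^sup>2 \<le> 18 * W / K"
    using K(1) W0 by (intro divide_left_mono) (auto simp: power2_eq_square)
  also have "\<dots> \<le> b / 2" using K(1,4) b by (simp add: field_simps)
  finally have Wb: "9 * (b / 18) + 18 * W / K\<^sup>2 \<le> b" by simp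
  have "\<forall>\<^sub>F n in sequentially. integrable (obs_law (D n)) (\<lambda>z. (infl n z - \<mu> n)\<^sup>2) \<and>
    (\<integral>z. (infl n z - \<mu> n)\<^sup>2 * indicator {z. 3 * K < \<bar>infl n z - \<mu> n\<bar>} z \<partial>obs_law (D n)) \<le> b \<and> V n \<le> (3 * K)\<^sup>2 + b"
    using K1 K2 regular
  proof eventually_elim
    case (elim n)
    interpret regular_sample "D n" "gb n" "ab n" \<psi> \<psi>2 C0 B0 D0 D1 C1 C2 C3 n "Q n" "Z n" by (rule elim(3))
    have "\<bar>\<mu> n\<bar> \<le> max 1 K1 + 1"
      by (rule mu1_bound[OF _ _ order_trans[OF mono elim(1)]]) auto
    then have \<mu>K: "\<bar>\<mu> n\<bar> \<le> K" using K(3) by linarith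
    have K0: "0 < K" using K(1) by linarith
    have b0: "0 \<le> b / 18" using b by simp
    note tail = phi_tail[OF K0 \<mu>K b0 order_trans[OF mono[OF K(2)] elim(2)]]
    have W': "18 * (1 + exp (- B0)) ^ 4 * D0\<^sup>2 * D1\<^sup>2 / K\<^sup>2 = 18 * W / K\<^sup>2" by (simp add: W_def mult.assoc)
    show ?case using tail Wb unfolding W' by (auto simp: power_mult_distrib)
  qed
  then show ?thesis using K(1) by (intro exI[of _ "3 * K"]) auto
qed

lemma var_bounded: "\<exists>B>0. \<forall>\<^sub>F n in sequentially. 0 \<le> V n \<and> V n \<le> B"
proof -
  obtain K where K: "0 < K" "\<forall>\<^sub>F n in sequentially. integrable (obs_law (D n)) (\<lambda>z. (infl n z - \<mu> n)\<^sup>2) \<and>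
    (\<integral>z. (infl n z - \<mu> n)\<^sup>2 * indicator {z. K < \<bar>infl n z - \<mu> n\<bar>} z \<partial>obs_law (D n)) \<le> 1 \<and> V n \<le> K\<^sup>2 + 1"
    using phi_unif[of 1] by auto
  have V0: "0 \<le> V n" for n by (simp add: asy_var_def)
  have "\<forall>\<^sub>F n in sequentially. 0 \<le> V n \<and> V n \<le> K\<^sup>2 + 1" using K(2) by eventually_elim (use V0 in auto)
  then show ?thesis by (intro exI[of _ "K\<^sup>2 + 1"]) (auto simp: add_nonneg_pos)
qed

end

section \<open>Limit theorems for the augmented estimator\<close>

lemma mult_divide_self: "0 < a \<Longrightarrow> a * (q / a) = (q :: real)"
  by simp

context sparse_asymptotics
begin

text \<open>
  The estimator is within \<open>o(1 / sqrt n)\<close> of the average of the influence function by \<open>fit_close\<close>, so that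
  \<open>char_distr_diff\<close> reduces the claim to \<open>char_mean\<close>, whose error terms vanish after choosing the truncation
  level by \<open>phi_unif\<close>.
\<close>

lemma central_limit: "asymp_normal (\<lambda>n. distr (Q n) borel (\<lambda>\<omega>. sqrt n * (muh n \<omega> - \<mu> n))) V"
proof -
  obtain B where B: "0 < B" "\<forall>\<^sub>F n in sequentially. 0 \<le> V n \<and> V n \<le> B" using var_bounded by blast
  let ?S = "\<lambda>n \<omega>. sqrt n * (muh n \<omega> - \<mu> n)" and ?g = "\<lambda>n z. infl n z - \<mu> n"
  have Sm: "?S n \<in> borel_measurable (Q n)" for n by measurable
  show ?thesis
  proof (rule asymp_normal_char[OF _ B(2)])
    show "real_distribution (distr (Q n) borel (?S n))" for n
      by (rule prob_space.real_distribution_distr[OF prob_space_Q Sm])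
    fix t :: real
    show "(\<lambda>n. char (distr (Q n) borel (?S n)) t - complex_of_real (exp (- (t\<^sup>2 * V n) / 2))) \<longlonglongrightarrow> 0"
    proof (rule tendstoI)
      fix e :: real assume e: "0 < e"
      have e8: "0 < e / 8" using e by simp
      have small_factor: "\<exists>d>0. r * d \<le> e / 8" if r: "0 \<le> r" for r :: real
      proof (intro exI[of _ "e / 8 / (r + 1)"] conjI)
        have r1: "0 < r + 1" using r by simp
        show "0 < e / 8 / (r + 1)" by (rule divide_pos_pos[OF e8 r1])
        have "r * (e / 8 / (r + 1)) \<le> (r + 1) * (e / 8 / (r + 1))"
          using e8 r1 by (intro mult_right_mono divide_nonneg_pos) auto
        also have "\<dots> = e / 8" by (rule mult_divide_self[OF r1])
        finally show "r * (e / 8 / (r + 1)) \<le> e / 8" .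
      qed
      obtain d where d: "0 < d" "\<bar>t\<bar> * d \<le> e / 8" using small_factor[of "\<bar>t\<bar>"] by auto
      obtain b where b: "0 < b" "t\<^sup>2 * b \<le> e / 8" using small_factor[of "t\<^sup>2"] by auto
      obtain K where K: "0 < K" and tail: "\<forall>\<^sub>F n in sequentially. integrable (obs_law (D n)) (\<lambda>z. (?g n z)\<^sup>2) \<and>
          (\<integral>z. (?g n z)\<^sup>2 * indicator {z. K < \<bar>?g n z\<bar>} z \<partial>obs_law (D n)) \<le> b \<and> V n \<le> K\<^sup>2 + b"
        using phi_unif[OF b(1)] by blast
      define far where "far n = {\<omega> \<in> space (Q n). d < \<bar>?S n \<omega> - sqrt n * avg n \<omega> (?g n)\<bar>}" for n
      have gm: "?g n \<in> borel_measurable (obs_law (D n))"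
        if "regular_sample (D n) (gb n) (ab n) \<psi> \<psi>2 C0 B0 D0 D1 C1 C2 C3 n (Q n) (Z n)" for n
      proof -
        interpret regular_sample "D n" "gb n" "ab n" \<psi> \<psi>2 C0 B0 D0 D1 C1 C2 C3 n "Q n" "Z n" by (rule that)
        show ?thesis using phi_measurable by simp
      qed
      have mm: "(\<lambda>\<omega>. avg n \<omega> (?g n)) \<in> borel_measurable (Q n)"
        if "regular_sample (D n) (gb n) (ab n) \<psi> \<psi>2 C0 B0 D0 D1 C1 C2 C3 n (Q n) (Z n)" for n
      proof -
        interpret regular_sample "D n" "gb n" "ab n" \<psi> \<psi>2 C0 B0 D0 D1 C1 C2 C3 n "Q n" "Z n" by (rule that)
        show ?thesis using S.mean_measurable[OF gm[OF that]] .
      qed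
      have center: "avg n \<omega> (?g n) = avg n \<omega> (infl n) - \<mu> n" if "0 < n" for n \<omega>
        using that by (simp add: samp_mean_def sum_subtractf diff_divide_distrib)
      have "(\<lambda>n. measure (Q n) (far n)) \<longlonglongrightarrow> 0"
      proof (rule whp_measure_tendsto_0[OF prob_space_Q fit_close[OF d(1)]])
        show "\<forall>\<^sub>F n in sequentially. far n \<in> sets (Q n)"
          using regular
        proof eventually_elim
          case (elim n)
          note [measurable] = mm[OF elim] Sm[of n]
          show ?case unfolding far_def by measurable
        qed
        show "\<forall>\<^sub>F n in sequentially. \<forall>\<omega>\<in>far n. \<not> (\<bar>sqrt n * (muh n \<omega> - avg n \<omega> (infl n))\<bar> \<le> d \<and>
            avg n \<omega> (\<lambda>z. (fit n \<omega> z - infl n z)\<^sup>2) \<le> d)"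
          using eventually_gt_at_top[of 0]
        proof eventually_elim
          case (elim n)
          have "?S n \<omega> - sqrt n * avg n \<omega> (?g n) = sqrt n * (muh n \<omega> - avg n \<omega> (infl n))" for \<omega>
            unfolding center[OF elim] by (simp add: algebra_simps)
          then show ?case unfolding far_def by simp
        qed
      qed
      then have far: "\<forall>\<^sub>F n in sequentially. measure (Q n) (far n) < e / 8" by (rule order_tendstoD(2)[OF _ e8])
      have "(\<lambda>n. \<bar>t\<bar> ^ 3 * K * B * sqrt (1 / n)) \<longlonglongrightarrow> \<bar>t\<bar> ^ 3 * K * B * sqrt 0"
        "(\<lambda>n. (t\<^sup>2 * B)\<^sup>2 * exp (t\<^sup>2 * B) * (1 / n)) \<longlonglongrightarrow> (t\<^sup>2 * B)\<^sup>2 * exp (t\<^sup>2 * B) * 0"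
        by (intro tendsto_intros lim_1_over_n)+
      then have small: "\<forall>\<^sub>F n in sequentially. \<bar>t\<bar> ^ 3 * K * B * sqrt (1 / n) < e / 8"
        "\<forall>\<^sub>F n in sequentially. (t\<^sup>2 * B)\<^sup>2 * exp (t\<^sup>2 * B) * (1 / n) < e / 8"
        by (intro order_tendstoD(2)[OF _ e8]; simp)+
      show "\<forall>\<^sub>F n in sequentially. dist (char (distr (Q n) borel (?S n)) t - complex_of_real (exp (- (t\<^sup>2 * V n) / 2))) 0 < e"
        using regular B(2) tail far small eventually_ge_at_top[of "nat \<lceil>t\<^sup>2 * B\<rceil>"]
      proof eventually_elim
        case (elim n)
        interpret regular_sample "D n" "gb n" "ab n" \<psi> \<psi>2 C0 B0 D0 D1 C1 C2 C3 n "Q n" "Z n" by (rule elim(1))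
        let ?c = "char (distr (Q n) borel (\<lambda>\<omega>. sqrt n * avg n \<omega> (?g n))) t"
        have v: "(\<integral>z. (?g n z)\<^sup>2 \<partial>obs_law (D n)) = V n" by (rule asy_var_eq[symmetric])
        have g0: "(\<integral>z. ?g n z \<partial>obs_law (D n)) = 0"
          using phi_mean by (simp add: S.P.prob_space[unfolded space_P])
        have tB: "t\<^sup>2 * V n \<le> t\<^sup>2 * B" by (rule mult_left_mono) (use elim(2) in auto)
        have "t\<^sup>2 * B \<le> n" using elim(7) by linarith
        then have tn: "t\<^sup>2 * (\<integral>z. (?g n z)\<^sup>2 \<partial>obs_law (D n)) \<le> n" using tB unfolding v by linarith
        have "cmod (?c - complex_of_real (exp (- (t\<^sup>2 * V n) / 2)))
          \<le> t\<^sup>2 * (\<integral>z. (?g n z)\<^sup>2 * indicator {z. K < \<bar>?g n z\<bar>} z \<partial>obs_law (D n)) + \<bar>t\<bar> ^ 3 * K * V n / sqrt n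
            + (t\<^sup>2 * V n)\<^sup>2 * exp (t\<^sup>2 * V n) / n"
          using S.char_mean[OF gm[OF elim(1)] conjunct1[OF elim(3)] g0 tn less_imp_le[OF K]] unfolding v .
        moreover have "t\<^sup>2 * (\<integral>z. (?g n z)\<^sup>2 * indicator {z. K < \<bar>?g n z\<bar>} z \<partial>obs_law (D n)) \<le> t\<^sup>2 * b"
          by (rule mult_left_mono) (use elim(3) in auto)
        moreover have "\<bar>t\<bar> ^ 3 * K * V n / sqrt n \<le> \<bar>t\<bar> ^ 3 * K * B * sqrt (1 / n)"
        proof -
          have "\<bar>t\<bar> ^ 3 * K * V n / sqrt n \<le> \<bar>t\<bar> ^ 3 * K * B / sqrt n"
            using elim(2) K by (intro divide_right_mono mult_left_mono) auto
          then show ?thesis by (simp add: real_sqrt_divide)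
        qed
        moreover have "(t\<^sup>2 * V n)\<^sup>2 * exp (t\<^sup>2 * V n) / n \<le> (t\<^sup>2 * B)\<^sup>2 * exp (t\<^sup>2 * B) * (1 / n)"
        proof -
          have "(t\<^sup>2 * V n)\<^sup>2 \<le> (t\<^sup>2 * B)\<^sup>2" using tB elim(2) by (intro power_mono) auto
          then have "(t\<^sup>2 * V n)\<^sup>2 * exp (t\<^sup>2 * V n) \<le> (t\<^sup>2 * B)\<^sup>2 * exp (t\<^sup>2 * B)" using tB by (intro mult_mono) auto
          then show ?thesis by (simp add: divide_right_mono)
        qed
        ultimately have A: "cmod (?c - complex_of_real (exp (- (t\<^sup>2 * V n) / 2))) \<le> e / 8 + e / 8 + e / 8"
          using b(2) elim(5,6) by linarith
        note [measurable] = mm[OF elim(1)] Sm[of n]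
        have "cmod (char (distr (Q n) borel (?S n)) t - ?c) \<le> \<bar>t\<bar> * d + 2 * measure (Q n) (far n)"
          unfolding far_def by (rule S.char_distr_diff[OF _ _ less_imp_le[OF d(1)]]) measurable
        then have C: "cmod (char (distr (Q n) borel (?S n)) t - ?c) \<le> e / 8 + 2 * (e / 8)" using d(2) elim(4) by linarith
        have "cmod (char (distr (Q n) borel (?S n)) t - complex_of_real (exp (- (t\<^sup>2 * V n) / 2)))
            \<le> cmod (char (distr (Q n) borel (?S n)) t - ?c) + cmod (?c - complex_of_real (exp (- (t\<^sup>2 * V n) / 2)))"
          using norm_triangle_ineq[of "char (distr (Q n) borel (?S n)) t - ?c" "?c - complex_of_real (exp (- (t\<^sup>2 * V n) / 2))"]
          by simp
        then show ?case using A C e unfolding dist_norm diff_0_right by linarith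
      qed
    qed
  qed
qed

lemma moments_close:
  assumes e: "0 < e"
  shows "whp Q (\<lambda>n \<omega>. \<bar>avg n \<omega> (\<lambda>z. (infl n z - \<mu> n)\<^sup>2) - V n\<bar> \<le> e)"
    and "whp Q (\<lambda>n \<omega>. (avg n \<omega> (\<lambda>z. infl n z - \<mu> n))\<^sup>2 \<le> e)"
proof -
  let ?g = "\<lambda>n z. infl n z - \<mu> n"
  show "whp Q (\<lambda>n \<omega>. \<bar>avg n \<omega> (\<lambda>z. (?g n z)\<^sup>2) - V n\<bar> \<le> e)"
  proof (rule whp_of_measure[OF prob_space_Q])
    show "\<forall>\<^sub>F n in sequentially. {\<omega> \<in> space (Q n). \<not> \<bar>avg n \<omega> (\<lambda>z. (?g n z)\<^sup>2) - V n\<bar> \<le> e} \<in> sets (Q n)"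
      using regular
    proof eventually_elim
      case (elim n)
      interpret regular_sample "D n" "gb n" "ab n" \<psi> \<psi>2 C0 B0 D0 D1 C1 C2 C3 n "Q n" "Z n" by (rule elim)
      have [measurable]: "(\<lambda>\<omega>. avg n \<omega> (\<lambda>z. (?g n z)\<^sup>2)) \<in> borel_measurable (Q n)"
        using S.mean_measurable[of "\<lambda>z. (?g n z)\<^sup>2"] phi_measurable by simp
      show ?case by measurable
    qed
    fix \<epsilon> :: real assume \<epsilon>: "0 < \<epsilon>"
    define b where "b = \<epsilon> * e / 8"
    have b: "0 < b" using \<epsilon> e by (simp add: b_def)
    obtain K where K: "0 < K" and tail: "\<forall>\<^sub>F n in sequentially. integrable (obs_law (D n)) (\<lambda>z. (?g n z)\<^sup>2) \<and>
        (\<integral>z. (?g n z)\<^sup>2 * indicator {z. K < \<bar>?g n z\<bar>} z \<partial>obs_law (D n)) \<le> b \<and> V n \<le> K\<^sup>2 + b"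
      using phi_unif[OF b] by blast
    have "(\<lambda>n. (K\<^sup>2)\<^sup>2 / (e / 2)\<^sup>2 * (1 / n)) \<longlonglongrightarrow> (K\<^sup>2)\<^sup>2 / (e / 2)\<^sup>2 * 0" by (intro tendsto_intros lim_1_over_n)
    then have "\<forall>\<^sub>F n in sequentially. (K\<^sup>2)\<^sup>2 / (e / 2)\<^sup>2 * (1 / n) < \<epsilon> / 2" using \<epsilon> by (intro order_tendstoD(2)) auto
    then show "\<forall>\<^sub>F n in sequentially. measure (Q n) {\<omega> \<in> space (Q n). \<not> \<bar>avg n \<omega> (\<lambda>z. (?g n z)\<^sup>2) - V n\<bar> \<le> e} \<le> \<epsilon>"
      using tail regular
    proof eventually_elim
      case (elim n)
      interpret regular_sample "D n" "gb n" "ab n" \<psi> \<psi>2 C0 B0 D0 D1 C1 C2 C3 n "Q n" "Z n" by (rule elim(3))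
      let ?h = "\<lambda>z. (?g n z)\<^sup>2"
      have v: "(\<integral>z. ?h z \<partial>obs_law (D n)) = V n" by (rule asy_var_eq[symmetric])
      have e2: "0 < e / 2" and K2: "0 \<le> K\<^sup>2" using e by simp_all
      have [measurable]: "(\<lambda>\<omega>. avg n \<omega> ?h) \<in> borel_measurable (Q n)"
        using S.mean_measurable[of ?h] phi_measurable by simp
      have set: "(K\<^sup>2 < \<bar>?h z\<bar>) = (K < \<bar>?g n z\<bar>)" for z
        using K abs_le_square_iff[of "?g n z" K] by auto
      have "(\<integral>z. \<bar>?h z\<bar> * indicator {z. K\<^sup>2 < \<bar>?h z\<bar>} z \<partial>obs_law (D n)) \<le> b"
        unfolding set using elim(2) by simp
      then have t: "2 * (\<integral>z. \<bar>?h z\<bar> * indicator {z. K\<^sup>2 < \<bar>?h z\<bar>} z \<partial>obs_law (D n)) / (e / 2) \<le> 2 * b / (e / 2)"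
        using e by (intro divide_right_mono mult_left_mono) auto
      have "measure (Q n) {\<omega> \<in> space (Q n). \<not> \<bar>avg n \<omega> ?h - V n\<bar> \<le> e}
          \<le> measure (Q n) {\<omega> \<in> space (Q n). 2 * (e / 2) \<le> \<bar>avg n \<omega> ?h - (\<integral>z. ?h z \<partial>obs_law (D n))\<bar>}"
        unfolding v by (intro S.finite_measure_mono) (auto, measurable)
      also have "\<dots> \<le> (K\<^sup>2)\<^sup>2 / (n * (e / 2)\<^sup>2) + 2 * (\<integral>z. \<bar>?h z\<bar> * indicator {z. K\<^sup>2 < \<bar>?h z\<bar>} z \<partial>obs_law (D n)) / (e / 2)"
        by (rule S.truncated_lln[OF conjunct1[OF elim(2)] K2 e2])
      also have "\<dots> \<le> (K\<^sup>2)\<^sup>2 / (n * (e / 2)\<^sup>2) + 2 * b / (e / 2)" using t by (rule add_left_mono)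
      also have "2 * b / (e / 2) = \<epsilon> / 2" using e by (simp add: b_def)
      also have "(K\<^sup>2)\<^sup>2 / (n * (e / 2)\<^sup>2) = (K\<^sup>2)\<^sup>2 / (e / 2)\<^sup>2 * (1 / n)" by simp
      finally show ?case using elim(1) by linarith
    qed
  qed
  show "whp Q (\<lambda>n \<omega>. (avg n \<omega> (\<lambda>z. ?g n z))\<^sup>2 \<le> e)"
  proof (rule whp_of_measure[OF prob_space_Q])
    show "\<forall>\<^sub>F n in sequentially. {\<omega> \<in> space (Q n). \<not> (avg n \<omega> (\<lambda>z. ?g n z))\<^sup>2 \<le> e} \<in> sets (Q n)"
      using regular
    proof eventually_elim
      case (elim n)
      interpret regular_sample "D n" "gb n" "ab n" \<psi> \<psi>2 C0 B0 D0 D1 C1 C2 C3 n "Q n" "Z n" by (rule elim)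
      have [measurable]: "(\<lambda>\<omega>. avg n \<omega> (?g n)) \<in> borel_measurable (Q n)"
        using S.mean_measurable[of "?g n"] phi_measurable by simp
      show ?case by measurable
    qed
    fix \<epsilon> :: real assume \<epsilon>: "0 < \<epsilon>"
    obtain B where B: "0 < B" "\<forall>\<^sub>F n in sequentially. 0 \<le> V n \<and> V n \<le> B" using var_bounded by blast
    obtain K where tail: "\<forall>\<^sub>F n in sequentially. integrable (obs_law (D n)) (\<lambda>z. (?g n z)\<^sup>2) \<and>
        (\<integral>z. (?g n z)\<^sup>2 * indicator {z. K < \<bar>?g n z\<bar>} z \<partial>obs_law (D n)) \<le> 1 \<and> V n \<le> K\<^sup>2 + 1"
      using phi_unif[of 1] by auto
    have "(\<lambda>n. B / e * (1 / n)) \<longlonglongrightarrow> B / e * 0" by (intro tendsto_intros lim_1_over_n)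
    then have "\<forall>\<^sub>F n in sequentially. B / e * (1 / n) < \<epsilon>" using \<epsilon> by (intro order_tendstoD(2)) auto
    then show "\<forall>\<^sub>F n in sequentially. measure (Q n) {\<omega> \<in> space (Q n). \<not> (avg n \<omega> (\<lambda>z. ?g n z))\<^sup>2 \<le> e} \<le> \<epsilon>"
      using tail regular B(2)
    proof eventually_elim
      case (elim n)
      interpret regular_sample "D n" "gb n" "ab n" \<psi> \<psi>2 C0 B0 D0 D1 C1 C2 C3 n "Q n" "Z n" by (rule elim(3))
      have gm: "?g n \<in> borel_measurable (obs_law (D n))" using phi_measurable by simp
      have g0: "(\<integral>z. ?g n z \<partial>obs_law (D n)) = 0"
        using phi_mean by (simp add: S.P.prob_space[unfolded space_P])
      have [measurable]: "(\<lambda>\<omega>. avg n \<omega> (?g n)) \<in> borel_measurable (Q n)" by (rule S.mean_measurable[OF gm])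
      note sm = S.second_moment_mean[OF gm conjunct1[OF elim(2)] g0]
      have "measure (Q n) {\<omega> \<in> space (Q n). \<not> (avg n \<omega> (?g n))\<^sup>2 \<le> e}
          \<le> measure (Q n) {\<omega> \<in> space (Q n). e \<le> (avg n \<omega> (?g n))\<^sup>2}"
        by (intro S.finite_measure_mono) (auto, measurable)
      also have "\<dots> \<le> (\<integral>\<omega>. (avg n \<omega> (?g n))\<^sup>2 \<partial>Q n) / e"
        by (rule integral_Markov_inequality_measure[where A="{}"]) (use sm(1) e in auto)
      also have "\<dots> = V n / n / e" unfolding sm(2) by (simp add: asy_var_eq)
      also have "\<dots> \<le> B / n / e" using elim(4) e by (intro divide_right_mono) auto
      also have "\<dots> = B / e * (1 / n)" by simp
      finally show ?case using elim(1) by simp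
    qed
  qed
qed

text \<open>
  The sample variance of \<open>f\<close> is its mean square around \<open>\<mu>0\<close> minus the squared error of its mean; the cross
  term between \<open>g - \<mu>0\<close> and \<open>f - g\<close> is split by Young's inequality with weight \<open>c\<close>.
\<close>

lemma V_hat_expansion:
  fixes n :: nat and z and f g :: "'y \<Rightarrow> real" and \<mu>0 c :: real
  assumes n: "0 < n" and c: "0 < c"
  defines "A \<equiv> \<lambda>h. (\<Sum>i<n. h (z i)) / real n"
  shows "\<bar>A (\<lambda>x. (f x - A f)\<^sup>2) - A (\<lambda>x. (g x - \<mu>0)\<^sup>2)\<bar>
    \<le> c * A (\<lambda>x. (g x - \<mu>0)\<^sup>2) + (1 + 1 / c) * A (\<lambda>x. (f x - g x)\<^sup>2) + (A f - \<mu>0)\<^sup>2"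
proof -
  have const: "A (\<lambda>_. r) = r" for r using n by (simp add: A_def)
  have add: "A (\<lambda>x. h x + k x) = A h + A k" and diff: "A (\<lambda>x. h x - k x) = A h - A k" and cm: "A (\<lambda>x. r * h x) = r * A h" for h k r
    by (simp_all add: A_def sum.distrib sum_subtractf add_divide_distrib diff_divide_distrib sum_distrib_left[symmetric])
  have mono: "A h \<le> A k" if "\<And>x. h x \<le> k x" for h k
    unfolding A_def using that by (intro divide_right_mono sum_mono) auto
  have "A (\<lambda>x. (f x - A f)\<^sup>2) = A (\<lambda>x. (f x - \<mu>0)\<^sup>2 + (2 * (\<mu>0 - A f)) * (f x - \<mu>0) + (\<mu>0 - A f)\<^sup>2)"
    by (rule arg_cong[where f=A]) (simp add: fun_eq_iff power2_eq_square algebra_simps)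
  also have "\<dots> = A (\<lambda>x. (f x - \<mu>0)\<^sup>2) - (A f - \<mu>0)\<^sup>2"
    unfolding add cm diff const by (simp add: power2_eq_square algebra_simps)
  finally have 1: "A (\<lambda>x. (f x - A f)\<^sup>2) = A (\<lambda>x. (f x - \<mu>0)\<^sup>2) - (A f - \<mu>0)\<^sup>2" .
  have pt: "\<bar>(f x - \<mu>0)\<^sup>2 - (g x - \<mu>0)\<^sup>2\<bar> \<le> c * (g x - \<mu>0)\<^sup>2 + (1 + 1 / c) * (f x - g x)\<^sup>2" for x
  proof -
    let ?a = "g x - \<mu>0" and ?d = "f x - g x"
    have "0 \<le> (c * \<bar>?a\<bar> - \<bar>?d\<bar>)\<^sup>2 / c" using c by simp
    also have "\<dots> = c * ?a\<^sup>2 + ?d\<^sup>2 / c - 2 * (\<bar>?a\<bar> * \<bar>?d\<bar>)"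
      using c by (simp add: power2_diff power_mult_distrib diff_divide_distrib add_divide_distrib power2_eq_square[of c] )
    finally have "2 * (\<bar>?a\<bar> * \<bar>?d\<bar>) \<le> c * ?a\<^sup>2 + ?d\<^sup>2 / c" by simp
    moreover have "(f x - \<mu>0)\<^sup>2 - ?a\<^sup>2 = 2 * (?a * ?d) + ?d\<^sup>2" by (simp add: power2_eq_square algebra_simps)
    moreover have "\<bar>2 * (?a * ?d) + ?d\<^sup>2\<bar> \<le> 2 * (\<bar>?a\<bar> * \<bar>?d\<bar>) + ?d\<^sup>2"
      by (rule order_trans[OF abs_triangle_ineq]) (simp add: abs_mult)
    ultimately show ?thesis by (simp add: distrib_right)
  qed
  have "A (\<lambda>x. (f x - \<mu>0)\<^sup>2) - A (\<lambda>x. (g x - \<mu>0)\<^sup>2) \<le> A (\<lambda>x. c * (g x - \<mu>0)\<^sup>2 + (1 + 1 / c) * (f x - g x)\<^sup>2)"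
    unfolding diff[symmetric] by (rule mono) (use pt in \<open>simp add: abs_le_iff\<close>)
  moreover have "A (\<lambda>x. (g x - \<mu>0)\<^sup>2) - A (\<lambda>x. (f x - \<mu>0)\<^sup>2) \<le> A (\<lambda>x. c * (g x - \<mu>0)\<^sup>2 + (1 + 1 / c) * (f x - g x)\<^sup>2)"
    unfolding diff[symmetric] by (rule mono) (use pt in \<open>simp add: abs_le_iff\<close>)
  ultimately have "\<bar>A (\<lambda>x. (f x - \<mu>0)\<^sup>2) - A (\<lambda>x. (g x - \<mu>0)\<^sup>2)\<bar> \<le> c * A (\<lambda>x. (g x - \<mu>0)\<^sup>2) + (1 + 1 / c) * A (\<lambda>x. (f x - g x)\<^sup>2)"
    unfolding add cm by (simp add: abs_le_iff)
  then show ?thesis unfolding 1 by (smt (verit) zero_le_power2)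
qed

lemma variance_consistent: "conv_in_prob_0 Q (\<lambda>n \<omega>. Vh n \<omega> - V n)"
  unfolding conv_in_prob_0_def
proof (intro allI impI)
  fix e :: real assume e: "0 < e"
  obtain B where B: "0 < B" "\<forall>\<^sub>F n in sequentially. 0 \<le> V n \<and> V n \<le> B" using var_bounded by blast
  (* The weight c makes the first term of V_hat_expansion at most e / 8, and h then bounds the others. *)
  define c where "c = e / 8 / (B + 1)"
  have c: "0 < c" using e B by (simp add: c_def)
  define h where "h = min (min 1 (e / 16)) (e / 8 / (1 + 1 / c))"
  have ic: "0 < 1 + 1 / c" using c by (simp add: add_pos_pos)
  have h: "0 < h" "h \<le> 1" "h \<le> e / 16" "(1 + 1 / c) * h \<le> e / 8"
  proof -
    show "0 < h" using e ic by (simp add: h_def)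
    show "h \<le> 1" "h \<le> e / 16" unfolding h_def by linarith+
    have "h \<le> e / 8 / (1 + 1 / c)" unfolding h_def by linarith
    then have "(1 + 1 / c) * h \<le> (1 + 1 / c) * (e / 8 / (1 + 1 / c))" using ic by (intro mult_left_mono) auto
    also have "\<dots> = e / 8" by (rule mult_divide_self[OF ic])
    finally show "(1 + 1 / c) * h \<le> e / 8" .
  qed
  note whp_all = whp_conj[OF prob_space_Q whp_conj[OF prob_space_Q moments_close(1)[OF h(1)] moments_close(2)[OF h(1)]] fit_close[OF h(1)]]
  have "(\<lambda>n. 2 * h\<^sup>2 * (1 / n)) \<longlonglongrightarrow> 2 * h\<^sup>2 * 0" by (intro tendsto_intros lim_1_over_n)
  then have nn: "\<forall>\<^sub>F n in sequentially. 2 * h\<^sup>2 * (1 / real n) < e / 8" using e by (intro order_tendstoD(2)) auto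
  show "(\<lambda>n. measure (Q n) {\<omega> \<in> space (Q n). e < \<bar>Vh n \<omega> - V n\<bar>}) \<longlonglongrightarrow> 0"
  proof (rule whp_measure_tendsto_0[OF prob_space_Q whp_all])
    show "\<forall>\<^sub>F n in sequentially. {\<omega> \<in> space (Q n). e < \<bar>Vh n \<omega> - V n\<bar>} \<in> sets (Q n)"
      by (intro always_eventually allI) measurable
    show "\<forall>\<^sub>F n in sequentially. \<forall>\<omega>\<in>{\<omega> \<in> space (Q n). e < \<bar>Vh n \<omega> - V n\<bar>}.
      \<not> ((\<bar>avg n \<omega> (\<lambda>z. (infl n z - \<mu> n)\<^sup>2) - V n\<bar> \<le> h \<and> (avg n \<omega> (\<lambda>z. infl n z - \<mu> n))\<^sup>2 \<le> h) \<and>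
        \<bar>sqrt n * (muh n \<omega> - avg n \<omega> (infl n))\<bar> \<le> h \<and> avg n \<omega> (\<lambda>z. (fit n \<omega> z - infl n z)\<^sup>2) \<le> h)"
      using nn B(2) eventually_gt_at_top[of 0]
    proof eventually_elim
      case (elim n)
      show ?case
      proof (intro ballI notI)
        fix \<omega> assume "\<omega> \<in> {\<omega> \<in> space (Q n). e < \<bar>Vh n \<omega> - V n\<bar>}"
        then have far: "e < \<bar>Vh n \<omega> - V n\<bar>" by simp
        assume "(\<bar>avg n \<omega> (\<lambda>z. (infl n z - \<mu> n)\<^sup>2) - V n\<bar> \<le> h \<and> (avg n \<omega> (\<lambda>z. infl n z - \<mu> n))\<^sup>2 \<le> h) \<and>
          \<bar>sqrt n * (muh n \<omega> - avg n \<omega> (infl n))\<bar> \<le> h \<and> avg n \<omega> (\<lambda>z. (fit n \<omega> z - infl n z)\<^sup>2) \<le> h"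
        then have a: "\<bar>avg n \<omega> (\<lambda>z. (infl n z - \<mu> n)\<^sup>2) - V n\<bar> \<le> h" "(avg n \<omega> (\<lambda>z. infl n z - \<mu> n))\<^sup>2 \<le> h"
          "\<bar>sqrt n * (muh n \<omega> - avg n \<omega> (infl n))\<bar> \<le> h" "avg n \<omega> (\<lambda>z. (fit n \<omega> z - infl n z)\<^sup>2) \<le> h" by auto
        have "\<bar>sqrt n * (muh n \<omega> - avg n \<omega> (infl n))\<bar>\<^sup>2 \<le> h\<^sup>2" using a(3) by (intro power_mono) auto
        then have "n * (muh n \<omega> - avg n \<omega> (infl n))\<^sup>2 \<le> h\<^sup>2" by (simp add: power_mult_distrib)
        then have r: "(muh n \<omega> - avg n \<omega> (infl n))\<^sup>2 \<le> h\<^sup>2 * (1 / n)"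
          using elim(3) by (simp add: pos_le_divide_eq mult.commute)
        have "avg n \<omega> (\<lambda>z. infl n z - \<mu> n) = avg n \<omega> (infl n) - \<mu> n"
          using elim(3) by (simp add: samp_mean_def sum_subtractf diff_divide_distrib)
        then have "(avg n \<omega> (infl n) - \<mu> n)\<^sup>2 \<le> h" using a(2) by simp
        moreover have "(x + y)\<^sup>2 \<le> 2 * x\<^sup>2 + 2 * y\<^sup>2" for x y :: real
          using zero_le_power2[of "x - y"] by (simp add: power2_eq_square algebra_simps)
        note this[of "muh n \<omega> - avg n \<omega> (infl n)" "avg n \<omega> (infl n) - \<mu> n"]
        ultimately have q: "(muh n \<omega> - \<mu> n)\<^sup>2 \<le> 2 * h\<^sup>2 * (1 / n) + 2 * h" using r by simp
        have ex: "\<bar>Vh n \<omega> - avg n \<omega> (\<lambda>z. (infl n z - \<mu> n)\<^sup>2)\<bar>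
          \<le> c * avg n \<omega> (\<lambda>z. (infl n z - \<mu> n)\<^sup>2) + (1 + 1 / c) * avg n \<omega> (\<lambda>z. (fit n \<omega> z - infl n z)\<^sup>2) + (muh n \<omega> - \<mu> n)\<^sup>2"
          unfolding V_hat_def mu_hat_def samp_mean_def by (rule V_hat_expansion[OF elim(3) c])
        have "avg n \<omega> (\<lambda>z. (infl n z - \<mu> n)\<^sup>2) \<le> B + 1" using a(1) elim(2) h(2) by linarith
        then have "c * avg n \<omega> (\<lambda>z. (infl n z - \<mu> n)\<^sup>2) \<le> c * (B + 1)" using c by (intro mult_left_mono) auto
        also have "\<dots> = e / 8" unfolding c_def mult.commute[of _ "B + 1"] by (rule mult_divide_self) (use B(1) in simp)
        finally have "c * avg n \<omega> (\<lambda>z. (infl n z - \<mu> n)\<^sup>2) \<le> e / 8" .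
        moreover have "(1 + 1 / c) * avg n \<omega> (\<lambda>z. (fit n \<omega> z - infl n z)\<^sup>2) \<le> (1 + 1 / c) * h"
          using ic a(4) by (intro mult_left_mono) auto
        ultimately have "\<bar>Vh n \<omega> - avg n \<omega> (\<lambda>z. (infl n z - \<mu> n)\<^sup>2)\<bar> \<le> e / 8 + e / 8 + (e / 8 + 2 * (e / 16))"
          using ex q h(3,4) elim(1) by linarith
        then show False using far a(1) h(3) e by linarith
      qed
    qed
  qed
qed

lemma confidence_interval:
  assumes V: "\<exists>v>0. \<forall>\<^sub>F n in sequentially. v \<le> V n" and c: "0 < c" "c < 1"
  shows "(\<lambda>n. measure (Q n) {\<omega> \<in> space (Q n).
      \<mu> n \<in> {muh n \<omega> - std_normal_quantile (1 - c / 2) * sqrt (Vh n \<omega> / real n) ..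
             muh n \<omega> + std_normal_quantile (1 - c / 2) * sqrt (Vh n \<omega> / real n)}}) \<longlonglongrightarrow> 1 - c"
proof -
  let ?z = "std_normal_quantile (1 - c / 2)"
  have q: "1 / 2 < 1 - c / 2" "1 - c / 2 < 1" using c by auto
  obtain v where v: "0 < v" "\<forall>\<^sub>F n in sequentially. v \<le> V n" using V by blast
  obtain B where B: "\<forall>\<^sub>F n in sequentially. 0 \<le> V n \<and> V n \<le> B" using var_bounded by blast
  have "(\<lambda>n. measure (Q n) {\<omega> \<in> space (Q n). \<bar>sqrt n * (muh n \<omega> - \<mu> n)\<bar> \<le> ?z * sqrt (Vh n \<omega>)}) \<longlonglongrightarrow> 2 * \<Phi> ?z - 1"
  proof (rule self_normalized_coverage[OF prob_space_Q _ _ v _ central_limit variance_consistent std_normal_quantile_cdf(2)[OF q]])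
    show "\<forall>\<^sub>F n in sequentially. V n \<le> B" using B by eventually_elim simp
  qed measurable
  then have lim: "(\<lambda>n. measure (Q n) {\<omega> \<in> space (Q n). \<bar>sqrt n * (muh n \<omega> - \<mu> n)\<bar> \<le> ?z * sqrt (Vh n \<omega>)}) \<longlonglongrightarrow> 1 - c"
    by (simp add: std_normal_quantile_cdf(1)[OF q])
  show ?thesis
  proof (rule Lim_transform_eventually[OF lim])
    show "\<forall>\<^sub>F n in sequentially. measure (Q n) {\<omega> \<in> space (Q n). \<bar>sqrt n * (muh n \<omega> - \<mu> n)\<bar> \<le> ?z * sqrt (Vh n \<omega>)}
      = measure (Q n) {\<omega> \<in> space (Q n). \<mu> n \<in> {muh n \<omega> - ?z * sqrt (Vh n \<omega> / real n) .. muh n \<omega> + ?z * sqrt (Vh n \<omega> / real n)}}"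
      using eventually_gt_at_top[of 0]
    proof eventually_elim
      case (elim n)
      have "(\<bar>sqrt n * (m - u)\<bar> \<le> z * sqrt w) = (u \<in> {m - z * sqrt (w / n) .. m + z * sqrt (w / n)})" for m u z w :: real
      proof -
        have "(\<bar>sqrt n * (m - u)\<bar> \<le> z * sqrt w) = (\<bar>m - u\<bar> \<le> z * sqrt w / sqrt n)"
          using elim by (simp add: abs_mult pos_le_divide_eq mult.commute)
        also have "z * sqrt w / sqrt n = z * sqrt (w / n)" by (simp add: real_sqrt_divide)
        finally show ?thesis by auto
      qed
      then show ?case by simp
    qed
  qed
qed

end

section \<open>Conclusion\<close>

lemma regular_sampleI:
  assumes "population_model D" "iid_sample D n Q Z" "0 < n" "mono \<psi>" "correct_ps D" "target_cal D gb" "target_wl \<psi> D gb ab"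
    and 1: "assumption1 D n gb C0 B0 \<nu>0 \<xi>0 \<eta>0"
    and 2: "assumption2 \<psi> D n gb ab C0 B0 D0 D1 \<nu>1 \<xi>1 \<eta>1"
    and 3: "assumption3 \<psi> \<psi>2 D n gb ab A0 A1 M0 C0 B0 \<eta>0 D0 D1 \<nu>1 \<xi>1 \<eta>1 C1 C2 C3 \<eta>2 \<eta>3"
    and "1 \<le> C0" "0 < D0" "0 < D1" "0 < C1" "0 < C2" "0 \<le> C3"
  shows "regular_sample D gb ab \<psi> \<psi>2 C0 B0 D0 D1 C1 C2 C3 n Q Z"
proof -
  note a1 = 1[unfolded assumption1_def] and a2 = 2[unfolded assumption2_def] and a3 = 3[unfolded assumption3_def]
  have c: "\<And>u. (\<psi> has_real_derivative \<psi>2 u) (at u)" "\<And>u u'. \<psi>2 u \<le> \<psi>2 u' * exp (C3 * \<bar>u - u'\<bar>)"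
    using a3 by blast+
  show ?thesis
    by (intro regular_sample.intro regular_population.intro causal_population.intro
        regular_population_axioms.intro regular_sample_axioms.intro assms c conjunct1[OF a1] conjunct1[OF conjunct2[OF a1]]
        conjunct1[OF a2] conjunct1[OF conjunct2[OF a3]] conjunct1[OF conjunct2[OF conjunct2[OF a3]]])
qed

lemma C01_pos:
  assumes "1 \<le> C0"
  shows "0 < C01 C0 B0" "0 < C11 C0 B0 D0 D1"
proof -
  have "0 < sqrt 2 * (exp (- B0) + 1) * C0" using assms by (intro mult_pos_pos) (auto simp: add_pos_pos)
  then show C: "0 < C01 C0 B0" by (simp add: C01_def less_max_iff_disj)
  then show "0 < C11 C0 B0 D0 D1" by (simp add: C11_def less_max_iff_disj)
qed

text \<open>
  How large the tuning constants have to be: their product with \<open>q\<close> has to dominate the noise \<open>W\<close>.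
\<close>

lemma noise_dominated:
  fixes A W q :: real
  assumes "1 + \<bar>W\<bar> / q < A" "0 < q"
  shows "W \<le> A * q" "0 < A"
proof -
  have "0 \<le> \<bar>W\<bar> / q" using assms(2) by simp
  with assms(1) show "0 < A" by linarith
  have "\<bar>W\<bar> / q \<le> A" using assms(1) by linarith
  then have "\<bar>W\<bar> \<le> A * q" using assms(2) by (simp add: pos_divide_le_eq)
  then show "W \<le> A * q" by linarith
qed

theorem proposition2:
  fixes C0 \<xi>0 \<nu>0 :: real
  assumes "1 \<le> C0" "1 < \<xi>0" "0 < \<nu>0"
  shows "\<exists>e0 :: real \<Rightarrow> real. (\<forall>A0>1. 0 < e0 A0) \<and>
    (\<forall>B0 D0 D1 \<nu>1 \<xi>1 \<eta>1 C1 C2 C3 \<eta>2 \<eta>3 :: real.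
      0 < D0 \<and> 0 < D1 \<and> 0 < \<nu>1 \<and> 1 < \<xi>1 \<and> 0 < \<eta>1 \<and> \<eta>1 < 1 \<and>
      0 < C1 \<and> 0 < C2 \<and> 0 \<le> C3 \<and> 0 \<le> \<eta>2 \<and> \<eta>2 < 1 \<and> 0 \<le> \<eta>3 \<and> \<eta>3 < 1 \<longrightarrow>
      (\<exists>a0>1. \<exists>a1>1. \<forall>A0>a0. \<forall>A1>a1. \<forall>\<eta>0 M0. 0 < \<eta>0 \<and> \<eta>0 \<le> e0 A0 \<and> 0 < M0 \<longrightarrow>
        (\<forall>(D :: nat \<Rightarrow> ('a, 'x) population) (Q :: nat \<Rightarrow> 'w measure) (Z :: nat \<Rightarrow> nat \<Rightarrow> 'w \<Rightarrow> 'x obs)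
            (\<psi> :: real \<Rightarrow> real) (\<psi>2 :: real \<Rightarrow> real)
            (gbar :: nat \<Rightarrow> nat \<Rightarrow> real) (abar :: nat \<Rightarrow> nat \<Rightarrow> real)
            (ghat :: nat \<Rightarrow> 'w \<Rightarrow> nat \<Rightarrow> real) (ahat :: nat \<Rightarrow> 'w \<Rightarrow> nat \<Rightarrow> real).
          (let p = (\<lambda>n. dict_dim (D n));
               l0 = (\<lambda>n. lam0 C0 B0 (p n) n);
               l1 = (\<lambda>n. lam1 C0 B0 D0 D1 (p n) n);
               Sg = (\<lambda>n. real (card (supp0 (D n) (gbar n))));
               Sa = (\<lambda>n. real (card (supp0 (D n) (abar n))));
               V = (\<lambda>n. asy_var \<psi> (D n) (gbar n) (abar n));
               muh = (\<lambda>n \<omega>. mu_hat \<psi> (D n) n (\<lambda>i. Z n i \<omega>) (ghat n \<omega>) (ahat n \<omega>));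
               Vh = (\<lambda>n \<omega>. V_hat \<psi> (D n) n (\<lambda>i. Z n i \<omega>) (ghat n \<omega>) (ahat n \<omega>))
           in
             mono \<psi> \<and>
             (\<forall>n. population_model (D n) \<and> iid_sample (D n) n (Q n) (Z n) \<and>
                  estimator_cal (D n) n (Q n) (Z n) (A0 * l0 n) (ghat n) \<and>
                  estimator_wl \<psi> (D n) n (Q n) (Z n) (A1 * l1 n) (ghat n) (ahat n)) \<and>
             unif_sq_integrable D \<and>
             (\<forall>\<^sub>F n in sequentially.
                  correct_ps (D n) \<and>
                  target_cal (D n) (gbar n) \<and>
                  target_wl \<psi> (D n) (gbar n) (abar n) \<and>
                  assumption1 (D n) n (gbar n) C0 B0 \<nu>0 \<xi>0 \<eta>0 \<and>
                  assumption2 \<psi> (D n) n (gbar n) (abar n) C0 B0 D0 D1 \<nu>1 \<xi>1 \<eta>1 \<and>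
                  assumption3 \<psi> \<psi>2 (D n) n (gbar n) (abar n)
                    A0 A1 M0 C0 B0 \<eta>0 D0 D1 \<nu>1 \<xi>1 \<eta>1 C1 C2 C3 \<eta>2 \<eta>3 \<and>
                  cal_error_bound (D n) n (Q n) (Z n) (ghat n) (gbar n) A0 (l0 n) M0) \<and>
             (\<lambda>n. (Sg n + Sa n) * ln (real (p n))) \<in> o(\<lambda>n. sqrt (real n))
           \<longrightarrow>
             asymp_normal (\<lambda>n. distr (Q n) borel (\<lambda>\<omega>. sqrt (real n) * (muh n \<omega> - mu1 (D n)))) V \<and>
             conv_in_prob_0 Q (\<lambda>n \<omega>. Vh n \<omega> - V n) \<and>
             ((\<exists>v>0. \<forall>\<^sub>F n in sequentially. v \<le> V n) \<longrightarrow>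
               (\<forall>c. 0 < c \<and> c < 1 \<longrightarrow>
                 (\<lambda>n. measure (Q n) {\<omega> \<in> space (Q n).
                    mu1 (D n) \<in> {muh n \<omega> - std_normal_quantile (1 - c / 2) * sqrt (Vh n \<omega> / real n) ..
                                 muh n \<omega> + std_normal_quantile (1 - c / 2) * sqrt (Vh n \<omega> / real n)}})
                 \<longlonglongrightarrow> 1 - c))))))"
proof (intro exI[of _ "\<lambda>_. 1"] conjI allI impI, goal_cases)
  case (2 B0 D0 D1 \<nu>1 \<xi>1 \<eta>1 C1 C2 C3 \<eta>2 \<eta>3)
  then have pos: "0 < D0" "0 < D1" "0 < C1" "0 < C2" "0 \<le> C3" and \<nu>1: "0 < \<nu>1" and \<xi>1: "1 < \<xi>1" by auto
  define W where "W = moment_scale C0 B0 D0 C1 * sqrt (24 * moment_bound D0 D1)"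
  define q0 where "q0 = cone_slack \<xi>0 * C01 C0 B0"
  define q1 where "q1 = cone_slack \<xi>1 * C11 C0 B0 D0 D1"
  note C = C01_pos[OF assms(1)]
  have q: "0 < q0" "0 < q1"
    unfolding q0_def q1_def using cone_slack(1)[OF assms(2)] cone_slack(1)[OF \<xi>1] C by (auto intro: mult_pos_pos)
  define a0 where "a0 = 2 + \<bar>W\<bar> / q0"
  define a1 where "a1 = 2 + \<bar>W\<bar> / q1"
  have a: "1 < a0" "1 < a1" using q by (simp_all add: a0_def a1_def add_pos_nonneg)
  show ?case
  proof (unfold Let_def, rule exI[of _ a0], rule conjI[OF a(1)], rule exI[of _ a1], rule conjI[OF a(2)], intro allI impI, goal_cases)
    case (1 A0 A1 \<eta>0 M0 D Q Z \<psi> \<psi>2 gbar abar ghat ahat)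
    have A: "W \<le> A0 * q0" "0 < A0" "W \<le> A1 * q1" "0 < A1"
      using noise_dominated[of W q0 A0] noise_dominated[of W q1 A1] 1(1,2) q by (auto simp: a0_def a1_def)
    have lam: "A0 * lam0 C0 B0 p n = A0 * C01 C0 B0 * score_rate p n"
      "A1 * lam1 C0 B0 D0 D1 p n = A1 * C11 C0 B0 D0 D1 * score_rate p n" for p n
      by (simp_all add: lam0_eq lam1_eq score_rate_def)
    from 1(4) have link: "mono \<psi>" and samp: "\<And>n. population_model (D n)" "\<And>n. iid_sample (D n) n (Q n) (Z n)"
      and est: "\<And>n. estimator_cal (D n) n (Q n) (Z n) (A0 * C01 C0 B0 * score_rate (dict_dim (D n)) n) (ghat n)"
        "\<And>n. estimator_wl \<psi> (D n) n (Q n) (Z n) (A1 * C11 C0 B0 D0 D1 * score_rate (dict_dim (D n)) n) (ghat n) (ahat n)"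
      and ui: "unif_sq_integrable D"
      and ev: "\<forall>\<^sub>F n in sequentially. correct_ps (D n) \<and> target_cal (D n) (gbar n) \<and> target_wl \<psi> (D n) (gbar n) (abar n) \<and>
          assumption1 (D n) n (gbar n) C0 B0 \<nu>0 \<xi>0 \<eta>0 \<and>
          assumption2 \<psi> (D n) n (gbar n) (abar n) C0 B0 D0 D1 \<nu>1 \<xi>1 \<eta>1 \<and>
          assumption3 \<psi> \<psi>2 (D n) n (gbar n) (abar n) A0 A1 M0 C0 B0 \<eta>0 D0 D1 \<nu>1 \<xi>1 \<eta>1 C1 C2 C3 \<eta>2 \<eta>3 \<and>
          cal_error_bound (D n) n (Q n) (Z n) (ghat n) (gbar n) A0 (lam0 C0 B0 (dict_dim (D n)) n) M0"
      and sp: "(\<lambda>n. (real (card (supp0 (D n) (gbar n))) + real (card (supp0 (D n) (abar n)))) * ln (real (dict_dim (D n))))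
        \<in> o(\<lambda>n. sqrt (real n))"
      unfolding lam by blast+
    interpret sparse_asymptotics D Q Z gbar abar ghat ahat \<psi> \<psi>2 C0 B0 D0 D1 C1 C2 C3 \<nu>0 \<nu>1 \<xi>0 \<xi>1
      "A0 * C01 C0 B0" "A1 * C11 C0 B0 D0 D1"
    proof
      show "\<forall>\<^sub>F n in sequentially. regular_sample (D n) (gbar n) (abar n) \<psi> \<psi>2 C0 B0 D0 D1 C1 C2 C3 n (Q n) (Z n)"
        using ev eventually_gt_at_top[of 0]
      proof eventually_elim
        case (elim n)
        then show ?case by (intro regular_sampleI[OF samp _ link]) (use assms(1) pos in auto)
      qed
      show "\<forall>\<^sub>F n in sequentially. compatibility (dict_dim (D n)) (Sigma_pop (D n) (gbar n)) (supp0 (D n) (gbar n)) \<nu>0 \<xi>0 \<and>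
          compatibility (dict_dim (D n)) (Sigma_pop (D n) (gbar n)) (supp0 (D n) (abar n)) \<nu>1 \<xi>1"
        using ev by eventually_elim (simp add: assumption1_def assumption2_def)
      show "moment_scale C0 B0 D0 C1 * sqrt (24 * moment_bound D0 D1) \<le> cone_slack \<xi>0 * (A0 * C01 C0 B0)"
        "moment_scale C0 B0 D0 C1 * sqrt (24 * moment_bound D0 D1) \<le> cone_slack \<xi>1 * (A1 * C11 C0 B0 D0 D1)"
        using A(1,3) by (simp_all add: W_def q0_def q1_def mult_ac)
      show "0 < A0 * C01 C0 B0" "0 < A1 * C11 C0 B0 D0 D1" using A C by (auto intro: mult_pos_pos)
    qed (fact samp link est assms pos \<nu>1 \<xi>1 ui sp)+
    show ?case
      by (intro conjI impI allI central_limit variance_consistent confidence_interval) auto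
  qed
qed simp

end
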